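(* Let $f(q)=\sum_{n=0}^\infty (1-q)\cdots(1-q^n)$, let $F(x)=e^{-1/(24x)}f(e^{-1/x})\in\mathbb{Q}[[1/x]]$, and let $G(p)$ be the Borel transform of $F(x)$. (a) $G(p)$ is given by $$G(p)=\frac{3\pi}{2\sqrt2}\sum_{n=1}^\infty\frac{\chi(n)\,n}{(-p+n^2\pi^2/6)^{5/2}}.$$ $G(p)$ is an analytic double-valued function on $\mathbb{C}\setminus\mathcal{N}$, with singularities in the set $\mathcal{N}\subset\mathbb{R}^+$, $$\mathcal{N}=\frac{\pi^2}{6}\left\{n^2\mid n\in\mathbb{N},\ n\equiv1,5,7,11 \bmod 12\right\}.$$ (b) The left and right summations $S^{\mathrm{mul}}$ and $S^{\mathrm{mur}}$ are defined for $\arg(x)\in(-5\pi/2,\pi/2)$ and for $\arg(x)\in(-\pi/2,5\pi/2)$ respectively, and are given by $$S^{\mathrm{mul}}(x)=\sqrt3\,x^{3/2}\int_{\gamma_{\arg(x)+\epsilon}}\frac{\eta(2\pi i z)}{(x-z)^{3/2}}\,dz-1,\qquad S^{\mathrm{mur}}(x)=\sqrt3\,x^{3/2}\int_{\gamma_{\arg(x)-\epsilon}}\frac{\eta(2\pi i z)}{(x-z)^{3/2}}\,dz-1 .$$ (c) For every reality-preserving average $\mathbf{m}$, the summation $S^{\mathbf{m}}$ is independent of $\mathbf{m}$, agrees with the median summation $S^{\mathrm{med}}$, and is given for $\Re(x)>0$ by $$S^{\mathrm{med}}(x)=\frac12\left(S^{\mathrm{mur}}(x)+S^{\mathrm{mul}}(x)\right)=\frac{\sqrt3\,x^{3/2}}{2}\left(\int_{\gamma_{\arg(x)+\epsilon}}\frac{\eta(2\pi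 i z)}{(x-z)^{3/2}}\,dz+\int_{\gamma_{\arg(x)-\epsilon}}\frac{\eta(2\pi i z)}{(x-z)^{3/2}}\,dz\right)-1 .$$ Moreover $\overline{S^{\mathrm{med}}(x)}=S^{\mathrm{med}}(\overline{x})$. (d) The associated Dirichlet series, defined for $\Re(x)>0$ by $\delta(x)=\frac12\left(S^{\mathrm{mur}}(x)-S^{\mathrm{mul}}(x)\right)$, equals $$\delta(x)=i\sqrt2\,(\pi x)^{3/2}\,\tilde\eta(2\pi i x).$$ $\delta$ is a lacunary series, with natural boundary $\Re(x)=0$ and with well-defined radial limits at the points of $\frac{1}{2\pi i}\mathbb{Q}$.
   Context: $f$ has $n=0$ term $1$; expanding $f(e^{-1/x})$ via the Taylor series of $f$ at $q=1$ gives a formal power series in $1/x$. The Borel transform of $\sum_{n\ge0}a_nx^{-n}$ is $\sum_{n\ge0}a_{n+1}p^n/n!$. For $F$ the constant term is $a_0=1$. $\chi$ is the primitive character of conductor $12$: $\chi(n)=1$ if $n\equiv1,11$, $\chi(n)=-1$ if $n\equiv5,7$, and $\chi(n)=0$ otherwise (mod $12$). For $\Im(z)>0$, $$\eta(z)=e^{\pi iz/12}\prod_{n\ge1}(1-e^{2\pi inz})=\sum_{n\ge1}\chi(n)e^{\pi in^2z/12},\qquad \tilde\eta(z)=\sum_{n\ge1}\chi(n)\,n\,e^{\pi in^2z/12}.$$ $\gamma_\theta$ is the ray $\{re^{i\theta}\mid r\ge0\}$ from $0$ to infinity. In the integrals, $\epsilon\in(0,2\pi)$ is such that the direction $\arg(x)\pm\epsilon$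 of the ray lies in $(-\pi/2,\pi/2)$ (for $\Re(x)>0$, any small $\epsilon>0$), and $x^{3/2}/(x-z)^{3/2}$ means $(1-z/x)^{-3/2}$, equal to $1$ at $z=0$ and continued along the ray. In $G$, $(-p+n^2\pi^2/6)^{-5/2}$ is positive for $0\le p<n^2\pi^2/6$. For $\Re(x)>0$, powers of $x$ are principal. Averages: list $\mathcal{N}=\{\eta_1<\eta_2<\dots\}$, put $\eta_0=0$, $\omega_i=\eta_i-\eta_{i-1}$. An average $\mathbf{m}$ is a collection of weights $\mathbf{m}^{\varpi_1,\dots,\varpi_r}$, indexed by $r\ge0$ and $\varpi_i=\binom{\epsilon_i}{\omega_i}$ with signs $\epsilon_i=\pm$, such that the weight with $r=0$ is $1$ and $$\mathbf{m}^{\varpi_1,\dots,\varpi_r}=\mathbf{m}^{\varpi_1,\dots,\varpi_r,\binom{+}{\omega_{r+1}}}+\mathbf{m}^{\varpi_1,\dots,\varpi_r,\binom{-}{\omega_{r+1}}}.$$ For $p\in(\eta_r,\eta_{r+1})$, $\mathbf{m}G(p)=\sum_{\epsilon_1,\dots,\epsilon_r=\pm}\mathbf{m}^{\varpi_1,\dots,\varpi_r}G^{\varpi_1,\dots,\varpi_r}(p)$, where $G^{\varpi_1,\dots,\varpi_r}$ is the analytic continuation of $G$ to $(\eta_r,\eta_{r+1})$ along a path from $0$ avoiding $\eta_i$ from above if $\epsilon_i=+$ and from below if $\epsilon_i=-$. The average is reality-preserving if it preserves reality (functions real near $0$ on the real axis are sent to real ones) and has real-valued weights. The median average $\mathrm{med}$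 has, for $r\ge1$, weight $1/2$ on the all-$+$ and on the all-$-$ addresses $(\epsilon_1,\dots,\epsilon_r)$ and weight $0$ otherwise. Laplace transforms: $(\mathcal{L}^{\mathbf{m}}G)(x)=\int_0^\infty e^{-xp}\,\mathbf{m}G(p)\,dp$, where $\mathbf{m}G$ is regarded as a distribution on $\mathbb{R}^+$; this is an average of line integrals of $e^{-xp}G(p)$ along paths in $\mathbb{C}\setminus\mathcal{N}$ from $0$ to $\infty$. In particular $(\mathcal{L}^{\mathrm{mur}}G)(x)=\int_{\gamma_r}e^{-px}G(p)\,dp$ and $(\mathcal{L}^{\mathrm{mul}}G)(x)=\int_{\gamma_l}e^{-px}G(p)\,dp$, where $\gamma_r$ (resp. $\gamma_l$) is a path in $\mathbb{C}\setminus\mathcal{N}$ from $0$ to $\infty$ that turns right (resp. left) at each singularity in $\mathcal{N}$; both are extended to the stated ranges of $\arg(x)$ by rotating the contour. The summation of $F$ with respect to $\mathbf{m}$ is $S^{\mathbf{m}}(x)=a_0+(\mathcal{L}^{\mathbf{m}}G)(x)$. Radial limit at $x_0$ with $\Re(x_0)=0$: limit along $x=x_0+t$, $t\to0^+$.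
   Formalization: In (b),(c) the trailing "-1" is dropped, since a_0=1 makes the printed formulas false; in (d) the sign is corrected to -i√2(πx)^{3/2}η̃(2πix); "double-valued" means each loop run twice restores G, some loop run once does not, and every point of N is a branch point of order two. *)

theory Defs
  imports "HOL-Complex_Analysis.Complex_Analysis"
begin

section \<open>The formal series and its Borel transform\<close>

text \<open>The Taylor series of $\sum_n (1-q)\cdots(1-q^n)$ at $q = 1$. The formal variable is
  $q - 1$; the sum converges in the metric of formal power series.\<close>

definition kz_taylor :: "rat fps" where
  "kz_taylor = (\<Sum>n. \<Prod>k=1..n. 1 - (1 + fps_X) ^ k)"

text \<open>The formal variable is $1/x$ from here on.\<close>

definition kz_series :: "rat fps" where
  "kz_series = fps_exp (-1/24) * fps_compose kz_taylor (fps_exp (-1) - 1)"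

definition borel_transform :: "rat fps \<Rightarrow> complex fps" where
  "borel_transform A = Abs_fps (\<lambda>n. of_rat (fps_nth A (Suc n)) / fact n)"

text \<open>Only the germ of this function at 0 is meaningful: outside of the disc of convergence
  the function is reached by analytic continuation along paths.\<close>

definition kz_borel :: "complex \<Rightarrow> complex" where
  "kz_borel = eval_fps (borel_transform kz_series)"

section \<open>Arithmetic functions\<close>

definition chi12 :: "nat \<Rightarrow> complex" where
  "chi12 n = (if n mod 12 \<in> {1, 11} then 1 else if n mod 12 \<in> {5, 7} then -1 else 0)"

definition eta :: "complex \<Rightarrow> complex" where
  "eta z = exp (of_real pi * \<i> * z / 12) *
           (\<Prod>n. 1 - exp (2 * of_real pi * \<i> * of_nat (Suc n) * z))"

definition eta_tilde :: "complex \<Rightarrow> complex" where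
  "eta_tilde z = (\<Sum>n. chi12 (Suc n) * of_nat (Suc n) *
                    exp (of_real pi * \<i> * of_nat (Suc n) ^ 2 * z / 12))"

definition sing_set :: "real set" where
  "sing_set = {pi\<^sup>2 / 6 * (real n)\<^sup>2 | n :: nat. n mod 12 \<in> {1, 5, 7, 11}}"

abbreviation sing_compl :: "complex set" where
  "sing_compl \<equiv> - (complex_of_real ` sing_set)"

section \<open>Analytic continuation along paths\<close>

text \<open>\<open>g t\<close> represents the germ at \<open>\<gamma> t\<close> obtained by continuing the germ of \<open>h\<close>
  at \<open>\<gamma> 0\<close> along \<open>\<gamma>\<close>. The parameter interval \<open>T\<close> (with left endpoint 0) is
  a parameter, so that paths running to infinity are covered.\<close>

definition continuation_along ::
  "(complex \<Rightarrow> complex) \<Rightarrow> (real \<Rightarrow> complex) \<Rightarrow> real set \<Rightarrow> (real \<Rightarrow> complex \<Rightarrow> complex) \<Rightarrow> bool" where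
  "continuation_along h \<gamma> T g \<longleftrightarrow>
     (\<forall>t\<in>T. g t analytic_on {\<gamma> t}) \<and>
     (\<forall>t\<in>T. \<forall>\<^sub>F s in at t within T. \<forall>\<^sub>F z in nhds (\<gamma> s). g s z = g t z) \<and>
     (\<forall>\<^sub>F z in nhds (\<gamma> 0). g 0 z = h z)"

definition path_from_0_in :: "complex set \<Rightarrow> (real \<Rightarrow> complex) \<Rightarrow> bool" where
  "path_from_0_in S \<gamma> \<longleftrightarrow> path \<gamma> \<and> pathstart \<gamma> = 0 \<and> path_image \<gamma> \<subseteq> S"

definition continuable_in :: "(complex \<Rightarrow> complex) \<Rightarrow> complex set \<Rightarrow> bool" where
  "continuable_in h S \<longleftrightarrow> (\<forall>\<gamma>. path_from_0_in S \<gamma> \<longrightarrow> (\<exists>g. continuation_along h \<gamma> {0..1} g))"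

text \<open>Double-valued like a square root: going twice around any loop leads back to the original
  germ, but going around once does not always do so. A sum of independent square roots
  is double-valued in this sense, although the values over all loops number more than two.\<close>

definition double_valued_in :: "(complex \<Rightarrow> complex) \<Rightarrow> complex set \<Rightarrow> bool" where
  "double_valued_in h S \<longleftrightarrow> continuable_in h S \<and>
     (\<forall>\<gamma> g. path_from_0_in S \<gamma> \<and> pathfinish \<gamma> = 0 \<and> continuation_along h (\<gamma> +++ \<gamma>) {0..1} g
        \<longrightarrow> (\<forall>\<^sub>F z in nhds 0. g 1 z = h z)) \<and>
     (\<exists>\<gamma> g. path_from_0_in S \<gamma> \<and> pathfinish \<gamma> = 0 \<and> continuation_along h \<gamma> {0..1} g
        \<and> \<not> (\<forall>\<^sub>F z in nhds 0. g 1 z = h z))"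

text \<open>At \<open>a\<close>, every continuation of \<open>h\<close> has a branch point of order exactly two:
  after reaching a point \<open>b\<close> near \<open>a\<close> (at parameter 1/2 of the joined path), one turn
  around \<open>a\<close> changes the germ and two turns do not.\<close>

definition circle_around :: "complex \<Rightarrow> complex \<Rightarrow> real \<Rightarrow> complex" where
  "circle_around a b t = a + (b - a) * cis (2 * pi * t)"

definition sqrt_branch_point :: "(complex \<Rightarrow> complex) \<Rightarrow> complex set \<Rightarrow> complex \<Rightarrow> bool" where
  "sqrt_branch_point h S a \<longleftrightarrow>
     (\<forall>\<gamma> b. path_from_0_in S \<gamma> \<and> pathfinish \<gamma> = b \<and> b \<noteq> a \<and> cball a (dist a b) - {a} \<subseteq> S \<longrightarrow>
        (let c = circle_around a b in
          (\<forall>g. continuation_along h (\<gamma> +++ c) {0..1} g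
             \<longrightarrow> \<not> (\<forall>\<^sub>F z in nhds b. g 1 z = g (1/2) z)) \<and>
          (\<forall>g. continuation_along h (\<gamma> +++ (c +++ c)) {0..1} g
             \<longrightarrow> (\<forall>\<^sub>F z in nhds b. g 1 z = g (1/2) z))))"

section \<open>Averages\<close>

text \<open>An address \<open>es\<close> lists, in increasing order of the singularities, whether each one is avoided
  from above (\<open>True\<close>) or below (\<open>False\<close>). Since the set of singularities is fixed,
  the gaps between them carry no information, so weights are indexed by the signs alone.\<close>

type_synonym weights = "bool list \<Rightarrow> complex"

definition is_average :: "weights \<Rightarrow> bool" where
  "is_average m \<longleftrightarrow> m [] = 1 \<and> (\<forall>es. m es = m (es @ [True]) + m (es @ [False]))"

definition med :: weights where
  "med es = (if es = [] then 1
             else if (\<forall>e\<in>set es. e) \<or> (\<forall>e\<in>set es. \<not> e) then 1/2 else 0)"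

definition num_sing :: "real \<Rightarrow> nat" where
  "num_sing p = card (sing_set \<inter> {..<p})"

definition address_path :: "bool list \<Rightarrow> real \<Rightarrow> (real \<Rightarrow> complex) \<Rightarrow> bool" where
  "address_path es p \<gamma> \<longleftrightarrow>
     \<gamma> piecewise_C1_differentiable_on {0..p} \<and> \<gamma> 0 = 0 \<and> \<gamma> p = of_real p \<and>
     (\<forall>t\<in>{0..p}. Re (\<gamma> t) = t) \<and>
     (\<forall>s\<in>sing_set \<inter> {..<p}. if es ! num_sing s then Im (\<gamma> s) > 0 else Im (\<gamma> s) < 0)"

definition address_value :: "(complex \<Rightarrow> complex) \<Rightarrow> bool list \<Rightarrow> real \<Rightarrow> complex" where
  "address_value h es p =
     (THE v. \<exists>\<gamma> g. address_path es p \<gamma> \<and> continuation_along h \<gamma> {0..p} g \<and> v = g p (of_real p))"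

definition average_value :: "weights \<Rightarrow> (complex \<Rightarrow> complex) \<Rightarrow> real \<Rightarrow> complex" where
  "average_value m h p = (\<Sum>es | length es = num_sing p. m es * address_value h es p)"

definition reality_preserving :: "weights \<Rightarrow> bool" where
  "reality_preserving m \<longleftrightarrow> (\<forall>es. m es \<in> \<real>) \<and>
     (\<forall>h. h analytic_on {0} \<and> continuable_in h sing_compl \<and>
          (\<forall>\<^sub>F t in nhds 0. h (complex_of_real t) \<in> \<real>)
        \<longrightarrow> (\<forall>p>0. p \<notin> sing_set \<longrightarrow> average_value m h p \<in> \<real>))"

section \<open>Laplace transforms and summations\<close>

definition address_integral ::
  "(complex \<Rightarrow> complex) \<Rightarrow> complex \<Rightarrow> bool list \<Rightarrow> real \<Rightarrow> complex" where
  "address_integral h x es p =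
     (THE I. \<exists>\<gamma> g. address_path es p \<gamma> \<and> continuation_along h \<gamma> {0..p} g \<and>
        ((\<lambda>t. exp (- (x * \<gamma> t)) * g t (\<gamma> t) * vector_derivative \<gamma> (at t within {0..p}))
           has_integral I) {0..p})"

text \<open>The averaged function need not be integrable at the singularities. As a distribution, its
  integral against the exponential over \<open>[0, p]\<close> is the weighted average of the line integrals
  from 0 to \<open>p\<close>. The limit as \<open>p\<close> tends to infinity is taken along points at
  distance at least \<open>d\<close> from the singularities, for each \<open>d > 0\<close>.\<close>

definition has_average_laplace ::
  "weights \<Rightarrow> (complex \<Rightarrow> complex) \<Rightarrow> complex \<Rightarrow> complex \<Rightarrow> bool" where
  "has_average_laplace m h x L \<longleftrightarrow>
     (\<forall>d>0. ((\<lambda>p. \<Sum>es | length es = num_sing p. m es * address_integral h x es p) \<longlongrightarrow> L)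
        (inf at_top (principal {p. \<forall>s\<in>sing_set. d \<le> \<bar>p - s\<bar>})))"

definition average_sum :: "weights \<Rightarrow> complex \<Rightarrow> complex" where
  "average_sum m x = of_rat (fps_nth kz_series 0) + (THE L. has_average_laplace m kz_borel x L)"

definition has_laplace_along ::
  "(complex \<Rightarrow> complex) \<Rightarrow> (real \<Rightarrow> complex) \<Rightarrow> complex \<Rightarrow> complex \<Rightarrow> bool" where
  "has_laplace_along h \<gamma> x L \<longleftrightarrow>
     (\<exists>g. continuation_along h \<gamma> {0..} g \<and>
        ((\<lambda>t. exp (- (x * \<gamma> t)) * g t (\<gamma> t) * vector_derivative \<gamma> (at t within {0..}))
           has_integral L) {0..})"

definition ray :: "real \<Rightarrow> real \<Rightarrow> complex" where
  "ray \<theta> t = of_real t * cis \<theta>"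

text \<open>The path runs along the positive real axis, and avoids every singularity on the
  left (i.e. from above) if \<open>\<sigma> = 1\<close> and on the right if \<open>\<sigma> = -1\<close>.\<close>

definition turning_path :: "real \<Rightarrow> real \<Rightarrow> real \<Rightarrow> complex" where
  "turning_path \<sigma> \<delta> t = Complex t (\<sigma> * max 0 (\<delta> - infdist t sing_set))"

text \<open>The point \<open>x\<close> with modulus \<open>r\<close> and argument \<open>\<phi>\<close> lives on the Riemann surface of
  the logarithm. For \<open>\<bar>\<phi>\<bar> < pi / 2\<close> the value is the integral along the turning path; the
  contour is rotated to the ray of direction \<open>\<theta>\<close>, away from the positive axis by less than a
  full turn, on the side of the turning path. All these integrals have to agree.\<close>

definition has_lateral_laplace :: "real \<Rightarrow> real \<Rightarrow> real \<Rightarrow> complex \<Rightarrow> bool" where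
  "has_lateral_laplace \<sigma> r \<phi> L \<longleftrightarrow>
     (\<bar>\<phi>\<bar> < pi / 2 \<longrightarrow> (\<forall>\<delta>. 0 < \<delta> \<and> \<delta> < pi\<^sup>2 / 6 \<longrightarrow>
        has_laplace_along kz_borel (turning_path \<sigma> \<delta>) (rcis r \<phi>) L)) \<and>
     (\<forall>\<theta>. 0 < \<sigma> * \<theta> \<and> \<sigma> * \<theta> < 2 * pi \<and> \<bar>\<phi> + \<theta>\<bar> < pi / 2 \<longrightarrow>
        has_laplace_along kz_borel (ray \<theta>) (rcis r \<phi>) L)"

definition lateral_sum :: "real \<Rightarrow> real \<Rightarrow> real \<Rightarrow> complex" where
  "lateral_sum \<sigma> r \<phi> = of_rat (fps_nth kz_series 0) + (THE L. has_lateral_laplace \<sigma> r \<phi> L)"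

definition S_mul :: "real \<Rightarrow> real \<Rightarrow> complex" where
  "S_mul r \<phi> = lateral_sum 1 r \<phi>"

definition S_mur :: "real \<Rightarrow> real \<Rightarrow> complex" where
  "S_mur r \<phi> = lateral_sum (-1) r \<phi>"

definition stokes_delta :: "complex \<Rightarrow> complex" where
  "stokes_delta x = (S_mur (norm x) (Arg x) - S_mul (norm x) (Arg x)) / 2"

text \<open>The integral of \<open>x\<^sup>3\<^sup>/\<^sup>2 eta (2 pi i z) / (x - z)\<^sup>3\<^sup>/\<^sup>2\<close> along the
  ray of direction \<open>\<theta>\<close>. If \<open>\<theta>\<close> is not the direction of \<open>x\<close>, then \<open>1 - z / x\<close>
  avoids the negative real axis on the ray, so the principal branch of the power is the
  one continued from the value 1 at \<open>z = 0\<close>.\<close>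

definition eta_integrand :: "complex \<Rightarrow> real \<Rightarrow> real \<Rightarrow> complex" where
  "eta_integrand x \<theta> t =
     eta (2 * of_real pi * \<i> * ray \<theta> t) * (1 - ray \<theta> t / x) powr (-3/2) * cis \<theta>"

definition eta_integral :: "complex \<Rightarrow> real \<Rightarrow> complex" where
  "eta_integral x \<theta> = integral {0..} (eta_integrand x \<theta>)"

section \<open>Lacunary series and natural boundaries\<close>

text \<open>Fabry's gap condition: the \<open>k\<close>-th exponent \<open>e\<^sub>k\<close> that occurs satisfies
  \<open>e\<^sub>k / k \<rightarrow> \<infinity>\<close>.\<close>

definition lacunary :: "(nat \<Rightarrow> complex) \<Rightarrow> bool" where
  "lacunary a \<longleftrightarrow> infinite {k. a k \<noteq> 0} \<and>
     filterlim (\<lambda>k. real (enumerate {k. a k \<noteq> 0} k) / real k) at_top at_top"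

definition natural_boundary :: "(complex \<Rightarrow> complex) \<Rightarrow> complex set \<Rightarrow> bool" where
  "natural_boundary f S \<longleftrightarrow> f holomorphic_on S \<and>
     (\<forall>z\<in>frontier S. \<not> (\<exists>e>0. \<exists>h. h holomorphic_on ball z e \<and> (\<forall>w\<in>ball z e \<inter> S. h w = f w)))"

end

theory Submission
 imports Defs "HOL-Probability.Probability" "HOL-Real_Asymp.Real_Asymp" "HOL-Number_Theory.Cong"
begin

text \<open>
Write \<open>loc n = \<pi>\<^sup>2 n\<^sup>2 / 6\<close> for the would-be singularity attached to \<open>n\<close>. Everything rests on two
identities that follow from one telescoping sum for \<open>\<Sum> (1 - x)(1 - xq) \<cdots> (1 - xq\<^sup>n) x\<^sup>n\<close>.

Analytically, at \<open>x = 1\<close> and \<open>\<bar>q\<bar> < 1\<close>, iterating the identity gives Euler's theorem, which turns the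
product eta into the theta series \<open>\<Sum> \<chi>(n) exp (- loc n z)\<close> (lemma \<open>eta_sums\<close>). Formally, with
\<open>q = exp (- t)\<close>, the same identity is a functional equation with only one solution polynomial in the
parameter; that solution is a regularized theta sum, so the coefficients of the series are
regularized odd moments of \<open>\<chi>\<close>. After the rotation \<open>v \<mapsto> i v\<close> their generating function is \<open>sin 2v / cos 3v\<close> up to a factor, and its partial fractions turn the Borel transform into \<open>\<Sum> \<chi>(n) n (loc n - p)\<^sup>-\<^sup>5\<^sup>/\<^sup>2\<close> up to a
factor (\<open>kz_borel_disc\<close>).

Every continuation of such a sum is obtained by continuing each square root of \<open>loc n - p\<close>
separately (\<open>canonical_continuation\<close>, \<open>continuation_germ\<close>). Hence monodromy only flips signs of the
roots: once around a loop gives a sign, twice gives the identity.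

Each term has an elementary primitive in terms of its root \<open>u\<close>, namely a multiple of an odd function
\<open>K4 x u\<close> built from the Gaussian primitive. A Laplace integral over any path is therefore the sum
over \<open>n\<close> of differences of endpoint values; the value at infinity depends only on the side on which
the path leaves the singularities. Dominated convergence gives the lateral sums (\<open>lateral_sum_eq\<close>), and
the same computation for the eta integral gives the same series (\<open>lateral_value_eta\<close>).

For an average, the oddness of \<open>K4\<close> means that a passed singularity enters only through the mean of
the signs at it. Testing with the single function \<open>(loc n - p)\<^sup>-\<^sup>5\<^sup>/\<^sup>2\<close>, which is purely imaginary
beyond \<open>loc n\<close>, shows that preserving reality is the vanishing of all these means
(\<open>balanced_reality_preserving\<close>). So the average does not depend on the weights.

Half the difference of the lateral sums is \<open>x\<^sup>3\<^sup>/\<^sup>2\<close> times a theta series with exponents \<open>n\<^sup>2\<close>. If it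
extended across the boundary it would be bounded near an interval of the imaginary axis, but
integrating against a smooth bump and a character isolates a single coefficient and bounds it
(\<open>theta_coefficient_bound\<close>), although the coefficients grow. At rational points the phases are periodic
with mean zero, and three summations by parts give the radial limits (\<open>periodic_gauss_limit\<close>).
\<close>

section \<open>A telescoping identity\<close>

lemma telescoping_identity:
 fixes q x :: "'a::comm_ring_1"
 shows "(\<Sum>n<N. (1 - x) * (\<Prod>k=1..n. 1 - x * q ^ k) * x ^ n)
    + q ^ 2 * x ^ 3 * (\<Sum>n<N. (\<Prod>k=1..Suc n. 1 - x * q ^ k) * (x * q) ^ n)
    = (\<Prod>k=1..N. 1 - x * q ^ k) * x ^ N * (q * x ^ 2 * q ^ N - 1) - (q * x ^ 2 - 1)"
proof (induction N)
 case (Suc N)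
 have step: "(S + a) + c * (T + b) = Z' - z"
  if "S + c * T = Z - z" "a + c * b = Z' - Z" for S T a b c z Z Z' :: 'a
 proof -
  have "(S + a) + c * (T + b) = (S + c * T) + (a + c * b)" by (simp add: distrib_left)
  thus ?thesis using that by simp
 qed
 define P where "P = (\<Prod>k=1..N. 1 - x * q ^ k)"
 have P_Suc: "(\<Prod>k=1..Suc N. 1 - x * q ^ k) = P * (1 - x * (q * q ^ N))"
  by (simp add: P_def)
 show ?case unfolding sum.lessThan_Suc
 proof (rule step[OF Suc])
  show "(1 - x) * (\<Prod>k=1..N. 1 - x * q ^ k) * x ^ N +
   q ^ 2 * x ^ 3 * ((\<Prod>k=1..Suc N. 1 - x * q ^ k) * (x * q) ^ N) =
   (\<Prod>k=1..Suc N. 1 - x * q ^ k) * x ^ Suc N * (q * x ^ 2 * q ^ Suc N - 1) -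
   (\<Prod>k=1..N. 1 - x * q ^ k) * x ^ N * (q * x ^ 2 * q ^ N - 1)"
   unfolding P_Suc P_def[symmetric] power_mult_distrib
   by (simp add: algebra_simps power2_eq_square power3_eq_cube)
 qed
qed simp

section \<open>Regularized moments of the character\<close>

text \<open>The exponential generating function of \<open>\<Sum> \<chi>(n) n\<^sup>j\<close> in Abel's sense: since \<open>\<chi>(n + 6) = - \<chi>(n)\<close>, the sum
\<open>\<Sum> \<chi>(n) exp (- n v)\<close> is this quotient.\<close>

definition theta_gf :: "'a::field_char_0 fps" where
 "theta_gf = (fps_exp (-1) - fps_exp (-5)) * inverse (1 + fps_exp (-6))"

lemma theta_gf_eq: "theta_gf * (1 + fps_exp (-6)) = fps_exp (-1) - fps_exp (-5)"
proof -
 have "inverse (1 + fps_exp (-6)) * (1 + fps_exp (-6)) = (1 :: 'a fps)"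
  by (rule inverse_mult_eq_1) simp
 thus ?thesis by (simp add: theta_gf_def mult.assoc)
qed

definition theta_moment :: "nat => 'a::field_char_0" where
 "theta_moment j = (-1) ^ j * fact j * fps_nth theta_gf j"

text \<open>The regularized value of \<open>\<Sum> \<chi>(n) p(n)\<close> for a polynomial \<open>p\<close>.\<close>

definition theta_mean :: "'a::field_char_0 poly => 'a" where
 "theta_mean p = (\<Sum>i\<le>degree p. coeff p i * theta_moment i)"

lemma theta_mean_altdef: "degree p \<le> N ==> theta_mean p = (\<Sum>i\<le>N. coeff p i * theta_moment i)"
 unfolding theta_mean_def
 by (rule sum.mono_neutral_left) (auto simp: coeff_eq_0)

lemma theta_mean_add: "theta_mean (p + q) = theta_mean p + theta_mean q"
proof -
 define N where "N = max (degree p) (degree q)"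
 have "degree p \<le> N" "degree q \<le> N" "degree (p + q) \<le> N"
  by (auto simp: N_def intro: degree_add_le)
 thus ?thesis
  by (simp add: theta_mean_altdef[of _ N] sum.distrib algebra_simps)
qed

lemma theta_mean_smult: "theta_mean (smult c p) = c * theta_mean p"
proof -
 have "degree (smult c p) \<le> degree p" by (rule degree_smult_le)
 thus ?thesis
  by (simp add: theta_mean_altdef[of _ "degree p"] sum_distrib_left mult.assoc)
qed

lemma theta_mean_0 [simp]: "theta_mean 0 = 0"
 by (simp add: theta_mean_def)

lemma theta_mean_sum: "theta_mean (sum f A) = (\<Sum>a\<in>A. theta_mean (f a))"
 by (induction A rule: infinite_finite_induct) (auto simp: theta_mean_add)

lemma theta_mean_monom: "theta_mean (monom c j) = c * theta_moment j"
proof -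
 have "theta_mean (monom c j) = (\<Sum>i\<le>j. coeff (monom c j) i * theta_moment i)"
  by (rule theta_mean_altdef) (rule degree_monom_le)
 also have "\<dots> = (\<Sum>i\<le>j. if i = j then c * theta_moment j else 0)"
  by (rule sum.cong) (auto simp: coeff_monom)
 also have "\<dots> = c * theta_moment j" by simp
 finally show ?thesis .
qed

lemma theta_mean_shift_monom:
 "theta_mean ([:6, 1:] ^ j) + theta_moment j = (1 - 5 ^ j :: 'a::field_char_0)"
proof -
 have "[:6, 1 :: 'a:] ^ j = ([:0, 1:] + [:6:]) ^ j" by simp
 also have "\<dots> = (\<Sum>i\<le>j. of_nat (j choose i) * [:0,1:] ^ i * [:6:] ^ (j - i))"
  by (rule binomial_ring)
 also have "\<dots> = (\<Sum>i\<le>j. monom (of_nat (j choose i) * 6 ^ (j - i)) i)"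
  by (intro sum.cong refl)
    (simp add: poly_const_pow of_nat_poly monom_altdef mult_ac)
 finally have "theta_mean ([:6, 1:] ^ j) = (\<Sum>i\<le>j. of_nat (j choose i) * 6 ^ (j - i) * (theta_moment i :: 'a))"
  by (simp add: theta_mean_sum theta_mean_monom)
 also have "\<dots> = (\<Sum>i\<le>j. (-1) ^ j * fact j * (fps_nth theta_gf i * ((-6) ^ (j - i) / fact (j - i))))"
 proof (intro sum.cong refl)
  fix i assume "i \<in> {..j}"
  hence i: "i \<le> j" by simp
  have "(-1 :: 'a) ^ j = (-1) ^ i * (-1) ^ (j - i)"
   using i by (simp flip: power_add)
  moreover have "(-6 :: 'a) ^ (j - i) = (-1) ^ (j - i) * 6 ^ (j - i)"
   by (metis mult_minus1 power_mult_distrib)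
  moreover have "(-1 :: 'a) ^ (j - i) * (-1) ^ (j - i) = 1"
   by (simp flip: power_mult_distrib)
  ultimately show "of_nat (j choose i) * 6 ^ (j - i) * (theta_moment i :: 'a) =
    (-1) ^ j * fact j * (fps_nth theta_gf i * ((-6) ^ (j - i) / fact (j - i)))"
   using i by (simp add: theta_moment_def binomial_fact field_simps)
 qed
 also have "\<dots> = (-1) ^ j * fact j * fps_nth (theta_gf * fps_exp (-6)) j"
  by (simp add: fps_mult_nth sum_distrib_left atMost_atLeast0)
 also have "\<dots> + theta_moment j = (-1) ^ j * fact j * fps_nth (theta_gf * (1 + fps_exp (-6))) j"
  by (simp add: theta_moment_def algebra_simps)
 also have "\<dots> = (-1) ^ j * ((-1) ^ j - (-5) ^ j)"
  unfolding theta_gf_eq by (simp add: field_simps)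
 also have "\<dots> = 1 - 5 ^ j"
  by (simp add: right_diff_distrib flip: power_mult_distrib)
 finally show ?thesis .
qed

lemma pcompose_power: "pcompose (p ^ n) q = pcompose p q ^ n"
 for p :: "'a::comm_semiring_1 poly"
 by (induction n) (auto simp: pcompose_mult pcompose_1)

text \<open>The antiperiodicity of \<open>\<chi>\<close> under the shift by 6 survives regularization; the right-hand
side is the contribution of \<open>n = 1\<close> and \<open>n = 5\<close>.\<close>

lemma theta_mean_shift:
 "theta_mean (pcompose p [:6, 1:]) + theta_mean p = poly p 1 - (poly p 5 :: 'a :: field_char_0)"
proof -
 have 1: "pcompose p [:6,1:] = (\<Sum>i\<le>degree p. smult (coeff p i) ([:6,1:] ^ i))"
  by (subst poly_as_sum_of_monoms[of p, symmetric], subst pcompose_sum)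
    (simp add: monom_altdef pcompose_smult pcompose_power pcompose_pCons)
 have "theta_mean (pcompose p [:6, 1:]) + theta_mean p =
    (\<Sum>i\<le>degree p. coeff p i * (theta_mean ([:6,1:] ^ i) + theta_moment i))"
  unfolding 1 by (simp add: theta_mean_sum theta_mean_smult theta_mean_def[of p] sum.distrib algebra_simps)
 also have "\<dots> = poly p 1 - poly p 5"
  unfolding theta_mean_shift_monom
  by (simp add: poly_altdef sum_subtractf algebra_simps)
 finally show ?thesis .
qed

text \<open>The regularized value of \<open>\<Sum> \<chi>(n) r(n) exp (p(n) t)\<close> as a formal series in \<open>t\<close>.\<close>

definition theta_exp :: "'a::field_char_0 poly => 'a poly => 'a fps" where
 "theta_exp p r = Abs_fps (%m. theta_mean (p ^ m * r) / fact m)"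

lemma theta_exp_shift: "fps_exp a * theta_exp p r = theta_exp ([:a:] + p) r"
proof (rule fps_ext)
 fix m
 have "theta_mean (([:a:] + p) ^ m * r) =
    theta_mean (\<Sum>i\<le>m. smult (of_nat (m choose i) * a ^ i) (p ^ (m - i) * r))"
  unfolding binomial_ring sum_distrib_right
  by (intro arg_cong[where f = theta_mean] sum.cong refl)
    (simp add: poly_const_pow of_nat_poly mult.commute)
 also have "\<dots> = (\<Sum>i\<le>m. of_nat (m choose i) * a ^ i * theta_mean (p ^ (m - i) * r))"
  by (simp add: theta_mean_sum theta_mean_smult)
 finally show "fps_nth (fps_exp a * theta_exp p r) m = fps_nth (theta_exp ([:a:] + p) r) m"
  by (simp add: theta_exp_def fps_mult_nth atMost_atLeast0 sum_divide_distrib binomial_fact)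
qed

lemma fps_prod_nth_eq_0:
 fixes f :: "'b => 'a::comm_ring_1 fps"
 assumes "\<And>k. k \<in> A ==> fps_nth (f k) 0 = 0" "m < card A"
 shows "fps_nth (prod f A) m = 0"
proof -
 have "prod f A = (\<Prod>k\<in>A. fps_X * fps_shift 1 (f k))"
  by (intro prod.cong refl fps_ext) (use assms in \<open>auto simp: fps_X_mult_nth\<close>)
 also have "\<dots> = fps_X ^ card A * (\<Prod>k\<in>A. fps_shift 1 (f k))"
  by (simp add: prod.distrib)
 finally show ?thesis using assms(2) by (simp add: fps_X_power_mult_nth)
qed

lemma fps_mult_nth_cong:
 assumes "\<And>i. i \<le> m ==> fps_nth B i = fps_nth B' i"
 shows "fps_nth (A * B) m = fps_nth (A * B') m"
 unfolding fps_mult_nth by (intro sum.cong refl) (use assms in auto)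

definition kz_term :: "'a::field_char_0 => nat => 'a fps" where
 "kz_term s n = (\<Prod>k=1..n. 1 - fps_exp (-s) * fps_exp (-1) ^ k) * fps_exp (-s) ^ n"

text \<open>The telescoping series with \<open>q = exp (- t)\<close> and \<open>x = exp (- s t)\<close>. The \<open>n\<close>-th term has order \<open>n\<close> in
\<open>t\<close>, so finitely many terms determine each coefficient.\<close>

definition kz_gen :: "'a::field_char_0 => 'a fps" where
 "kz_gen s = Abs_fps (%m. fps_nth (\<Sum>n<Suc m. kz_term s n) m)"

lemma kz_term_nth_0: "m < n ==> fps_nth (kz_term s n) m = 0"
proof -
 assume "m < n"
 have "fps_nth (fps_exp (-s) ^ n * (\<Prod>k=1..n. 1 - fps_exp (-s) * fps_exp (-1) ^ k)) m
   = fps_nth (fps_exp (-s) ^ n * 0) m"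
  by (intro fps_mult_nth_cong, subst fps_prod_nth_eq_0) (use \<open>m < n\<close> in \<open>auto simp: fps_nth_power_0\<close>)
 thus ?thesis by (simp add: kz_term_def mult.commute)
qed

lemma kz_gen_nth: "m < N ==> fps_nth (kz_gen s) m = fps_nth (\<Sum>n<N. kz_term s n) m"
proof -
 assume "m < N"
 have "(\<Sum>n<N. fps_nth (kz_term s n) m) = (\<Sum>n<Suc m. fps_nth (kz_term s n) m)"
  by (rule sum.mono_neutral_right) (use \<open>m < N\<close> in \<open>auto intro!: kz_term_nth_0\<close>)
 thus ?thesis by (simp add: kz_gen_def fps_sum_nth)
qed

text \<open>The telescoping identity with a remainder of order larger than the coefficient in question.\<close>

lemma kz_gen_functional_equation:
 fixes s :: "'a::field_char_0"
 shows "(1 - fps_exp (-s)) * kz_gen s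
    + fps_exp (-(2 + 3 * s)) * ((1 - fps_exp (-(s + 1))) * kz_gen (s + 1)) = 1 - fps_exp (-(1 + 2 * s))"
proof (rule fps_ext)
 fix m
 define N where "N = Suc m"
 define x q :: "'a fps" where "x = fps_exp (-s)" and "q = fps_exp (-1)"
 have xq: "fps_exp (-(s + 1)) = x * q"
  by (simp add: x_def q_def flip: fps_exp_add_mult)
 have e1: "fps_exp (-(2 + 3 * s)) = q ^ 2 * x ^ 3"
  by (simp add: x_def q_def fps_exp_power_mult algebra_simps flip: fps_exp_add_mult)
 have e2: "fps_exp (-(1 + 2 * s)) = q * x ^ 2"
  by (simp add: x_def q_def fps_exp_power_mult algebra_simps flip: fps_exp_add_mult)
 have t1: "kz_term s n = (\<Prod>k=1..n. 1 - x * q ^ k) * x ^ n" for n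
  by (simp add: kz_term_def x_def q_def)
 have t2: "(1 - x * q) * kz_term (s + 1) n = (\<Prod>k=1..Suc n. 1 - x * q ^ k) * (x * q) ^ n" for n
 proof -
  have "(\<Prod>k=1..Suc n. 1 - x * q ^ k) = (1 - x * q) * (\<Prod>k=Suc 1..Suc n. 1 - x * q ^ k)"
   by (subst prod.atLeast_Suc_atMost) auto
  also have "(\<Prod>k=Suc 1..Suc n. 1 - x * q ^ k) = (\<Prod>k=1..n. 1 - x * q * q ^ k)"
   by (subst prod.atLeast_Suc_atMost_Suc_shift) (simp add: mult.assoc)
  finally show ?thesis
   by (simp add: kz_term_def xq q_def[symmetric] mult_ac del: minus_add_distrib)
 qed
 have z: "fps_nth ((\<Prod>k=1..N. 1 - x * q ^ k) * Z) m = 0" for Z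
 proof -
  have "fps_nth (Z * (\<Prod>k=1..N. 1 - x * q ^ k)) m = fps_nth (Z * 0) m"
   by (intro fps_mult_nth_cong, subst fps_prod_nth_eq_0) (auto simp: N_def x_def q_def fps_nth_power_0)
  thus ?thesis by (simp add: mult.commute)
 qed
 have "fps_nth ((1 - fps_exp (-s)) * kz_gen s
    + fps_exp (-(2 + 3 * s)) * ((1 - fps_exp (-(s + 1))) * kz_gen (s + 1))) m =
    fps_nth ((1 - x) * (\<Sum>n<N. kz_term s n)) m
    + fps_nth ((q ^ 2 * x ^ 3 * (1 - x * q)) * (\<Sum>n<N. kz_term (s + 1) n)) m"
  unfolding e1 xq fps_add_nth x_def[symmetric] mult.assoc[symmetric]
  by (intro arg_cong2[where f = "(+)"] fps_mult_nth_cong kz_gen_nth) (auto simp: N_def)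
 also have "\<dots> = fps_nth ((\<Sum>n<N. (1 - x) * (\<Prod>k=1..n. 1 - x * q ^ k) * x ^ n)
    + q ^ 2 * x ^ 3 * (\<Sum>n<N. (\<Prod>k=1..Suc n. 1 - x * q ^ k) * (x * q) ^ n)) m"
  unfolding t2[symmetric] unfolding t1 fps_add_nth
  by (simp only: sum_distrib_left mult.assoc)
 also have "\<dots> = fps_nth (1 - fps_exp (-(1 + 2 * s))) m"
  unfolding telescoping_identity e2 fps_sub_nth unfolding mult.assoc z by simp
 finally show "fps_nth ((1 - fps_exp (-s)) * kz_gen s
    + fps_exp (-(2 + 3 * s)) * ((1 - fps_exp (-(s + 1))) * kz_gen (s + 1))) m =
    fps_nth (1 - fps_exp (-(1 + 2 * s))) m" .
qed

section \<open>Coefficients polynomial in a parameter\<close>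

definition polynomial_family :: "('a::field_char_0 => 'a fps) => bool" where
 "polynomial_family F \<longleftrightarrow> (\<forall>m. \<exists>p. \<forall>s. fps_nth (F s) m = poly p s)"

lemma polynomial_family_const: "polynomial_family (%s. F)"
 unfolding polynomial_family_def by (intro allI, rule_tac x = "[:fps_nth F m:]" in exI) auto

lemma polynomial_family_add:
 "polynomial_family F ==> polynomial_family G ==> polynomial_family (%s. F s + G s)"
 unfolding polynomial_family_def by (metis fps_add_nth poly_add)

lemma polynomial_family_diff:
 "polynomial_family F ==> polynomial_family G ==> polynomial_family (%s. F s - G s)"
 unfolding polynomial_family_def by (metis fps_sub_nth poly_diff)

lemma polynomial_family_mult:
 assumes "polynomial_family F" "polynomial_family G"
 shows "polynomial_family (%s. F s * G s)"
proof -
 from assms obtain f g where fg: "\<And>m s. fps_nth (F s) m = poly (f m) s"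
   "\<And>m s. fps_nth (G s) m = poly (g m) s"
  unfolding polynomial_family_def by metis
 show ?thesis unfolding polynomial_family_def
 proof
  fix m
  show "\<exists>p. \<forall>s. fps_nth (F s * G s) m = poly p s"
   by (rule exI[of _ "\<Sum>i=0..m. f i * g (m - i)"]) (simp add: fps_mult_nth fg poly_sum)
 qed
qed

lemma polynomial_family_prod:
 "(\<And>k. k \<in> A ==> polynomial_family (F k)) ==> polynomial_family (%s. \<Prod>k\<in>A. F k s)"
 by (induction A rule: infinite_finite_induct)
   (auto intro: polynomial_family_mult polynomial_family_const)

lemma polynomial_family_power: "polynomial_family F ==> polynomial_family (%s. F s ^ n)"
 using polynomial_family_prod[of "{..<n}" "%_. F"] by simp

lemma polynomial_family_sum:
 "(\<And>k. k \<in> A ==> polynomial_family (F k)) ==> polynomial_family (%s. \<Sum>k\<in>A. F k s)"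
 by (induction A rule: infinite_finite_induct)
   (auto intro: polynomial_family_add polynomial_family_const)

lemma polynomial_family_exp: "polynomial_family (%s. fps_exp (-s))"
 unfolding polynomial_family_def
proof
 fix m :: nat
 show "\<exists>p. \<forall>s::'a. fps_nth (fps_exp (-s)) m = poly p s"
  by (rule exI[of _ "smult (1 / fact m) ([:0, -1:] ^ m)"]) simp
qed

lemma polynomial_family_kz_gen: "polynomial_family kz_gen"
 unfolding polynomial_family_def
proof
 fix m :: nat
 have "polynomial_family (%s::'a. \<Sum>n<Suc m. kz_term s n)"
  unfolding kz_term_def
  by (intro polynomial_family_sum polynomial_family_mult polynomial_family_prod
     polynomial_family_power polynomial_family_diff polynomial_family_const polynomial_family_exp)
 thus "\<exists>p. \<forall>s::'a. fps_nth (kz_gen s) m = poly p s"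
  unfolding polynomial_family_def kz_gen_def by simp
qed

text \<open>This makes the solution of the functional equation unique: the lowest coefficient of the
difference of two solutions is antiperiodic in \<open>s\<close>.\<close>

lemma poly_antiperiodic_eq_0:
 fixes p :: "'a::field_char_0 poly"
 assumes "\<And>s. poly p s + poly p (s + 1) = 0"
 shows "p = 0"
proof -
 have per: "poly p (of_nat (2 * n)) = poly p 0" for n
 proof (induction n)
  case (Suc n)
  have "poly p (of_nat (2 * Suc n)) = poly p (of_nat (2 * n) + 1 + 1)" by simp
  also have "\<dots> = poly p (of_nat (2 * n))"
   using assms[of "of_nat (2 * n)"] assms[of "of_nat (2 * n) + 1"]
   by (metis add.commute add_left_cancel)
  finally show ?case using Suc by simp
 qed simp
 have "infinite (range (%n. of_nat (2 * n) :: 'a))"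
  by (rule range_inj_infinite) (auto simp: inj_on_def)
 moreover have "range (%n. of_nat (2 * n) :: 'a) \<subseteq> {s. poly (p - [:poly p 0:]) s = 0}"
  using per by auto
 ultimately have "p - [:poly p 0:] = 0"
  using poly_roots_finite finite_subset by blast
 then obtain c where c: "p = [:c:]" by (metis eq_iff_diff_eq_0)
 show ?thesis using assms[of 0] by (simp add: c)
qed

definition theta_base :: "'a::field_char_0 poly" where "theta_base = [:-1/24, 0, 1/24:]"
definition theta_slope :: "'a::field_char_0 poly" where "theta_slope = [:-1/2, 1/2:]"

text \<open>For \<open>n\<close> prime to 6 the exponent \<open>(n\<^sup>2 - 1) / 24 + s (n - 1) / 2\<close> is that of \<open>q\<close> in the iterated
telescoping identity at \<open>x = q\<^sup>s\<close>, so this is its expected right-hand side.\<close>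

definition theta_side :: "'a::field_char_0 => 'a fps" where
 "theta_side s = theta_exp (- theta_base + smult s (- theta_slope)) 1"

lemma theta_side_functional_equation:
 fixes s :: "'a::field_char_0"
 shows "theta_side s + fps_exp (-(2 + 3 * s)) * theta_side (s + 1) = 1 - fps_exp (-(1 + 2 * s))"
proof -
 define p :: "'a poly" where "p = - theta_base + smult s (- theta_slope)"
 have "[:-(2 + 3 * s):] + (- theta_base + smult (s + 1) (- theta_slope)) = pcompose p [:6, 1:]"
  by (simp add: p_def theta_base_def theta_slope_def pcompose_pCons pcompose_add pcompose_diff
    pcompose_uminus pcompose_smult field_simps)
 hence "fps_exp (-(2 + 3 * s)) * theta_side (s + 1) = theta_exp (pcompose p [:6, 1:]) 1"
  unfolding theta_side_def theta_exp_shift by simp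
 moreover have "theta_exp p 1 + theta_exp (pcompose p [:6, 1:]) 1 = 1 - fps_exp (-(1 + 2 * s))"
 proof (rule fps_ext)
  fix m
  have "fps_nth (theta_exp p 1 + theta_exp (pcompose p [:6, 1:]) 1) m =
     (theta_mean (pcompose (p ^ m) [:6, 1:]) + theta_mean (p ^ m)) / fact m"
   by (simp add: theta_exp_def pcompose_power add_divide_distrib)
  also have "\<dots> = (poly p 1 ^ m - poly p 5 ^ m) / fact m"
   unfolding theta_mean_shift by simp
  also have "poly p 1 = 0" by (simp add: p_def theta_base_def theta_slope_def)
  also have "poly p 5 = -(1 + 2 * s)"
   by (simp add: p_def theta_base_def theta_slope_def field_simps)
  finally show "fps_nth (theta_exp p 1 + theta_exp (pcompose p [:6, 1:]) 1) m =
     fps_nth (1 - fps_exp (-(1 + 2 * s))) m"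
   unfolding fps_sub_nth fps_exp_nth by (cases "m = 0") (simp_all add: diff_divide_distrib del: minus_add_distrib)
 qed
 ultimately show ?thesis by (simp add: theta_side_def p_def)
qed

definition theta_side_poly :: "nat => 'a::field_char_0 poly" where
 "theta_side_poly m = (\<Sum>i\<le>m. monom (of_nat (m choose i) *
   theta_mean ((- theta_slope) ^ i * (- theta_base) ^ (m - i)) / fact m) i)"

lemma theta_side_nth: "fps_nth (theta_side s) m = poly (theta_side_poly m) s"
proof -
 define A B :: "'a poly" where "A = - theta_base" and "B = - theta_slope"
 have "(A + smult s B) ^ m = (\<Sum>i\<le>m. smult (of_nat (m choose i) * s ^ i) (B ^ i * A ^ (m - i)))"
  unfolding add.commute[of A] binomial_ring
  by (intro sum.cong refl) (simp add: of_nat_poly smult_power mult.commute)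
 hence "theta_mean ((A + smult s B) ^ m) =
   (\<Sum>i\<le>m. of_nat (m choose i) * s ^ i * theta_mean (B ^ i * A ^ (m - i)))"
  by (simp add: theta_mean_sum theta_mean_smult)
 thus ?thesis
  unfolding theta_side_def theta_exp_def theta_side_poly_def A_def[symmetric] B_def[symmetric]
  by (simp add: poly_sum poly_monom sum_divide_distrib mult_ac)
qed

text \<open>Both sides have coefficients polynomial in \<open>s\<close> and satisfy the same equation.\<close>

lemma kz_gen_eq_theta_side: "(1 - fps_exp (-s)) * kz_gen s = theta_side (s :: 'a :: field_char_0)"
proof -
 define D :: "'a => 'a fps" where "D s = (1 - fps_exp (-s)) * kz_gen s - theta_side s" for s
 have "polynomial_family D"
  unfolding D_def
  by (intro polynomial_family_diff polynomial_family_mult polynomial_family_const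
     polynomial_family_exp polynomial_family_kz_gen)
    (auto simp: polynomial_family_def theta_side_nth)
 then obtain d where d: "\<And>s m. fps_nth (D s) m = poly (d m) s"
  unfolding polynomial_family_def by metis
 have diff: "(X - T) + E * (Y - U) = (X + E * Y) - (T + E * U)" for X T E Y U :: "'a fps"
  by (simp add: algebra_simps)
 have eq: "D s + fps_exp (-(2 + 3 * s)) * D (s + 1) = 0" for s
  unfolding D_def diff kz_gen_functional_equation theta_side_functional_equation by simp
 have "d m = 0" for m
 proof (induction m rule: less_induct)
  case (less m)
  show ?case
  proof (rule poly_antiperiodic_eq_0)
   fix s
   have "fps_nth (fps_exp (-(2 + 3 * s)) * D (s + 1)) m =
     (\<Sum>i=0..m. fps_nth (fps_exp (-(2 + 3 * s))) i * fps_nth (D (s + 1)) (m - i))"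
    by (rule fps_mult_nth)
   also have "\<dots> = (\<Sum>i=0..m. if i = 0 then fps_nth (D (s + 1)) m else 0)"
    by (intro sum.cong refl) (use less in \<open>auto simp: d\<close>)
   finally have "fps_nth (fps_exp (-(2 + 3 * s)) * D (s + 1)) m = poly (d m) (s + 1)"
    by (simp add: d)
   thus "poly (d m) s + poly (d m) (s + 1) = 0"
    using arg_cong[OF eq[of s], of "%F. fps_nth F m"] by (simp add: d)
  qed
 qed
 hence "D s = 0" by (intro fps_ext) (simp add: d)
 thus ?thesis by (simp add: D_def)
qed

text \<open>At \<open>s = 0\<close> the factor \<open>1 - exp (- s t)\<close> vanishes, so the equation between polynomials in \<open>s\<close> is
differentiated at 0; comparing linear coefficients gives the factor \<open>(n - 1) / 2\<close>.\<close>

lemma kz_gen_0: "kz_gen (0 :: 'a :: field_char_0) = theta_exp (- theta_base) (- theta_slope)"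
proof (rule fps_ext)
 fix m
 obtain r where r: "\<And>s j. fps_nth (kz_gen (s::'a)) j = poly (r j) s"
  using polynomial_family_kz_gen unfolding polynomial_family_def by metis
 define u where "u = (\<Sum>i=1..Suc m. smult (- ((-1) ^ i / fact i)) (monom 1 i * r (Suc m - i)))"
 have "poly u s = poly (theta_side_poly (Suc m)) s" for s
 proof -
  have "fps_nth ((1 - fps_exp (-s)) * kz_gen s) (Suc m) =
    (\<Sum>i=0..Suc m. fps_nth (1 - fps_exp (-s)) i * poly (r (Suc m - i)) s)"
   by (simp add: fps_mult_nth r)
  also have "\<dots> = (\<Sum>i=1..Suc m. fps_nth (1 - fps_exp (-s)) i * poly (r (Suc m - i)) s)"
   by (rule sum.mono_neutral_right) auto
  also have "\<dots> = (\<Sum>i=1..Suc m. poly (smult (- ((-1) ^ i / fact i)) (monom 1 i * r (Suc m - i))) s)"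
   by (intro sum.cong refl) (auto simp: poly_monom power_minus[of s])
  finally show ?thesis
   unfolding kz_gen_eq_theta_side theta_side_nth u_def by (simp add: poly_sum)
 qed
 hence u: "u = theta_side_poly (Suc m)" by (subst poly_eq_poly_eq_iff[symmetric]) auto
 have "coeff u 1 = (\<Sum>i=1..Suc m. if i = 1 then coeff (r m) 0 else 0)"
  unfolding u_def coeff_sum by (intro sum.cong refl) (auto simp: coeff_monom_mult)
 also have "\<dots> = fps_nth (kz_gen (0::'a)) m" by (simp add: r poly_0_coeff_0)
 finally have "fps_nth (kz_gen (0::'a)) m = coeff (theta_side_poly (Suc m)) 1" by (simp only: u)
 also have "\<dots> = (\<Sum>i\<le>Suc m. if i = 1 then of_nat (Suc m choose 1) *
    theta_mean ((- theta_slope) ^ 1 * (- theta_base) ^ m) / fact (Suc m) else 0)"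
  unfolding theta_side_poly_def coeff_sum by (intro sum.cong refl) auto
 also have "\<dots> = theta_mean ((- theta_base) ^ m * (- theta_slope)) / fact m"
  by (simp add: mult_ac divide_simps del: of_nat_Suc)
 finally show "fps_nth (kz_gen 0) m = fps_nth (theta_exp (- theta_base) (- theta_slope :: 'a poly)) m"
  by (simp add: theta_exp_def)
qed

lemma fps_exp_mult_kz_gen_nth:
 "fps_nth (fps_exp (-1/24) * kz_gen (0::'a::field_char_0)) m =
   (-1/24) ^ m / fact m * (theta_moment (2 * m) - theta_moment (2 * m + 1)) / 2"
proof -
 have "fps_exp (-1/24) * kz_gen 0 = theta_exp [:0, 0, -1/24 :: 'a:] [:1/2, -1/2:]"
  unfolding kz_gen_0 theta_exp_shift by (simp add: theta_base_def theta_slope_def)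
 moreover have "[:0, 0, -1/24 :: 'a:] ^ m * [:1/2, -1/2:] =
    smult ((-1/24) ^ m / 2) (monom 1 (2 * m) + monom (-1) (2 * m + 1))"
 proof -
  have a: "[:0, 0, -1/24 :: 'a:] = monom (-1/24) 2"
   by (simp add: monom_altdef power2_eq_square)
  have b: "[:1/2, -1/2 :: 'a:] = smult (1/2) (monom 1 0 + monom (-1) 1)"
   by (simp add: monom_altdef)
  show ?thesis unfolding a b
   by (simp add: monom_power mult_monom smult_add_right algebra_simps smult_monom
     del: One_nat_def)
 qed
 ultimately show ?thesis
  by (simp only: theta_exp_def theta_mean_smult theta_mean_add theta_mean_monom fps_nth_Abs_fps) simp
qed

lemma kz_taylor_nth:
 "N > m ==> fps_nth kz_taylor m = fps_nth (\<Sum>n<N. \<Prod>k=1..n. 1 - (1 + fps_X) ^ k) m"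
proof -
 assume "N > m"
 define f :: "nat => rat fps" where "f n = (\<Prod>k=1..n. 1 - (1 + fps_X) ^ k)" for n
 have f0: "fps_nth (f n) j = 0" if "j < n" for n j
  unfolding f_def by (rule fps_prod_nth_eq_0) (use that in \<open>auto simp: fps_nth_power_0\<close>)
 define g where "g = Abs_fps (%m. fps_nth (\<Sum>n<Suc m. f n) m)"
 have g: "fps_nth g m = fps_nth (\<Sum>n<N. f n) m" if "m < N" for m N
 proof -
  have "(\<Sum>n<N. fps_nth (f n) m) = (\<Sum>n<Suc m. fps_nth (f n) m)"
   by (rule sum.mono_neutral_right) (use that f0 in auto)
  thus ?thesis by (simp add: g_def fps_sum_nth)
 qed
 have "f sums g" unfolding sums_def
 proof (rule tendsto_fpsI)
  fix m
  show "\<forall>\<^sub>F N in sequentially. fps_nth (\<Sum>n<N. f n) m = fps_nth g m"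
   using eventually_gt_at_top[of m] by eventually_elim (simp add: g)
 qed
 hence "kz_taylor = g" unfolding kz_taylor_def f_def[symmetric] by (simp add: sums_iff)
 thus ?thesis using g[OF \<open>N > m\<close>] by (simp add: f_def)
qed

lemma kz_taylor_compose: "fps_compose kz_taylor (fps_exp (-1) - 1) = kz_gen 0"
proof (rule fps_ext)
 fix m
 define h :: "rat fps" where "h = fps_exp (-1) - 1"
 have h0: "fps_nth h 0 = 0" by (simp add: h_def)
 have "fps_nth (fps_compose kz_taylor h) m =
   (\<Sum>i=0..m. fps_nth (\<Sum>n<Suc m. \<Prod>k=1..n. 1 - (1 + fps_X) ^ k) i * fps_nth (h ^ i) m)"
  unfolding fps_compose_nth by (intro sum.cong refl) (simp add: kz_taylor_nth[of _ "Suc m"])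
 also have "\<dots> = fps_nth (fps_compose (\<Sum>n<Suc m. \<Prod>k=1..n. 1 - (1 + fps_X) ^ k) h) m"
  by (simp add: fps_compose_nth)
 also have "fps_compose (\<Sum>n<Suc m. \<Prod>k=1..n. 1 - (1 + fps_X) ^ k) h = (\<Sum>n<Suc m. kz_term 0 n)"
  unfolding fps_compose_sum_distrib kz_term_def
  by (simp add: fps_compose_prod_distrib[OF h0] fps_compose_sub_distrib fps_compose_add_distrib
     fps_compose_power[OF h0, symmetric] fps_compose_1 fps_X_fps_compose_startby0 h0 del: sum.lessThan_Suc)
    (simp add: h_def)
 finally show "fps_nth (fps_compose kz_taylor (fps_exp (-1) - 1)) m = fps_nth (kz_gen 0) m"
  unfolding kz_gen_def h_def by simp
qed

lemma kz_series_nth_theta_moment: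
 "fps_nth kz_series m = (-1/24) ^ m / fact m * (theta_moment (2 * m) - theta_moment (2 * m + 1)) / 2"
 unfolding kz_series_def kz_taylor_compose by (rule fps_exp_mult_kz_gen_nth)

section \<open>The pentagonal number theorem and eta\<close>

lemma norm_chi12_le: "norm (chi12 n) \<le> 1"
 by (auto simp: chi12_def)

definition euler_product :: "complex => complex => nat => complex" where
 "euler_product q x n = (\<Prod>k=1..n. 1 - x * q ^ k)"

definition euler_series :: "complex => complex => complex" where
 "euler_series q x = (\<Sum>n. (1 - x) * euler_product q x n * x ^ n)"

lemma norm_euler_product_le:
 assumes "norm q < 1" "norm x \<le> 1"
 shows "norm (euler_product q x n) \<le> exp (1 / (1 - norm q))"
proof -
 have "norm (euler_product q x n) \<le> (\<Prod>k=1..n. exp (norm q ^ k))"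
  unfolding euler_product_def prod_norm[symmetric]
 proof (intro prod_mono conjI norm_ge_zero)
  fix k
  have "norm (1 - x * q ^ k) \<le> 1 + norm x * norm q ^ k"
   by (rule order_trans[OF norm_triangle_ineq4]) (simp add: norm_mult norm_power)
  also have "\<dots> \<le> 1 + norm q ^ k"
   using assms by (intro add_left_mono mult_left_le_one_le) auto
  also have "\<dots> \<le> exp (norm q ^ k)" by (rule exp_ge_add_one_self)
  finally show "norm (1 - x * q ^ k) \<le> exp (norm q ^ k)" .
 qed
 also have "\<dots> = exp (\<Sum>k=1..n. norm q ^ k)" by (simp add: exp_sum)
 also have "(\<Sum>k=1..n. norm q ^ k) \<le> (\<Sum>k. norm q ^ k)"
  by (rule sum_le_suminf) (use assms in \<open>auto simp: summable_geometric\<close>)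
 also have "(\<Sum>k. norm q ^ k) = 1 / (1 - norm q)"
  using assms by (simp add: suminf_geometric)
 finally show ?thesis by simp
qed

lemma summable_euler_series:
 assumes "norm q < 1" "norm x < 1"
 shows "summable (%n. (1 - x) * euler_product q x n * x ^ n)"
proof (rule summable_comparison_test')
 show "summable (%n. 2 * exp (1 / (1 - norm q)) * norm x ^ n)"
  using assms by (intro summable_mult summable_geometric) auto
 fix n
 have "norm (1 - x) \<le> 2" using norm_triangle_ineq4[of 1 x] assms by simp
 thus "norm ((1 - x) * euler_product q x n * x ^ n) \<le> 2 * exp (1 / (1 - norm q)) * norm x ^ n"
  using assms unfolding norm_mult norm_power
  by (intro mult_mono norm_euler_product_le) auto
qed

lemma norm_euler_series_le:
 assumes "norm q < 1" "norm x \<le> norm q"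
 shows "norm (euler_series q x) \<le> 2 * exp (1 / (1 - norm q)) / (1 - norm q)"
proof -
 have s: "summable (%n. 2 * exp (1 / (1 - norm q)) * norm q ^ n)"
  using assms by (intro summable_mult summable_geometric) auto
 have "norm (euler_series q x) \<le> (\<Sum>n. 2 * exp (1 / (1 - norm q)) * norm q ^ n)"
  unfolding euler_series_def
 proof (rule norm_suminf_le[OF _ s])
  fix n
  have "norm (1 - x) \<le> 2" using norm_triangle_ineq4[of 1 x] assms by simp
  thus "norm ((1 - x) * euler_product q x n * x ^ n) \<le> 2 * exp (1 / (1 - norm q)) * norm q ^ n"
   using assms unfolding norm_mult norm_power
   by (intro mult_mono norm_euler_product_le power_mono) auto
 qed
 also have "\<dots> = 2 * exp (1 / (1 - norm q)) / (1 - norm q)"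
  using assms by (subst suminf_mult) (auto simp: suminf_geometric summable_geometric)
 finally show ?thesis .
qed

lemma euler_shifted_product:
 "(\<Prod>k=1..Suc n. 1 - x * q ^ k) = (1 - x * q) * euler_product q (x * q) n"
proof -
 have "(\<Prod>k=1..Suc n. 1 - x * q ^ k) = (1 - x * q) * (\<Prod>k=Suc 1..Suc n. 1 - x * q ^ k)"
  by (subst prod.atLeast_Suc_atMost) auto
 also have "(\<Prod>k=Suc 1..Suc n. 1 - x * q ^ k) = euler_product q (x * q) n"
  unfolding euler_product_def
  by (subst prod.atLeast_Suc_atMost_Suc_shift) (simp add: mult.assoc)
 finally show ?thesis .
qed

lemma euler_telescoping:
 "(\<Sum>n<N. (1 - x) * euler_product q x n * x ^ n)
  + q ^ 2 * x ^ 3 * (\<Sum>n<N. (1 - x * q) * euler_product q (x * q) n * (x * q) ^ n)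
  = euler_product q x N * x ^ N * (q * x ^ 2 * q ^ N - 1) - (q * x ^ 2 - 1)"
 using telescoping_identity[of x q N]
 unfolding euler_shifted_product by (simp add: euler_product_def)

text \<open>Inside the unit disc the boundary term of the telescoping identity tends to 0.\<close>

lemma euler_series_functional_equation:
 assumes "norm q < 1" "norm x < 1"
 shows "euler_series q x + q ^ 2 * x ^ 3 * euler_series q (x * q) = 1 - q * x ^ 2"
proof -
 have xq: "norm (x * q) < 1"
 proof -
  have "norm x * norm q \<le> norm x * 1" using assms by (intro mult_left_mono) auto
  thus ?thesis using assms by (simp add: norm_mult)
 qed
 have x0: "(%N. x ^ N) \<longlonglongrightarrow> 0" and q0: "(%N. q ^ N) \<longlonglongrightarrow> 0"
  using assms by (auto intro: LIMSEQ_power_zero)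
 have "(%N. euler_product q x N * x ^ N) \<longlonglongrightarrow> 0"
 proof (rule Lim_null_comparison)
  show "\<forall>\<^sub>F N in sequentially. norm (euler_product q x N * x ^ N) \<le> exp (1 / (1 - norm q)) * norm x ^ N"
   using assms by (intro always_eventually allI)
    (auto simp: norm_mult norm_power intro!: mult_right_mono norm_euler_product_le)
  show "(%N. exp (1 / (1 - norm q)) * norm x ^ N) \<longlonglongrightarrow> 0"
   by (rule tendsto_mult_right_zero) (use assms in \<open>auto intro!: LIMSEQ_power_zero\<close>)
 qed
 hence "(%N. euler_product q x N * x ^ N * (q * x ^ 2 * q ^ N - 1) - (q * x ^ 2 - 1))
   \<longlonglongrightarrow> 0 * (q * x ^ 2 * 0 - 1) - (q * x ^ 2 - 1)"
  by (intro tendsto_intros q0)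
 moreover have "(%N. (\<Sum>n<N. (1 - x) * euler_product q x n * x ^ n)
   + q ^ 2 * x ^ 3 * (\<Sum>n<N. (1 - x * q) * euler_product q (x * q) n * (x * q) ^ n))
   \<longlonglongrightarrow> euler_series q x + q ^ 2 * x ^ 3 * euler_series q (x * q)"
  unfolding euler_series_def
  by (intro tendsto_intros summable_LIMSEQ summable_euler_series assms xq)
 ultimately show ?thesis
  unfolding euler_telescoping by (auto dest: LIMSEQ_unique)
qed

lemma euler_product_limit:
 assumes "norm q < 1" "(%N. \<Prod>k=1..N. 1 - q ^ k) \<longlonglongrightarrow> L"
 shows "L = 1 - q - q ^ 2 * euler_series q q"
proof -
 have q0: "(%N. q ^ N) \<longlonglongrightarrow> 0"
  using assms by (auto intro: LIMSEQ_power_zero)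
 have "(%N. euler_product q 1 N * 1 ^ N * (q * 1 ^ 2 * q ^ N - 1) - (q * 1 ^ 2 - 1))
   \<longlonglongrightarrow> L * 1 * (q * 1 ^ 2 * 0 - 1) - (q * 1 ^ 2 - 1)"
  using assms(2) unfolding euler_product_def mult_1_left power_one by (intro tendsto_intros q0)
 moreover have "(%N. (\<Sum>n<N. (1 - 1) * euler_product q 1 n * 1 ^ n)
   + q ^ 2 * 1 ^ 3 * (\<Sum>n<N. (1 - 1 * q) * euler_product q (1 * q) n * (1 * q) ^ n))
   \<longlonglongrightarrow> q ^ 2 * euler_series q q"
  unfolding euler_series_def mult_1_left power_one mult_1_right diff_self mult_zero_left sum.neutral_const add_0
  by (intro tendsto_intros summable_LIMSEQ summable_euler_series assms)
 ultimately have "q ^ 2 * euler_series q q = L * 1 * (q * 1 ^ 2 * 0 - 1) - (q * 1 ^ 2 - 1)"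
  unfolding euler_telescoping by (auto dest: LIMSEQ_unique)
 thus ?thesis by (simp add: algebra_simps)
qed

definition pent_exp :: "nat => nat" where "pent_exp n = (n\<^sup>2 - 1) div 24"

lemma pent_exp_eq: "chi12 n ~= 0 ==> n\<^sup>2 = 24 * pent_exp n + 1"
proof -
 assume "chi12 n ~= 0"
 hence *: "n mod 12 \<in> {1,5,7,11}" by (auto simp: chi12_def split: if_splits)
 have "r\<^sup>2 mod 24 = 1" if "r \<in> {1,5,7,11}" for r :: nat using that by auto
 from this[OF *] have "(n mod 12)\<^sup>2 mod 24 = 1" .
 have "(12 * a + b)\<^sup>2 = 24 * (6 * a\<^sup>2 + a * b) + b\<^sup>2" for a b :: nat
  by (simp add: power2_eq_square algebra_simps)
 from this[of "n div 12" "n mod 12"]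
 have "n\<^sup>2 = 24 * (6 * (n div 12)\<^sup>2 + (n div 12) * (n mod 12)) + (n mod 12)\<^sup>2"
  unfolding mult_div_mod_eq .
 hence "n\<^sup>2 mod 24 = (24 * (6 * (n div 12)\<^sup>2 + (n div 12) * (n mod 12)) + (n mod 12)\<^sup>2) mod 24"
  by (rule arg_cong)
 hence "n\<^sup>2 mod 24 = 1" unfolding mod_mult_self4 \<open>(n mod 12)\<^sup>2 mod 24 = 1\<close> .
 moreover have "m = 24 * ((m - 1) div 24) + 1" if "m mod 24 = 1" for m :: nat
 proof -
  have "m = 24 * (m div 24) + 1" using div_mult_mod_eq[of m 24] that by simp
  then obtain k where "m = 24 * k + 1" ..
  thus ?thesis by simp
 qed
 ultimately show ?thesis unfolding pent_exp_def by blast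
qed

lemma chi12_block:
 "chi12 (6 * J) = 0" "chi12 (6 * J + 1) = (-1) ^ J" "chi12 (6 * J + 2) = 0" "chi12 (6 * J + 3) = 0"
 "chi12 (6 * J + 4) = 0" "chi12 (6 * J + 5) = - ((-1) ^ J)"
proof -
 have *: "(6 * J + r) mod 12 = (if even J then r else 6 + r)" if "r < 6" for r
 proof (cases "even J")
  case True
  then obtain k where "J = 2 * k" by (auto elim: evenE)
  hence "6 * J + r = r + k * 12" by simp
  hence "(6 * J + r) mod 12 = (r + k * 12) mod 12" by (rule arg_cong)
  also have "\<dots> = r" unfolding mod_mult_self1 using that by simp
  finally show ?thesis using True by simp
 next
  case False
  then obtain k where "J = 2 * k + 1" by (auto elim: oddE)
  hence "6 * J + r = (6 + r) + k * 12" by simp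
  hence "(6 * J + r) mod 12 = ((6 + r) + k * 12) mod 12" by (rule arg_cong)
  also have "\<dots> = 6 + r" unfolding mod_mult_self1 using that by simp
  finally show ?thesis using False by simp
 qed
 show "chi12 (6 * J) = 0" using *[of 0] by (simp add: chi12_def)
 show "chi12 (6 * J + 1) = (-1) ^ J" using *[of 1] by (auto simp: chi12_def)
 show "chi12 (6 * J + 2) = 0" using *[of 2] by (auto simp: chi12_def)
 show "chi12 (6 * J + 3) = 0" using *[of 3] by (auto simp: chi12_def)
 show "chi12 (6 * J + 4) = 0" using *[of 4] by (auto simp: chi12_def)
 show "chi12 (6 * J + 5) = - ((-1) ^ J)" using *[of 5] by (auto simp: chi12_def)
qed

lemma pent_exp_rec:
 "pent_exp (6 * J + 5) = pent_exp (6 * J + 1) + 2 * J + 1"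
 "pent_exp (6 * Suc J + 1) = pent_exp (6 * J + 1) + 3 * J + 2"
proof -
 have "chi12 (6 * J + 5) ~= 0" "chi12 (6 * J + 1) ~= 0" "chi12 (6 * Suc J + 1) ~= 0"
  unfolding chi12_block by auto
 note * = this[THEN pent_exp_eq]
 have "24 * pent_exp (6 * J + 5) + 1 = (6 * J + 5)\<^sup>2" by (rule *(1)[symmetric])
 also have "\<dots> = (6 * J + 1)\<^sup>2 + 24 * (2 * J + 1)"
  by (simp add: power2_eq_square algebra_simps)
 finally show "pent_exp (6 * J + 5) = pent_exp (6 * J + 1) + 2 * J + 1"
  unfolding *(2) by simp
 have "24 * pent_exp (6 * Suc J + 1) + 1 = (6 * Suc J + 1)\<^sup>2" by (rule *(3)[symmetric])
 also have "\<dots> = (6 * J + 1)\<^sup>2 + 24 * (3 * J + 2)"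
  by (simp add: power2_eq_square algebra_simps)
 finally show "pent_exp (6 * Suc J + 1) = pent_exp (6 * J + 1) + 3 * J + 2"
  unfolding *(2) by simp
qed

lemma sum_block6: "sum f {..<6 * Suc J} = sum f {..<6 * J} + f (6 * J) + f (6 * J + 1) + f (6 * J + 2)
  + f (6 * J + 3) + f (6 * J + 4) + (f (6 * J + 5) :: 'a :: comm_monoid_add)"
proof -
 have "sum f {..<m + 6} = sum f {..<m} + f m + f (m + 1) + f (m + 2) + f (m + 3) + f (m + 4) + f (m + 5)" for m
  by (simp add: numeral_eq_Suc)
 from this[of "6 * J"] show ?thesis by (simp add: add.commute)
qed

text \<open>Each application of the functional equation at \<open>x = q\<^sup>j\<close> splits off the next block of six
exponents and leaves a remainder with a large power of \<open>q\<close>.\<close>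

lemma euler_product_partial:
 assumes q: "norm q < 1" and lim: "(%N. \<Prod>k=1..N. 1 - q ^ k) \<longlonglongrightarrow> L"
 shows "L = (\<Sum>n<6 * Suc J. chi12 n * q ^ pent_exp n)
   + (-1) ^ Suc J * q ^ pent_exp (6 * Suc J + 1) * euler_series q (q ^ Suc J)"
proof (induction J)
 case 0
 have "pent_exp 1 = 0" "pent_exp 5 = 1" "pent_exp 7 = 2" by (auto simp: pent_exp_def)
 have "(\<Sum>n<6 * Suc 0. chi12 n * q ^ pent_exp n) = 1 - q"
  unfolding sum_block6 chi12_block using pent_exp_rec(1)[of 0] \<open>pent_exp 1 = 0\<close> by simp
 moreover have "pent_exp (6 * Suc 0 + 1) = 2" using \<open>pent_exp 7 = 2\<close> by simp
 ultimately show ?case using euler_product_limit[OF q lim] by simp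
next
 case (Suc J)
 define x where "x = q ^ Suc J"
 define e where "e = pent_exp (6 * Suc J + 1)"
 have "norm x < 1" unfolding x_def norm_power
  by (rule le_less_trans[OF power_Suc_le_self q]) (use q in auto)
 have x2: "x ^ 2 = q ^ (2 * Suc J)" and x3: "x ^ 3 = q ^ (3 * Suc J)"
  by (simp_all only: x_def power_mult[symmetric] mult.commute)
 from \<open>norm x < 1\<close> have "euler_series q x = 1 - q * x ^ 2 - q ^ 2 * x ^ 3 * euler_series q (x * q)"
  using euler_series_functional_equation[OF q, of x] by (simp add: algebra_simps)
 moreover have "q ^ pent_exp (6 * Suc J + 5) = q ^ e * (q * x ^ 2)"
  unfolding pent_exp_rec(1)[of "Suc J"] e_def[symmetric] x2 by (simp only: power_add power_one_right mult_ac)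
 moreover have "q ^ pent_exp (6 * Suc (Suc J) + 1) = q ^ e * (q ^ 2 * x ^ 3)"
  unfolding pent_exp_rec(2)[of "Suc J"] e_def[symmetric] x3 by (simp only: power_add power_one_right mult_ac)
 moreover have "q ^ Suc (Suc J) = x * q" by (simp add: x_def)
 ultimately show ?case
  unfolding sum_block6[of _ "Suc J"] chi12_block
  by (subst Suc, unfold x_def[symmetric] e_def[symmetric]) (simp only:, simp add: algebra_simps)
qed

lemma summable_pent:
 assumes q: "norm q < 1"
 shows "summable (%n. chi12 n * q ^ pent_exp n)"
proof (rule summable_comparison_test')
 show "summable (%n. norm q ^ (n - 1))"
  by (subst summable_Suc_iff[symmetric]) (use q in \<open>simp add: summable_geometric\<close>)
 fix n :: nat assume "n \<ge> 24"
 show "norm (chi12 n * q ^ pent_exp n) \<le> norm q ^ (n - 1)"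
 proof (cases "chi12 n = 0")
  case False
  have "24 * n \<le> n ^ 2" using \<open>n \<ge> 24\<close> by (simp add: power2_eq_square)
  hence "24 * (n - 1) \<le> n\<^sup>2 - 1" using \<open>n \<ge> 24\<close> by linarith
  hence "n - 1 \<le> pent_exp n" unfolding pent_exp_def by linarith
  hence "norm q ^ pent_exp n \<le> norm q ^ (n - 1)"
   using q by (intro power_decreasing) auto
  moreover have "norm (chi12 n) * norm q ^ pent_exp n \<le> norm q ^ pent_exp n"
   using norm_chi12_le[of n] by (intro mult_left_le_one_le) auto
  ultimately show ?thesis unfolding norm_mult norm_power by linarith
 qed auto
qed

theorem pentagonal_number_theorem:
 assumes q: "norm q < 1" and lim: "(%N. \<Prod>k=1..N. 1 - q ^ k) \<longlonglongrightarrow> L"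
 shows "(%n. chi12 n * q ^ pent_exp n) sums L"
proof -
 define B where "B = 2 * exp (1 / (1 - norm q)) / (1 - norm q)"
 have "filterlim (%J. 6 * Suc J) sequentially sequentially"
  by (rule filterlim_subseq) (auto simp: strict_mono_def)
 hence "(%J. \<Sum>n<6 * Suc J. chi12 n * q ^ pent_exp n) \<longlonglongrightarrow> (\<Sum>n. chi12 n * q ^ pent_exp n)"
  by (rule filterlim_compose[OF summable_LIMSEQ[OF summable_pent[OF q]]])
 moreover have "(%J. (-1) ^ Suc J * q ^ pent_exp (6 * Suc J + 1) * euler_series q (q ^ Suc J)) \<longlonglongrightarrow> 0"
 proof (rule Lim_null_comparison)
  show "\<forall>\<^sub>F J in sequentially. norm ((-1) ^ Suc J * q ^ pent_exp (6 * Suc J + 1) * euler_series q (q ^ Suc J)) \<le> norm q ^ J * B"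
  proof (intro always_eventually allI)
   fix J
   have "J \<le> pent_exp (6 * Suc J + 1)" unfolding pent_exp_rec by linarith
   hence "norm q ^ pent_exp (6 * Suc J + 1) \<le> norm q ^ J"
    using q by (intro power_decreasing) auto
   moreover have "norm (q ^ Suc J) \<le> norm q"
    unfolding norm_power using q power_decreasing[of 1 "Suc J" "norm q"] by simp
   ultimately show "norm ((-1) ^ Suc J * q ^ pent_exp (6 * Suc J + 1) * euler_series q (q ^ Suc J)) \<le> norm q ^ J * B"
    unfolding norm_mult norm_power B_def norm_minus_cancel norm_one power_one mult_1_left
    by (intro mult_mono norm_euler_series_le[OF q]) (use q in \<open>auto simp: norm_power norm_mult\<close>)
  qed
  show "(%J. norm q ^ J * B) \<longlonglongrightarrow> 0"
   by (rule tendsto_mult_left_zero) (use q in \<open>auto intro!: LIMSEQ_power_zero\<close>)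
 qed
 ultimately have "(%J. (\<Sum>n<6 * Suc J. chi12 n * q ^ pent_exp n)
   + (-1) ^ Suc J * q ^ pent_exp (6 * Suc J + 1) * euler_series q (q ^ Suc J)) \<longlonglongrightarrow>
   (\<Sum>n. chi12 n * q ^ pent_exp n) + 0"
  by (intro tendsto_add)
 hence "L = (\<Sum>n. chi12 n * q ^ pent_exp n)"
  unfolding euler_product_partial[OF q lim, symmetric] by (simp add: LIMSEQ_const_iff)
 thus ?thesis using summable_pent[OF q] by (simp add: sums_iff)
qed

definition loc :: "nat => real" where "loc n = pi\<^sup>2 / 6 * (real n)\<^sup>2"

abbreviation cloc :: "nat => complex" where "cloc n \<equiv> of_real (loc n)"

lemma eta_sums:
 assumes "Re w > 0"
 shows "(%n. chi12 n * exp (- (cloc n * w))) sums eta (2 * of_real pi * \<i> * w)"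
proof -
 define z where "z = 2 * of_real pi * \<i> * w"
 define q where "q = exp (2 * of_real pi * \<i> * z)"
 have "Re (2 * of_real pi * \<i> * z) = - (4 * pi ^ 2 * Re w)"
  by (simp add: z_def power2_eq_square)
 moreover have "4 * pi ^ 2 * Re w > 0" using assms by simp
 ultimately have q: "norm q < 1" unfolding q_def norm_exp_eq_Re by simp
 have qpow: "exp (2 * of_real pi * \<i> * of_nat (Suc n) * z) = q ^ Suc n" for n
  unfolding q_def exp_of_nat_mult[symmetric] by (simp add: mult_ac)
 have "convergent_prod (%n. 1 + (- (q ^ Suc n)))"
 proof (rule summable_imp_convergent_prod_complex)
  show "summable (%k. norm (- (q ^ Suc k)))"
   unfolding norm_minus_cancel norm_power summable_Suc_iff using q by (simp add: summable_geometric)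
  fix k
  have "norm (q ^ Suc k) < 1" unfolding norm_power
   by (rule le_less_trans[OF power_Suc_le_self q]) (use q in auto)
  thus "- (q ^ Suc k) ~= -1" by auto
 qed
 hence "(%n. \<Prod>i\<le>n. 1 - q ^ Suc i) \<longlonglongrightarrow> (\<Prod>n. 1 - q ^ Suc n)"
  using convergent_prod_LIMSEQ by fastforce
 moreover have "(\<Prod>i\<le>n. 1 - q ^ Suc i) = (\<Prod>k=1..Suc n. 1 - q ^ k)" for n
  by (simp only: One_nat_def prod.atLeast1_atMost_eq lessThan_Suc_atMost)
 ultimately have "(%N. \<Prod>k=1..N. 1 - q ^ k) \<longlonglongrightarrow> (\<Prod>n. 1 - q ^ Suc n)"
  by (subst filterlim_sequentially_Suc[symmetric]) simp
 from sums_mult[OF pentagonal_number_theorem[OF q this], of "exp (of_real pi * \<i> * z / 12)"]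
 have *: "(%n. exp (of_real pi * \<i> * z / 12) * (chi12 n * q ^ pent_exp n)) sums eta z"
  unfolding eta_def qpow .
 have "exp (of_real pi * \<i> * z / 12) * (chi12 n * q ^ pent_exp n) = chi12 n * exp (- (cloc n * w))" for n
 proof (cases "chi12 n = 0")
  case False
  have "of_nat (n\<^sup>2) = (of_nat (24 * pent_exp n + 1) :: complex)"
   using pent_exp_eq[OF False] by (rule arg_cong)
  hence n: "(of_nat n)\<^sup>2 = (24 * of_nat (pent_exp n) + 1 :: complex)" by simp
  have "exp (of_real pi * \<i> * z / 12) * q ^ pent_exp n =
     exp (of_real pi * \<i> * z / 12 + of_nat (pent_exp n) * (2 * of_real pi * \<i> * z))"
   unfolding q_def exp_of_nat_mult[symmetric] exp_add ..
  also have "of_real pi * \<i> * z / 12 + of_nat (pent_exp n) * (2 * of_real pi * \<i> * z)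
    = of_real pi * \<i> * z / 12 * (24 * of_nat (pent_exp n) + 1)"
   by (simp add: field_simps)
  also have "\<dots> = - (cloc n * w)"
   unfolding n[symmetric] by (simp add: z_def loc_def field_simps power2_eq_square)
  finally show ?thesis by simp
 qed simp
 with * show ?thesis by (simp only: z_def)
qed

section \<open>Partial fractions and the Borel transform near 0\<close>

text \<open>The logarithmic derivative of the reflection formula of the Gamma function; together with the
series of Digamma it gives the partial fractions of the cotangent.\<close>

lemma Digamma_reflection:
 fixes z :: complex
 assumes z: "z \<notin> \<int>"
 shows "Digamma (1 - z) - Digamma z = of_real pi * cot (of_real pi * z)"
proof -
 have s: "sin (of_real pi * w) ~= 0" if "w \<notin> \<int>" for w :: complex
 proof
  assume "sin (of_real pi * w) = 0"
  then obtain n :: int where "of_real pi * w = of_real (of_int n * pi)"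
   unfolding sin_eq_0 by auto
  hence "w = of_int n" by simp
  thus False using that by auto
 qed
 have z': "1 - z \<notin> \<int>" using z by (metis Ints_1 Ints_diff diff_diff_eq2 diff_add_cancel add_diff_cancel_left')
 have nz: "z \<notin> \<int>\<^sub>\<le>\<^sub>0" "1 - z \<notin> \<int>\<^sub>\<le>\<^sub>0" using z z' nonpos_Ints_subset_Ints by blast+
 have G: "Gamma z ~= 0" "Gamma (1 - z) ~= 0" using nz by (simp_all add: Gamma_eq_zero_iff)
 define H where "H w = Gamma w * Gamma (1 - w) * sin (of_real pi * w)" for w :: complex
 have "(H has_field_derivative
   (Gamma z * Digamma z * Gamma (1 - z) - Gamma z * (Gamma (1 - z) * Digamma (1 - z))) * sin (of_real pi * z)
   + Gamma z * Gamma (1 - z) * (cos (of_real pi * z) * of_real pi)) (at z)"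
  unfolding H_def using nz by (auto intro!: derivative_eq_intros simp: algebra_simps)
 moreover have "(H has_field_derivative 0) (at z)"
 proof (rule has_field_derivative_transform_within_open)
  show "((%_. of_real pi) has_field_derivative 0) (at z)" by simp
  show "open (- \<int> :: complex set)" by (simp add: open_Compl closed_Ints)
  show "z \<in> - \<int>" using z by simp
  show "of_real pi = H w" if "w \<in> - \<int>" for w
   using s[of w] that by (simp add: H_def Gamma_reflection_complex)
 qed
 ultimately have "(Gamma z * Digamma z * Gamma (1 - z) - Gamma z * (Gamma (1 - z) * Digamma (1 - z))) * sin (of_real pi * z)
   + Gamma z * Gamma (1 - z) * (cos (of_real pi * z) * of_real pi) = 0"
  using DERIV_unique by blast
 hence "Gamma z * Gamma (1 - z) * ((Digamma z - Digamma (1 - z)) * sin (of_real pi * z) + cos (of_real pi * z) * of_real pi) = 0"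
  by (simp add: algebra_simps)
 hence "(Digamma z - Digamma (1 - z)) * sin (of_real pi * z) + cos (of_real pi * z) * of_real pi = 0"
  using G by simp
 thus ?thesis using s[OF z] by (simp add: cot_def field_simps)
qed

lemma cot_sums:
 fixes z :: complex
 assumes z: "z \<notin> \<int>"
 shows "(%k. 1 / (of_nat k + z) - 1 / (of_nat k + 1 - z)) sums (of_real pi * cot (of_real pi * z))"
proof -
 have D: "(%k. inverse (of_nat (Suc k)) - inverse (w + of_nat k)) sums (Digamma w + euler_mascheroni)"
  if "w ~= 0" for w :: complex
  using summable_Digamma[OF that] by (simp add: Digamma_def sums_iff)
 have "z ~= 0" "1 - z ~= 0" using z by auto
 from sums_diff[OF D[OF this(2)] D[OF this(1)]] show ?thesis
  unfolding Digamma_reflection[OF z, symmetric] by (simp add: field_simps)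
qed

lemma sums_swap:
 fixes f :: "nat => nat => 'a :: {real_normed_algebra, banach}"
 assumes sums: "\<And>n. (%m. f n m) sums g n"
  and bound: "\<And>n M. norm (\<Sum>m<M. f n m) \<le> B n" and B: "summable B"
  and col: "\<And>m. summable (%n. f n m)"
 shows "summable g" "(%m. \<Sum>n. f n m) sums (\<Sum>n. g n)"
proof -
 have T: "eventually (%M. summable (%n. norm (\<Sum>m<M. f n m))) sequentially \<and>
      summable (%n. norm (g n)) \<and>
      ((%M. suminf (%n. \<Sum>m<M. f n m)) \<longlongrightarrow> suminf g) sequentially"
  by (rule tannerys_theorem[where M = B])
    (use sums bound B in \<open>auto simp: sums_def intro!: always_eventually\<close>)
 from T show "summable g" using summable_norm_cancel by blast
 have "(\<Sum>n. \<Sum>m<M. f n m) = (\<Sum>m<M. \<Sum>n. f n m)" for M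
  using col by (intro suminf_sum) auto
 thus "(%m. \<Sum>n. f n m) sums (\<Sum>n. g n)" using T by (simp add: sums_def)
qed

definition pole :: "nat => real" where "pole n = pi / 6 * real n"

definition char_value :: "nat => complex" where
 "char_value m = (\<Sum>n. chi12 n / of_real (pole n) ^ (2 * m + 2))"

lemma summable_inverse_pole_sq: "summable (%n. inverse (pole n ^ 2))"
proof -
 have "summable (%n. 36 / pi ^ 2 * inverse (real n ^ 2))"
  by (intro summable_mult inverse_power_summable) auto
 thus ?thesis by (simp add: pole_def power_mult_distrib field_simps)
qed

lemma chi12_0 [simp]: "chi12 0 = 0" by (simp add: chi12_def)

lemma pole_ge: "n > 0 ==> pole n \<ge> pi / 6"
 by (simp add: pole_def field_simps)

lemma norm_char_term_le:
 "norm (chi12 n / of_real (pole n) ^ (2 * m + 2)) \<le> (6 / pi) ^ (2 * m) * inverse (pole n ^ 2)"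
proof (cases "n = 0")
 case False
 have p: "pole n > 0" using False by (simp add: pole_def)
 have "inverse (pole n) \<le> 6 / pi"
  using False by (simp add: pole_def field_simps)
 hence "inverse (pole n) ^ (2 * m) \<le> (6 / pi) ^ (2 * m)"
  using p by (intro power_mono) auto
 hence "inverse (pole n) ^ (2 * m) * inverse (pole n ^ 2) \<le> (6 / pi) ^ (2 * m) * inverse (pole n ^ 2)"
  by (intro mult_right_mono) auto
 moreover have "norm (chi12 n) * (inverse (pole n) ^ (2 * m) * inverse (pole n ^ 2))
   \<le> inverse (pole n) ^ (2 * m) * inverse (pole n ^ 2)"
  using norm_chi12_le[of n] p by (intro mult_left_le_one_le) auto
 moreover have "norm (chi12 n / of_real (pole n) ^ (2 * m + 2)) =
   norm (chi12 n) * (inverse (pole n) ^ (2 * m) * inverse (pole n ^ 2))"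
  using p by (simp only: divide_inverse power_add inverse_mult_distrib norm_mult norm_inverse
     norm_power norm_of_real abs_of_pos power_inverse)
 ultimately show ?thesis by linarith
qed simp

lemma summable_char_value: "summable (%n. chi12 n / of_real (pole n) ^ (2 * m + 2))"
 by (rule summable_comparison_test'[OF _ norm_char_term_le])
   (intro summable_mult summable_inverse_pole_sq)

lemma char_gf_sums:
 assumes v: "norm v < pi / 6"
 defines "t \<equiv> (%n. chi12 n * (2 * v / (of_real (pole n) ^ 2 - v ^ 2)))"
 shows "summable t" "(%m. 2 * char_value m * v ^ (2 * m + 1)) sums (\<Sum>n. t n)"
proof -
 define \<rho> where "\<rho> = 6 / pi * norm v"
 have \<rho>: "0 \<le> \<rho>" "\<rho> < 1" using v by (auto simp: \<rho>_def field_simps)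
 define f where "f n m = chi12 n / of_real (pole n) ^ (2 * m + 2) * (2 * v ^ (2 * m + 1))" for n m
 have geom: "\<rho> ^ 2 < 1" using \<rho> by (simp add: abs_square_less_1)
 define B where "B n = 2 * norm v / (1 - \<rho>\<^sup>2) * inverse (pole n ^ 2)" for n
 have f_le: "norm (f n m) \<le> 2 * norm v * inverse (pole n ^ 2) * (\<rho>\<^sup>2) ^ m" for n m
 proof -
  have "norm (f n m) \<le> ((6 / pi) ^ (2 * m) * inverse (pole n ^ 2)) * (2 * norm v ^ (2 * m + 1))"
   unfolding f_def norm_mult norm_power norm_numeral
   by (intro mult_right_mono norm_char_term_le) auto
  also have "(6 / pi) ^ (2 * m) * norm v ^ (2 * m) = (\<rho>\<^sup>2) ^ m"
   by (simp only: \<rho>_def power_mult_distrib[symmetric] power_mult)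
  hence "((6 / pi) ^ (2 * m) * inverse (pole n ^ 2)) * (2 * norm v ^ (2 * m + 1)) =
   2 * norm v * inverse (pole n ^ 2) * (\<rho>\<^sup>2) ^ m"
   by (simp add: mult_ac)
  finally show ?thesis .
 qed
 have summable_geom: "summable (%m. (\<rho>\<^sup>2) ^ m)" using geom \<rho> by (intro summable_geometric) auto
 have "(%m. f n m) sums t n" for n
 proof (cases "n = 0")
  case False
  have p: "pole n > norm v" using pole_ge[of n] False v by simp
  hence p0: "pole n > 0" using norm_ge_zero[of v] by linarith
  define u where "u = v ^ 2 / of_real (pole n) ^ 2"
  have "norm u < 1"
   unfolding u_def norm_divide norm_power using p p0 by (simp add: power_strict_mono)
  from sums_mult[OF geometric_sums[OF this], of "chi12 n * 2 * v / of_real (pole n) ^ 2"]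
  have "(%m. chi12 n * 2 * v / of_real (pole n) ^ 2 * u ^ m) sums
    (chi12 n * 2 * v / of_real (pole n) ^ 2 * (1 / (1 - u)))" .
  moreover have "chi12 n * 2 * v / of_real (pole n) ^ 2 * u ^ m = f n m" for m
  proof -
   define P V :: complex where "P = of_real (pole n) ^ 2" and "V = v ^ 2"
   have "f n m = chi12 n / (P ^ m * P) * (2 * (V ^ m * v))"
    by (simp only: f_def power_add power_mult P_def V_def power_one_right)
   moreover have "P ~= 0" using p0 by (simp add: P_def)
   ultimately show ?thesis
    by (simp add: u_def P_def[symmetric] V_def[symmetric] power_divide field_simps)
  qed
  moreover have "of_real (pole n) ^ 2 * (1 - u) = of_real (pole n) ^ 2 - v ^ 2"
   using p0 by (simp add: u_def field_simps)
  hence "chi12 n * 2 * v / of_real (pole n) ^ 2 * (1 / (1 - u)) = t n"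
   using p0 by (simp add: t_def)
  ultimately show ?thesis by simp
 qed (simp add: f_def t_def)
 moreover have "norm (\<Sum>m<M. f n m) \<le> B n" for n M
 proof -
  have "norm (\<Sum>m<M. f n m) \<le> (\<Sum>m<M. 2 * norm v * inverse (pole n ^ 2) * (\<rho>\<^sup>2) ^ m)"
   by (rule order_trans[OF norm_sum]) (intro sum_mono f_le)
  also have "\<dots> \<le> (\<Sum>m. 2 * norm v * inverse (pole n ^ 2) * (\<rho>\<^sup>2) ^ m)"
   by (intro sum_le_suminf summable_mult summable_geom) auto
  also have "\<dots> = B n"
   using geom \<rho> by (subst suminf_mult[OF summable_geom], subst suminf_geometric) (auto simp: B_def)
  finally show ?thesis .
 qed
 moreover have "summable B"
  unfolding B_def by (intro summable_mult summable_inverse_pole_sq)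
 moreover have "summable (%n. f n m)" for m
  unfolding f_def by (intro summable_mult2 summable_char_value)
 ultimately have 1: "summable t" and 2: "(%m. \<Sum>n. f n m) sums (\<Sum>n. t n)"
  by (rule sums_swap)+
 show "summable t" by fact
 have "(\<Sum>n. f n m) = 2 * char_value m * v ^ (2 * m + 1)" for m
  unfolding f_def char_value_def
  by (subst suminf_mult2[symmetric, OF summable_char_value]) simp
 with 2 show "(%m. 2 * char_value m * v ^ (2 * m + 1)) sums (\<Sum>n. t n)" by simp
qed

lemma sum_block12:
 "(\<Sum>n<12 * K. chi12 n * h n) =
  (\<Sum>k<K. h (12 * k + 1) - h (12 * k + 5) - h (12 * k + 7) + h (12 * k + 11))"
proof (induction K)
 case (Suc K)
 have "sum g {..<m + 12} = sum g {..<m} + g m + g (m+1) + g (m+2) + g (m+3) + g (m+4) + g (m+5)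
   + g (m+6) + g (m+7) + g (m+8) + g (m+9) + g (m+10) + g (m+11)" for m and g :: "nat => complex"
  by (simp add: numeral_eq_Suc)
 from this[of "%n. chi12 n * h n" "12 * K"] Suc
 show ?case by (simp add: chi12_def mod_Suc add.commute[of 12])
qed simp

lemma cot_diff:
 fixes a b :: complex
 assumes "sin a ~= 0" "sin b ~= 0"
 shows "cot a - cot b = sin (b - a) / (sin a * sin b)"
 using assms by (simp add: cot_def sin_diff field_simps)

text \<open>The partial fractions of \<open>sin 2v / cos 3v\<close>. The poles \<open>\<pi> n / 6\<close> with \<open>\<chi>(n) \<noteq> 0\<close> fall into four
progressions modulo 12, and these are the poles of four shifted cotangents.\<close>

lemma char_gf_closed_form:
 assumes v: "norm v < pi / 6"
 shows "(\<Sum>n. chi12 n * (2 * v / (of_real (pole n) ^ 2 - v ^ 2))) * cos (3 * v) * of_real (sqrt 3 / 6) = sin (2 * v)"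
proof -
 define y where "y = v / of_real (2 * pi)"
 have vy: "v = of_real (2 * pi) * y" by (simp add: y_def)
 have ny: "norm y < 1 / 12" using v by (simp add: y_def norm_divide field_simps)
 hence Re_y: "\<bar>Re y\<bar> < 1 / 12" using abs_Re_le_cmod[of y] by linarith
 have nint: "z \<notin> \<int>" if "0 < Re z" "Re z < 1" for z :: complex
  using that by (auto elim!: Ints_cases)
 have z: "1/12 - y \<notin> \<int>" "1/12 + y \<notin> \<int>" "5/12 - y \<notin> \<int>" "5/12 + y \<notin> \<int>"
  by (rule nint; use Re_y in \<open>simp add: abs_if split: if_splits\<close>)+
 define h where "h n = 2 * v / (of_real (pole n) ^ 2 - v ^ 2)" for n
 define g where "g k r = 1 / (of_nat k + r - y) - 1 / (of_nat k + r + y)" for k and r :: complex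
 have nz: "of_nat k + r + z ~= 0" if "r = of_real r'" "1/12 \<le> r'" "norm z < 1 / 12" for k r r' and z :: complex
 proof
  assume "of_nat k + r + z = 0"
  hence "Re z = - (real k + r')" using that(1)
   by (metis Re_complex_of_real add.commute add_eq_0_iff complex_Re_of_nat plus_complex.sel(1) zero_complex.sel(1))
  moreover have "\<bar>Re z\<bar> < 1/12" using that(3) abs_Re_le_cmod[of z] by linarith
  ultimately show False using that(2) by auto
 qed
 have hg: "h n = g k r / of_real (2 * pi)" if r: "r = of_real (real r' / 12)" and n: "n = 12 * k + r'" "r' \<ge> 1" for n k r r'
 proof -
  define a where "a = of_nat k + r"
  have p: "of_real (pole n) = of_real (2 * pi) * a"
   by (simp add: pole_def n r a_def field_simps)
  have 1: "a - y ~= 0" using nz[OF r, of "- y" k] ny n(2) by (simp add: a_def)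
  have 2: "a + y ~= 0" using nz[OF r, of "y" k] ny n(2) by (simp add: a_def)
  have "g k r = 2 * y / ((a - y) * (a + y))"
  proof -
   have "g k r = 1 / (a - y) - 1 / (a + y)" by (simp only: g_def a_def)
   thus ?thesis using 1 2 by (simp add: diff_frac_eq)
  qed
  moreover have "of_real (pole n) ^ 2 - v ^ 2 = of_real (2 * pi) ^ 2 * ((a - y) * (a + y))"
   unfolding p vy by (simp add: power_mult_distrib power2_eq_square algebra_simps)
  ultimately show ?thesis
   unfolding h_def using 1 2 by (simp add: vy power2_eq_square)
 qed
 define S where "S = (of_real pi * (cot (of_real pi * (1/12 - y)) - cot (of_real pi * (1/12 + y)))
  - of_real pi * (cot (of_real pi * (5/12 - y)) - cot (of_real pi * (5/12 + y)))) / of_real (2 * pi)"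
 have "(%k. ((1 / (of_nat k + (1/12 - y)) - 1 / (of_nat k + 1 - (1/12 - y)))
    - (1 / (of_nat k + (1/12 + y)) - 1 / (of_nat k + 1 - (1/12 + y)))
    - ((1 / (of_nat k + (5/12 - y)) - 1 / (of_nat k + 1 - (5/12 - y)))
    - (1 / (of_nat k + (5/12 + y)) - 1 / (of_nat k + 1 - (5/12 + y))))) / of_real (2 * pi)) sums
  ((of_real pi * cot (of_real pi * (1/12 - y)) - of_real pi * cot (of_real pi * (1/12 + y))
  - (of_real pi * cot (of_real pi * (5/12 - y)) - of_real pi * cot (of_real pi * (5/12 + y)))) / of_real (2 * pi))"
  by (intro sums_divide sums_diff cot_sums z)
 also have "(%k. ((1 / (of_nat k + (1/12 - y)) - 1 / (of_nat k + 1 - (1/12 - y)))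
    - (1 / (of_nat k + (1/12 + y)) - 1 / (of_nat k + 1 - (1/12 + y)))
    - ((1 / (of_nat k + (5/12 - y)) - 1 / (of_nat k + 1 - (5/12 - y)))
    - (1 / (of_nat k + (5/12 + y)) - 1 / (of_nat k + 1 - (5/12 + y))))) / of_real (2 * pi))
   = (%k. h (12 * k + 1) - h (12 * k + 5) - h (12 * k + 7) + h (12 * k + 11))"
 proof
  fix k
  have e: "of_nat k + (r - y) = of_nat k + r - y" "of_nat k + (r + y) = of_nat k + r + y"
    "of_nat k + 1 - (r - y) = of_nat k + (1 - r) + y" "of_nat k + 1 - (r + y) = of_nat k + (1 - r) - y" for r
   by (simp_all add: algebra_simps)
  have "h (12 * k + 1) = g k (1/12) / of_real (2 * pi)" "h (12 * k + 5) = g k (5/12) / of_real (2 * pi)"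
    "h (12 * k + 7) = g k (7/12) / of_real (2 * pi)" "h (12 * k + 11) = g k (11/12) / of_real (2 * pi)"
   by (rule hg[OF _ refl]; simp)+
  thus "((1 / (of_nat k + (1/12 - y)) - 1 / (of_nat k + 1 - (1/12 - y)))
    - (1 / (of_nat k + (1/12 + y)) - 1 / (of_nat k + 1 - (1/12 + y)))
    - ((1 / (of_nat k + (5/12 - y)) - 1 / (of_nat k + 1 - (5/12 - y)))
    - (1 / (of_nat k + (5/12 + y)) - 1 / (of_nat k + 1 - (5/12 + y))))) / of_real (2 * pi)
    = h (12 * k + 1) - h (12 * k + 5) - h (12 * k + 7) + h (12 * k + 11)"
   unfolding e by (simp add: g_def add_divide_distrib diff_divide_distrib)
 qed
 finally have lim: "(%K. \<Sum>n<12 * K. chi12 n * h n) \<longlonglongrightarrow> S"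
  unfolding sums_def sum_block12 S_def by (simp add: right_diff_distrib)
 have "filterlim (%K::nat. 12 * K) sequentially sequentially"
  by (rule filterlim_subseq) (auto simp: strict_mono_def)
 from filterlim_compose[OF summable_LIMSEQ[OF char_gf_sums(1)[OF v]] this] lim
 have "(\<Sum>n. chi12 n * h n) = S" unfolding h_def by (rule LIMSEQ_unique)
 moreover have "S * cos (3 * v) * of_real (sqrt 3 / 6) = sin (2 * v)"
 proof -
  have sin_nz: "sin (of_real pi * z) ~= 0" if "z \<notin> \<int>" for z :: complex
  proof
   assume "sin (of_real pi * z) = 0"
   then obtain n :: int where "of_real pi * z = of_real (of_int n * pi)"
    unfolding sin_eq_0 by auto
   hence "z = of_int n" by simp
   thus False using that by auto
  qed
  define c where "c = cos v"
  define q where "q = complex_of_real (sqrt 3)"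
  have q2: "q * q = 3" by (simp add: q_def flip: of_real_mult)
  have ss: "sin (of_real pi * (a - y)) * sin (of_real pi * (a + y)) = (c - cos (of_real (2 * pi) * a)) / 2" for a
  proof -
   have "sin (of_real pi * (a - y)) * sin (of_real pi * (a + y)) =
     (cos (of_real pi * (a - y) - of_real pi * (a + y)) - cos (of_real pi * (a - y) + of_real pi * (a + y))) / 2"
    by (rule sin_times_sin)
   also have "of_real pi * (a - y) - of_real pi * (a + y) = - v" by (simp add: vy algebra_simps)
   also have "of_real pi * (a - y) + of_real pi * (a + y) = of_real (2 * pi) * a" by (simp add: algebra_simps)
   finally show ?thesis by (simp add: c_def)
  qed
  have "cos (of_real (2 * pi) * (1 / 12)) = complex_of_real (cos (pi / 6))"
   by (simp flip: cos_of_real)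
  hence c1: "cos (of_real (2 * pi) * (1 / 12)) = q / 2" by (simp add: cos_30 q_def)
  have "(5::real) * pi / 6 = pi - pi / 6" by simp
  hence "cos (5 * pi / 6) = - (sqrt 3 / 2)" by (simp only: cos_pi_minus cos_30)
  moreover have "cos (of_real (2 * pi) * (5 / 12)) = complex_of_real (cos (5 * pi / 6))"
   by (simp flip: cos_of_real)
  ultimately have c5: "cos (of_real (2 * pi) * (5 / 12)) = - q / 2" by (simp add: q_def)
  note ss1 = ss[of "1/12", unfolded c1] and ss5 = ss[of "5/12", unfolded c5]
  have nz1: "c - q / 2 ~= 0" using ss1 sin_nz z by auto
  have nz5: "c + q / 2 ~= 0" using ss5 sin_nz z by auto
  have dd: "cot (of_real pi * (a - y)) - cot (of_real pi * (a + y)) =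
    sin v / (sin (of_real pi * (a - y)) * sin (of_real pi * (a + y)))" if "a - y \<notin> \<int>" "a + y \<notin> \<int>" for a
   by (subst cot_diff, rule sin_nz, fact, rule sin_nz, fact) (simp add: vy algebra_simps)
  have cancel: "(of_real pi * A - of_real pi * B) / of_real (2 * pi) = (A - B) / 2" for A B :: complex
   by (simp add: field_simps)
  have "S = (sin v / ((c - q / 2) / 2) - sin v / ((c + q / 2) / 2)) / 2"
   unfolding S_def dd[OF z(1,2)] dd[OF z(3,4)] ss1 ss5 cancel by simp
  also have "\<dots> = sin v * q / ((c - q / 2) * (c + q / 2))"
   using nz1 nz5 by (simp add: divide_simps) (simp add: algebra_simps)
  finally have "S * ((c - q / 2) * (c + q / 2)) = sin v * q" using nz1 nz5 by simp
  moreover have "cos (3 * v) = 4 * c * ((c - q / 2) * (c + q / 2))"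
   unfolding cos_treble_cos c_def[symmetric] using q2
   by (simp add: algebra_simps power3_eq_cube)
  ultimately have "S * cos (3 * v) = 4 * c * (sin v * q)" by (simp add: mult_ac)
  hence "S * cos (3 * v) * of_real (sqrt 3 / 6) = 4 * c * sin v * (q * q) / 6"
   by (simp add: q_def)
  thus ?thesis unfolding q2 by (simp add: sin_double c_def)
 qed
 ultimately show ?thesis by (simp add: h_def)
qed

text \<open>At \<open>v \<mapsto> i v\<close> the quotient of exponentials is a quotient of a sine by a cosine, so the moments
are Dirichlet values of the character: the functional equation of its L-function.\<close>

lemma theta_gf_complex:
 "theta_gf = Abs_fps (%j. if odd j then of_real (sqrt 3 / 3) * (-1) ^ (j div 2) * char_value (j div 2) else 0 :: complex)"
proof -
 define C where "C = Abs_fps (%j. if odd j then of_real (sqrt 3 / 3) * (-1) ^ (j div 2) * char_value (j div 2) else 0 :: complex)"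
 define H where "H v = (\<Sum>n. chi12 n * (2 * v / (of_real (pole n) ^ 2 - v ^ 2)))" for v
 define c where "c v = - \<i> * of_real (sqrt 3 / 6) * H (\<i> * v)" for v
 have c_sums: "(%j. fps_nth C j * v ^ j) sums c v" if "norm v < pi / 6" for v
 proof -
  have "(%m. 2 * char_value m * (\<i> * v) ^ (2 * m + 1)) sums H (\<i> * v)"
   unfolding H_def by (rule char_gf_sums) (use that in \<open>simp add: norm_mult\<close>)
  from sums_mult[OF this, of "- \<i> * of_real (sqrt 3 / 6)"]
  have "(%m. - \<i> * of_real (sqrt 3 / 6) * (2 * char_value m * (\<i> * v) ^ (2 * m + 1))) sums c v"
   by (simp add: c_def)
  also have "(%m. - \<i> * of_real (sqrt 3 / 6) * (2 * char_value m * (\<i> * v) ^ (2 * m + 1))) =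
    (%m. fps_nth C (2 * m + 1) * v ^ (2 * m + 1))"
  proof
   fix m
   have "(\<i> * v) ^ (2 * m + 1) = \<i> * ((-1) ^ m * v ^ (2 * m + 1))"
    by (simp add: power_mult_distrib power_mult power_minus[of "v\<^sup>2"])
   thus "- \<i> * of_real (sqrt 3 / 6) * (2 * char_value m * (\<i> * v) ^ (2 * m + 1)) =
     fps_nth C (2 * m + 1) * v ^ (2 * m + 1)"
    by (simp only:) (simp add: C_def)
  qed
  finally show ?thesis
  proof (subst (asm) sums_mono_reindex[of "%m. 2 * m + 1" "%j. fps_nth C j * v ^ j"])
   show "fps_nth C n * v ^ n = 0" if "n \<notin> range (%m. 2 * m + 1)" for n
    using that by (auto simp: C_def elim: oddE)
  qed (auto simp: strict_mono_def)
 qed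
 have ev: "\<forall>\<^sub>F v in nhds (0::complex). norm v < pi / 6"
  by (rule order_tendstoD[OF tendsto_norm[OF filterlim_ident]]) auto
 have "c has_fps_expansion C"
  by (rule has_fps_expansionI) (use ev in eventually_elim, rule c_sums)
 hence e1: "(%v. c v * (1 + exp (-6 * v))) has_fps_expansion (C * (1 + fps_exp (-6)))"
  by (intro fps_expansion_intros)
 have e2: "(%v. exp (-1 * v) - exp (-5 * v)) has_fps_expansion (fps_exp (-1) - fps_exp (-5 :: complex))"
  by (intro fps_expansion_intros)
 have "\<forall>\<^sub>F v in nhds (0::complex). c v * (1 + exp (-6 * v)) = exp (-1 * v) - exp (-5 * v)"
  using ev
 proof eventually_elim
  case (elim v)
  have "norm (\<i> * v) < pi / 6" using elim by (simp add: norm_mult)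
  from char_gf_closed_form[OF this]
  have "H (\<i> * v) * cos (3 * (\<i> * v)) * of_real (sqrt 3 / 6) = sin (2 * (\<i> * v))"
   by (simp add: H_def)
  hence "c v * cos (3 * (\<i> * v)) = - \<i> * sin (2 * (\<i> * v))"
   by (simp add: c_def mult_ac)
  also have "cos (3 * (\<i> * v)) = (exp (- 3 * v) + exp (3 * v)) / 2"
   by (simp add: cos_exp_eq mult_ac)
  also have "sin (2 * (\<i> * v)) = (exp (- 2 * v) - exp (2 * v)) / (2 * \<i>)"
   by (simp add: sin_exp_eq mult_ac)
  also have "- \<i> * ((exp (- 2 * v) - exp (2 * v)) / (2 * \<i>)) = (exp (2 * v) - exp (- 2 * v)) / 2"
   by (simp add: field_simps)
  finally have "c v * (exp (- 3 * v) + exp (3 * v)) = exp (2 * v) - exp (- 2 * v)"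
   by simp
  hence "c v * (exp (- 3 * v) + exp (3 * v)) * exp (- 3 * v) = (exp (2 * v) - exp (- 2 * v)) * exp (- 3 * v)"
   by simp
  hence "c v * (exp (3 * v) * exp (- 3 * v) + exp (- 3 * v) * exp (- 3 * v))
    = exp (2 * v) * exp (- 3 * v) - exp (- 2 * v) * exp (- 3 * v)"
   by (simp only: algebra_simps)
  thus ?case unfolding exp_add[symmetric] by simp
 qed
 from e1 this have "(%v. exp (-1 * v) - exp (-5 * v)) has_fps_expansion (C * (1 + fps_exp (-6)))"
  by (subst (asm) has_fps_expansion_cong[OF _ refl])
 from fps_expansion_unique_complex[OF this e2]
 have "C * (1 + fps_exp (-6)) = theta_gf * (1 + fps_exp (-6))" by (simp add: theta_gf_eq)
 moreover have "fps_nth (1 + fps_exp (-6) :: complex fps) 0 ~= 0" by simp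
 hence "1 + fps_exp (-6) ~= (0 :: complex fps)" by (metis fps_zero_nth)
 ultimately show ?thesis unfolding C_def[symmetric] by (metis mult_right_cancel)
qed

lemma of_rat_theta_gf: "of_rat (fps_nth theta_gf j) = fps_nth (theta_gf :: complex fps) j"
proof -
 define F :: "complex fps" where "F = Abs_fps (%j. of_rat (fps_nth theta_gf j))"
 have ofr: "(of_rat ((-a) ^ j / fact j) :: complex) = (- of_rat a) ^ j / fact j" for a :: rat and j
  by (simp add: of_rat_divide of_rat_power of_rat_minus) (metis of_rat_of_nat_eq of_nat_fact)
 have "F * (1 + fps_exp (-6)) = fps_exp (-1) - fps_exp (-5)"
 proof (rule fps_ext)
  fix j
  have e: "fps_nth (1 + fps_exp (-6) :: complex fps) k = of_rat (fps_nth (1 + fps_exp (-6)) k)" for k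
   using ofr[of 6 k] by (simp add: of_rat_add)
  have "fps_nth (F * (1 + fps_exp (-6))) j = of_rat (fps_nth (theta_gf * (1 + fps_exp (-6))) j)"
   unfolding fps_mult_nth e by (simp add: F_def of_rat_sum of_rat_mult)
  also have "\<dots> = fps_nth (fps_exp (-1) - fps_exp (-5)) j"
   unfolding theta_gf_eq using ofr[of 1 j] ofr[of 5 j] by (simp add: of_rat_diff)
  finally show "fps_nth (F * (1 + fps_exp (-6))) j = fps_nth (fps_exp (-1) - fps_exp (-5)) j" .
 qed
 hence "F * (1 + fps_exp (-6)) = theta_gf * (1 + fps_exp (-6))" by (simp add: theta_gf_eq)
 moreover have "fps_nth (1 + fps_exp (-6) :: complex fps) 0 ~= 0" by simp
 hence "1 + fps_exp (-6) ~= (0 :: complex fps)" by (metis fps_zero_nth)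
 ultimately have "F = theta_gf" by (metis mult_right_cancel)
 thus ?thesis by (simp add: F_def fps_eq_iff)
qed

lemma kz_series_nth:
 "of_rat (fps_nth kz_series m) = of_real (sqrt 3 / 6 * fact (2 * m + 1) / (24 ^ m * fact m)) * char_value m"
proof -
 have mom: "of_rat (theta_moment j) = (theta_moment j :: complex)" for j
  unfolding theta_moment_def of_rat_theta_gf[symmetric]
  by (simp add: of_rat_mult of_rat_power of_rat_minus) (metis of_rat_of_nat_eq of_nat_fact)
 have fct: "of_rat (fact m) = (fact m :: complex)" by (metis of_rat_of_nat_eq of_nat_fact)
 have "of_rat (fps_nth kz_series m) =
   (-1/24) ^ m / fact m * (theta_moment (2 * m) - theta_moment (2 * m + 1)) / (2 :: complex)"
  unfolding kz_series_nth_theta_moment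
  by (simp add: of_rat_divide of_rat_mult of_rat_diff of_rat_power of_rat_minus mom fct)
 also have "theta_moment (2 * m) = (0 :: complex)"
  by (simp add: theta_moment_def theta_gf_complex)
 also have "theta_moment (2 * m + 1) = - (fact (2 * m + 1) * (of_real (sqrt 3 / 3) * (-1) ^ m * char_value m))"
  by (simp add: theta_moment_def theta_gf_complex)
 also have "(-1/24) ^ m / fact m * (0 - - (fact (2 * m + 1) * (of_real (sqrt 3 / 3) * (-1) ^ m * char_value m))) / 2
   = ((-1) ^ m * (-1) ^ m) * (fact (2 * m + 1) * (of_real (sqrt 3 / 6) * char_value m)) / (24 ^ m * fact m)"
  by (simp add: power_divide power_minus[of "1/24"] field_simps)
 also have "((-1) ^ m * (-1) ^ m) = (1 :: complex)" by (simp flip: power_mult_distrib)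
 finally show ?thesis by simp
qed

lemma kz_series_0: "fps_nth kz_series 0 = 1"
 unfolding kz_series_def kz_taylor_compose by (simp add: kz_gen_def kz_term_def)

lemma char_value_0: "of_real (sqrt 3 / 6) * char_value 0 = 1"
 using kz_series_nth[of 0] by (simp add: kz_series_0)

lemma pochhammer_five_halves:
 "pochhammer (5 / 2 :: 'a :: field_char_0) j = fact (2 * j + 3) / (6 * 4 ^ j * fact (j + 1))"
proof (induction j)
 case (Suc j)
 have nz: "of_nat j + 2 ~= (0 :: 'a)" using of_nat_neq_0[of "Suc j", where 'a = 'a]
  by (metis Suc_eq_plus1 add.commute add_2_eq_Suc' of_nat_Suc of_nat_add of_nat_neq_0 of_nat_numeral)
 have "pochhammer (5 / 2 :: 'a) (Suc j) = pochhammer (5/2) j * (5/2 + of_nat j)"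
  by (rule pochhammer_Suc)
 moreover have "2 * Suc j + 3 = Suc (Suc (2 * j + 3))" by simp
 hence "(fact (2 * Suc j + 3) :: 'a) = (2 * of_nat j + 5) * ((2 * of_nat j + 4) * fact (2 * j + 3))"
  by (simp only: fact_Suc) (simp add: add.commute)
 moreover have "(fact (Suc j + 1) :: 'a) = (of_nat j + 2) * fact (j + 1)"
  by (simp only: Suc_eq_plus1[symmetric] fact_Suc) (simp add: algebra_simps)
 moreover have "F / (6 * Q * G) * (5 / 2 + J) = (2 * J + 5) * ((2 * J + 4) * F) / (6 * (4 * Q) * ((J + 2) * G))"
  if "J + 2 ~= 0" "Q ~= 0" "G ~= 0" for F Q G J :: 'a
 proof -
  have "F / (6 * Q * G) * (5 / 2 + J) = (2 * J + 5) * ((2 * T) * F) / (6 * (4 * Q) * (T * G))"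
   if "T ~= 0" for T using that \<open>Q ~= 0\<close> \<open>G ~= 0\<close> by (simp add: field_simps)
  from this[OF \<open>J + 2 ~= 0\<close>] show ?thesis by (simp only: distrib_left) simp
 qed
 from this[OF nz _ fact_nonzero, of "4 ^ j" "fact (2 * j + 3)" "j + 1"]
 have "fact (2 * j + 3) / (6 * 4 ^ j * fact (j + 1)) * (5 / 2 + of_nat j) =
  (2 * of_nat j + 5) * ((2 * of_nat j + 4) * fact (2 * j + 3)) / (6 * (4 * 4 ^ j) * ((of_nat j + 2) * fact (j + 1) :: 'a))"
  by simp
 ultimately show ?case unfolding Suc power_Suc by (simp only:)
qed (simp add: fact_numeral)

definition borel_const :: real where "borel_const = 3 * pi / (2 * sqrt 2)"

lemma sqrt_loc: "sqrt (loc n) = real n * pi / sqrt 6"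
 by (simp add: loc_def real_sqrt_mult real_sqrt_divide)

text \<open>With \<open>m = j + 1\<close>, the factor \<open>(2m + 1)! / (24\<^sup>m m! j!)\<close> is up to powers a Pochhammer symbol of 5/2,
so each \<open>n\<close> contributes the binomial series of the exponent -5/2.\<close>

lemma borel_coeff:
 "fps_nth (borel_transform kz_series) j =
  (\<Sum>n. of_real borel_const * (chi12 n * of_nat n / of_real (sqrt (loc n)) ^ 5) *
    (of_real (pochhammer (5/2) j / fact j / loc n ^ j)))"
proof -
 have t: "of_real borel_const * (chi12 n * of_nat n / of_real (sqrt (loc n)) ^ 5) *
    (of_real (pochhammer (5/2) j / fact j / loc n ^ j)) =
    of_real (sqrt 3 / 6 * fact (2 * j + 3) / (24 ^ (j + 1) * fact (j + 1)) / fact j) *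
    (chi12 n / of_real (pole n) ^ (2 * (j + 1) + 2))" for n
 proof (cases "n = 0")
  case False
  define p where "p = pole n"
  have p: "p > 0" using False by (simp add: p_def pole_def)
  have n: "real n = 6 / pi * p" by (simp add: p_def pole_def)
  have l: "loc n = 6 * p ^ 2" by (simp add: loc_def p_def pole_def field_simps power2_eq_square)
  have s: "sqrt (loc n) = sqrt 6 * p" using p by (simp add: l real_sqrt_mult)
  have s6: "sqrt 6 ^ 5 = 36 * (sqrt 2 * sqrt 3)"
  proof -
   have "sqrt 6 ^ 5 = (sqrt 6 ^ 2) ^ 2 * sqrt 6" by (simp add: power_numeral_reduce)
   hence "sqrt 6 ^ 5 = 36 * sqrt 6" by simp
   moreover have "sqrt 6 = sqrt 2 * sqrt 3" by (simp flip: real_sqrt_mult)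
   ultimately show ?thesis by (simp only:)
  qed
  have "borel_const * (real n / (sqrt (loc n)) ^ 5) * (pochhammer (5/2) j / fact j / loc n ^ j) =
   sqrt 3 / 6 * fact (2 * j + 3) / (24 ^ (j + 1) * fact (j + 1)) / fact j * (1 / p ^ (2 * (j + 1) + 2))"
  proof -
   define A where "A = sqrt 2"
   define B where "B = sqrt 3"
   have AB: "A * A = 2" "B * B = 3" "A > 0" "B > 0" by (auto simp: A_def B_def)
   have "3 * pi / (2 * A) * (6 / pi * p / (36 * (A * B) * p ^ 5)) = 1 / (4 * (A * A) * (B * p ^ 4))"
    using p AB(3,4) by (simp add: field_simps power_numeral_reduce)
   also have "\<dots> = B / (8 * (B * B) * p ^ 4)" using AB p by (simp add: field_simps)
   finally have k: "3 * pi / (2 * A) * (6 / pi * p / (36 * (A * B) * p ^ 5)) = B / (24 * p ^ 4)"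
    by (simp add: AB)
   have F1: "borel_const * (real n / (sqrt (loc n)) ^ 5) = B / (24 * p ^ 4)"
    unfolding borel_const_def s power_mult_distrib s6 n A_def[symmetric] B_def[symmetric] k ..
   have F2: "(24::real) ^ (j + 1) = 24 * (6 ^ j * 4 ^ j)" by (simp flip: power_mult_distrib)
   have F3: "p ^ (2 * (j + 1) + 2) = p ^ 4 * (p\<^sup>2) ^ j"
    by (simp add: power_add power_mult power_numeral_reduce)
   show ?thesis
    unfolding F1 unfolding F2 F3 pochhammer_five_halves l power_mult_distrib B_def[symmetric]
    using p by (simp add: field_simps del: fact_Suc)
  qed
  from arg_cong[OF this, of "%x. complex_of_real x * chi12 n"]
  show ?thesis by (simp add: p_def mult_ac)
 qed simp
 have e: "2 * (j + 1) + 1 = 2 * j + 3" by simp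
 have "fps_nth (borel_transform kz_series) j =
   of_real (sqrt 3 / 6 * fact (2 * j + 3) / (24 ^ (j + 1) * fact (j + 1)) / fact j) * char_value (j + 1)"
  unfolding borel_transform_def fps_nth_Abs_fps Suc_eq_plus1 kz_series_nth e by simp
 also have "\<dots> = (\<Sum>n. of_real (sqrt 3 / 6 * fact (2 * j + 3) / (24 ^ (j + 1) * fact (j + 1)) / fact j) *
    (chi12 n / of_real (pole n) ^ (2 * (j + 1) + 2)))"
  unfolding char_value_def by (rule suminf_mult[OF summable_char_value, symmetric])
 finally show ?thesis unfolding t .
qed

definition principal_root :: "nat => complex => complex" where
 "principal_root n z = of_real (sqrt (loc n)) * csqrt ((cloc n - z) / cloc n)"

lemma powr_minus_five_halves: "z ~= 0 ==> z powr (-5/2) = 1 / csqrt z ^ 5"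
proof -
 assume "z ~= 0"
 have "csqrt z ^ 5 = exp (5 * (Ln z / 2))"
  using \<open>z ~= 0\<close> by (simp add: csqrt_exp_Ln flip: exp_of_nat_mult)
 moreover have "z powr (-5/2) = exp (- (5 * (Ln z / 2)))" using \<open>z ~= 0\<close> by (simp add: powr_def)
 ultimately show ?thesis by (simp only: exp_minus inverse_eq_divide)
qed

lemma loc_ge: "n > 0 ==> loc n \<ge> pi ^ 2 / 6 * real n"
proof -
 assume "n > 0"
 hence "real n * 1 \<le> real n * real n" by (intro mult_left_mono) auto
 thus ?thesis by (simp add: loc_def power2_eq_square)
qed

lemma loc_pos: "n > 0 ==> loc n > 0"
 by (simp add: loc_def)

lemma sqrt_loc_ge: "sqrt (loc n) \<ge> real n"
proof -
 have "sqrt 6 \<le> sqrt (3\<^sup>2)" by (intro real_sqrt_le_mono) simp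
 hence "sqrt 6 \<le> pi" using pi_gt3 by simp
 from mult_left_mono[OF this, of "real n"] show ?thesis unfolding sqrt_loc by (simp add: field_simps)
qed

lemma summable_n_over_n5: "summable (%n. real n / real n ^ 5)"
proof -
 have "real n / real n ^ 5 = inverse (real n ^ 4)" for n
  by (cases "n = 0") (simp_all add: field_simps power_numeral_reduce)
 thus ?thesis by (simp add: inverse_power_summable)
qed

text \<open>The two sums over \<open>n\<close> and over the power of \<open>p\<close> may be exchanged because the coefficients of
\<open>(1 - z)\<^sup>-\<^sup>5\<^sup>/\<^sup>2\<close> are positive and \<open>\<Sum> n / n\<^sup>5\<close> converges.\<close>

lemma kz_borel_disc:
 assumes p: "norm p < pi ^ 2 / 6"
 defines "g \<equiv> (%n. chi12 n * of_nat n / principal_root n p ^ 5)"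
 shows "summable g"
  and "(%j. fps_nth (borel_transform kz_series) j * p ^ j) sums (of_real borel_const * (\<Sum>n. g n))"
proof -
 define r where "r = norm p / (pi ^ 2 / 6)"
 have r: "0 \<le> r" "r < 1" using p by (simp_all add: r_def field_simps)
 define c :: "nat => real" where "c j = pochhammer (5/2) j / fact j" for j
 have c0: "c j \<ge> 0" for j unfolding c_def by (intro divide_nonneg_nonneg pochhammer_nonneg) auto
 have gb: "((- 5 / 2 :: complex) gchoose j) = (-1) ^ j * of_real (c j)" for j
  using pochhammer_of_real[of "5/2 :: real" j, where 'a = complex]
  by (simp add: gbinomial_pochhammer c_def)
 have cs: "(%j. of_real (c j) * u ^ j) sums (1 / csqrt (1 - u) ^ 5)" if "norm u < 1" for u :: complex
 proof -
  have "(%j. ((- 5 / 2) gchoose j) * (- u) ^ j) sums (1 + (- u)) powr (- 5 / 2)"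
   using that by (intro gen_binomial_complex) auto
  moreover have "((- 5 / 2) gchoose j) * (- u) ^ j = of_real (c j) * u ^ j" for j
   unfolding gb by (simp add: power_minus[of u])
  moreover have "1 - u ~= 0" using that by auto
  ultimately show ?thesis using powr_minus_five_halves[of "1 - u"] by simp
 qed
 have "summable (%j. of_real (c j) * complex_of_real r ^ j)"
  using cs[of "of_real r"] r by (simp add: sums_iff)
 hence "summable (%j. complex_of_real (c j * r ^ j))" by simp
 hence cr: "summable (%j. c j * r ^ j)" by (simp only: summable_of_real_iff)
 define A where "A n = of_real borel_const * (chi12 n * of_nat n / of_real (sqrt (loc n)) ^ 5)" for n
 define f where "f n j = A n * (of_real (c j / loc n ^ j)) * p ^ j" for n j
 have A_le: "norm (A n) \<le> borel_const * (real n / real n ^ 5)" for n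
 proof (cases "n = 0")
  case False
  have "borel_const > 0" by (simp add: borel_const_def)
  hence "norm (A n) = borel_const * (norm (chi12 n) * real n / sqrt (loc n) ^ 5)"
   unfolding A_def norm_mult norm_divide norm_power norm_of_real
   using loc_pos[of n] False by simp
  also have "\<dots> \<le> borel_const * (1 * real n / real n ^ 5)"
   using False by (intro mult_left_mono frac_le mult_right_mono norm_chi12_le power_mono sqrt_loc_ge)
     (auto simp: borel_const_def)
  finally show ?thesis by simp
 qed (simp add: A_def)
 have l6: "inverse (loc n) \<le> 6 / pi ^ 2" if "n > 0" for n
 proof -
  have "pi ^ 2 / 6 * 1 \<le> pi ^ 2 / 6 * real n" using that by (intro mult_left_mono) auto
  hence "pi ^ 2 / 6 \<le> loc n" using loc_ge[OF that] by linarith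
  hence "inverse (loc n) \<le> inverse (pi ^ 2 / 6)" by (intro le_imp_inverse_le) auto
  thus ?thesis by simp
 qed
 have Ac_le: "norm (A n * of_real (c j / loc n ^ j)) \<le> norm (A n) * (c j * (6 / pi ^ 2) ^ j)" for n j
 proof (cases "n = 0")
  case False
  have "inverse (loc n) ^ j \<le> (6 / pi ^ 2) ^ j"
   using l6[of n] loc_pos[of n] False by (intro power_mono) auto
  hence "norm (A n) * (c j * inverse (loc n) ^ j) \<le> norm (A n) * (c j * (6 / pi ^ 2) ^ j)"
   using c0 by (intro mult_left_mono) auto
  moreover have "norm (A n * of_real (c j / loc n ^ j)) = norm (A n) * (c j * inverse (loc n) ^ j)"
   using c0[of j] loc_pos[of n] False unfolding norm_mult norm_of_real
   by (simp add: power_inverse divide_inverse)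
  ultimately show ?thesis by simp
 qed (simp add: A_def)
 have f_le: "norm (f n j) \<le> norm (A n) * (c j * r ^ j)" for n j
 proof -
  have "norm (f n j) = norm (A n * of_real (c j / loc n ^ j)) * norm p ^ j"
   unfolding f_def norm_mult norm_power ..
  also have "\<dots> \<le> norm (A n) * (c j * (6 / pi ^ 2) ^ j) * norm p ^ j"
   by (intro mult_right_mono Ac_le) auto
  also have "\<dots> = norm (A n) * (c j * ((6 / pi ^ 2) ^ j * norm p ^ j))" by simp
  also have "(6 / pi ^ 2) ^ j * norm p ^ j = r ^ j"
   unfolding r_def power_mult_distrib[symmetric] by (simp add: mult.commute)
  finally show ?thesis .
 qed
 have sums: "(%j. f n j) sums (of_real borel_const * g n)" for n
 proof (cases "n = 0")
  case False
  hence l: "loc n > 0" by (intro loc_pos) simp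
  have "pi ^ 2 / 6 * 1 \<le> pi ^ 2 / 6 * real n" using False by (intro mult_left_mono) auto
  hence "pi ^ 2 / 6 \<le> loc n" using loc_ge[of n] False by linarith
  hence "norm p < loc n" using p by linarith
  hence "norm (p / cloc n) < 1" using l by (simp add: norm_divide)
  from sums_mult[OF cs[OF this], of "A n"]
  have "(%j. A n * (of_real (c j) * (p / cloc n) ^ j)) sums (A n * (1 / csqrt (1 - p / cloc n) ^ 5))" .
  moreover have "A n * (of_real (c j) * (p / cloc n) ^ j) = f n j" for j
   by (simp add: f_def power_divide)
  moreover have "1 - p / cloc n = (cloc n - p) / cloc n"
   using l by (simp add: field_simps)
  ultimately show ?thesis by (simp add: A_def g_def principal_root_def power_mult_distrib mult_ac)
 qed (simp add: f_def g_def A_def)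
 have bound: "norm (\<Sum>j<M. f n j) \<le> borel_const * (real n / real n ^ 5) * (\<Sum>j. c j * r ^ j)" for n M
 proof -
  have "norm (\<Sum>j<M. f n j) \<le> (\<Sum>j<M. norm (A n) * (c j * r ^ j))"
   by (rule order_trans[OF norm_sum]) (intro sum_mono f_le)
  also have "\<dots> = norm (A n) * (\<Sum>j<M. c j * r ^ j)" by (simp add: sum_distrib_left)
  also have "\<dots> \<le> norm (A n) * (\<Sum>j. c j * r ^ j)"
   using c0 r by (intro mult_left_mono sum_le_suminf cr) auto
  also have "\<dots> \<le> borel_const * (real n / real n ^ 5) * (\<Sum>j. c j * r ^ j)"
   using c0 r by (intro mult_right_mono A_le suminf_nonneg cr) auto
  finally show ?thesis .
 qed
 have sA: "summable (%n. norm (A n))"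
 proof (rule summable_comparison_test')
  show "summable (%n. borel_const * (real n / real n ^ 5))"
   by (intro summable_mult summable_n_over_n5)
  show "norm (norm (A n)) \<le> borel_const * (real n / real n ^ 5)" for n using A_le[of n] by simp
 qed
 have col: "summable (%n. f n j)" for j
  by (rule summable_comparison_test'[OF summable_mult2[OF sA] f_le])
 have sc: "summable (%n. A n * of_real (c j / loc n ^ j))" for j
  by (rule summable_comparison_test'[OF summable_mult2[OF sA] Ac_le])
 have sB: "summable (%n. borel_const * (real n / real n ^ 5) * (\<Sum>j. c j * r ^ j))"
  by (intro summable_mult2 summable_mult summable_n_over_n5)
 note sw = sums_swap[OF sums bound sB col]
 have nz: "borel_const ~= 0" by (simp add: borel_const_def)
 show sg: "summable g" using summable_mult[OF sw(1), of "inverse (of_real borel_const)"] nz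
  by (simp only: mult.assoc[symmetric]) simp
 have "(\<Sum>n. f n j) = fps_nth (borel_transform kz_series) j * p ^ j" for j
 proof -
  have "(\<Sum>n. f n j) = (\<Sum>n. A n * of_real (c j / loc n ^ j)) * p ^ j"
   unfolding f_def by (rule suminf_mult2[OF sc, symmetric])
  thus ?thesis by (simp only: borel_coeff A_def c_def)
 qed
 with sw(2) show "(%j. fps_nth (borel_transform kz_series) j * p ^ j) sums (of_real borel_const * (\<Sum>n. g n))"
  by (simp add: suminf_mult[OF sg])
qed

section \<open>Continuation by branches of square roots\<close>

text \<open>Stated for all \<open>n\<close> at once: this uniform distance controls all terms of a branch sum.\<close>

definition away :: "real => complex => bool" where
 "away \<kappa> z \<longleftrightarrow> \<kappa> > 0 \<and> (\<forall>n. chi12 n ~= 0 \<longrightarrow> \<kappa> \<le> norm (cloc n - z))"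

lemma chi12_eq_0_iff: "chi12 n ~= 0 \<longleftrightarrow> n mod 12 \<in> {1, 5, 7, 11}"
 by (auto simp: chi12_def)

lemma chi12_imp_pos: "chi12 n ~= 0 ==> n > 0"
 by (cases "n = 0") auto

lemma sing_set_eq: "sing_set = loc ` {n. chi12 n ~= 0}"
 unfolding sing_set_def loc_def image_def chi12_eq_0_iff by blast

lemma loc_inj: "loc n = loc m \<longleftrightarrow> n = m"
 by (simp add: loc_def)

lemma norm_loc: "norm (cloc n) = loc n"
 unfolding norm_of_real by (simp add: loc_def)

lemma loc_ge_sq: "real n ^ 2 \<le> loc n"
proof -
 have "real n ^ 2 \<le> sqrt (loc n) ^ 2" by (intro power_mono sqrt_loc_ge) auto
 thus ?thesis by (simp add: loc_def)
qed

lemma loc_ge_real: "real n \<le> loc n"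
 by (rule order_trans[OF _ loc_ge_sq]) (cases n, auto simp: power2_eq_square)

lemma finite_loc_less: "finite {n. loc n < r}"
proof (rule finite_subset)
 show "{n. loc n < r} \<subseteq> {..nat \<lceil>r\<rceil>}"
 proof
  fix n assume "n \<in> {n. loc n < r}"
  hence "real n \<le> real (nat \<lceil>r\<rceil>)" using loc_ge_real[of n] real_nat_ceiling_ge[of r]
   unfolding mem_Collect_eq by linarith
  thus "n \<in> {..nat \<lceil>r\<rceil>}" by simp
 qed
qed auto

lemma away_exists:
 assumes "z \<in> sing_compl"
 obtains \<kappa> where "away \<kappa> z"
proof -
 define A where "A = {n. chi12 n ~= 0 \<and> loc n < norm z + 1}"
 have A: "finite A" unfolding A_def by (rule finite_subset[OF _ finite_loc_less]) auto
 define B where "B = insert 1 ((%n. norm (cloc n - z)) ` A)"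
 have "finite B" using A by (simp add: B_def)
 have "Min B > 0"
 proof -
  have "x > 0" if "x \<in> B" for x
   using that assms unfolding B_def A_def by (auto simp: sing_set_eq)
  thus ?thesis using \<open>finite B\<close> by (subst Min_gr_iff) (auto simp: B_def)
 qed
 moreover have "Min B \<le> norm (cloc n - z)" if "chi12 n ~= 0" for n
 proof (cases "n \<in> A")
  case True
  thus ?thesis using \<open>finite B\<close> by (intro Min_le) (auto simp: B_def)
 next
  case False
  hence "loc n \<ge> norm z + 1" using that by (auto simp: A_def)
  moreover have "norm (cloc n) \<le> norm (cloc n - z) + norm z"
   by (metis diff_add_cancel norm_triangle_ineq)
  moreover have "norm (cloc n) = loc n" by (rule norm_loc)
  moreover have "Min B \<le> 1" using \<open>finite B\<close> by (intro Min_le) (auto simp: B_def)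
  ultimately show ?thesis by linarith
 qed
 ultimately show ?thesis using that by (auto simp: away_def)
qed

lemma away_half:
 assumes "away \<kappa> z0" "z \<in> ball z0 (\<kappa> / 2)"
 shows "away (\<kappa> / 2) z"
 unfolding away_def
proof (intro conjI allI impI)
 show "\<kappa> / 2 > 0" using assms by (auto simp: away_def)
 fix n assume "chi12 n ~= 0"
 hence "\<kappa> \<le> norm (cloc n - z0)" using assms by (auto simp: away_def)
 moreover have "norm (cloc n - z0) \<le> norm (cloc n - z) + norm (z - z0)"
  by (metis diff_add_cancel add_diff_eq norm_triangle_ineq)
 moreover have "norm (z - z0) < \<kappa> / 2" using assms(2) by (simp add: dist_norm norm_minus_commute)
 ultimately show "\<kappa> / 2 \<le> norm (cloc n - z)" by linarith
qed

lemma away_not_eq: "away \<kappa> z ==> chi12 n ~= 0 ==> cloc n ~= z"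
 by (force simp: away_def)

definition away_const :: "real => real => real" where
 "away_const \<kappa> R = sqrt (1 + R / \<kappa>) ^ 5"

lemma root_bound:
 assumes "away \<kappa> z" "norm z \<le> R" "chi12 n ~= 0" "u ^ 2 = cloc n - z"
 shows "1 / norm u ^ 5 \<le> away_const \<kappa> R / real n ^ 5"
proof -
 have \<kappa>: "\<kappa> > 0" "\<kappa> \<le> norm (cloc n - z)" using assms by (auto simp: away_def)
 have R: "R \<ge> 0" using assms(2) norm_ge_zero[of z] by linarith
 have n: "n > 0" using assms(3) by (rule chi12_imp_pos)
 have u2: "norm u ^ 2 = norm (cloc n - z)" using assms(4) by (metis norm_power)
 have "norm (cloc n) \<le> norm (cloc n - z) + norm z"
  by (metis diff_add_cancel norm_triangle_ineq)
 hence "loc n \<le> norm (cloc n - z) + R" using assms(2) unfolding norm_loc by linarith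
 also have "R \<le> norm (cloc n - z) * (R / \<kappa>)"
  using mult_right_mono[OF \<kappa>(2), of "R / \<kappa>"] \<kappa>(1) R by simp
 finally have "real n ^ 2 \<le> norm u ^ 2 * (1 + R / \<kappa>)"
  unfolding u2 using loc_ge_sq[of n] by (simp add: algebra_simps)
 hence "sqrt (real n ^ 2) \<le> sqrt (norm u ^ 2 * (1 + R / \<kappa>))" by (rule real_sqrt_le_mono)
 hence le: "real n \<le> norm u * sqrt (1 + R / \<kappa>)" by (simp add: real_sqrt_mult)
 hence "norm u > 0" using n by (cases "u = 0") auto
 moreover have "real n ^ 5 \<le> (norm u * sqrt (1 + R / \<kappa>)) ^ 5" by (intro power_mono le) auto
 ultimately show ?thesis using n unfolding away_const_def by (simp add: field_simps power_mult_distrib)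
qed

definition coeff_ok :: "(nat => complex) => real => bool" where
 "coeff_ok c K \<longleftrightarrow> (\<forall>n. norm (c n) \<le> K * real n) \<and> (\<forall>n. chi12 n = 0 \<longrightarrow> c n = 0)"

lemma coeff_term_bound:
 assumes "coeff_ok c K" "away \<kappa> z" "norm z \<le> R" "chi12 n ~= 0 ==> u ^ 2 = cloc n - z"
 shows "norm (c n / u ^ 5) \<le> K * away_const \<kappa> R * (real n / real n ^ 5)"
proof (cases "chi12 n = 0")
 case True
 have "norm (c 1) \<le> K * real 1" using assms(1) unfolding coeff_ok_def by blast
 hence "K \<ge> 0" using norm_ge_zero[of "c 1"] unfolding of_nat_1 mult_1_right by linarith
 moreover have "R \<ge> 0" using assms(3) norm_ge_zero[of z] by linarith
 hence "R / \<kappa> \<ge> 0" using assms(2) by (auto simp: away_def)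
 hence "away_const \<kappa> R \<ge> 0"
  unfolding away_const_def by (intro zero_le_power real_sqrt_ge_zero) linarith
 ultimately show ?thesis using True assms(1) by (simp add: coeff_ok_def)
next
 case False
 from root_bound[OF assms(2,3) this assms(4)[OF this]]
 have "norm (c n) * (1 / norm u ^ 5) \<le> (K * real n) * (away_const \<kappa> R / real n ^ 5)"
  using assms(1) order_trans[OF norm_ge_zero, of "c n" "K * real n"]
  by (intro mult_mono) (auto simp: coeff_ok_def)
 thus ?thesis by (simp add: norm_divide norm_power mult_ac)
qed

text \<open>The root of \<open>loc n - z\<close> near \<open>z0\<close> with the value \<open>u\<close> at \<open>z0\<close>. The quotient under the principal root
has positive real part near \<open>z0\<close>, so no branch cut is met.\<close>

definition branch_root :: "nat => complex => complex => complex => complex" where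
 "branch_root n u z0 z = u * csqrt ((cloc n - z) / (cloc n - z0))"

definition branch_sum :: "(nat => complex) => (nat => complex) => complex => complex => complex" where
 "branch_sum c w z0 z = (\<Sum>n. c n / branch_root n (w n) z0 z ^ 5)"

definition roots_at :: "(nat => complex) => complex => bool" where
 "roots_at w z \<longleftrightarrow> (\<forall>n. chi12 n ~= 0 \<longrightarrow> w n ^ 2 = cloc n - z)"

lemma branch_root_self: "cloc n ~= z0 ==> branch_root n u z0 z0 = u"
 by (simp add: branch_root_def)

lemma branch_root_sq:
 assumes "u ^ 2 = cloc n - z0" "cloc n ~= z0"
 shows "branch_root n u z0 z ^ 2 = cloc n - z"
 using assms by (simp add: branch_root_def power_mult_distrib)

lemma Re_ratio_pos:
 fixes N z z0 :: complex
 assumes "norm (z - z0) < norm (N - z0)"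
 shows "Re ((N - z) / (N - z0)) > 0"
proof -
 have "N ~= z0" using assms by auto
 hence "(N - z) / (N - z0) = 1 - (z - z0) / (N - z0)" by (simp add: field_simps)
 moreover have "norm ((z - z0) / (N - z0)) < 1" using assms \<open>N ~= z0\<close> by (simp add: norm_divide)
 hence "Re ((z - z0) / (N - z0)) < 1" using complex_Re_le_cmod le_less_trans by blast
 ultimately show ?thesis by simp
qed

lemma Re_pos_notin_nonpos: "Re z > 0 ==> z \<notin> \<real>\<^sub>\<le>\<^sub>0"
 by (auto simp: complex_nonpos_Reals_iff)

lemma csqrt_mult_Re_pos:
 assumes "Re A > 0" "Re B > 0"
 shows "csqrt (A * B) = csqrt A * csqrt B"
proof (rule csqrt_mult)
 have "\<bar>Arg A\<bar> < pi / 2" "\<bar>Arg B\<bar> < pi / 2" using assms Arg_Re_pos by blast+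
 thus "Arg A + Arg B \<in> {- pi<..pi}" by auto
qed

lemma branch_root_transfer:
 fixes z0 z1 z :: complex
 assumes "norm (z1 - z0) < norm (cloc n - z0)" "norm (z - z1) < norm (cloc n - z1)"
 shows "branch_root n (branch_root n u z0 z1) z1 z = branch_root n u z0 z"
proof -
 define N where "N = cloc n"
 have "csqrt ((N - z1) / (N - z0) * ((N - z) / (N - z1))) = csqrt ((N - z1) / (N - z0)) * csqrt ((N - z) / (N - z1))"
  by (rule csqrt_mult_Re_pos) (use assms in \<open>auto intro!: Re_ratio_pos simp: N_def\<close>)
 moreover have "N - z1 ~= 0" "N - z0 ~= 0" using assms by (auto simp: N_def)
 hence "(N - z1) / (N - z0) * ((N - z) / (N - z1)) = (N - z) / (N - z0)" by simp
 ultimately show ?thesis by (simp only: branch_root_def N_def[symmetric] mult.assoc)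
qed

lemma branch_root_holomorphic:
 assumes "\<kappa> \<le> norm (cloc n - z0)"
 shows "branch_root n u z0 holomorphic_on ball z0 \<kappa>"
proof -
 have "(cloc n - z) / (cloc n - z0) \<notin> \<real>\<^sub>\<le>\<^sub>0" if "z \<in> ball z0 \<kappa>" for z
  by (rule Re_pos_notin_nonpos, rule Re_ratio_pos) (use that assms in \<open>auto simp: dist_norm norm_minus_commute\<close>)
 note nonpos = this
 show ?thesis
 proof (cases "cloc n = z0")
  case True
  hence "ball z0 \<kappa> = {}" using assms by simp
  thus ?thesis by (simp only: holomorphic_on_def) simp
 next
  case False
  thus ?thesis unfolding branch_root_def using nonpos by (intro holomorphic_intros) auto
 qed
qed

lemma branch_sum_uniform_limit:
 assumes "coeff_ok c K" "away \<kappa> z0" "roots_at w z0"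
 shows "uniform_limit (ball z0 (\<kappa> / 2)) (%N z. \<Sum>n<N. c n / branch_root n (w n) z0 z ^ 5)
      (branch_sum c w z0) sequentially"
 unfolding branch_sum_def
proof (rule Weierstrass_m_test)
 show "summable (%n. K * away_const (\<kappa> / 2) (norm z0 + \<kappa> / 2) * (real n / real n ^ 5))"
  by (intro summable_mult summable_n_over_n5)
 fix n z assume z: "z \<in> ball z0 (\<kappa> / 2)"
 have "norm z \<le> norm z0 + norm (z - z0)" by (metis add.commute diff_add_cancel norm_triangle_ineq)
 hence "norm z \<le> norm z0 + \<kappa> / 2" using z by (simp add: dist_norm norm_minus_commute)
 thus "norm (c n / branch_root n (w n) z0 z ^ 5) \<le>
   K * away_const (\<kappa> / 2) (norm z0 + \<kappa> / 2) * (real n / real n ^ 5)"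
  using assms(3) away_not_eq[OF assms(2)]
  by (intro coeff_term_bound[OF assms(1) away_half[OF assms(2) z]] branch_root_sq) (auto simp: roots_at_def)
qed

lemma branch_sum_summable:
 assumes "coeff_ok c K" "away \<kappa> z0" "roots_at w z0"
 shows "summable (%n. c n / w n ^ 5)"
proof (rule summable_comparison_test')
 show "summable (%n. K * away_const \<kappa> (norm z0) * (real n / real n ^ 5))"
  by (intro summable_mult summable_n_over_n5)
 show "norm (c n / w n ^ 5) \<le> K * away_const \<kappa> (norm z0) * (real n / real n ^ 5)" for n
  by (rule coeff_term_bound[OF assms(1,2)]) (use assms(3) in \<open>auto simp: roots_at_def\<close>)
qed

lemma branch_sum_self:
 assumes "coeff_ok c K" "away \<kappa> z0"
 shows "branch_sum c w z0 z0 = (\<Sum>n. c n / w n ^ 5)"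
proof -
 have "c n / branch_root n (w n) z0 z0 ^ 5 = c n / w n ^ 5" for n
  using assms(1) branch_root_self[OF away_not_eq[OF assms(2)]]
  by (cases "chi12 n = 0") (auto simp: coeff_ok_def)
 thus ?thesis by (simp only: branch_sum_def)
qed

lemma branch_root_nonzero:
 assumes "u ^ 2 = cloc n - z0" "cloc n ~= z0" "cloc n ~= z"
 shows "branch_root n u z0 z ~= 0"
 using branch_root_sq[OF assms(1,2), of z] assms(3) by auto

lemma branch_sum_holomorphic:
 assumes "coeff_ok c K" "away \<kappa> z0" "roots_at w z0"
 shows "branch_sum c w z0 holomorphic_on ball z0 (\<kappa> / 2)"
proof (rule holomorphic_uniform_sequence)
 show "open (ball z0 (\<kappa> / 2))" by simp
 fix N
 show "(%z. \<Sum>n<N. c n / branch_root n (w n) z0 z ^ 5) holomorphic_on ball z0 (\<kappa> / 2)"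
 proof (intro holomorphic_on_sum)
  fix n
  show "(%z. c n / branch_root n (w n) z0 z ^ 5) holomorphic_on ball z0 (\<kappa> / 2)"
  proof (cases "chi12 n = 0")
   case False
   have "\<kappa> / 2 \<le> norm (cloc n - z0)" using assms(2) False by (force simp: away_def)
   moreover have "branch_root n (w n) z0 z ~= 0" if "z \<in> ball z0 (\<kappa> / 2)" for z
    using assms(3) False away_not_eq[OF assms(2)] away_not_eq[OF away_half[OF assms(2) that]]
    by (intro branch_root_nonzero) (auto simp: roots_at_def)
   ultimately show ?thesis
    by (intro holomorphic_intros branch_root_holomorphic) auto
  qed (use assms(1) in \<open>simp add: coeff_ok_def\<close>)
 qed
next
 fix z assume "z \<in> ball z0 (\<kappa> / 2)"
 then obtain d where "d > 0" "cball z d \<subseteq> ball z0 (\<kappa> / 2)"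
  using open_contains_cball open_ball by metis
 thus "\<exists>d>0. cball z d \<subseteq> ball z0 (\<kappa> / 2) \<and>
   uniform_limit (cball z d) (%N z. \<Sum>n<N. c n / branch_root n (w n) z0 z ^ 5) (branch_sum c w z0) sequentially"
  using uniform_limit_on_subset[OF branch_sum_uniform_limit[OF assms]] by blast
qed

lemma branch_sum_transfer:
 assumes "coeff_ok c K" "away \<kappa> z0" "z1 \<in> ball z0 (\<kappa> / 2)" "z \<in> ball z1 (\<kappa> / 2)"
 shows "branch_sum c (%n. branch_root n (w n) z0 z1) z1 z = branch_sum c w z0 z"
 unfolding branch_sum_def
proof (intro arg_cong[where f = suminf] ext)
 fix n
 show "c n / branch_root n (branch_root n (w n) z0 z1) z1 z ^ 5 = c n / branch_root n (w n) z0 z ^ 5"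
 proof (cases "chi12 n = 0")
  case False
  have "away (\<kappa> / 2) z1" using away_half[OF assms(2,3)] .
  hence "norm (z - z1) < norm (cloc n - z1)" "norm (z1 - z0) < norm (cloc n - z0)"
   using False assms unfolding away_def by (force simp: dist_norm norm_minus_commute)+
  thus ?thesis by (subst branch_root_transfer) auto
 qed (use assms(1) in \<open>simp add: coeff_ok_def\<close>)
qed

text \<open>Two continuous square roots of the same nowhere vanishing function differ by a constant sign on a
connected set.\<close>

lemma sqrt_path_sign:
 fixes u v :: "'a::topological_space => complex"
 assumes "connected S" "continuous_on S u" "continuous_on S v"
   "\<And>t. t \<in> S ==> u t ^ 2 = v t ^ 2" "\<And>t. t \<in> S ==> u t ~= 0"
 obtains \<sigma> where "\<sigma> \<in> {1, -1}" "\<And>t. t \<in> S ==> v t = \<sigma> * u t"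
proof -
 define f where "f t = v t / u t" for t
 have f: "f t \<in> {1, -1}" if "t \<in> S" for t
 proof -
  have "(f t)\<^sup>2 = 1" using assms(4)[OF that, symmetric] assms(5)[OF that] by (simp add: f_def power_divide)
  thus ?thesis by (simp add: power2_eq_1_iff)
 qed
 have "f constant_on S"
 proof (rule continuous_finite_range_constant)
  show "continuous_on S f" unfolding f_def by (intro continuous_intros assms(2,3)) (use assms(5) in auto)
  show "finite (f ` S)" using f by (intro finite_subset[of "f ` S" "{1,-1}"]) auto
 qed fact
 then obtain k where k: "\<And>t. t \<in> S ==> f t = k" unfolding constant_on_def by blast
 show ?thesis
 proof (cases "S = {}")
  case True thus ?thesis using that[of 1] by simp
 next
  case False
  hence "k \<in> {1,-1}" using k f by (metis ex_in_conv)
  moreover have "v t = k * u t" if "t \<in> S" for t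
   using k[OF that] assms(5)[OF that] by (simp add: f_def field_simps)
  ultimately show ?thesis using that by blast
 qed
qed

lemma sqrt_path_unique:
 fixes u v :: "'a::topological_space => complex"
 assumes "connected S" "continuous_on S u" "continuous_on S v"
   "\<And>t. t \<in> S ==> u t ^ 2 = v t ^ 2" "\<And>t. t \<in> S ==> u t ~= 0"
   "t0 \<in> S" "u t0 = v t0" "t \<in> S"
 shows "u t = v t"
proof -
 obtain \<sigma> where \<sigma>: "\<sigma> \<in> {1, -1}" "\<And>t. t \<in> S ==> v t = \<sigma> * u t"
  using sqrt_path_sign[OF assms(1-5)] by blast
 have "\<sigma> = 1" using \<sigma>(2)[OF assms(6)] assms(5)[OF assms(6)] assms(7) by simp
 thus ?thesis using \<sigma>(2)[OF assms(8)] by simp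
qed

text \<open>A continuous choice of all roots along a path, starting from the positive roots. This is the
whole information needed to continue a branch sum.\<close>

definition root_family :: "(real => complex) => real set => (nat => real => complex) => bool" where
 "root_family \<gamma> T w \<longleftrightarrow> (\<forall>n. chi12 n ~= 0 \<longrightarrow> continuous_on T (w n) \<and> w n 0 = of_real (sqrt (loc n)) \<and>
   (\<forall>t\<in>T. w n t ^ 2 = cloc n - \<gamma> t))"

lemma sing_compl_not_loc: "z \<in> sing_compl ==> chi12 n ~= 0 ==> cloc n ~= z"
 by (auto simp: sing_set_eq)

lemma root_family_local:
 assumes T: "convex T" and \<gamma>: "continuous_on T \<gamma>" "\<gamma> ` T \<subseteq> sing_compl"
  and w: "root_family \<gamma> T w" and t: "t \<in> T" and \<kappa>: "away \<kappa> (\<gamma> t)"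
 shows "\<forall>\<^sub>F s in at t within T. s \<in> T \<and> \<gamma> s \<in> ball (\<gamma> t) (\<kappa> / 2) \<and>
      (\<forall>n. chi12 n ~= 0 \<longrightarrow> w n s = branch_root n (w n t) (\<gamma> t) (\<gamma> s))"
proof -
 have "\<kappa> > 0" using \<kappa> by (simp add: away_def)
 then obtain \<eta> where \<eta>: "\<eta> > 0" "\<And>s. s \<in> T ==> dist s t < \<eta> ==> dist (\<gamma> s) (\<gamma> t) < \<kappa> / 2"
  using \<gamma>(1) t unfolding continuous_on_iff by (metis half_gt_zero)
 define U where "U = T \<inter> ball t \<eta>"
 have U: "connected U" "t \<in> U" using T t \<eta>(1) by (auto simp: U_def intro!: convex_connected convex_Int)
 have inb: "\<gamma> s \<in> ball (\<gamma> t) (\<kappa> / 2)" if "s \<in> U" for s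
  using \<eta>(2)[of s] that by (auto simp: U_def dist_commute)
 have root: "w n s = branch_root n (w n t) (\<gamma> t) (\<gamma> s)" if "s \<in> U" and n: "chi12 n ~= 0" for n s
 proof (rule sqrt_path_unique[OF U(1) _ _ _ _ U(2) _ that(1), where u = "w n"])
  have wn: "continuous_on T (w n)" "\<And>t. t \<in> T ==> w n t ^ 2 = cloc n - \<gamma> t"
   using w n by (auto simp: root_family_def)
  show "continuous_on U (w n)" using wn(1) by (rule continuous_on_subset) (auto simp: U_def)
  have "\<kappa> / 2 \<le> norm (cloc n - \<gamma> t)" using \<kappa> n by (force simp: away_def)
  from holomorphic_on_imp_continuous_on[OF branch_root_holomorphic[OF this]]
  have "continuous_on (ball (\<gamma> t) (\<kappa> / 2)) (branch_root n (w n t) (\<gamma> t))" .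
  thus "continuous_on U (%s. branch_root n (w n t) (\<gamma> t) (\<gamma> s))"
   by (rule continuous_on_compose2) (use inb \<gamma>(1) in \<open>auto simp: U_def intro: continuous_on_subset\<close>)
  show "w n s ^ 2 = branch_root n (w n t) (\<gamma> t) (\<gamma> s) ^ 2" if "s \<in> U" for s
   using that t wn(2) n away_not_eq[OF \<kappa> n] by (subst branch_root_sq) (auto simp: U_def)
  show "w n s ~= 0" if "s \<in> U" for s
   using wn(2)[of s] sing_compl_not_loc[OF _ n, of "\<gamma> s"] that \<gamma>(2) by (auto simp: U_def)
  show "w n t = branch_root n (w n t) (\<gamma> t) (\<gamma> t)"
   using away_not_eq[OF \<kappa> n] by (simp add: branch_root_self)
 qed
 have "\<forall>\<^sub>F s in at t within T. s \<in> U"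
  unfolding eventually_at using \<eta>(1) by (intro exI[of _ \<eta>]) (auto simp: U_def dist_commute)
 thus ?thesis by eventually_elim (use inb root in \<open>auto simp: U_def\<close>)
qed

lemma root_family_roots_at: "root_family \<gamma> T w ==> t \<in> T ==> roots_at (%n. w n t) (\<gamma> t)"
 by (auto simp: root_family_def roots_at_def)

lemma root_familyD:
 assumes "root_family \<gamma> T w" "chi12 n ~= 0"
 shows "S \<subseteq> T ==> continuous_on S (w n)" "w n 0 = of_real (sqrt (loc n))"
  "t \<in> T ==> w n t ^ 2 = cloc n - \<gamma> t"
 using assms unfolding root_family_def by (blast intro: continuous_on_subset)+

lemma continuous_on_csqrt_compose:
 assumes "continuous_on S f" "\<And>t. t \<in> S ==> f t \<notin> \<real>\<^sub>\<le>\<^sub>0"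
 shows "continuous_on S (%t. csqrt (f t))"
 by (rule continuous_on_compose2[OF holomorphic_on_imp_continuous_on[OF holomorphic_on_csqrt] assms(1)])
   (use assms(2) in auto)

definition germ_at_0 :: "(nat => complex) => complex => complex" where
 "germ_at_0 c z = branch_sum c (%n. of_real (sqrt (loc n))) 0 z"

abbreviation germ_eq :: "(complex => complex) => (nat => complex) => bool" where
 "germ_eq h c \<equiv> \<forall>\<^sub>F z in nhds 0. h z = germ_at_0 c z"

lemma branch_sum_cong:
 assumes "coeff_ok c K" "\<And>n. chi12 n ~= 0 ==> w n = w' n"
 shows "branch_sum c w z0 z = branch_sum c w' z0 z"
 unfolding branch_sum_def
proof (intro arg_cong[where f = suminf] ext)
 fix n show "c n / branch_root n (w n) z0 z ^ 5 = c n / branch_root n (w' n) z0 z ^ 5"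
  using assms by (cases "chi12 n = 0") (auto simp: coeff_ok_def)
qed

lemma canonical_continuation:
 assumes T: "convex T" "0 \<in> T" and \<gamma>: "continuous_on T \<gamma>" "\<gamma> ` T \<subseteq> sing_compl" "\<gamma> 0 = 0"
  and w: "root_family \<gamma> T w" and c: "coeff_ok c K"
  and h: "germ_eq h c"
 shows "continuation_along h \<gamma> T (%t. branch_sum c (%n. w n t) (\<gamma> t))"
 unfolding continuation_along_def
proof (intro conjI ballI)
 fix t assume t: "t \<in> T"
 then obtain \<kappa> where \<kappa>: "away \<kappa> (\<gamma> t)" using away_exists \<gamma>(2) by (metis image_subset_iff)
 hence k0: "\<kappa> > 0" by (simp add: away_def)
 show "branch_sum c (%n. w n t) (\<gamma> t) analytic_on {\<gamma> t}"
  unfolding analytic_at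
  using branch_sum_holomorphic[OF c \<kappa> root_family_roots_at[OF w t]] k0
  by (intro exI[of _ "ball (\<gamma> t) (\<kappa> / 2)"]) auto
 show "\<forall>\<^sub>F s in at t within T. \<forall>\<^sub>F z in nhds (\<gamma> s). branch_sum c (%n. w n s) (\<gamma> s) z = branch_sum c (%n. w n t) (\<gamma> t) z"
  using root_family_local[OF T(1) \<gamma>(1,2) w t \<kappa>]
 proof eventually_elim
  case (elim s)
  have "\<forall>\<^sub>F z in nhds (\<gamma> s). z \<in> ball (\<gamma> s) (\<kappa> / 2)"
   using k0 by (intro eventually_nhds_in_open) auto
  thus ?case
  proof eventually_elim
   case (elim z)
   have "branch_sum c (%n. w n s) (\<gamma> s) z =
      branch_sum c (%n. branch_root n (w n t) (\<gamma> t) (\<gamma> s)) (\<gamma> s) z"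
    by (rule branch_sum_cong[OF c]) (use \<open>s \<in> T \<and> _\<close> in blast)
   also have "\<dots> = branch_sum c (%n. w n t) (\<gamma> t) z"
    by (rule branch_sum_transfer[OF c \<kappa> _ elim]) (use \<open>s \<in> T \<and> _\<close> in blast)
   finally show ?case .
  qed
 qed
next
 have "branch_sum c (%n. w n 0) (\<gamma> 0) z = germ_at_0 c z" for z
  unfolding germ_at_0_def \<gamma>(3) by (rule branch_sum_cong[OF c]) (use w in \<open>auto simp: root_family_def\<close>)
 thus "\<forall>\<^sub>F z in nhds (\<gamma> 0). branch_sum c (%n. w n 0) (\<gamma> 0) z = h z"
  using h unfolding \<gamma>(3) by (auto elim: eventually_mono)
qed

text \<open>A nowhere vanishing function on a convex set has a continuous square root.\<close>

lemma root_family_exists: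
 assumes T: "convex T" "0 \<in> T" and \<gamma>: "continuous_on T \<gamma>" "\<gamma> ` T \<subseteq> sing_compl" "\<gamma> 0 = 0"
 obtains w where "root_family \<gamma> T w"
proof -
 have "\<exists>u. continuous_on T u \<and> u 0 = of_real (sqrt (loc n)) \<and> (\<forall>t\<in>T. u t ^ 2 = cloc n - \<gamma> t)"
  if n: "chi12 n ~= 0" for n
 proof -
  have "continuous_on T (%t. cloc n - \<gamma> t)" by (intro continuous_intros \<gamma>)
  moreover have "contractible T" using T(1) by (rule convex_imp_contractible)
  moreover have "cloc n - \<gamma> t ~= 0" if "t \<in> T" for t
   using sing_compl_not_loc[OF _ n, of "\<gamma> t"] that \<gamma>(2) by auto
  ultimately obtain g where g: "continuous_on T g" "\<And>t. t \<in> T ==> cloc n - \<gamma> t = g t ^ 2"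
   using continuous_sqrt_on_contractible by blast
  have "g 0 ^ 2 = of_real (sqrt (loc n)) ^ 2"
   using g(2)[OF T(2)] \<gamma>(3) by (simp add: loc_def flip: of_real_power)
  hence "g 0 = of_real (sqrt (loc n)) \<or> - g 0 = of_real (sqrt (loc n))"
   by (metis minus_minus power2_eq_iff)
  thus ?thesis
  proof
   assume "g 0 = of_real (sqrt (loc n))"
   thus ?thesis using g by (intro exI[of _ g]) auto
  next
   assume "- g 0 = of_real (sqrt (loc n))"
   thus ?thesis using g by (intro exI[of _ "%t. - g t"]) (auto intro!: continuous_intros)
  qed
 qed
 then obtain w where "\<And>n. chi12 n ~= 0 ==> continuous_on T (w n) \<and> w n 0 = of_real (sqrt (loc n)) \<and> (\<forall>t\<in>T. w n t ^ 2 = cloc n - \<gamma> t)"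
  by metis
 thus ?thesis using that[of w] by (simp add: root_family_def)
qed

lemma holomorphic_germs_eq:
 assumes "f holomorphic_on ball z0 r" "g holomorphic_on ball z0 r" "a \<in> ball z0 r" "b \<in> ball z0 r"
  and ev: "\<forall>\<^sub>F z in nhds a. f z = g z"
 shows "\<forall>\<^sub>F z in nhds b. f z = g z"
proof -
 obtain A where A: "open A" "a \<in> A" "\<And>z. z \<in> A ==> f z = g z"
  using ev unfolding eventually_nhds by blast
 have "f z = g z" if "z \<in> ball z0 r" for z
 proof (rule analytic_continuation_open[of "A \<inter> ball z0 r" "ball z0 r" f g])
  show "A \<inter> ball z0 r ~= {}" using A(2) assms(3) by auto
 qed (use A assms that in auto)
 moreover have "\<forall>\<^sub>F z in nhds b. z \<in> ball z0 r" using assms(4) by (intro eventually_nhds_in_open) auto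
 ultimately show ?thesis by (auto elim: eventually_mono)
qed

text \<open>The set of parameters at which the two germs agree is open and closed.\<close>

lemma continuation_unique:
 assumes T: "connected T" "0 \<in> T" and \<gamma>: "continuous_on T \<gamma>"
  and g: "continuation_along h \<gamma> T g" and g': "continuation_along h \<gamma> T g'" and t: "t \<in> T"
 shows "\<forall>\<^sub>F z in nhds (\<gamma> t). g t z = g' t z"
proof -
 define P where "P t \<longleftrightarrow> (\<forall>\<^sub>F z in nhds (\<gamma> t). g t z = g' t z)" for t
 have "P 0 = P t"
 proof (rule connected_local_const[OF T t]; intro ballI)
  fix t assume t: "t \<in> T"
  have "g t analytic_on {\<gamma> t}" "g' t analytic_on {\<gamma> t}"
   using g g' t by (auto simp: continuation_along_def)
  then obtain d d' where d: "d > 0" "g t holomorphic_on ball (\<gamma> t) d" and d': "d' > 0" "g' t holomorphic_on ball (\<gamma> t) d'"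
   unfolding analytic_on_def by auto
  define r where "r = min d d'"
  have r: "r > 0" "g t holomorphic_on ball (\<gamma> t) r" "g' t holomorphic_on ball (\<gamma> t) r"
   using d d' by (auto simp: r_def intro: holomorphic_on_subset)
  have "(\<gamma> \<longlongrightarrow> \<gamma> t) (at t within T)" using \<gamma> t by (auto simp: continuous_on_def)
  hence "\<forall>\<^sub>F s in at t within T. \<gamma> s \<in> ball (\<gamma> t) r"
   by (rule topological_tendstoD) (use r in auto)
  moreover have "\<forall>\<^sub>F s in at t within T. \<forall>\<^sub>F z in nhds (\<gamma> s). g s z = g t z"
   "\<forall>\<^sub>F s in at t within T. \<forall>\<^sub>F z in nhds (\<gamma> s). g' s z = g' t z"
   using g g' t by (auto simp: continuation_along_def)
  ultimately show "\<forall>\<^sub>F s in at t within T. P t = P s"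
  proof eventually_elim
   case (elim s)
   have "P s \<longleftrightarrow> (\<forall>\<^sub>F z in nhds (\<gamma> s). g t z = g' t z)"
    unfolding P_def
   proof
    assume "\<forall>\<^sub>F z in nhds (\<gamma> s). g s z = g' s z"
    with elim(2,3) show "\<forall>\<^sub>F z in nhds (\<gamma> s). g t z = g' t z" by eventually_elim simp
   next
    assume "\<forall>\<^sub>F z in nhds (\<gamma> s). g t z = g' t z"
    with elim(2,3) show "\<forall>\<^sub>F z in nhds (\<gamma> s). g s z = g' s z" by eventually_elim simp
   qed
   also have "\<dots> \<longleftrightarrow> P t"
    unfolding P_def using holomorphic_germs_eq[OF r(2,3)] elim(1) r(1) by (meson centre_in_ball)
   finally show ?case ..
  qed
 qed
 moreover have "P 0"
 proof -
  have "\<forall>\<^sub>F z in nhds (\<gamma> 0). g 0 z = h z" "\<forall>\<^sub>F z in nhds (\<gamma> 0). g' 0 z = h z"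
   using g g' by (auto simp: continuation_along_def)
  thus ?thesis unfolding P_def by eventually_elim simp
 qed
 ultimately show ?thesis by (simp add: P_def)
qed

lemma continuation_germ:
 assumes T: "convex T" "0 \<in> T" and \<gamma>: "continuous_on T \<gamma>" "\<gamma> ` T \<subseteq> sing_compl" "\<gamma> 0 = 0"
  and w: "root_family \<gamma> T w" and c: "coeff_ok c K"
  and h: "germ_eq h c"
  and g: "continuation_along h \<gamma> T g" and t: "t \<in> T"
 shows "\<forall>\<^sub>F z in nhds (\<gamma> t). g t z = branch_sum c (%n. w n t) (\<gamma> t) z"
  and "g t (\<gamma> t) = (\<Sum>n. c n / w n t ^ 5)"
proof -
 show ev: "\<forall>\<^sub>F z in nhds (\<gamma> t). g t z = branch_sum c (%n. w n t) (\<gamma> t) z"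
  using continuation_unique[OF convex_connected[OF T(1)] T(2) \<gamma>(1) g canonical_continuation[OF T \<gamma> w c h] t] .
 obtain \<kappa> where \<kappa>: "away \<kappa> (\<gamma> t)" using away_exists \<gamma>(2) t by (metis image_subset_iff)
 show "g t (\<gamma> t) = (\<Sum>n. c n / w n t ^ 5)"
  using eventually_nhds_x_imp_x[OF ev] branch_sum_self[OF c \<kappa>] by simp
qed

definition kz_coeff :: "nat => complex" where
 "kz_coeff n = of_real borel_const * (chi12 n * of_nat n)"

lemma borel_const_pos: "borel_const > 0" by (simp add: borel_const_def)

lemma coeff_ok_kz: "coeff_ok kz_coeff borel_const"
 unfolding coeff_ok_def
proof (intro conjI allI impI)
 fix n
 have "norm (chi12 n) * real n \<le> 1 * real n" by (intro mult_right_mono norm_chi12_le) auto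
 thus "norm (kz_coeff n) \<le> borel_const * real n"
  using borel_const_pos by (simp add: kz_coeff_def norm_mult)
qed (simp add: kz_coeff_def)

lemma kz_borel_eq_germ:
 assumes "norm z < pi ^ 2 / 6"
 shows "kz_borel z = germ_at_0 kz_coeff z"
proof -
 note disc = kz_borel_disc[OF assms]
 have "kz_borel z = of_real borel_const * (\<Sum>n. chi12 n * of_nat n / principal_root n z ^ 5)"
  unfolding kz_borel_def eval_fps_def using disc(2) by (rule sums_unique[symmetric])
 also have "\<dots> = (\<Sum>n. kz_coeff n / principal_root n z ^ 5)"
  by (subst suminf_mult[OF disc(1), symmetric]) (simp add: kz_coeff_def)
 finally show ?thesis
  by (simp add: germ_at_0_def branch_sum_def branch_root_def principal_root_def)
qed

lemma kz_borel_germ: "\<forall>\<^sub>F z in nhds 0. kz_borel z = germ_at_0 kz_coeff z"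
proof -
 have "\<forall>\<^sub>F z in nhds (0::complex). z \<in> ball 0 (pi ^ 2 / 6)"
  by (rule eventually_nhds_in_open) auto
 thus ?thesis by eventually_elim (simp add: kz_borel_eq_germ)
qed

section \<open>Monodromy\<close>

text \<open>Over the first and the second round the roots differ by a sign, so the total change is a square.\<close>

lemma root_double_loop:
 fixes u p :: "real => complex"
 assumes h: "h > 0" and u: "continuous_on {a..a + 2 * h} u"
  and sq: "\<And>t. t \<in> {a..a + 2 * h} ==> u t ^ 2 = N - p t"
  and nz: "\<And>t. t \<in> {a..a + 2 * h} ==> p t ~= N"
  and per: "\<And>s. s \<in> {0..h} ==> p (a + h + s) = p (a + s)"
 shows "u (a + 2 * h) = u a"
proof -
 obtain \<sigma> where \<sigma>: "\<sigma> \<in> {1, -1}" "\<And>s. s \<in> {0..h} ==> u (a + h + s) = \<sigma> * u (a + s)"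
 proof (rule sqrt_path_sign[of "{0..h}" "%s. u (a + s)" "%s. u (a + h + s)"])
  show "continuous_on {0..h} (%s. u (a + s))" "continuous_on {0..h} (%s. u (a + h + s))"
   using h by (auto intro!: continuous_on_compose2[OF u] continuous_intros)
  show "u (a + s) ^ 2 = u (a + h + s) ^ 2" if "s \<in> {0..h}" for s
   using that h by (simp add: sq per)
  show "u (a + s) ~= 0" if "s \<in> {0..h}" for s
   using sq[of "a + s"] nz[of "a + s"] that h by auto
 qed auto
 have "u (a + 2 * h) = \<sigma> * u (a + h)" using \<sigma>(2)[of h] h by (simp add: algebra_simps)
 also have "u (a + h) = \<sigma> * u a" using \<sigma>(2)[of 0] h by simp
 finally show ?thesis using \<sigma>(1) by auto
qed

text \<open>The circle does not enclose \<open>N\<close>, so \<open>(N - z) / (N - A)\<close> stays in the right half plane.\<close>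

lemma root_circle_other:
 fixes u :: "real => complex"
 assumes l: "l > 0" and u: "continuous_on {a..a + l} u"
  and sq: "\<And>t. t \<in> {a..a + l} ==> u t ^ 2 = N - (A + (b - A) * cis (2 * pi * ((t - a) / l)))"
  and N: "norm (b - A) < norm (N - A)"
 shows "u (a + l) = u a"
proof -
 define p where "p t = A + (b - A) * cis (2 * pi * ((t - a) / l))" for t
 have p: "norm (p t - A) < norm (N - A)" for t using N by (simp add: p_def norm_mult)
 have NA: "N ~= A" using N by auto
 define v where "v t = csqrt (N - A) * csqrt ((N - p t) / (N - A))" for t
 have v2: "v t ^ 2 = N - p t" for t using NA by (simp add: v_def power_mult_distrib)
 have vnz: "v t ~= 0" for t using p[of t] v2[of t] by auto
 obtain \<sigma> where \<sigma>: "\<sigma> \<in> {1, -1}" "\<And>t. t \<in> {a..a + l} ==> u t = \<sigma> * v t"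
 proof (rule sqrt_path_sign[of "{a..a + l}" v u])
  have pc: "continuous_on {a..a + l} p" unfolding p_def using l by (intro continuous_intros) auto
  show "continuous_on {a..a + l} v" unfolding v_def
   using NA Re_pos_notin_nonpos[OF Re_ratio_pos[OF p]]
   by (intro continuous_on_mult continuous_on_const continuous_on_csqrt_compose continuous_on_divide
      continuous_on_diff pc) auto
  show "v t ^ 2 = u t ^ 2" if "t \<in> {a..a + l}" for t using sq[OF that] v2[of t] by (simp add: p_def)
 qed (use u vnz in auto)
 moreover have "p (a + l) = p a" using l by (simp add: p_def)
 hence "v (a + l) = v a" by (simp add: v_def)
 ultimately show ?thesis using l by simp
qed

lemma root_circle_self:
 fixes u :: "real => complex"
 assumes l: "l > 0" and u: "continuous_on {a..a + l} u"
  and sq: "\<And>t. t \<in> {a..a + l} ==> u t ^ 2 = A - (A + (b - A) * cis (2 * pi * ((t - a) / l)))"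
  and b: "b ~= A"
 shows "u (a + l) = - u a"
proof -
 define v where "v t = u a * cis (pi * ((t - a) / l))" for t
 have ua: "u a ^ 2 = A - b" using sq[of a] l by simp
 have "u (a + l) = v (a + l)"
 proof (rule sqrt_path_unique[of "{a..a + l}" u v])
  show "continuous_on {a..a + l} v" unfolding v_def using l by (intro continuous_intros) auto
  show "u t ^ 2 = v t ^ 2" if "t \<in> {a..a + l}" for t
   using sq[OF that] by (simp add: v_def power_mult_distrib ua Complex.DeMoivre algebra_simps)
  show "u t ~= 0" if "t \<in> {a..a + l}" for t
   using sq[OF that] b by auto
  show "u a = v a" by (simp add: v_def)
 qed (use u l in auto)
 thus ?thesis using l by (simp add: v_def)
qed

text \<open>If one root changes its sign, only one summand changes, and it is not zero.\<close>

lemma branch_sum_single_flip: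
 assumes c: "coeff_ok c K" and z: "z \<in> sing_compl" and w: "roots_at w z" "roots_at w' z"
  and k: "chi12 k ~= 0" "c k ~= 0" and flip: "w' k = - w k"
  and other: "\<And>n. chi12 n ~= 0 ==> n ~= k ==> w' n = w n"
 shows "branch_sum c w' z z ~= branch_sum c w z z"
proof -
 obtain \<kappa> where \<kappa>: "away \<kappa> z" using z away_exists by blast
 have "(%n. c n / w' n ^ 5 - c n / w n ^ 5) sums ((\<Sum>n. c n / w' n ^ 5) - (\<Sum>n. c n / w n ^ 5))"
  by (intro sums_diff summable_sums branch_sum_summable[OF c \<kappa>] w)
 moreover have "c n / w' n ^ 5 - c n / w n ^ 5 = (if n = k then - 2 * c k / w k ^ 5 else 0)" for n
  using other[of n] flip c by (cases "chi12 n = 0") (auto simp: coeff_ok_def power_minus_odd)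
 ultimately have "(%n. if n = k then - 2 * c k / w k ^ 5 else 0) sums ((\<Sum>n. c n / w' n ^ 5) - (\<Sum>n. c n / w n ^ 5))"
  by simp
 from sums_unique2[OF this sums_single[of k "%_. - 2 * c k / w k ^ 5"]]
 have "(\<Sum>n. c n / w' n ^ 5) - (\<Sum>n. c n / w n ^ 5) = - 2 * c k / w k ^ 5" .
 moreover have "w k ~= 0"
 proof
  assume "w k = 0"
  hence "cloc k = z" using w(1) k(1) by (force simp: roots_at_def)
  thus False using z k(1) by (auto simp: sing_set_eq)
 qed
 ultimately show ?thesis using k(2) by (auto simp: branch_sum_self[OF c \<kappa>])
qed

lemma path_from_0_facts:
 assumes "path_from_0_in S \<gamma>"
 shows "continuous_on {0..1} \<gamma>" "\<gamma> ` {0..1} \<subseteq> S" "\<gamma> 0 = 0"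
 using assms by (auto simp: path_from_0_in_def path_def path_image_def pathstart_def)

lemma path_from_0_join:
 assumes "path_from_0_in S \<gamma>" "path c" "pathstart c = pathfinish \<gamma>" "path_image c \<subseteq> S"
 shows "path_from_0_in S (\<gamma> +++ c)"
 using assms by (auto simp: path_from_0_in_def path_image_join)

lemma continuable_germ:
 assumes c: "coeff_ok c K" and h: "germ_eq h c"
 shows "continuable_in h sing_compl"
 unfolding continuable_in_def
proof (intro allI impI)
 fix \<gamma> assume "path_from_0_in sing_compl \<gamma>"
 note \<gamma> = path_from_0_facts[OF this]
 obtain w where "root_family \<gamma> {0..1} w" using root_family_exists[OF _ _ \<gamma>] by auto
 from canonical_continuation[OF _ _ \<gamma> this c h] show "\<exists>g. continuation_along h \<gamma> {0..1} g" by auto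
qed

lemma circle_around_facts:
 assumes "b ~= a" "cball a (dist a b) - {a} \<subseteq> S"
 shows "path (circle_around a b)" "pathstart (circle_around a b) = b" "pathfinish (circle_around a b) = b"
  "path_image (circle_around a b) \<subseteq> S"
proof -
 show "path (circle_around a b)" unfolding path_def circle_around_def by (intro continuous_intros)
 show "pathstart (circle_around a b) = b" "pathfinish (circle_around a b) = b"
  by (simp_all add: pathstart_def pathfinish_def circle_around_def)
 have "circle_around a b t \<in> cball a (dist a b) - {a}" for t
  using assms(1) by (auto simp: circle_around_def dist_norm norm_mult norm_minus_commute)
 thus "path_image (circle_around a b) \<subseteq> S" using assms(2) by (auto simp: path_image_def)
qed

lemma circle_other_dist:
 assumes "cball (cloc k) (dist (cloc k) b) - {cloc k} \<subseteq> sing_compl"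
  "chi12 n ~= 0" "n ~= k"
 shows "norm (b - cloc k) < norm (cloc n - cloc k)"
proof (rule ccontr)
 assume "\<not> ?thesis"
 hence "cloc n \<in> cball (cloc k) (dist (cloc k) b)"
  by (simp add: dist_norm norm_minus_commute)
 moreover have "cloc n ~= cloc k" using assms(3) loc_inj by simp
 ultimately have "cloc n \<in> sing_compl" using assms(1) by blast
 thus False using assms(2) by (auto simp: sing_set_eq)
qed

text \<open>A small circle flips the root of the enclosed singularity and no other one.\<close>

lemma sqrt_branch_point_germ:
 assumes c: "coeff_ok c K" and h: "germ_eq h c"
  and k: "chi12 k ~= 0" "c k ~= 0"
 shows "sqrt_branch_point h sing_compl (cloc k)"
 unfolding sqrt_branch_point_def Let_def
proof (intro allI impI conjI)
 define A where "A = cloc k"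
 fix \<gamma> b g
 assume "path_from_0_in sing_compl \<gamma> \<and> pathfinish \<gamma> = b \<and> b ~= cloc k \<and>
   cball (cloc k) (dist (cloc k) b) - {cloc k} \<subseteq> sing_compl"
 hence \<gamma>: "path_from_0_in sing_compl \<gamma>" "pathfinish \<gamma> = b" and b: "b ~= A"
  and ball: "cball A (dist A b) - {A} \<subseteq> sing_compl" by (auto simp: A_def)
 define C where "C = circle_around A b"
 note C = circle_around_facts[OF b ball, folded C_def]
 have b_in: "b \<in> sing_compl" using ball b by (auto simp: dist_norm)
 {
  assume g: "continuation_along h (\<gamma> +++ circle_around (cloc k) b) {0..1} g"
  define P where "P = \<gamma> +++ C"
  have "path_from_0_in sing_compl P"
   unfolding P_def by (rule path_from_0_join) (use \<gamma> C in auto)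
  note P = path_from_0_facts[OF this]
  obtain w where w: "root_family P {0..1} w" using root_family_exists[OF _ _ P] by auto
  have germ: "\<forall>\<^sub>F z in nhds (P t). g t z = branch_sum c (%n. w n t) (P t) z" if "t \<in> {0..1}" for t
   by (rule continuation_germ(1)[OF _ _ P w c h _ that])
     (use g in \<open>auto simp: P_def C_def A_def\<close>)
  have Pb: "P 1 = b" "P (1/2) = b"
   using \<gamma>(2) C by (auto simp: P_def joinpaths_def pathfinish_def)
  have P2: "P t = A + (b - A) * cis (2 * pi * ((t - 1/2) / (1/2)))" if "t \<in> {1/2..1/2 + 1/2}" for t
  proof (cases "t = 1/2")
   case True thus ?thesis by (simp add: True Pb)
  next
   case False thus ?thesis using that by (simp add: P_def joinpaths_def C_def circle_around_def algebra_simps)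
  qed
  have wn: "continuous_on {1/2..1/2 + 1/2} (w n)"
   "\<And>t. t \<in> {1/2..1/2 + 1/2} ==> w n t ^ 2 = cloc n - (A + (b - A) * cis (2 * pi * ((t - 1/2) / (1/2))))"
   if "chi12 n ~= 0" for n
  proof -
   show "continuous_on {1/2..1/2 + 1/2} (w n)" by (rule root_familyD(1)[OF w that]) auto
   fix t :: real assume t: "t \<in> {1/2..1/2 + 1/2}"
   hence "t \<in> {0..1}" by auto
   from root_familyD(3)[OF w that this]
   show "w n t ^ 2 = cloc n - (A + (b - A) * cis (2 * pi * ((t - 1/2) / (1/2))))"
    unfolding P2[OF t] .
  qed
  have flip: "w k 1 = - w k (1/2)"
   using root_circle_self[OF _ wn(1)[OF k(1)] wn(2)[OF k(1), folded A_def] b] by simp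
  have other: "w n 1 = w n (1/2)" if n: "chi12 n ~= 0" "n ~= k" for n
   using root_circle_other[OF _ wn[OF n(1)] circle_other_dist[OF ball[unfolded A_def] n, folded A_def]] by simp
  have "branch_sum c (%n. w n 1) b b ~= branch_sum c (%n. w n (1/2)) b b"
   using root_family_roots_at[OF w, of 1] root_family_roots_at[OF w, of "1/2"] Pb
   by (intro branch_sum_single_flip[OF c b_in _ _ k] flip other) auto
  moreover have "g 1 b = branch_sum c (%n. w n 1) b b" "g (1/2) b = branch_sum c (%n. w n (1/2)) b b"
   using eventually_nhds_x_imp_x[OF germ[of 1]] eventually_nhds_x_imp_x[OF germ[of "1/2"]] Pb by auto
  ultimately have "g 1 b ~= g (1/2) b" by simp
  thus "\<not> (\<forall>\<^sub>F z in nhds b. g 1 z = g (1/2) z)" by (auto dest: eventually_nhds_x_imp_x)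
 }
 {
  assume g: "continuation_along h (\<gamma> +++ circle_around (cloc k) b +++ circle_around (cloc k) b) {0..1} g"
  define P where "P = \<gamma> +++ C +++ C"
  have "path_from_0_in sing_compl P"
   unfolding P_def by (rule path_from_0_join) (use \<gamma> C in \<open>auto simp: path_image_join\<close>)
  note P = path_from_0_facts[OF this]
  obtain w where w: "root_family P {0..1} w" using root_family_exists[OF _ _ P] by auto
  have germ: "\<forall>\<^sub>F z in nhds (P t). g t z = branch_sum c (%n. w n t) (P t) z" if "t \<in> {0..1}" for t
   by (rule continuation_germ(1)[OF _ _ P w c h _ that])
     (use g in \<open>auto simp: P_def C_def A_def\<close>)
  have Pb: "P 1 = b" "P (1/2) = b"
   using \<gamma>(2) C by (auto simp: P_def joinpaths_def pathfinish_def)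
  have eq: "w n 1 = w n (1/2)" if n: "chi12 n ~= 0" for n
  proof -
   have "w n (1/2 + 2 * (1/4)) = w n (1/2)"
   proof (rule root_double_loop[where p = P])
    show "P (1/2 + 1/4 + s) = P (1/2 + s)" if "s \<in> {0..1/4}" for s
    proof -
     have C01: "C 1 = b" "C 0 = b" using C by (auto simp: pathstart_def pathfinish_def)
     show ?thesis
     proof (cases "s = 0")
      case True thus ?thesis using Pb C01 by (simp add: P_def joinpaths_def)
     next
      case False
      hence s: "0 < s" "s \<le> 1/4" using that by auto
      have "P (1/2 + 1/4 + s) = C (4 * s)" using s by (simp add: P_def joinpaths_def algebra_simps)
      moreover have "P (1/2 + s) = C (4 * s)" using s by (simp add: P_def joinpaths_def algebra_simps)
      ultimately show ?thesis by simp
     qed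
    qed
    show "continuous_on {1/2..1/2 + 2 * (1/4)} (w n)"
     by (rule root_familyD(1)[OF w n]) auto
    show "w n t ^ 2 = cloc n - P t" if "t \<in> {1/2..1/2 + 2 * (1/4)}" for t
     by (rule root_familyD(3)[OF w n]) (use that in auto)
    show "P t ~= cloc n" if "t \<in> {1/2..1/2 + 2 * (1/4)}" for t

    proof -
     have "P t \<in> P ` {0..1}" by (rule imageI) (use that in auto)
     hence "P t \<in> sing_compl" using P(2) by blast
     thus ?thesis using sing_compl_not_loc[OF _ n] by metis
    qed
   qed auto
   thus ?thesis by simp
  qed
  have "branch_sum c (%n. w n 1) b z = branch_sum c (%n. w n (1/2)) b z" for z
   by (rule branch_sum_cong[OF c eq])
  with germ[of 1] germ[of "1/2"] Pb show "\<forall>\<^sub>F z in nhds b. g 1 z = g (1/2) z"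
   by (auto elim: eventually_elim2)
 }
qed

text \<open>The loop that changes the germ is the circle through 0 around the first singularity.\<close>

lemma double_valued_germ:
 assumes c: "coeff_ok c K" and h: "germ_eq h c" and c1: "c 1 ~= 0"
 shows "double_valued_in h sing_compl"
 unfolding double_valued_in_def
proof (intro conjI allI impI)
 show "continuable_in h sing_compl" by (rule continuable_germ[OF c h])
next
 fix \<gamma> g
 assume "path_from_0_in sing_compl \<gamma> \<and> pathfinish \<gamma> = 0 \<and> continuation_along h (\<gamma> +++ \<gamma>) {0..1} g"
 hence \<gamma>: "path_from_0_in sing_compl \<gamma>" "pathfinish \<gamma> = 0" and g: "continuation_along h (\<gamma> +++ \<gamma>) {0..1} g" by auto
 define P where "P = \<gamma> +++ \<gamma>"
 have "path_from_0_in sing_compl P"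
  unfolding P_def by (rule path_from_0_join) (use \<gamma> in \<open>auto simp: path_from_0_in_def\<close>)
 note P = path_from_0_facts[OF this]
 obtain w where w: "root_family P {0..1} w" using root_family_exists[OF _ _ P] by auto
 have g01: "\<gamma> 0 = 0" "\<gamma> 1 = 0" using \<gamma> by (auto simp: path_from_0_in_def pathstart_def pathfinish_def)
 have P1: "P 1 = 0" using g01 by (simp add: P_def joinpaths_def)
 have "\<forall>\<^sub>F z in nhds (P 1). g 1 z = branch_sum c (%n. w n 1) (P 1) z"
  by (rule continuation_germ(1)[OF _ _ P w c h]) (use g in \<open>auto simp: P_def\<close>)
 moreover have eq: "w n 1 = of_real (sqrt (loc n))" if n: "chi12 n ~= 0" for n
 proof -
  have "w n (0 + 2 * (1/2)) = w n 0"
  proof (rule root_double_loop[where p = P])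
   show "P (0 + 1/2 + s) = P (0 + s)" if "s \<in> {0..1/2}" for s
    using that g01 by (cases "s = 0") (auto simp: P_def joinpaths_def algebra_simps)
   show "continuous_on {0..0 + 2 * (1/2)} (w n)"
    by (rule root_familyD(1)[OF w n]) auto
   show "w n t ^ 2 = cloc n - P t" if "t \<in> {0..0 + 2 * (1/2)}" for t
    by (rule root_familyD(3)[OF w n]) (use that in auto)
   show "P t ~= cloc n" if "t \<in> {0..0 + 2 * (1/2)}" for t

    proof -
     have "P t \<in> P ` {0..1}" by (rule imageI) (use that in auto)
     hence "P t \<in> sing_compl" using P(2) by blast
     thus ?thesis using sing_compl_not_loc[OF _ n] by metis
    qed
  qed auto
  thus ?thesis using root_familyD(2)[OF w n] by simp
 qed
 have "branch_sum c (%n. w n 1) 0 z = germ_at_0 c z" for z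
  unfolding germ_at_0_def by (rule branch_sum_cong[OF c eq])
 ultimately show "\<forall>\<^sub>F z in nhds 0. g 1 z = h z"
  using h unfolding P1 by (auto elim: eventually_elim2)
next
 define A where "A = complex_of_real (loc 1)"
 have chi1: "chi12 1 ~= 0" by (simp add: chi12_def)
 have A: "(0::complex) ~= A" using loc_pos[of 1] by (simp add: A_def)
 have far: "2 * loc 1 < loc n" if "chi12 n ~= 0" "n ~= 1" for n
 proof -
  have "n \<ge> 2" using chi12_imp_pos[OF that(1)] that(2) by auto
  hence "2 ^ 2 \<le> (real n) ^ 2" by (intro power_mono) auto
  hence "pi ^ 2 / 6 * 4 \<le> pi ^ 2 / 6 * (real n) ^ 2" by (intro mult_left_mono) auto
  thus ?thesis by (simp add: loc_def)
 qed
 have ball: "cball A (dist A 0) - {A} \<subseteq> sing_compl"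
 proof
  fix z assume z: "z \<in> cball A (dist A 0) - {A}"
  show "z \<in> sing_compl"
  proof (rule ccontr)
   assume "\<not> ?thesis"
   then obtain n where n: "chi12 n ~= 0" "z = cloc n" by (auto simp: sing_set_eq)
   hence "n ~= 1" using z by (auto simp: A_def)
   have "z - A = of_real (loc n - loc 1)" by (simp add: n A_def)
   hence "norm (z - A) = \<bar>loc n - loc 1\<bar>" by (simp only: norm_of_real)
   moreover have "norm (z - A) \<le> loc 1" using z norm_loc[of 1] by (simp add: A_def dist_norm norm_minus_commute)
   ultimately show False using far[OF n(1) \<open>n ~= 1\<close>] by linarith
  qed
 qed
 define P where "P = circle_around A 0"
 note C = circle_around_facts[OF A ball, folded P_def]
 have p0: "path_from_0_in sing_compl P" using C by (simp add: path_from_0_in_def)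
 note P = path_from_0_facts[OF p0]
 obtain w where w: "root_family P {0..1} w" using root_family_exists[OF _ _ P] by auto
 define g where "g t = branch_sum c (%n. w n t) (P t)" for t
 have g: "continuation_along h P {0..1} g"
  unfolding g_def by (rule canonical_continuation[OF _ _ P w c h]) auto
 have wn: "continuous_on {0..0 + 1} (w n)"
   "\<And>t. t \<in> {0..0 + 1} ==> w n t ^ 2 = cloc n - (A + (0 - A) * cis (2 * pi * ((t - 0) / 1)))"
   if "chi12 n ~= 0" for n
 proof -
  show "continuous_on {0..0 + 1} (w n)" by (rule root_familyD(1)[OF w that]) auto
  fix t :: real assume "t \<in> {0..0 + 1}"
  hence "t \<in> {0..1}" by simp
  from root_familyD(3)[OF w that this]
  show "w n t ^ 2 = cloc n - (A + (0 - A) * cis (2 * pi * ((t - 0) / 1)))"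
   by (simp add: P_def circle_around_def)
 qed
 have flip: "w 1 1 = - w 1 0"
  using root_circle_self[OF _ wn(1)[OF chi1] wn(2)[OF chi1, folded A_def] A] by simp
 have other: "w n 1 = w n 0" if n: "chi12 n ~= 0" "n ~= 1" for n
  using root_circle_other[OF _ wn[OF n(1)] circle_other_dist[OF ball[unfolded A_def] n, folded A_def]] by simp
 have P1: "P 1 = 0" using C by (simp add: pathfinish_def)
 have "P 0 \<in> P ` {0..1}" by (rule imageI) simp
 hence "P 0 \<in> sing_compl" using P(2) by blast
 hence z0: "0 \<in> sing_compl" unfolding P(3) .
 have "branch_sum c (%n. w n 1) 0 0 ~= branch_sum c (%n. w n 0) 0 0"
  using root_family_roots_at[OF w, of 1] root_family_roots_at[OF w, of 0] P1 P(3)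
  by (intro branch_sum_single_flip[OF c z0 _ _ chi1 c1] flip other) auto
 moreover have "branch_sum c (%n. w n 0) 0 0 = h 0"
 proof -
  have "branch_sum c (%n. w n 0) 0 0 = germ_at_0 c 0"
   unfolding germ_at_0_def by (rule branch_sum_cong[OF c]) (rule root_familyD(2)[OF w])
  thus ?thesis using eventually_nhds_x_imp_x[OF h] by simp
 qed
 ultimately have "g 1 0 ~= h 0" by (simp add: g_def P1)
 hence "\<not> (\<forall>\<^sub>F z in nhds 0. g 1 z = h z)" by (auto dest: eventually_nhds_x_imp_x)
 thus "\<exists>\<gamma> g. path_from_0_in sing_compl \<gamma> \<and> pathfinish \<gamma> = 0 \<and> continuation_along h \<gamma> {0..1} g
    \<and> \<not> (\<forall>\<^sub>F z in nhds 0. g 1 z = h z)"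
  using p0 C g by (intro exI[of _ P] exI[of _ g]) auto
qed

section \<open>Primitives of the Laplace integrands\<close>

definition gauss_prim :: "complex => complex" where
 "gauss_prim = (SOME F. (\<forall>z. (F has_field_derivative exp (- (z ^ 2))) (at z)) \<and> F 0 = 0)"

lemma gauss_prim_props: "(\<forall>z. (gauss_prim has_field_derivative exp (- (z ^ 2))) (at z)) \<and> gauss_prim 0 = 0"
proof -
 have "\<exists>g. \<forall>z\<in>(UNIV :: complex set). (g has_field_derivative exp (- (z ^ 2))) (at z within UNIV)"
  by (rule holomorphic_convex_primitive'[of UNIV "%z. exp (- (z ^ 2))"]) (auto intro!: holomorphic_intros)
 then obtain g where g: "\<And>z::complex. (g has_field_derivative exp (- (z ^ 2))) (at z)" by auto
 have "((%z. g z - g 0) has_field_derivative exp (- (z ^ 2))) (at z)" for z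
  using DERIV_diff[OF g[of z] DERIV_const[of "g 0"]] by simp
 hence "\<exists>F. (\<forall>z. (F has_field_derivative exp (- (z ^ 2))) (at z)) \<and> F 0 = (0::complex)"
  by (intro exI[of _ "%z. g z - g 0"]) auto
 thus ?thesis unfolding gauss_prim_def by (rule someI_ex)
qed

lemma gauss_prim_deriv: "(gauss_prim has_field_derivative exp (- (z ^ 2))) (at z)"
 and gauss_prim_0 [simp]: "gauss_prim 0 = 0"
 using gauss_prim_props by auto

lemma gauss_prim_unique:
 assumes "\<And>z. (F has_field_derivative exp (- (z ^ 2))) (at z)" "F 0 = 0"
 shows "F z = gauss_prim z"
proof -
 have "\<exists>c. \<forall>z\<in>UNIV. F z - gauss_prim z = c"
  by (rule has_field_derivative_zero_constant)
    (auto intro!: derivative_eq_intros assms(1) gauss_prim_deriv)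
 then obtain c where "\<And>z. F z - gauss_prim z = c" by auto
 from this[of 0] this[of z] show ?thesis using assms(2) by simp
qed

lemma gauss_prim_minus: "gauss_prim (- z) = - gauss_prim z"
proof -
 have "((%z. - gauss_prim (- z)) has_field_derivative exp (- (z ^ 2))) (at z)" for z
  by (auto intro!: derivative_eq_intros DERIV_chain2[OF gauss_prim_deriv])
 from gauss_prim_unique[OF this, of z] show ?thesis by (metis gauss_prim_0 minus_minus minus_zero)
qed

lemma gauss_prim_cnj: "gauss_prim (cnj z) = cnj (gauss_prim z)"
proof -
 have "((cnj \<circ> gauss_prim \<circ> cnj) has_field_derivative exp (- (z ^ 2))) (at z)" for z
  using has_field_derivative_cnj_cnj[OF gauss_prim_deriv[of "cnj z"]] by (simp add: exp_cnj)
 from gauss_prim_unique[OF this, of z] show ?thesis by (simp add: o_def) (metis complex_cnj_cnj)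
qed

lemma gauss_prim_real_limit: "((%y. gauss_prim (complex_of_real y)) \<longlongrightarrow> of_real (sqrt pi / 2)) at_top"
proof -
 have im: "gauss_prim (complex_of_real y) = of_real (Re (gauss_prim (complex_of_real y)))" for y
  using gauss_prim_cnj[of "complex_of_real y"] by (simp add: complex_eq_iff)
 have vd: "((%y. Re (gauss_prim (complex_of_real y))) has_field_derivative exp (- (y ^ 2))) (at y)" for y
 proof -
  have "((gauss_prim \<circ> complex_of_real) has_vector_derivative 1 * exp (- ((complex_of_real y) ^ 2))) (at y)"
   by (rule field_vector_diff_chain_at[OF _ gauss_prim_deriv])
     (auto intro!: derivative_eq_intros simp: has_vector_derivative_def scaleR_conv_of_real)
  hence "((%y. Re ((gauss_prim \<circ> complex_of_real) y)) has_vector_derivative Re (1 * exp (- ((complex_of_real y) ^ 2)))) (at y)"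
   by (rule bounded_linear.has_vector_derivative[OF bounded_linear_Re])
  moreover have "exp (- ((complex_of_real y) ^ 2)) = of_real (exp (- (y ^ 2)))"
   by (simp flip: exp_of_real)
  ultimately show ?thesis by (simp add: has_real_derivative_iff_has_vector_derivative)
 qed
 have "((%y. LINT x|lborel. indicator {..y} x *\<^sub>R (indicator {0..} x *\<^sub>R exp (- x\<^sup>2))) \<longlongrightarrow>
   (LINT x|lborel. indicator {0..} x *\<^sub>R exp (- x\<^sup>2 :: real))) at_top"
  using gaussian_moment_0 by (intro tendsto_integral_at_top) (auto simp: has_bochner_integral_iff)
 also have "(LINT x|lborel. indicator {0..} x *\<^sub>R exp (- x\<^sup>2 :: real)) = sqrt pi / 2"
  using gaussian_moment_0 by (simp add: has_bochner_integral_iff)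
 finally have lim: "((%y. LINT x|lborel. indicator {..y} x *\<^sub>R (indicator {0..} x *\<^sub>R exp (- x\<^sup>2))) \<longlongrightarrow> sqrt pi / 2) at_top" .
 have "((%y. Re (gauss_prim (complex_of_real y))) \<longlongrightarrow> sqrt pi / 2) at_top"
 proof (rule Lim_transform_eventually[OF lim])
  show "\<forall>\<^sub>F y in at_top. (LINT x|lborel. indicator {..y} x *\<^sub>R (indicator {0..} x *\<^sub>R exp (- x\<^sup>2)))
    = Re (gauss_prim (complex_of_real y))"
   using eventually_ge_at_top[of 0]
  proof eventually_elim
   case (elim y)
   have "(LINT x|lborel. indicator {..y} x *\<^sub>R (indicator {0..} x *\<^sub>R exp (- x\<^sup>2))) =
      (LINT x|lborel. exp (- x\<^sup>2) * indicator {0..y} x)"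
    by (rule Bochner_Integration.integral_cong) (auto simp: indicator_def)
   also have "\<dots> = Re (gauss_prim (complex_of_real y)) - Re (gauss_prim (complex_of_real 0))"
    by (rule integral_FTC_Icc_real) (use elim vd in \<open>auto intro!: continuous_intros\<close>)
   finally show ?case by simp
  qed
 qed
 hence "((%y. complex_of_real (Re (gauss_prim (complex_of_real y)))) \<longlongrightarrow> of_real (sqrt pi / 2)) at_top"
  by (rule tendsto_of_real)
 thus ?thesis using im by simp
qed

text \<open>In the sector \<open>\<bar>Im z\<bar> < Re z\<close> the Gaussian decays, so the segment from \<open>y Z\<close> to the real axis contributes
nothing in the limit.\<close>

lemma sector_limits:
 fixes y :: "nat => real" and Z :: "nat => complex"
 assumes y: "filterlim y at_top sequentially" and Z: "Z \<longlonglongrightarrow> c" and c: "\<bar>Im c\<bar> < Re c"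
 shows "(%k. exp (- ((of_real (y k) * Z k) ^ 2))) \<longlonglongrightarrow> 0"
  and "(%k. gauss_prim (of_real (y k) * Z k)) \<longlonglongrightarrow> of_real (sqrt pi / 2)"
  and "filterlim (%k. norm (of_real (y k) * Z k)) at_top sequentially"
proof -
 define m where "m v = Re v - \<bar>Im v\<bar>" for v :: complex
 define \<mu> where "\<mu> = min 1 (m c / 2)"
 have \<mu>: "0 < \<mu>" "\<mu> \<le> 1" "\<mu> < m c" using c by (auto simp: \<mu>_def m_def min_def)
 have "(%k. m (Z k)) \<longlonglongrightarrow> m c" unfolding m_def by (intro tendsto_intros Z)
 hence evm: "\<forall>\<^sub>F k in sequentially. \<mu> < m (Z k)" using \<mu>(3) by (rule order_tendstoD)
 have evy: "\<forall>\<^sub>F k in sequentially. y k \<ge> 1" using y by (auto simp: filterlim_at_top)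
 have sq: "\<mu> ^ 2 \<le> Re (v ^ 2)" if "\<mu> \<le> m v" for v
 proof -
  have "Re (v ^ 2) = (Re v - \<bar>Im v\<bar>) * (Re v + \<bar>Im v\<bar>)"
   by (simp add: power2_eq_square algebra_simps)
  moreover have "\<mu> * \<mu> \<le> (Re v - \<bar>Im v\<bar>) * (Re v + \<bar>Im v\<bar>)"
   using that \<mu> by (intro mult_mono) (auto simp: m_def)
  ultimately show ?thesis by (simp add: power2_eq_square)
 qed
 have expb: "norm (exp (- ((of_real t * v) ^ 2))) \<le> exp (- (\<mu> ^ 2 * t ^ 2))" if "\<mu> \<le> m v" for t v
 proof -
  have "t ^ 2 * \<mu> ^ 2 \<le> t ^ 2 * Re (v ^ 2)" by (intro mult_left_mono sq that) auto
  moreover have "Re ((of_real t * v) ^ 2) = t ^ 2 * Re (v ^ 2)"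
  proof -
   have "(of_real t * v) ^ 2 = (t ^ 2) *\<^sub>R (v ^ 2)" by (simp add: scaleR_conv_of_real power_mult_distrib)
   thus ?thesis by (simp only: scaleR_complex.sel)
  qed
  ultimately show ?thesis by (simp add: norm_exp_eq_Re mult.commute)
 qed
 have y2: "filterlim (%k. \<mu> ^ 2 * y k ^ 2) at_top sequentially"
 proof -
  have "filterlim (%k. y k ^ 2) at_top sequentially" using y by (intro filterlim_pow_at_top) auto
  from filterlim_tendsto_pos_mult_at_top[OF tendsto_const _ this, of "\<mu> ^ 2"] show ?thesis using \<mu> by simp
 qed
 have e0: "(%k. exp (- (\<mu> ^ 2 * y k ^ 2))) \<longlonglongrightarrow> 0"
  by (rule filterlim_compose[OF exp_at_bot]) (use y2 in \<open>simp add: filterlim_uminus_at_bot\<close>)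
 show "(%k. exp (- ((of_real (y k) * Z k) ^ 2))) \<longlonglongrightarrow> 0"
  by (rule Lim_null_comparison[OF _ e0]) (use evm in eventually_elim, rule expb, simp)
 show "filterlim (%k. norm (of_real (y k) * Z k)) at_top sequentially"
 proof (rule filterlim_at_top_mono)
  show "filterlim (%k. \<mu> * y k) at_top sequentially"
   by (rule filterlim_tendsto_pos_mult_at_top[OF tendsto_const _ y]) (use \<mu> in auto)
  show "\<forall>\<^sub>F k in sequentially. \<mu> * y k \<le> norm (of_real (y k) * Z k)"
   using evm evy
  proof eventually_elim
   case (elim k)
   have "\<mu> \<le> norm (Z k)" using elim(1) complex_Re_le_cmod[of "Z k"] by (simp add: m_def)
   hence "\<mu> * y k \<le> norm (Z k) * y k" using elim(2) by (intro mult_right_mono) auto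
   thus ?case using elim(2) by (simp add: norm_mult mult.commute)
  qed
 qed
 have r: "(%k. gauss_prim (of_real (y k))) \<longlonglongrightarrow> of_real (sqrt pi / 2)"
  by (rule filterlim_compose[OF gauss_prim_real_limit y])
 have "(%k. gauss_prim (of_real (y k) * Z k) - gauss_prim (of_real (y k))) \<longlonglongrightarrow> 0"
 proof (rule Lim_null_comparison)
  show "\<forall>\<^sub>F k in sequentially. norm (gauss_prim (of_real (y k) * Z k) - gauss_prim (of_real (y k))) \<le>
    exp (- (\<mu> ^ 2 * y k ^ 2)) * (y k * norm (Z k - 1))"
   using evm evy
  proof eventually_elim
   case (elim k)
   define S where "S = closed_segment (of_real (y k) * Z k) (complex_of_real (y k))"
   have "norm (gauss_prim (of_real (y k) * Z k) - gauss_prim (of_real (y k))) \<le>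
     exp (- (\<mu> ^ 2 * y k ^ 2)) * norm (of_real (y k) * Z k - of_real (y k))"
   proof (rule field_differentiable_bound[of S])
    show "(gauss_prim has_field_derivative exp (- (z ^ 2))) (at z within S)" for z
     using gauss_prim_deriv by (rule has_field_derivative_at_within)
    fix z assume "z \<in> S"
    then obtain u where u: "0 \<le> u" "u \<le> 1" "z = (1 - u) *\<^sub>R (of_real (y k) * Z k) + u *\<^sub>R complex_of_real (y k)"
     unfolding S_def closed_segment_def by blast
    define v where "v = (1 - u) *\<^sub>R Z k + of_real u"
    have zv: "z = of_real (y k) * v" unfolding u v_def by (simp add: scaleR_conv_of_real algebra_simps)
    have "\<bar>Im v\<bar> = (1 - u) * \<bar>Im (Z k)\<bar>" using u by (simp add: v_def abs_mult)
    hence "m v = (1 - u) * m (Z k) + u" by (simp add: m_def v_def algebra_simps)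
    moreover have "(1 - u) * \<mu> \<le> (1 - u) * m (Z k)" using elim(1) u by (intro mult_left_mono) auto
    moreover have "u * \<mu> \<le> u" using u \<mu> by (simp add: mult_left_le)
    ultimately have "\<mu> \<le> m v" by (simp add: algebra_simps)
    thus "norm (exp (- (z ^ 2))) \<le> exp (- (\<mu> ^ 2 * y k ^ 2))" unfolding zv by (rule expb)
   qed (auto simp: S_def)
   also have "of_real (y k) * Z k - of_real (y k) = of_real (y k) * (Z k - 1)" by (simp add: algebra_simps)
   also have "norm (of_real (y k) * (Z k - 1)) = y k * norm (Z k - 1)" using elim(2) by (simp add: norm_mult)
   finally show ?case .
  qed
  have "((%t::real. exp (- (\<mu> ^ 2 * t ^ 2)) * t) \<longlongrightarrow> 0) at_top" using \<mu>(1) by real_asymp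
  hence "(%k. exp (- (\<mu> ^ 2 * y k ^ 2)) * y k) \<longlonglongrightarrow> 0" using y by (rule filterlim_compose)
  moreover have "(%k. norm (Z k - 1)) \<longlonglongrightarrow> norm (c - 1)" by (intro tendsto_intros Z)
  ultimately have "(%k. exp (- (\<mu> ^ 2 * y k ^ 2)) * y k * norm (Z k - 1)) \<longlonglongrightarrow> 0 * norm (c - 1)"
   by (rule tendsto_mult)
  thus "(%k. exp (- (\<mu> ^ 2 * y k ^ 2)) * (y k * norm (Z k - 1))) \<longlonglongrightarrow> 0" by (simp add: mult.assoc)
 qed
 from tendsto_add[OF this r] show "(%k. gauss_prim (of_real (y k) * Z k)) \<longlonglongrightarrow> of_real (sqrt pi / 2)" by simp
qed

definition erf_prim :: "complex => complex => complex" where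
 "erf_prim x u = gauss_prim (csqrt (- x) * u) / csqrt (- x)"

lemma erf_prim_eq:
 assumes "s ^ 2 = - x" "x ~= 0"
 shows "erf_prim x u = gauss_prim (s * u) / s"
proof -
 have "s ^ 2 = csqrt (- x) ^ 2" using assms by simp
 hence "s = csqrt (- x) \<or> s = - csqrt (- x)" by (rule power2_eq_iff[THEN iffD1])
 thus ?thesis by (auto simp: erf_prim_def gauss_prim_minus)
qed

lemma erf_prim_deriv:
 assumes "x ~= 0"
 shows "(erf_prim x has_field_derivative exp (x * u ^ 2)) (at u)"
proof -
 have "((%u. gauss_prim (csqrt (- x) * u) / csqrt (- x)) has_field_derivative
   exp (- ((csqrt (- x) * u) ^ 2)) * csqrt (- x) / csqrt (- x)) (at u)"
  by (rule DERIV_cdivide, rule DERIV_chain2[OF gauss_prim_deriv]) (auto intro!: derivative_eq_intros)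
 thus ?thesis using assms by (simp add: erf_prim_def[abs_def] power_mult_distrib)
qed

lemma erf_prim_minus: "erf_prim x (- u) = - erf_prim x u"
 by (simp add: erf_prim_def gauss_prim_minus)

lemma erf_prim_cnj:
 assumes "x ~= 0"
 shows "erf_prim (cnj x) (cnj u) = cnj (erf_prim x u)"
proof -
 have "cnj (csqrt (- x)) ^ 2 = - cnj x" by (simp flip: complex_cnj_power)
 from erf_prim_eq[OF this, of "cnj u"] assms show ?thesis
  by (simp add: erf_prim_def flip: gauss_prim_cnj)
qed

text \<open>An odd primitive of \<open>exp (x u\<^sup>2) / u\<^sup>4\<close>. The substitution \<open>u\<^sup>2 = N - p\<close> turns the Laplace integrand
\<open>exp (- x p) (N - p)\<^sup>-\<^sup>5\<^sup>/\<^sup>2\<close> into a multiple of it; \<open>K2\<close> plays the same part for the exponent -3/2.\<close>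

definition K4 :: "complex => complex => complex" where
 "K4 x u = - (1 / (3 * u ^ 3) + 2 * x / (3 * u)) * exp (x * u ^ 2) + 4 * x ^ 2 / 3 * erf_prim x u"

definition K2 :: "complex => complex => complex" where
 "K2 x u = - exp (x * u ^ 2) / u + 2 * x * erf_prim x u"

lemma K4_minus: "K4 x (- u) = - K4 x u"
 by (simp add: K4_def erf_prim_minus power_minus_odd algebra_simps)

lemma K4_cnj: "x ~= 0 ==> K4 (cnj x) (cnj u) = cnj (K4 x u)"
 by (simp add: K4_def erf_prim_cnj exp_cnj)

lemma K4_K2: "u ~= 0 ==> K4 x u = - exp (x * u ^ 2) / (3 * u ^ 3) + 2 * x / 3 * K2 x u"
 by (simp add: K4_def K2_def field_simps power2_eq_square)

lemma K2_deriv: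
 assumes "x ~= 0" "u ~= 0"
 shows "(K2 x has_field_derivative exp (x * u ^ 2) / u ^ 2) (at u)"
 unfolding K2_def[abs_def] using assms
 by (auto intro!: derivative_eq_intros erf_prim_deriv simp: field_simps power2_eq_square)

lemma K4_deriv:
 assumes "x ~= 0" "u ~= 0"
 shows "(K4 x has_field_derivative exp (x * u ^ 2) / u ^ 4) (at u)"
proof -
 have "((%u. - (1 / (3 * u ^ 3) + 2 * x / (3 * u)) * exp (x * u ^ 2) + 4 * x ^ 2 / 3 * erf_prim x u)
  has_field_derivative exp (x * u ^ 2) / u ^ 4) (at u)"
  using assms
  by (auto intro!: derivative_eq_intros erf_prim_deriv) (simp add: field_simps power_numeral_reduce)
 thus ?thesis by (simp add: K4_def[abs_def])
qed

text \<open>The root \<open>s\<close> of \<open>- x\<close> fixes the direction: only \<open>s u\<close> matters, and it has to go to infinity in the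
sector of decay.\<close>

lemma K_limits:
 fixes y :: "nat => real" and Z u :: "nat => complex"
 assumes y: "filterlim y at_top sequentially" and Z: "Z \<longlonglongrightarrow> c" and c: "\<bar>Im c\<bar> < Re c"
  and s: "s ^ 2 = - x" "x ~= 0" and u: "\<And>k. s * u k = of_real (y k) * Z k"
 shows "(%k. K4 x (u k)) \<longlonglongrightarrow> 2 * x ^ 2 / 3 * of_real (sqrt pi) / s"
  and "(%k. K2 x (u k)) \<longlonglongrightarrow> x * of_real (sqrt pi) / s"
proof -
 note lims = sector_limits[OF y Z c]
 have s0: "s ~= 0" using s by auto
 have ex: "exp (x * u k ^ 2) = exp (- ((of_real (y k) * Z k) ^ 2))" for k
  using s by (simp flip: u add: power_mult_distrib)
 have e: "(%k. exp (x * u k ^ 2)) \<longlonglongrightarrow> 0" unfolding ex by (rule lims(1))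
 have E: "(%k. erf_prim x (u k)) \<longlonglongrightarrow> of_real (sqrt pi / 2) / s"
  unfolding erf_prim_eq[OF s] u by (intro tendsto_divide lims(2) tendsto_const s0)
 have inv: "(%k. 1 / u k) \<longlonglongrightarrow> 0"
 proof -
  have "(%k. 1 / (of_real (y k) * Z k)) \<longlonglongrightarrow> 0"
  proof (rule tendsto_norm_zero_cancel)
   have "(%k. inverse (norm (of_real (y k) * Z k))) \<longlonglongrightarrow> 0"
    by (rule tendsto_inverse_0_at_top[OF lims(3)])
   thus "(%k. norm (1 / (of_real (y k) * Z k))) \<longlonglongrightarrow> 0" by (simp add: norm_divide inverse_eq_divide)
  qed
  from tendsto_mult_right[OF this, of s] show ?thesis using s0 by (simp flip: u)
 qed
 have "(%k. - ((1 / u k) ^ 3 / 3 + 2 * x / 3 * (1 / u k)) * exp (x * u k ^ 2) + 4 * x ^ 2 / 3 * erf_prim x (u k))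
   \<longlonglongrightarrow> - (0 ^ 3 / 3 + 2 * x / 3 * 0) * 0 + 4 * x ^ 2 / 3 * (of_real (sqrt pi / 2) / s)"
  by (intro tendsto_intros e E inv) simp_all
 thus "(%k. K4 x (u k)) \<longlonglongrightarrow> 2 * x ^ 2 / 3 * of_real (sqrt pi) / s"
  by (simp add: K4_def power_one_over mult_ac)
 have "(%k. - (1 / u k) * exp (x * u k ^ 2) + 2 * x * erf_prim x (u k)) \<longlonglongrightarrow> - 0 * 0 + 2 * x * (of_real (sqrt pi / 2) / s)"
  by (intro tendsto_intros e E inv)
 thus "(%k. K2 x (u k)) \<longlonglongrightarrow> x * of_real (sqrt pi) / s" by (simp add: K2_def mult_ac)
qed

section \<open>Improper integrals\<close>

text \<open>Dominated convergence over growing intervals. Only a sequence of endpoints is needed for the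
limit of the primitive, because integrability comes from the majorant.\<close>

lemma improper_FTC:
 fixes F f :: "real => complex" and h :: "real => real"
 assumes S: "\<And>b. finite (S \<inter> {0..b})"
  and deriv: "\<And>t. t > 0 ==> t \<notin> S ==> (F has_vector_derivative f t) (at t)"
  and cont: "continuous_on {0..} F"
  and h: "h integrable_on {0..}" "\<And>t. t \<ge> 0 ==> h t \<ge> 0"
  and le: "\<And>t. t > 0 ==> t \<notin> S ==> norm (f t) \<le> h t"
  and b: "filterlim b at_top sequentially" and l: "(%k. F (b k)) \<longlonglongrightarrow> l"
 shows "(f has_integral (l - F 0)) {0..}"
proof -
 define f' where "f' t = (if t \<in> S \<or> t \<le> 0 then 0 else f t)" for t
 define g where "g k t = (if t \<in> {0..max 0 (b k)} then f' t else 0)" for k t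
 have FTC: "(f' has_integral F B - F 0) {0..B}" if "B \<ge> 0" for B
 proof (rule fundamental_theorem_of_calculus_interior_strong[OF S that])
  show "continuous_on {0..B} F" using cont by (rule continuous_on_subset) auto
  show "(F has_vector_derivative f' t) (at t)" if "t \<in> {0<..<B} - S \<inter> {0..B}" for t
   using deriv[of t] that by (auto simp: f'_def)
 qed
 have g: "(g k has_integral (F (max 0 (b k)) - F 0)) {0..}" for k
  unfolding g_def by (subst has_integral_restrict) (auto intro: FTC)
 have evb: "\<forall>\<^sub>F k in sequentially. t \<le> b k" for t
  using b unfolding filterlim_at_top by blast
 have d1: "g k integrable_on {0..}" for k using g by blast
 have d3: "norm (g k t) \<le> h t" if "t \<in> {0..}" for k t
  using le[of t] h(2)[of t] that by (auto simp: g_def f'_def)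
 have d4: "(%k. g k t) \<longlonglongrightarrow> f' t" if "t \<in> {0..}" for t
 proof (rule tendsto_eventually)
  show "\<forall>\<^sub>F k in sequentially. g k t = f' t" using evb[of t]
  proof eventually_elim
   case (elim k)
   have "t \<in> {0..max 0 (b k)}" using that elim unfolding atLeastAtMost_iff atLeast_iff by linarith
   thus ?case unfolding g_def by (rule if_P)
  qed
 qed
 note dc = dominated_convergence[OF d1 h(1) d3 d4]
 have "\<forall>\<^sub>F k in sequentially. 0 \<le> b k" by (rule evb)
 hence "\<forall>\<^sub>F k in sequentially. integral {0..} (g k) = F (b k) - F 0"
 proof eventually_elim
  case (elim k)
  thus ?case using integral_unique[OF g[of k]] by (simp add: max_absorb2)
 qed
 from Lim_transform_eventually[OF dc(2) this]
 have "integral {0..} f' = l - F 0" by (rule LIMSEQ_unique[OF _ tendsto_diff[OF l tendsto_const]])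
 hence f': "(f' has_integral (l - F 0)) {0..}" using integrable_integral[OF dc(1)] by simp
 have "negligible (\<Union>k::nat. insert 0 (S \<inter> {0..real k}))"
  by (intro negligible_Union_nat negligible_finite) (simp add: S)
 hence neg: "negligible (insert 0 (S \<inter> {0..}))"
 proof (rule negligible_subset)
  show "insert 0 (S \<inter> {0..}) \<subseteq> (\<Union>k::nat. insert 0 (S \<inter> {0..real k}))"
  proof
   fix t assume t: "t \<in> insert 0 (S \<inter> {0..})"
   obtain k :: nat where "t \<le> real k" using real_arch_simple by blast
   thus "t \<in> (\<Union>k::nat. insert 0 (S \<inter> {0..real k}))" using t by auto
  qed
 qed
 show ?thesis
  by (rule has_integral_spike[OF neg _ f']) (auto simp: f'_def)
qed

text \<open>Dominated convergence for series with a majorant that is a product.\<close>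

lemma series_integral:
 fixes u :: "nat => real => complex"
 assumes S: "negligible S" and u: "\<And>n. (u n has_integral I n) {0..}"
  and le: "\<And>n t. t \<ge> 0 ==> t \<notin> S ==> norm (u n t) \<le> a n * h t"
  and a: "summable a" and h: "h integrable_on {0..}" "\<And>t. t \<ge> 0 ==> h t \<ge> 0"
  and a0: "\<And>n. a n \<ge> 0"
 shows "norm (I n) \<le> a n * integral {0..} h" and "summable I"
  and "((%t. \<Sum>n. u n t) has_integral (\<Sum>n. I n)) {0..}"
proof -
 define u' where "u' n t = (if t \<in> S then 0 else u n t)" for n t
 have u': "(u' n has_integral I n) {0..}" for n
  by (rule has_integral_spike[OF S _ u]) (auto simp: u'_def)
 have le': "norm (u' n t) \<le> a n * h t" if "t \<ge> 0" for n t
 proof (cases "t \<in> S")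
  case True
  thus ?thesis using mult_nonneg_nonneg[OF a0[of n] h(2)[OF that]] by (simp add: u'_def)
 next
  case False
  thus ?thesis using le[OF that False, of n] by (simp add: u'_def)
 qed
 have I_le: "norm (I n) \<le> a n * integral {0..} h" for n
 proof -
  have "norm (integral {0..} (u' n)) \<le> integral {0..} (%t. a n * h t)"
  proof (rule integral_norm_bound_integral[OF has_integral_integrable[OF u']])
   show "(%t. a n * h t) integrable_on {0..}" using integrable_on_cmult_left[OF h(1), of "a n"] by simp
   show "norm (u' n t) \<le> a n * h t" if "t \<in> {0..}" for t by (rule le') (use that in simp)
  qed
  thus ?thesis using integral_unique[OF u'[of n]] by simp
 qed
 show "norm (I n) \<le> a n * integral {0..} h" by (rule I_le)
 show sI: "summable I" by (rule summable_comparison_test'[OF summable_mult2[OF a] I_le])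
 define P where "P k t = (\<Sum>n<k. u' n t)" for k t
 have P: "(P k has_integral (\<Sum>n<k. I n)) {0..}" for k
  unfolding P_def by (intro has_integral_sum u') auto
 have su: "summable (%n. u' n t)" if "t \<ge> 0" for t
  by (rule summable_comparison_test'[OF summable_mult2[OF a] le'[OF that]])
 have d1: "P k integrable_on {0..}" for k using P by blast
 have d2: "(%t. (\<Sum>n. a n) * h t) integrable_on {0..}"
  using integrable_on_cmult_left[OF h(1), of "\<Sum>n. a n"] by simp
 have d3: "norm (P k t) \<le> (\<Sum>n. a n) * h t" if "t \<in> {0..}" for k t
 proof -
  have t: "t \<ge> 0" using that by simp
  have "norm (P k t) \<le> (\<Sum>n<k. a n * h t)" unfolding P_def
   by (rule order_trans[OF norm_sum]) (intro sum_mono le' t)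
  also have "\<dots> = (\<Sum>n<k. a n) * h t" by (simp add: sum_distrib_right)
  also have "\<dots> \<le> (\<Sum>n. a n) * h t"
   by (intro mult_right_mono sum_le_suminf a h(2) t) (auto simp: a0)
  finally show ?thesis .
 qed
 have d4: "(%k. P k t) \<longlonglongrightarrow> (\<Sum>n. u' n t)" if "t \<in> {0..}" for t
  unfolding P_def by (rule summable_LIMSEQ, rule su) (use that in simp)
 note dc = dominated_convergence[OF d1 d2 d3 d4]
 have "(%k. \<Sum>n<k. I n) \<longlonglongrightarrow> integral {0..} (%t. \<Sum>n. u' n t)"
  using dc(2) integral_unique[OF P] by simp
 hence "integral {0..} (%t. \<Sum>n. u' n t) = (\<Sum>n. I n)"
  by (rule LIMSEQ_unique) (rule summable_LIMSEQ[OF sI])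
 hence "((%t. \<Sum>n. u' n t) has_integral (\<Sum>n. I n)) {0..}" using integrable_integral[OF dc(1)] by simp
 thus "((%t. \<Sum>n. u n t) has_integral (\<Sum>n. I n)) {0..}"
  by (rule has_integral_spike[OF S, rotated]) (auto simp: u'_def)
qed

lemma poly_exp_bound:
 fixes c :: real assumes "c > 0" "t \<ge> 0"
 shows "(1 + t) ^ 5 \<le> (1 + 5 / c) ^ 5 * exp (c * t)"
proof -
 have "(1 + 5 / c) * (1 + c * t / 5) = 1 + t + (c * t / 5 + 5 / c)" using assms(1) by (simp add: field_simps)
 moreover have "c * t / 5 + 5 / c \<ge> 0" using assms by simp
 ultimately have "1 + t \<le> (1 + 5 / c) * (1 + c * t / 5)" by linarith
 also have "\<dots> \<le> (1 + 5 / c) * exp (c * t / 5)"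
  using assms(1) by (intro mult_left_mono exp_ge_add_one_self) simp
 finally have "(1 + t) ^ 5 \<le> ((1 + 5 / c) * exp (c * t / 5)) ^ 5"
  using assms(2) by (intro power_mono) simp_all
 also have "\<dots> = (1 + 5 / c) ^ 5 * exp (c * t / 5) ^ 5" by (rule power_mult_distrib)
 also have "exp (c * t / 5) ^ 5 = exp (real 5 * (c * t / 5))" by (rule exp_of_nat_mult[symmetric])
 also have "real 5 * (c * t / 5) = c * t" by simp
 finally show ?thesis .
qed

lemma integrable_exp_decay:
 fixes a :: real
 assumes "a > 0"
 shows "(%t. C * exp (- a * t)) integrable_on {0..}"
 using integrable_on_cmult_left[OF has_integral_integrable[OF has_integral_exp_minus_to_infinity[OF assms, of 0]], of C]
 by simp

section \<open>Laplace integrals along paths\<close>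

lemma branch_root_deriv:
 assumes "norm (z - z0) < norm (cloc n - z0)" "u ^ 2 = cloc n - z0" "z ~= cloc n"
 shows "(branch_root n u z0 has_field_derivative (- 1 / (2 * branch_root n u z0 z))) (at z)"
proof -
 define B where "B = branch_root n u z0"
 have ne: "cloc n ~= z0" using assms(1) by auto
 have sq: "B w ^ 2 = cloc n - w" for w
  unfolding B_def by (rule branch_root_sq[OF assms(2) ne])
 have "B holomorphic_on ball z0 (norm (cloc n - z0))"
  unfolding B_def by (rule branch_root_holomorphic) simp
 moreover have "z \<in> ball z0 (norm (cloc n - z0))"
  using assms(1) by (simp add: dist_norm norm_minus_commute)
 ultimately have "B field_differentiable (at z)"
  by (rule holomorphic_on_imp_differentiable_at[OF _ open_ball])
 then obtain D where D: "(B has_field_derivative D) (at z)" by (auto simp: field_differentiable_def)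
 have "((%w. B w ^ 2) has_field_derivative (2 * B z * D)) (at z)"
  by (rule derivative_eq_intros D refl)+ simp
 moreover have "((%w. B w ^ 2) has_field_derivative (- 1)) (at z)"
  unfolding sq by (auto intro!: derivative_eq_intros)
 ultimately have "2 * B z * D = - 1" by (rule DERIV_unique)
 moreover have "B z ~= 0" using sq[of z] assms(3) by auto
 ultimately have "D = - 1 / (2 * B z)" by (simp add: field_simps)
 thus ?thesis using D by (simp add: B_def)
qed

definition J_prim :: "complex => real => complex => complex" where
 "J_prim x N u = 2 * exp (- (x * of_real N)) * (K4 x (of_real (sqrt N)) - K4 x u)"

lemma J_prim_deriv:
 assumes x: "x ~= 0" and r: "(r has_field_derivative (- 1 / (2 * r z))) (at z)"
  and sq: "r z ^ 2 = of_real N - z" and nz: "r z ~= 0"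
 shows "((%z. J_prim x N (r z)) has_field_derivative exp (- (x * z)) / r z ^ 5) (at z)"
proof -
 have "((%z. K4 x (r z)) has_field_derivative exp (x * r z ^ 2) / r z ^ 4 * (- 1 / (2 * r z))) (at z)"
  by (rule DERIV_chain2[OF K4_deriv[OF x nz] r])
 hence "((%z. J_prim x N (r z)) has_field_derivative
   2 * exp (- (x * of_real N)) * (0 - exp (x * r z ^ 2) / r z ^ 4 * (- 1 / (2 * r z)))) (at z)"
  unfolding J_prim_def by (intro DERIV_cmult DERIV_diff DERIV_const)
 also have "2 * exp (- (x * of_real N)) * (0 - exp (x * r z ^ 2) / r z ^ 4 * (- 1 / (2 * r z)))
   = (exp (- (x * of_real N)) * exp (x * r z ^ 2)) / r z ^ 5"
  using nz by (simp add: field_simps power_numeral_reduce)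
 also have "exp (- (x * of_real N)) * exp (x * r z ^ 2) = exp (- (x * z))"
  unfolding sq exp_add[symmetric] by (simp add: algebra_simps)
 finally show ?thesis .
qed

lemma J_prim_branch_deriv:
 assumes "x ~= 0" "norm (z - z0) < norm (cloc n - z0)" "u ^ 2 = cloc n - z0" "z ~= cloc n"
 shows "((%z. J_prim x (loc n) (branch_root n u z0 z)) has_field_derivative
      exp (- (x * z)) / branch_root n u z0 z ^ 5) (at z)"
proof -
 have ne: "cloc n ~= z0" using assms(2) by auto
 show ?thesis
  by (rule J_prim_deriv[OF assms(1) branch_root_deriv[OF assms(2-4)] branch_root_sq[OF assms(3) ne]
     branch_root_nonzero[OF assms(3) ne assms(4)[symmetric]]])
qed

lemma J_prim_0: "J_prim x N (of_real (sqrt N)) = 0"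
 by (simp add: J_prim_def)

lemma continuous_on_K4:
 assumes "x ~= 0"
 shows "continuous_on (- {0}) (K4 x)"
 by (rule DERIV_continuous_on[where D = "%u. exp (x * u ^ 2) / u ^ 4"],
   rule has_field_derivative_at_within, rule K4_deriv[OF assms]) simp

lemma root_nonzero:
 assumes "root_family \<gamma> T w" "\<gamma> ` T \<subseteq> sing_compl" "chi12 n ~= 0" "t \<in> T"
 shows "w n t ~= 0"
proof
 assume "w n t = 0"
 hence "cloc n = \<gamma> t" using root_familyD(3)[OF assms(1,3,4)] by simp
 moreover have "\<gamma> t \<in> sing_compl" using assms(2,4) by blast
 ultimately show False using sing_compl_not_loc[OF _ assms(3)] by metis
qed

lemma root_term_continuous:
 assumes "x ~= 0" "root_family \<gamma> T w" "\<gamma> ` T \<subseteq> sing_compl" "chi12 n ~= 0"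
 shows "continuous_on T (%s. J_prim x (loc n) (w n s))"
proof -
 have "continuous_on T (%s. K4 x (w n s))"
  by (rule continuous_on_compose2[OF continuous_on_K4[OF assms(1)] root_familyD(1)[OF assms(2,4) order_refl]])
    (use root_nonzero[OF assms(2-4)] in auto)
 thus ?thesis unfolding J_prim_def by (intro continuous_intros)
qed

lemma root_term_deriv:
 assumes T: "convex T" and \<gamma>: "continuous_on T \<gamma>" "\<gamma> ` T \<subseteq> sing_compl"
  and w: "root_family \<gamma> T w" and t: "t \<in> interior T" and n: "chi12 n ~= 0" and x: "x ~= 0"
  and d: "(\<gamma> has_vector_derivative d) (at t)"
 shows "((%s. J_prim x (loc n) (w n s)) has_vector_derivative (d * (exp (- (x * \<gamma> t)) / w n t ^ 5))) (at t)"
proof -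
 have tT: "t \<in> T" using t interior_subset by blast
 have gt: "\<gamma> t \<in> sing_compl" using tT \<gamma>(2) by blast
 obtain \<kappa> where \<kappa>: "away \<kappa> (\<gamma> t)" using gt away_exists by blast
 have ne: "cloc n ~= \<gamma> t" by (rule sing_compl_not_loc[OF gt n])
 define B where "B z = J_prim x (loc n) (branch_root n (w n t) (\<gamma> t) z)" for z
 have "(B has_field_derivative exp (- (x * \<gamma> t)) / branch_root n (w n t) (\<gamma> t) (\<gamma> t) ^ 5) (at (\<gamma> t))"
  unfolding B_def by (rule J_prim_branch_deriv[OF x]) (use ne root_familyD(3)[OF w n tT] in auto)
 hence "(B has_field_derivative exp (- (x * \<gamma> t)) / w n t ^ 5) (at (\<gamma> t))"
  by (simp add: branch_root_self[OF ne])
 from field_vector_diff_chain_at[OF d this]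
 have 1: "(B \<circ> \<gamma> has_vector_derivative d * (exp (- (x * \<gamma> t)) / w n t ^ 5)) (at t)" .
 have "at t within T = at t" using t by (rule at_within_interior)
 with root_family_local[OF T \<gamma> w tT \<kappa>]
 have "\<forall>\<^sub>F s in at t. s \<in> T \<and> \<gamma> s \<in> ball (\<gamma> t) (\<kappa> / 2) \<and>
      (\<forall>n. chi12 n ~= 0 \<longrightarrow> w n s = branch_root n (w n t) (\<gamma> t) (\<gamma> s))" by simp
 hence 2: "\<forall>\<^sub>F s in at t. (B \<circ> \<gamma>) s = J_prim x (loc n) (w n s)"
  by eventually_elim (use n in \<open>simp add: B_def\<close>)
 have 3: "(B \<circ> \<gamma>) t = J_prim x (loc n) (w n t)" by (simp add: B_def branch_root_self[OF ne])
 show ?thesis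
  using has_derivative_transform_eventually[OF 1[unfolded has_vector_derivative_def] 2 3]
  by (simp add: has_vector_derivative_def)
qed

text \<open>A path on which all terms can be integrated and summed at once: uniformly away from the
singularities, of linear growth, with bounded speed off the locally finite set \<open>S\<close>, and with exponential decay.\<close>

definition good_path :: "complex => (real => complex) => real => real => real set => bool" where
 "good_path x \<gamma> \<kappa> a S \<longleftrightarrow> continuous_on {0..} \<gamma> \<and> \<gamma> 0 = 0 \<and> a > 0 \<and> (\<forall>t\<ge>0. away \<kappa> (\<gamma> t)) \<and>
   (\<exists>A. \<forall>t\<ge>0. norm (\<gamma> t) \<le> A * (1 + t)) \<and> (\<forall>b. finite (S \<inter> {0..b})) \<and>
   (\<exists>M. \<forall>t>0. t \<notin> S \<longrightarrow> (\<gamma> has_vector_derivative vector_derivative \<gamma> (at t)) (at t) \<and>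
     norm (vector_derivative \<gamma> (at t)) \<le> M) \<and>
   (\<exists>A. \<forall>t\<ge>0. norm (exp (- (x * \<gamma> t))) \<le> A * exp (- a * t))"

lemma away_sing_compl: "away \<kappa> z ==> z \<in> sing_compl"
 unfolding sing_set_eq by (auto dest!: away_not_eq)

lemma good_path_sing_compl: "good_path x \<gamma> \<kappa> a S ==> \<gamma> ` {0..} \<subseteq> sing_compl"
proof
 fix z assume "good_path x \<gamma> \<kappa> a S" "z \<in> \<gamma> ` {0..}"
 then obtain t where "t \<ge> 0" "z = \<gamma> t" by auto
 moreover have "\<forall>t\<ge>0. away \<kappa> (\<gamma> t)" using \<open>good_path x \<gamma> \<kappa> a S\<close> unfolding good_path_def by (elim conjE)
 ultimately show "z \<in> sing_compl" using away_sing_compl by metis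
qed

text \<open>The powers of \<open>t\<close> that come from \<open>root_bound\<close> are absorbed by half of the exponential decay.\<close>

lemma good_path_bound:
 assumes gp: "good_path x \<gamma> \<kappa> a S" and w: "root_family \<gamma> {0..} w"
 obtains B where "B \<ge> 0" "\<And>n t. chi12 n ~= 0 ==> t > 0 ==> t \<notin> S ==>
   norm (vector_derivative \<gamma> (at t) * (exp (- (x * \<gamma> t)) / w n t ^ 5)) \<le> 1 / real n ^ 5 * (B * exp (- (a / 2) * t))"
proof -
 from gp have a: "a > 0" and aw: "\<And>t. t \<ge> 0 ==> away \<kappa> (\<gamma> t)" unfolding good_path_def by blast+
 from gp obtain A where A: "\<And>t. t \<ge> 0 ==> norm (\<gamma> t) \<le> A * (1 + t)" unfolding good_path_def by blast
 from gp obtain M where M: "\<And>t. t > 0 ==> t \<notin> S ==> norm (vector_derivative \<gamma> (at t)) \<le> M"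
  unfolding good_path_def by blast
 from gp obtain A' where A': "\<And>t. t \<ge> 0 ==> norm (exp (- (x * \<gamma> t))) \<le> A' * exp (- a * t)"
  unfolding good_path_def by blast
 have A0: "A \<ge> 0" using order_trans[OF norm_ge_zero A[of 0]] by simp
 have A'0: "A' \<ge> 0" using order_trans[OF norm_ge_zero A'[of 0]] by simp
 define M' where "M' = max M 0"
 have k0: "\<kappa> > 0" using aw[of 0] by (simp add: away_def)
 define Q where "Q = (1 + A / \<kappa>) ^ 5 * (1 + 5 / (a / 2)) ^ 5"
 have Q0: "Q \<ge> 0" using A0 k0 a by (simp add: Q_def)
 show ?thesis
 proof (rule that[of "M' * (A' * Q)"])
  show "M' * (A' * Q) \<ge> 0" using A'0 Q0 by (simp add: M'_def)
  fix n t assume n: "chi12 n ~= 0" and t: "t > 0" "t \<notin> S"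
  have t0: "t \<ge> 0" "t \<in> {0..}" using t by auto
  have R: "1 / norm (w n t) ^ 5 \<le> away_const \<kappa> (A * (1 + t)) / real n ^ 5"
   by (rule root_bound[OF aw[OF t0(1)] A[OF t0(1)] n root_familyD(3)[OF w n t0(2)]])
  have ac: "away_const \<kappa> (A * (1 + t)) \<le> Q * exp (a / 2 * t)"
  proof -
   define y where "y = 1 + A * (1 + t) / \<kappa>"
   have y1: "y \<ge> 1" using A0 k0 t0 by (simp add: y_def)
   have "sqrt y \<le> sqrt (y * y)" using y1 by (intro real_sqrt_le_mono) simp
   hence "sqrt y \<le> y" using y1 by simp
   also have "y \<le> (1 + A / \<kappa>) * (1 + t)" using t0 by (simp add: y_def algebra_simps)
   finally have "sqrt y ^ 5 \<le> ((1 + A / \<kappa>) * (1 + t)) ^ 5" using y1 by (intro power_mono) simp_all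
   also have "\<dots> = (1 + A / \<kappa>) ^ 5 * (1 + t) ^ 5" by (rule power_mult_distrib)
   also have "\<dots> \<le> (1 + A / \<kappa>) ^ 5 * ((1 + 5 / (a / 2)) ^ 5 * exp (a / 2 * t))"
    using A0 k0 a t0 by (intro mult_left_mono poly_exp_bound) simp_all
   finally show ?thesis by (simp add: away_const_def y_def Q_def mult.assoc)
  qed
  have "norm (vector_derivative \<gamma> (at t) * (exp (- (x * \<gamma> t)) / w n t ^ 5)) =
   norm (vector_derivative \<gamma> (at t)) * (norm (exp (- (x * \<gamma> t))) * (1 / norm (w n t) ^ 5))"
   by (simp add: norm_mult norm_divide norm_power)
  also have "\<dots> \<le> M' * ((A' * exp (- a * t)) * ((Q * exp (a / 2 * t)) / real n ^ 5))"
  proof (intro mult_mono)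
   show "norm (vector_derivative \<gamma> (at t)) \<le> M'" using M[OF t] by (simp add: M'_def)
   show "norm (exp (- (x * \<gamma> t))) \<le> A' * exp (- a * t)" by (rule A'[OF t0(1)])
   have "away_const \<kappa> (A * (1 + t)) / real n ^ 5 \<le> (Q * exp (a / 2 * t)) / real n ^ 5"
    by (intro divide_right_mono ac) simp
   thus "1 / norm (w n t) ^ 5 \<le> (Q * exp (a / 2 * t)) / real n ^ 5" using R by linarith
  qed (use A'0 in \<open>simp_all add: M'_def\<close>)
  also have "\<dots> = 1 / real n ^ 5 * (M' * (A' * Q) * (exp (- a * t) * exp (a / 2 * t)))" by simp
  also have "exp (- a * t) * exp (a / 2 * t) = exp (- (a / 2) * t)"
   unfolding exp_add[symmetric] by (simp add: field_simps)
  finally show "norm (vector_derivative \<gamma> (at t) * (exp (- (x * \<gamma> t)) / w n t ^ 5))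
    \<le> 1 / real n ^ 5 * (M' * (A' * Q) * exp (- (a / 2) * t))" .
 qed
qed

definition lat_term :: "complex => real => complex => complex" where
 "lat_term x N Kinf = 2 * exp (- (x * of_real N)) * (K4 x (of_real (sqrt N)) - Kinf)"

lemma laplace_term_integral:
 assumes gp: "good_path x \<gamma> \<kappa> a S" and w: "root_family \<gamma> {0..} w" and x: "x ~= 0" and n: "chi12 n ~= 0"
  and b: "filterlim b at_top sequentially" and K: "(%k. K4 x (w n (b k))) \<longlonglongrightarrow> Kinf"
 shows "((%t. vector_derivative \<gamma> (at t) * (exp (- (x * \<gamma> t)) / w n t ^ 5)) has_integral lat_term x (loc n) Kinf) {0..}"
proof -
 obtain B where B: "B \<ge> 0" "\<And>n t. chi12 n ~= 0 ==> t > 0 ==> t \<notin> S ==>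
   norm (vector_derivative \<gamma> (at t) * (exp (- (x * \<gamma> t)) / w n t ^ 5)) \<le> 1 / real n ^ 5 * (B * exp (- (a / 2) * t))"
  using good_path_bound[OF gp w] by blast
 from gp have gc: "continuous_on {0..} \<gamma>" and a: "a > 0" and S: "\<And>b. finite (S \<inter> {0..b})"
  and d: "\<And>t. t > 0 ==> t \<notin> S ==> (\<gamma> has_vector_derivative vector_derivative \<gamma> (at t)) (at t)"
  unfolding good_path_def by blast+
 note sc = good_path_sing_compl[OF gp]
 define F where "F t = J_prim x (loc n) (w n t)" for t
 have "((%t. vector_derivative \<gamma> (at t) * (exp (- (x * \<gamma> t)) / w n t ^ 5)) has_integral lat_term x (loc n) Kinf - F 0) {0..}"
 proof (rule improper_FTC[OF S])
  show "(F has_vector_derivative vector_derivative \<gamma> (at t) * (exp (- (x * \<gamma> t)) / w n t ^ 5)) (at t)"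
   if "t > 0" "t \<notin> S" for t
   unfolding F_def
   by (rule root_term_deriv[OF _ gc sc w _ n x d[OF that]]) (use that in \<open>simp_all add: interior_real_atLeast\<close>)
  show "continuous_on {0..} F" unfolding F_def by (rule root_term_continuous[OF x w sc n])
  show "(%t. (1 / real n ^ 5 * B) * exp (- (a / 2) * t)) integrable_on {0..}"
   using a by (intro integrable_exp_decay) simp
  show "0 \<le> 1 / real n ^ 5 * B * exp (- (a / 2) * t)" for t using B(1) by simp
  show "norm (vector_derivative \<gamma> (at t) * (exp (- (x * \<gamma> t)) / w n t ^ 5)) \<le> 1 / real n ^ 5 * B * exp (- (a / 2) * t)"
   if "t > 0" "t \<notin> S" for t using B(2)[OF n that] by simp
  show "(%k. F (b k)) \<longlonglongrightarrow> lat_term x (loc n) Kinf"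
   unfolding F_def J_prim_def lat_term_def by (intro tendsto_intros K)
 qed (rule b)
 moreover have "F 0 = 0" unfolding F_def root_familyD(2)[OF w n] by (rule J_prim_0)
 ultimately show ?thesis by simp
qed

lemma summable_inverse_5: "summable (%n. K * (real n / real n ^ 5))"
 by (intro summable_mult summable_n_over_n5)

lemma negligible_locally_finite:
 fixes S :: "real set"
 assumes S: "\<And>b. finite (S \<inter> {0..b})"
 shows "negligible (insert 0 (S \<inter> {0..}))"
proof -
 have "negligible (\<Union>k::nat. insert 0 (S \<inter> {0..real k}))"
  by (intro negligible_Union_nat negligible_finite) (simp add: S)
 thus ?thesis
 proof (rule negligible_subset)
  show "insert 0 (S \<inter> {0..}) \<subseteq> (\<Union>k::nat. insert 0 (S \<inter> {0..real k}))"
  proof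
   fix t assume t: "t \<in> insert 0 (S \<inter> {0..})"
   obtain k :: nat where "t \<le> real k" using real_arch_simple by blast
   thus "t \<in> (\<Union>k::nat. insert 0 (S \<inter> {0..real k}))" using t by auto
  qed
 qed
qed

abbreviation laplace_integrand ::
 "(real => complex => complex) => (real => complex) => complex => real set => real => complex" where
 "laplace_integrand g \<gamma> x T \<equiv> %t. exp (- (x * \<gamma> t)) * g t (\<gamma> t) * vector_derivative \<gamma> (at t within T)"

text \<open>The value of the transform depends on the path only through the common limit \<open>Kinf\<close> of the
primitives at infinity.\<close>

lemma laplace_sum:
 assumes gp: "good_path x \<gamma> \<kappa> a S" and w: "root_family \<gamma> {0..} w" and x: "x ~= 0" and c: "coeff_ok c K"
  and b: "\<And>n. filterlim (b n) at_top sequentially"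
  and K: "\<And>n. chi12 n ~= 0 ==> (%k. K4 x (w n (b n k))) \<longlonglongrightarrow> Kinf"
  and h: "germ_eq h c"
 shows "has_laplace_along h \<gamma> x (\<Sum>n. c n * lat_term x (loc n) Kinf)"
  and "summable (%n. c n * lat_term x (loc n) Kinf)"
proof -
 obtain B where B: "B \<ge> 0" "\<And>n t. chi12 n ~= 0 ==> t > 0 ==> t \<notin> S ==>
   norm (vector_derivative \<gamma> (at t) * (exp (- (x * \<gamma> t)) / w n t ^ 5)) \<le> 1 / real n ^ 5 * (B * exp (- (a / 2) * t))"
  using good_path_bound[OF gp w] by blast
 from gp have gc: "continuous_on {0..} \<gamma>" and g0: "\<gamma> 0 = 0" and a: "a > 0" and S: "\<And>b. finite (S \<inter> {0..b})"
  and aw: "\<And>t. t \<ge> 0 ==> away \<kappa> (\<gamma> t)"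
  unfolding good_path_def by blast+
 note sc = good_path_sing_compl[OF gp]
 have cz: "c n = 0" if "chi12 n = 0" for n using c that by (simp add: coeff_ok_def)
 have cb: "norm (c n) \<le> K * real n" for n using c unfolding coeff_ok_def by blast
 have K0: "K \<ge> 0" using order_trans[OF norm_ge_zero cb[of 1]] by simp
 define u where "u n t = c n * (vector_derivative \<gamma> (at t) * (exp (- (x * \<gamma> t)) / w n t ^ 5))" for n t
 have u_int: "(u n has_integral c n * lat_term x (loc n) Kinf) {0..}" for n
 proof (cases "chi12 n = 0")
  case True
  have "u n = (%t. 0)" by (simp add: u_def cz[OF True] fun_eq_iff)
  thus ?thesis by (simp add: cz[OF True])
 next
  case False
  show ?thesis unfolding u_def
   by (rule has_integral_mult_right[OF laplace_term_integral[OF gp w x False b K[OF False]]])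
 qed
 note neg = negligible_locally_finite[OF S]
 have le: "norm (u n t) \<le> K * (real n / real n ^ 5) * (B * exp (- (a / 2) * t))"
  if "t \<ge> 0" "t \<notin> insert 0 (S \<inter> {0..})" for n t
 proof (cases "chi12 n = 0")
  case True
  thus ?thesis using K0 B(1) by (simp add: u_def cz)
 next
  case False
  have t: "t > 0" "t \<notin> S" using that by auto
  have "norm (u n t) \<le> (K * real n) * (1 / real n ^ 5 * (B * exp (- (a / 2) * t)))"
   unfolding u_def norm_mult[of "c n"] by (intro mult_mono cb B(2)[OF False t]) (use K0 in simp_all)
  thus ?thesis by simp
 qed
 have hint: "(%t. B * exp (- (a / 2) * t)) integrable_on {0..}" using a by (intro integrable_exp_decay) simp
 have hp: "0 \<le> B * exp (- (a / 2) * t)" for t using B(1) by simp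
 have ap: "0 \<le> K * (real n / real n ^ 5)" for n using K0 by simp
 note S3 = series_integral(2,3)[OF neg u_int le summable_inverse_5 hint hp ap]
 show "summable (%n. c n * lat_term x (loc n) Kinf)" by (rule S3(1))
 define g where "g t = branch_sum c (%n. w n t) (\<gamma> t)" for t
 have g: "continuation_along h \<gamma> {0..} g"
  unfolding g_def by (rule canonical_continuation[OF _ _ gc sc g0 w c h]) simp_all
 have gval: "g t (\<gamma> t) = (\<Sum>n. c n / w n t ^ 5)" and gsum: "summable (%n. c n / w n t ^ 5)" if "t \<ge> 0" for t
 proof -
  have t: "t \<in> {0..}" using that by simp
  show "g t (\<gamma> t) = (\<Sum>n. c n / w n t ^ 5)" unfolding g_def by (rule branch_sum_self[OF c aw[OF that]])
  show "summable (%n. c n / w n t ^ 5)"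
   by (rule branch_sum_summable[OF c aw[OF that] root_family_roots_at[OF w t]])
 qed
 have "((laplace_integrand g \<gamma> x {0..}) has_integral
    (\<Sum>n. c n * lat_term x (loc n) Kinf)) {0..}"
 proof (rule has_integral_spike[OF neg _ S3(2)])
  fix t assume "t \<in> {0..} - insert 0 (S \<inter> {0..})"
  hence t: "t > 0" "t \<ge> 0" by auto
  have "at t within {0..} = at t" using t by (intro at_within_interior) (simp add: interior_real_atLeast)
  moreover have "(\<Sum>n. u n t) = vector_derivative \<gamma> (at t) * exp (- (x * \<gamma> t)) * (\<Sum>n. c n / w n t ^ 5)"
   by (subst suminf_mult[OF gsum[OF t(2)], symmetric]) (simp add: u_def mult_ac)
  ultimately show "exp (- (x * \<gamma> t)) * g t (\<gamma> t) * vector_derivative \<gamma> (at t within {0..}) = (\<Sum>n. u n t)"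
   by (simp add: gval[OF t(2)] mult_ac)
 qed
 thus "has_laplace_along h \<gamma> x (\<Sum>n. c n * lat_term x (loc n) Kinf)"
  unfolding has_laplace_along_def using g by blast
qed

lemma has_laplace_along_unique:
 assumes "has_laplace_along h \<gamma> x L" "has_laplace_along h \<gamma> x L'" "continuous_on {0..} \<gamma>"
 shows "L = L'"
proof -
 obtain g where g: "continuation_along h \<gamma> {0..} g"
   "((laplace_integrand g \<gamma> x {0..}) has_integral L) {0..}"
  using assms(1) unfolding has_laplace_along_def by blast
 obtain g' where g': "continuation_along h \<gamma> {0..} g'"
   "((laplace_integrand g' \<gamma> x {0..}) has_integral L') {0..}"
  using assms(2) unfolding has_laplace_along_def by blast
 have "g t (\<gamma> t) = g' t (\<gamma> t)" if "t \<in> {0..}" for t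
  using eventually_nhds_x_imp_x[OF continuation_unique[OF _ _ assms(3) g(1) g'(1) that]] by simp
 hence "((laplace_integrand g \<gamma> x {0..}) has_integral L') {0..}"
  by (intro has_integral_eq[OF _ g'(2)]) simp
 with g(2) show ?thesis by (rule has_integral_unique)
qed

section \<open>Rays\<close>

lemma csqrt_scale:
 assumes "t > 0" shows "csqrt (of_real t * z) = of_real (sqrt t) * csqrt z"
proof (rule csqrt_unique)
 have "of_real (sqrt t) ^ 2 = complex_of_real t" using assms by (simp flip: of_real_power)
 thus "(of_real (sqrt t) * csqrt z) ^ 2 = of_real t * z" by (simp add: power_mult_distrib)
 have "0 < Re (csqrt z) \<or> Re (csqrt z) = 0 \<and> 0 \<le> Im (csqrt z)" by (rule csqrt_principal)
 thus "0 < Re (of_real (sqrt t) * csqrt z) \<or> Re (of_real (sqrt t) * csqrt z) = 0 \<and> 0 \<le> Im (of_real (sqrt t) * csqrt z)"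
  using assms by auto
qed

lemma cos_less_one:
 assumes "\<theta> ~= 0" "\<bar>\<theta>\<bar> < 2 * pi" shows "cos \<theta> < 1"
proof (rule ccontr)
 assume "\<not> cos \<theta> < 1"
 hence "cos \<theta> = 1" using cos_le_one[of \<theta>] by linarith
 then obtain n :: int where n: "\<theta> = n * 2 * pi" by (auto simp: cos_one_2pi_int)
 have "\<bar>real_of_int n\<bar> * (2 * pi) < 1 * (2 * pi)" using assms(2) unfolding n by (simp add: abs_mult)
 hence "\<bar>real_of_int n\<bar> < 1" by (simp only: mult_less_cancel_right) simp
 hence "n = 0" by linarith
 thus False using n assms(1) by simp
qed

lemma ray_dist:
 assumes "N \<ge> 0" "t \<ge> 0"
 shows "N * sqrt (1 - max (cos \<theta>) 0) \<le> norm (of_real N - of_real t * cis \<theta>)"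
proof -
 define m where "m = max (cos \<theta>) 0"
 have m: "0 \<le> m" "m \<le> 1" "cos \<theta> \<le> m" by (auto simp: m_def)
 have "norm (of_real N - of_real t * cis \<theta>) ^ 2 = (N - t * cos \<theta>) ^ 2 + (t * sin \<theta>) ^ 2"
  by (simp add: cmod_power2)
 also have "\<dots> = N ^ 2 - 2 * N * t * cos \<theta> + t ^ 2 * ((cos \<theta>) ^ 2 + (sin \<theta>) ^ 2)"
 proof -
  have "(N - t * C) ^ 2 + (t * S) ^ 2 = N ^ 2 - 2 * N * t * C + t ^ 2 * (C ^ 2 + S ^ 2)" for C S :: real
   by (simp add: power2_eq_square algebra_simps)
  thus ?thesis .
 qed
 also have "\<dots> = N ^ 2 + t ^ 2 - 2 * N * t * cos \<theta>" by simp
 finally have eq: "norm (of_real N - of_real t * cis \<theta>) ^ 2 = N ^ 2 + t ^ 2 - 2 * N * t * cos \<theta>" .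
 have "2 * N * t * cos \<theta> \<le> 2 * N * t * m" using assms m by (intro mult_left_mono) auto
 moreover have "m * (2 * N * t) \<le> m * (N ^ 2 + t ^ 2)"
  using m sum_squares_bound[of N t] by (intro mult_left_mono) auto
 moreover have "0 \<le> (1 - m) * t ^ 2" using m by simp
 ultimately have "N ^ 2 * (1 - m) \<le> norm (of_real N - of_real t * cis \<theta>) ^ 2"
  unfolding eq by (simp add: algebra_simps)
 moreover have "(N * sqrt (1 - m)) ^ 2 = N ^ 2 * (1 - m)" using m by (simp add: power_mult_distrib)
 ultimately have "(N * sqrt (1 - m)) ^ 2 \<le> norm (of_real N - of_real t * cis \<theta>) ^ 2" by simp
 thus ?thesis unfolding m_def by (rule power2_le_imp_le) simp
qed

lemma ray_notin_nonpos:
 assumes "N > 0" "t \<ge> 0" "cos \<theta> < 1"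
 shows "of_real N - of_real t * cis \<theta> \<notin> \<real>\<^sub>\<le>\<^sub>0"
proof
 assume "of_real N - of_real t * cis \<theta> \<in> \<real>\<^sub>\<le>\<^sub>0"
 hence *: "N - t * cos \<theta> \<le> 0" "t * sin \<theta> = 0" by (auto simp: complex_nonpos_Reals_iff)
 hence "t ~= 0" using assms(1) by auto
 hence "sin \<theta> = 0" using *(2) by simp
 hence "(cos \<theta>) ^ 2 = 1" using sin_cos_squared_add[of \<theta>] by simp
 hence "cos \<theta> = 1 \<or> cos \<theta> = -1" by (simp add: power2_eq_1_iff)
 hence "cos \<theta> = -1" using assms(3) by simp
 hence "N + t \<le> 0" using *(1) by simp
 thus False using assms by simp
qed

lemma csqrt_neg_cis:
 assumes "\<sigma> \<in> {1, -1 :: real}" "0 < \<sigma> * \<theta>" "\<sigma> * \<theta> < 2 * pi"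
 shows "csqrt (- cis \<theta>) = cis ((\<theta> - \<sigma> * pi) / 2)"
proof (rule csqrt_unique)
 have "cis ((\<theta> - \<sigma> * pi) / 2) ^ 2 = cis (\<theta> - \<sigma> * pi)"
  by (simp add: Complex.DeMoivre diff_divide_distrib)
 also have "\<dots> = - cis \<theta>" using assms(1) by (auto simp: complex_eq_iff cos_diff sin_diff cos_add sin_add)
 finally show "cis ((\<theta> - \<sigma> * pi) / 2) ^ 2 = - cis \<theta>" .
 have "cos ((\<theta> - \<sigma> * pi) / 2) > 0" using assms by (intro cos_gt_zero_pi) auto
 thus "0 < Re (cis ((\<theta> - \<sigma> * pi) / 2)) \<or> Re (cis ((\<theta> - \<sigma> * pi) / 2)) = 0 \<and> 0 \<le> Im (cis ((\<theta> - \<sigma> * pi) / 2))"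
  by simp
qed

text \<open>The root of \<open>- x\<close> that belongs to the contours on the side \<open>\<sigma>\<close>; the argument \<open>\<phi>\<close> is not reduced.\<close>

definition lat_root :: "real => real => real => complex" where
 "lat_root \<sigma> r \<phi> = of_real (sqrt r) * cis ((\<phi> + \<sigma> * pi) / 2)"

lemma lat_root_sq:
 assumes "\<sigma> \<in> {1, -1 :: real}" "r > 0"
 shows "lat_root \<sigma> r \<phi> ^ 2 = - rcis r \<phi>"
proof -
 have "lat_root \<sigma> r \<phi> ^ 2 = of_real (sqrt r ^ 2) * cis (\<phi> + \<sigma> * pi)"
  unfolding lat_root_def power_mult_distrib by (simp add: Complex.DeMoivre add_divide_distrib)
 also have "cis (\<phi> + \<sigma> * pi) = - cis \<phi>" using assms(1) by (auto simp: complex_eq_iff cos_diff sin_diff cos_add sin_add)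
 finally show ?thesis using assms(2) by (simp add: rcis_def)
qed

definition lat_limit :: "real => real => real => complex" where
 "lat_limit \<sigma> r \<phi> = 2 * rcis r \<phi> ^ 2 / 3 * of_real (sqrt pi) / lat_root \<sigma> r \<phi>"

lemma cis_sector:
 assumes "\<bar>\<alpha>\<bar> < pi / 2" "r > 0"
 shows "\<bar>Im (of_real r * cis (\<alpha> / 2))\<bar> < Re (of_real r * cis (\<alpha> / 2))"
proof -
 have "cos \<alpha> > 0" using assms by (intro cos_gt_zero_pi) auto
 hence "(sin (\<alpha> / 2)) ^ 2 < (cos (\<alpha> / 2)) ^ 2" using cos_double[of "\<alpha> / 2"] by simp
 moreover have "cos (\<alpha> / 2) > 0" using assms by (intro cos_gt_zero_pi) auto
 ultimately have "\<bar>sin (\<alpha> / 2)\<bar> < cos (\<alpha> / 2)"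
  by (metis abs_of_pos power2_less_imp_less less_imp_le power2_abs)
 thus ?thesis using assms(2) by (simp add: abs_mult)
qed

lemma csqrt_ray_limit:
 assumes \<sigma>: "\<sigma> \<in> {1, -1 :: real}" "0 < \<sigma> * \<theta>" "\<sigma> * \<theta> < 2 * pi"
 shows "(%k. csqrt (of_real (N / real (Suc k)) - cis \<theta>)) \<longlonglongrightarrow> cis ((\<theta> - \<sigma> * pi) / 2)"
proof -
 have "cos \<theta> < 1" using \<sigma> by (intro cos_less_one) auto
 hence nn: "- cis \<theta> \<notin> \<real>\<^sub>\<le>\<^sub>0"
 proof -
  have False if h: "cos \<theta> \<ge> 0" "sin \<theta> = 0"
  proof -
   have "(cos \<theta>) ^ 2 = 1" using sin_cos_squared_add[of \<theta>] h by simp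
   hence "cos \<theta> = 1 \<or> cos \<theta> = -1" by (simp add: power2_eq_1_iff)
   thus False using h \<open>cos \<theta> < 1\<close> by simp
  qed
  thus ?thesis by (auto simp: complex_nonpos_Reals_iff)
 qed
 have "(%k. N / real (Suc k)) \<longlonglongrightarrow> 0" by (rule LIMSEQ_Suc[OF lim_const_over_n])
 hence "(%k. of_real (N / real (Suc k)) - cis \<theta>) \<longlonglongrightarrow> of_real 0 - cis \<theta>"
  by (intro tendsto_intros)
 hence "(%k. csqrt (of_real (N / real (Suc k)) - cis \<theta>)) \<longlonglongrightarrow> csqrt (- cis \<theta>)"
  by (intro isCont_tendsto_compose[OF continuous_at_csqrt[OF nn]]) simp
 thus ?thesis unfolding csqrt_neg_cis[OF \<sigma>] .
qed

lemma filterlim_sqrt_Suc: "filterlim (%k. sqrt (real (Suc k))) at_top sequentially"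
 by (rule filterlim_compose[OF sqrt_at_top])
   (simp add: filterlim_compose[OF filterlim_real_sequentially filterlim_Suc] del: of_nat_Suc)

lemma ray_root_family:
 assumes "cos \<theta> < 1"
 shows "root_family (ray \<theta>) {0..} (%n t. csqrt (cloc n - ray \<theta> t))"
 unfolding root_family_def
proof (intro allI impI conjI ballI)
 fix n assume n: "chi12 n ~= 0"
 have l: "loc n > 0" using chi12_imp_pos[OF n] by (rule loc_pos)
 show "continuous_on {0..} (%t. csqrt (cloc n - ray \<theta> t))"
 proof (rule continuous_on_csqrt_compose)
  show "continuous_on {0..} (%t. cloc n - ray \<theta> t)" unfolding ray_def by (intro continuous_intros)
  show "cloc n - ray \<theta> t \<notin> \<real>\<^sub>\<le>\<^sub>0" if "t \<in> {0..}" for t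
   unfolding ray_def using that by (intro ray_notin_nonpos l assms) simp
 qed
 show "csqrt (cloc n - ray \<theta> 0) = of_real (sqrt (loc n))" using l by (simp add: ray_def)
qed simp

lemma good_path_ray:
 assumes r: "r > 0" and \<theta>: "cos \<theta> < 1" and \<phi>: "\<bar>\<phi> + \<theta>\<bar> < pi / 2"
 shows "good_path (rcis r \<phi>) (ray \<theta>) (sqrt (1 - max (cos \<theta>) 0)) (r * cos (\<phi> + \<theta>)) {}"
 unfolding good_path_def
proof (intro conjI allI impI)
 have vd: "(ray \<theta> has_vector_derivative cis \<theta>) (at t)" for t
  unfolding ray_def[abs_def] by (auto intro!: derivative_eq_intros)
 show "continuous_on {0..} (ray \<theta>)" unfolding ray_def[abs_def] by (intro continuous_intros)
 show "ray \<theta> 0 = 0" by (simp add: ray_def)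
 have "cos (\<phi> + \<theta>) > 0" using \<phi> by (intro cos_gt_zero_pi) linarith+
 thus "r * cos (\<phi> + \<theta>) > 0" using r by simp
 show "away (sqrt (1 - max (cos \<theta>) 0)) (ray \<theta> t)" if "t \<ge> 0" for t
  unfolding away_def
 proof (intro conjI allI impI)
  show k0: "0 < sqrt (1 - max (cos \<theta>) 0)" using \<theta> by simp
  fix n assume n: "chi12 n ~= 0"
  have "1 \<le> real n" using chi12_imp_pos[OF n] by simp
  hence "1 \<le> loc n" using loc_ge_real[of n] by linarith
  hence "1 * sqrt (1 - max (cos \<theta>) 0) \<le> loc n * sqrt (1 - max (cos \<theta>) 0)"
   using k0 by (intro mult_right_mono) simp_all
  also have "\<dots> \<le> norm (cloc n - ray \<theta> t)"
   unfolding ray_def using that by (intro ray_dist) (simp_all add: loc_def)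
  finally show "sqrt (1 - max (cos \<theta>) 0) \<le> norm (cloc n - ray \<theta> t)" by simp
 qed
 show "\<exists>A. \<forall>t\<ge>0. norm (ray \<theta> t) \<le> A * (1 + t)"
  by (rule exI[of _ 1]) (simp add: ray_def norm_mult)
 show "\<exists>M. \<forall>t>0. t \<notin> {} \<longrightarrow> (ray \<theta> has_vector_derivative vector_derivative (ray \<theta>) (at t)) (at t) \<and>
     norm (vector_derivative (ray \<theta>) (at t)) \<le> M"
  using vd vector_derivative_at[OF vd] by (intro exI[of _ 1]) simp
 have "norm (exp (- (rcis r \<phi> * ray \<theta> t))) = exp (- (r * cos (\<phi> + \<theta>)) * t)" for t
  by (simp add: norm_exp_eq_Re ray_def rcis_def cos_add algebra_simps)
 thus "\<exists>A. \<forall>t\<ge>0. norm (exp (- (rcis r \<phi> * ray \<theta> t))) \<le> A * exp (- (r * cos (\<phi> + \<theta>)) * t)"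
  by (intro exI[of _ 1]) simp
qed simp

lemma rcis_nonzero: "r > 0 ==> rcis r \<phi> ~= 0" by (simp add: rcis_def)

text \<open>On a ray all roots are asymptotic to the same function of the parameter, hence the limit does
not depend on \<open>n\<close> nor on the direction.\<close>

lemma lateral_ray:
 assumes r: "r > 0" and \<sigma>: "\<sigma> \<in> {1, -1 :: real}" "0 < \<sigma> * \<theta>" "\<sigma> * \<theta> < 2 * pi" and \<phi>: "\<bar>\<phi> + \<theta>\<bar> < pi / 2"
  and c: "coeff_ok c K" and h: "germ_eq h c"
 shows "has_laplace_along h (ray \<theta>) (rcis r \<phi>) (\<Sum>n. c n * lat_term (rcis r \<phi>) (loc n) (lat_limit \<sigma> r \<phi>))"
  and "summable (%n. c n * lat_term (rcis r \<phi>) (loc n) (lat_limit \<sigma> r \<phi>))"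
proof -
 have \<theta>: "cos \<theta> < 1" using \<sigma> by (intro cos_less_one) auto
 define s where "s = lat_root \<sigma> r \<phi>"
 have s2: "s ^ 2 = - rcis r \<phi>" unfolding s_def by (rule lat_root_sq[OF \<sigma>(1) r])
 have lim: "(%k. K4 (rcis r \<phi>) (csqrt (cloc n - ray \<theta> (real (Suc k))))) \<longlonglongrightarrow> lat_limit \<sigma> r \<phi>" for n
  unfolding lat_limit_def s_def[symmetric]
 proof (rule K_limits(1)[OF filterlim_sqrt_Suc _ _ s2 rcis_nonzero[OF r]])
  have "(%k. s * csqrt (of_real (loc n / real (Suc k)) - cis \<theta>)) \<longlonglongrightarrow> s * cis ((\<theta> - \<sigma> * pi) / 2)"
   by (intro tendsto_mult tendsto_const csqrt_ray_limit \<sigma>)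
  also have "s * cis ((\<theta> - \<sigma> * pi) / 2) = of_real (sqrt r) * cis ((\<phi> + \<theta>) / 2)"
   by (simp add: s_def lat_root_def cis_mult add_divide_distrib diff_divide_distrib)
  finally show "(%k. s * csqrt (of_real (loc n / real (Suc k)) - cis \<theta>)) \<longlonglongrightarrow> of_real (sqrt r) * cis ((\<phi> + \<theta>) / 2)" .
  show "\<bar>Im (of_real (sqrt r) * cis ((\<phi> + \<theta>) / 2))\<bar> < Re (of_real (sqrt r) * cis ((\<phi> + \<theta>) / 2))"
   using r by (intro cis_sector \<phi>) simp
  fix k
  have "cloc n - ray \<theta> (real (Suc k)) = of_real (real (Suc k)) * (of_real (loc n / real (Suc k)) - cis \<theta>)"
   by (simp add: ray_def field_simps del: of_nat_Suc)
  hence "csqrt (cloc n - ray \<theta> (real (Suc k))) = of_real (sqrt (real (Suc k))) * csqrt (of_real (loc n / real (Suc k)) - cis \<theta>)"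
   by (simp only:) (rule csqrt_scale, simp)
  thus "s * csqrt (cloc n - ray \<theta> (real (Suc k))) = of_real (sqrt (real (Suc k))) * (s * csqrt (of_real (loc n / real (Suc k)) - cis \<theta>))"
   by (simp only: mult_ac)
 qed
 have b: "filterlim (%k. real (Suc k)) at_top sequentially"
  by (rule filterlim_compose[OF filterlim_real_sequentially filterlim_Suc])
 show "has_laplace_along h (ray \<theta>) (rcis r \<phi>) (\<Sum>n. c n * lat_term (rcis r \<phi>) (loc n) (lat_limit \<sigma> r \<phi>))"
  and "summable (%n. c n * lat_term (rcis r \<phi>) (loc n) (lat_limit \<sigma> r \<phi>))"
  by (rule laplace_sum[OF good_path_ray[OF r \<theta> \<phi>] ray_root_family[OF \<theta>] rcis_nonzero[OF r] c b lim h])+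
qed

section \<open>The eta integral\<close>

lemma powr_minus_three_halves: "z ~= 0 ==> z powr (-3/2) = 1 / csqrt z ^ 3"
proof -
 assume "z ~= 0"
 have "csqrt z ^ 3 = exp (3 * (Ln z / 2))"
  using \<open>z ~= 0\<close> by (simp add: csqrt_exp_Ln flip: exp_of_nat_mult)
 moreover have "z powr (-3/2) = exp (- (3 * (Ln z / 2)))" using \<open>z ~= 0\<close> by (simp add: powr_def)
 ultimately show ?thesis by (simp only: exp_minus inverse_eq_divide)
qed

lemma exp_minus_le_powr: "y > 0 ==> exp (- y) \<le> y powr (-3/4 :: real)"
proof -
 assume y: "y > 0"
 have "y powr (3/4) \<le> exp y"
 proof (cases "y \<le> 1")
  case True
  have "y powr (3/4) \<le> 1 powr (3/4)" using True y by (intro powr_mono2) auto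
  also have "\<dots> \<le> exp y" using y by simp
  finally show ?thesis .
 next
  case False
  have "y powr (3/4) \<le> y powr 1" using False by (intro powr_mono) auto
  also have "y powr 1 = y" using y by simp
  also have "y \<le> exp y" using exp_ge_add_one_self[of y] by linarith
  finally show ?thesis .
 qed
 hence "inverse (exp y) \<le> inverse (y powr (3/4))" using y by (intro le_imp_inverse_le) auto
 thus ?thesis by (simp add: exp_minus powr_minus)
qed

definition eta_majorant :: "real => real => real" where
 "eta_majorant c t = (c / 2) powr (-3/4) * ((if t \<in> {0..1} then t powr (-3/4) else 0) + exp (- (c / 2) * t))"

lemma eta_majorant_nonneg: "eta_majorant c t \<ge> 0"
 by (simp add: eta_majorant_def)

lemma eta_majorant_integrable:
 assumes "c > 0" shows "eta_majorant c integrable_on {0..}"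
proof -
 have "((%t::real. t powr (-3/4)) has_integral (1 powr (-3/4 + 1) / (-3/4 + 1))) {0..1}"
  by (rule has_integral_powr_from_0) auto
 hence "((%t::real. if t \<in> {0..1} then t powr (-3/4) else 0) has_integral (1 powr (-3/4 + 1) / (-3/4 + 1))) {0..}"
  by (subst has_integral_restrict) auto
 from has_integral_integrable[OF this]
 have "(%t. (if t \<in> {0..1} then t powr (-3/4) else 0) + 1 * exp (- (c / 2) * t)) integrable_on {0..}"
  using assms by (intro integrable_add integrable_exp_decay) simp_all
 from integrable_on_cmult_left[OF this, of "(c / 2) powr (-3/4)"]
 show ?thesis by (simp add: eta_majorant_def[abs_def])
qed

text \<open>Near 0 the theta series is not absolutely bounded; the power -3/4 is integrable at 0 and makes the
terms summable in \<open>n\<close>.\<close>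

lemma eta_majorant_bound:
 assumes c: "c > 0" and t: "t > 0" and n: "n > 0"
 shows "exp (- (c * loc n * t)) \<le> real n powr (-3/2) * eta_majorant c t"
proof -
 define y where "y = c * real n ^ 2 * t / 2"
 have y: "y > 0" using c t n by (simp add: y_def)
 have n1: "1 \<le> real n ^ 2" using n by simp
 have "c * t * real n ^ 2 \<le> c * t * loc n" using c t by (intro mult_left_mono loc_ge_sq) simp
 moreover have "c * t * 1 \<le> c * t * real n ^ 2" using c t n1 by (intro mult_left_mono) simp_all
 ultimately have "- (c * loc n * t) \<le> - y + - (c / 2) * t"
 proof -
  have "y = (c * t * real n ^ 2) / 2" "c * loc n * t = c * t * loc n" "- (c / 2) * t = - (c * t * 1) / 2"
   by (simp_all add: y_def)
  moreover assume "c * t * real n ^ 2 \<le> c * t * loc n" "c * t * 1 \<le> c * t * real n ^ 2"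
  ultimately show ?thesis by linarith
 qed
 hence "exp (- (c * loc n * t)) \<le> exp (- y) * exp (- (c / 2) * t)" by (simp flip: exp_add)
 also have "\<dots> \<le> y powr (-3/4) * exp (- (c / 2) * t)"
  by (intro mult_right_mono exp_minus_le_powr y) simp
 also have "y powr (-3/4) = real n powr (-3/2) * ((c / 2) powr (-3/4) * t powr (-3/4))"
 proof -
  have yeq: "y = (real n ^ 2) * ((c / 2) * t)" by (simp add: y_def)
  have pm: "(v * u) powr a = v powr a * u powr a" if "v \<ge> 0" "u \<ge> 0" for u v a :: real
   using that by (simp add: powr_mult)
  have "y powr (-3/4) = (real n ^ 2) powr (-3/4) * ((c / 2) * t) powr (-3/4)"
   unfolding yeq by (rule pm) (use c t in simp_all)
  also have "((c / 2) * t) powr (-3/4) = (c / 2) powr (-3/4) * t powr (-3/4)"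
   by (rule pm) (use c t in simp_all)
  finally have "y powr (-3/4) = (real n ^ 2) powr (-3/4) * ((c / 2) powr (-3/4) * t powr (-3/4))" .
  moreover have "(real n ^ 2) powr (-3/4) = real n powr (-3/2)"
   using n by (simp flip: powr_numeral add: powr_powr)
  ultimately show ?thesis by simp
 qed
 also have "real n powr (-3/2) * ((c / 2) powr (-3/4) * t powr (-3/4)) * exp (- (c / 2) * t)
   = (real n powr (-3/2) * (c / 2) powr (-3/4)) * (t powr (-3/4) * exp (- (c / 2) * t))" by simp
 also have "\<dots> \<le> (real n powr (-3/2) * (c / 2) powr (-3/4)) * ((if t \<in> {0..1} then t powr (-3/4) else 0) + exp (- (c / 2) * t))"
 proof (intro mult_left_mono)
  show "t powr (-3/4) * exp (- (c / 2) * t) \<le> (if t \<in> {0..1} then t powr (-3/4) else 0) + exp (- (c / 2) * t)"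
  proof (cases "t \<le> 1")
   case True
   have "t powr (-3/4) * exp (- (c / 2) * t) \<le> t powr (-3/4) * 1"
    using c t by (intro mult_left_mono) auto
   moreover have "0 \<le> exp (- (c / 2) * t)" by simp
   moreover have "t \<in> {0..1}" using True t by simp
   hence "(if t \<in> {0..1} then t powr (-3/4) else 0) = t powr (-3/4)" by (rule if_P)
   ultimately show ?thesis by linarith
  next
   case False
   have "t powr (-3/4) \<le> t powr 0" using False by (intro powr_mono) auto
   hence "t powr (-3/4) * exp (- (c / 2) * t) \<le> 1 * exp (- (c / 2) * t)"
    using t by (intro mult_right_mono) auto
   thus ?thesis using False by simp
  qed
 qed simp
 finally show ?thesis by (simp add: eta_majorant_def mult_ac)
qed

definition eta_term :: "complex => real => complex => complex" where
 "eta_term x N Kinf = - 2 * x * of_real (sqrt N) * exp (- (x * of_real N)) * (Kinf - K2 x (of_real (sqrt N)))"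

text \<open>One integration by parts: the exponent -5/2 is reduced to -3/2, and the boundary term at 0 is
a multiple of \<open>1 / loc n\<close>.\<close>

lemma eta_term_lat_term:
 assumes x: "x ~= 0" and n: "n > 0"
 shows "of_real borel_const * of_nat n * lat_term x (loc n) (2 * x / 3 * Q) =
     of_real (sqrt 3) * eta_term x (loc n) Q - of_real (sqrt 3 / loc n)"
proof -
 define N where "N = loc n"
 define R where "R = complex_of_real (sqrt N)"
 have N: "N > 0" unfolding N_def by (rule loc_pos[OF n])
 have R: "R ~= 0" "R ^ 2 = of_real N" using N by (simp_all add: R_def flip: of_real_power)
 define E where "E = exp (- (x * of_real N))"
 have E: "E * exp (x * R ^ 2) = 1" unfolding E_def R exp_add[symmetric] by simp
 have cn: "borel_const * real n = 3 / 2 * sqrt 3 * sqrt N"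
 proof -
  have "sqrt N = real n * pi / sqrt 6" unfolding N_def by (rule sqrt_loc)
  moreover have "sqrt 6 = sqrt 2 * sqrt 3" by (simp flip: real_sqrt_mult)
  ultimately show ?thesis by (simp add: borel_const_def field_simps)
 qed
 have "complex_of_real (borel_const * real n) = of_real (3 / 2 * sqrt 3) * R"
  unfolding cn R_def by simp
 hence c1: "of_real borel_const * of_nat n = of_real (3 / 2 * sqrt 3) * R" by simp
 have "lat_term x N (2 * x / 3 * Q) = 2 * E * (- exp (x * R ^ 2) / (3 * R ^ 3) + 2 * x / 3 * K2 x R - 2 * x / 3 * Q)"
  unfolding lat_term_def R_def[symmetric] E_def[symmetric] K4_K2[OF R(1)] ..
 also have "\<dots> = - 2 * (E * exp (x * R ^ 2)) / (3 * R ^ 3) + 4 * x / 3 * E * (K2 x R - Q)"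
  by (simp add: algebra_simps)
 finally have L: "lat_term x N (2 * x / 3 * Q) = - 2 / (3 * R ^ 3) + 4 * x / 3 * E * (K2 x R - Q)" unfolding E by simp
 have M: "eta_term x N Q = 2 * x * R * E * (K2 x R - Q)"
  unfolding eta_term_def R_def[symmetric] E_def[symmetric] by (simp add: algebra_simps)
 have "of_real (3 / 2 * sqrt 3) * R * (- 2 / (3 * R ^ 3) + 4 * x / 3 * E * (K2 x R - Q))
   = of_real (sqrt 3) * (2 * x * R * E * (K2 x R - Q)) - of_real (sqrt 3) / R ^ 2"
  using R(1) by (simp add: field_simps power_numeral_reduce)
 thus ?thesis unfolding N_def[symmetric] c1 L M R(2) by simp
qed

text \<open>The left-hand side collects the boundary terms of the integrations by parts; by the
formula for the coefficients of the formal series it is the constant term of that series.\<close>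

lemma sum_inverse_loc: "(%n. of_real (sqrt 3) * (chi12 n / cloc n)) sums 1"
proof -
 have "(%n. of_real (sqrt 3 / 6) * (chi12 n / of_real (pole n) ^ (2 * 0 + 2))) sums (of_real (sqrt 3 / 6) * char_value 0)"
  unfolding char_value_def by (intro sums_mult summable_sums summable_char_value)
 moreover have "of_real (sqrt 3 / 6) * (chi12 n / of_real (pole n) ^ (2 * 0 + 2)) = of_real (sqrt 3) * (chi12 n / cloc n)" for n
 proof -
  have "pole n ^ 2 = loc n / 6" by (simp add: pole_def loc_def power_mult_distrib power2_eq_square)
  moreover have "2 * 0 + 2 = (2 :: nat)" by simp
  ultimately have "complex_of_real (pole n) ^ (2 * 0 + 2) = of_real (loc n / 6)"
   by (simp only: of_real_power[symmetric])
  thus ?thesis by (simp only:) simp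
 qed
 ultimately show ?thesis unfolding char_value_0 by (simp only:)
qed

definition lat_limit2 :: "real => real => real => complex" where
 "lat_limit2 \<sigma> r \<phi> = rcis r \<phi> * of_real (sqrt pi) / lat_root \<sigma> r \<phi>"

lemma lat_limit_eq: "lat_limit \<sigma> r \<phi> = 2 * rcis r \<phi> / 3 * lat_limit2 \<sigma> r \<phi>"
 by (simp add: lat_limit_def lat_limit2_def power2_eq_square)

lemma eta_integrand_term_bound:
 assumes r: "r > 0" and \<eta>: "cos \<eta> < 1" and t: "t \<ge> 0"
 shows "1 / norm (csqrt (1 - of_real (t / r) * cis \<eta>)) ^ 3 \<le> 1 / sqrt (sqrt (1 - max (cos \<eta>) 0)) ^ 3"
proof -
 have "1 * sqrt (1 - max (cos \<eta>) 0) \<le> norm (of_real 1 - of_real (t / r) * cis \<eta>)"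
  by (rule ray_dist) (use r t in simp_all)
 hence "sqrt (sqrt (1 - max (cos \<eta>) 0)) \<le> norm (csqrt (1 - of_real (t / r) * cis \<eta>))" by simp
 hence "sqrt (sqrt (1 - max (cos \<eta>) 0)) ^ 3 \<le> norm (csqrt (1 - of_real (t / r) * cis \<eta>)) ^ 3"
  by (rule power_mono) (use \<eta> in simp)
 moreover have "0 < sqrt (sqrt (1 - max (cos \<eta>) 0)) ^ 3" using \<eta> by simp
 moreover have "1 / v \<le> 1 / u" if "u \<le> v" "0 < u" for u v :: real using that by (simp add: frac_le)
 ultimately show ?thesis by blast
qed

lemma eta_term_integral:
 assumes r: "r > 0" and \<sigma>: "\<sigma> \<in> {1, -1 :: real}" "0 < \<sigma> * \<eta>" "\<sigma> * \<eta> < 2 * pi" and \<phi>: "\<bar>\<phi> + \<eta>\<bar> < pi / 2"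
  and N: "N > 0"
 shows "((%t. exp (- (of_real N * ray (\<phi> + \<eta>) t)) / csqrt (1 - of_real (t / r) * cis \<eta>) ^ 3 * cis (\<phi> + \<eta>))
   has_integral eta_term (rcis r \<phi>) N (lat_limit2 \<sigma> r \<phi>)) {0..}"
proof -
 define x where "x = rcis r \<phi>"
 define \<theta> where "\<theta> = \<phi> + \<eta>"
 define s where "s = lat_root \<sigma> r \<phi>"
 define p where "p t = 1 - of_real (t / r) * cis \<eta>" for t
 define E where "E = exp (- (x * of_real N))"
 define R where "R = complex_of_real (sqrt N)"
 have R: "R ~= 0" "R ^ 2 = of_real N" using N by (simp_all add: R_def flip: of_real_power)
 have x: "x ~= 0" unfolding x_def by (rule rcis_nonzero[OF r])
 have \<eta>1: "cos \<eta> < 1" using \<sigma> by (intro cos_less_one) auto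
 have s2: "s ^ 2 = - x" unfolding s_def x_def by (rule lat_root_sq[OF \<sigma>(1) r])
 have pn: "p t \<notin> \<real>\<^sub>\<le>\<^sub>0" if "t \<ge> 0" for t
  using ray_notin_nonpos[of 1 "t / r" \<eta>] \<eta>1 r that by (simp add: p_def)
 have xc: "x * (of_real (t / r) * cis \<eta>) = ray \<theta> t" for t
  using r by (simp add: x_def \<theta>_def rcis_def ray_def cis_mult[symmetric])
 have co: "cos \<theta> > 0" unfolding \<theta>_def using \<phi> by (intro cos_gt_zero_pi) linarith+
 define G where "G z = - 2 * x * R * E * K2 x (R * csqrt z)" for z
 define k where "k = 1 / sqrt (sqrt (1 - max (cos \<eta>) 0)) ^ 3"
 have k0: "k \<ge> 0" using \<eta>1 by (simp add: k_def)
 have Gd: "(G has_field_derivative (- 2 * x * R * E * (exp (x * (R * csqrt z) ^ 2) / (R * csqrt z) ^ 2 * (R * inverse (2 * csqrt z))))) (at z)"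
  if z: "z \<notin> \<real>\<^sub>\<le>\<^sub>0" for z
 proof -
  have "z ~= 0" using z by auto
  hence nz: "R * csqrt z ~= 0" using R by simp
  have i: "((%z. R * csqrt z) has_field_derivative R * inverse (2 * csqrt z)) (at z)"
   by (rule DERIV_cmult, rule has_field_derivative_csqrt[OF z])
  show ?thesis unfolding G_def
   by (rule DERIV_cmult, rule DERIV_chain2[where f = "K2 x" and g = "%z. R * csqrt z", OF K2_deriv[OF x nz] i])
 qed
 have "((%t. exp (- (of_real N * ray \<theta> t)) / csqrt (p t) ^ 3 * cis \<theta>) has_integral
   (- 2 * x * R * E * lat_limit2 \<sigma> r \<phi> - G (p 0))) {0..}"
 proof (rule improper_FTC[where S = "{}" and F = "%t. G (p t)" and h = "%t. k * exp (- (N * cos \<theta>) * t)"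
    and b = "%k. real (Suc k)"])
  fix t :: real assume t: "t > 0"
  have pz: "csqrt (p t) ~= 0" using pn[of t] t by auto
  have "(p has_vector_derivative - (of_real (1 / r) * cis \<eta>)) (at t)"
  proof -
   have "((%t. 1 - t *\<^sub>R (of_real (1 / r) * cis \<eta>)) has_vector_derivative - (of_real (1 / r) * cis \<eta>)) (at t)"
    by (auto intro!: derivative_eq_intros)
   moreover have "(%t. 1 - t *\<^sub>R (of_real (1 / r) * cis \<eta>)) = p"
    by (simp add: p_def fun_eq_iff scaleR_conv_of_real)
   ultimately show ?thesis by simp
  qed
  from field_vector_diff_chain_at[OF this Gd[OF pn[of t]]] t
  have "((G \<circ> p) has_vector_derivative - (of_real (1 / r) * cis \<eta>) *
   (- 2 * x * R * E * (exp (x * (R * csqrt (p t)) ^ 2) / (R * csqrt (p t)) ^ 2 * (R * inverse (2 * csqrt (p t)))))) (at t)" by simp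
  also have "- (of_real (1 / r) * cis \<eta>) *
   (- 2 * x * R * E * (exp (x * (R * csqrt (p t)) ^ 2) / (R * csqrt (p t)) ^ 2 * (R * inverse (2 * csqrt (p t)))))
   = (x * (of_real (1 / r) * cis \<eta>)) * (E * exp (x * (R * csqrt (p t)) ^ 2)) / csqrt (p t) ^ 3"
   using R(1) pz by (simp add: field_simps power_numeral_reduce)
  also have "x * (of_real (1 / r) * cis \<eta>) = cis \<theta>" using xc[of 1] by (simp add: ray_def)
  also have "E * exp (x * (R * csqrt (p t)) ^ 2) = exp (- (of_real N * ray \<theta> t))"
  proof -
   have "(R * csqrt (p t)) ^ 2 = of_real N * p t" by (simp add: power_mult_distrib R)
   hence "E * exp (x * (R * csqrt (p t)) ^ 2) = exp (- (x * of_real N) + x * (of_real N * p t))"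
    by (simp only: E_def exp_add)
   also have "- (x * of_real N) + x * (of_real N * p t) = - (of_real N * (x * (of_real (t / r) * cis \<eta>)))"
    by (simp add: p_def algebra_simps)
   finally show ?thesis unfolding xc .
  qed
  finally show "((%t. G (p t)) has_vector_derivative exp (- (of_real N * ray \<theta> t)) / csqrt (p t) ^ 3 * cis \<theta>) (at t)"
   by (simp add: o_def mult.commute)
  have "norm (exp (- (of_real N * ray \<theta> t)) / csqrt (p t) ^ 3 * cis \<theta>) =
    exp (- (N * cos \<theta>) * t) * (1 / norm (csqrt (p t)) ^ 3)"
   by (simp add: norm_mult norm_divide norm_power norm_exp_eq_Re ray_def mult_ac del: norm_csqrt)
  also have "\<dots> \<le> exp (- (N * cos \<theta>) * t) * k"
   unfolding k_def p_def using t by (intro mult_left_mono eta_integrand_term_bound[OF r \<eta>1]) simp_all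
  finally show "norm (exp (- (of_real N * ray \<theta> t)) / csqrt (p t) ^ 3 * cis \<theta>) \<le> k * exp (- (N * cos \<theta>) * t)"
   by (simp add: mult.commute)
 next
  have "continuous_on {0..} p" unfolding p_def by (intro continuous_intros) (use r in auto)
  moreover have "continuous_on (- \<real>\<^sub>\<le>\<^sub>0) G" by (rule DERIV_continuous_on, rule has_field_derivative_at_within, rule Gd) simp
  ultimately show "continuous_on {0..} (%t. G (p t))"
   by (intro continuous_on_compose2[of "- \<real>\<^sub>\<le>\<^sub>0" G "{0..}" p]) (use pn in auto)
  show "(%t. k * exp (- (N * cos \<theta>) * t)) integrable_on {0..}"
   using N co by (intro integrable_exp_decay) simp
  show "filterlim (%k. real (Suc k)) at_top sequentially"
   by (rule filterlim_compose[OF filterlim_real_sequentially filterlim_Suc])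
  have "(%k. K2 x (R * csqrt (p (real (Suc k))))) \<longlonglongrightarrow> x * of_real (sqrt pi) / s"
  proof (rule K_limits(2)[OF filterlim_sqrt_Suc _ _ s2 x])
   have "(%k. s * R / of_real (sqrt r) * csqrt (of_real (r / real (Suc k)) - cis \<eta>)) \<longlonglongrightarrow> s * R / of_real (sqrt r) * cis ((\<eta> - \<sigma> * pi) / 2)"
    by (intro tendsto_mult tendsto_const csqrt_ray_limit \<sigma>)
   also have "s * R / of_real (sqrt r) * cis ((\<eta> - \<sigma> * pi) / 2) = of_real (sqrt N) * cis (\<theta> / 2)"
   proof -
    have "cis ((\<phi> + \<sigma> * pi) / 2) * cis ((\<eta> - \<sigma> * pi) / 2) = cis (\<theta> / 2)"
     by (simp add: cis_mult \<theta>_def add_divide_distrib diff_divide_distrib)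
    thus ?thesis using r by (simp add: s_def lat_root_def R_def)
   qed
   finally show "(%k. s * R / of_real (sqrt r) * csqrt (of_real (r / real (Suc k)) - cis \<eta>)) \<longlonglongrightarrow> of_real (sqrt N) * cis (\<theta> / 2)" .
   show "\<bar>Im (of_real (sqrt N) * cis (\<theta> / 2))\<bar> < Re (of_real (sqrt N) * cis (\<theta> / 2))"
    using N \<phi> by (intro cis_sector) (simp_all add: \<theta>_def)
   fix k
   define m where "m = real (Suc k)"
   have m: "m > 0" by (simp add: m_def)
   have "p m = of_real (m / r) * (of_real (r / m) - cis \<eta>)"
    using r m by (simp add: p_def field_simps)
   hence "csqrt (p m) = of_real (sqrt (m / r)) * csqrt (of_real (r / m) - cis \<eta>)"
    by (simp only:) (rule csqrt_scale, use r m in simp)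
   also have "of_real (sqrt (m / r)) = complex_of_real (sqrt m) / of_real (sqrt r)" by (simp add: real_sqrt_divide)
   finally show "s * (R * csqrt (p (real (Suc k)))) = of_real (sqrt (real (Suc k))) *
     (s * R / of_real (sqrt r) * csqrt (of_real (r / real (Suc k)) - cis \<eta>))"
    unfolding m_def[symmetric] by simp
  qed
  thus "(%k. G (p (real (Suc k)))) \<longlonglongrightarrow> - 2 * x * R * E * lat_limit2 \<sigma> r \<phi>"
   unfolding G_def lat_limit2_def x_def[symmetric] s_def[symmetric] by (intro tendsto_mult tendsto_const)
 qed (use k0 in simp_all)
 moreover have "- 2 * x * R * E * lat_limit2 \<sigma> r \<phi> - G (p 0) = eta_term x N (lat_limit2 \<sigma> r \<phi>)"
  by (simp add: G_def p_def eta_term_def E_def R_def algebra_simps)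
 ultimately show ?thesis by (simp add: p_def x_def \<theta>_def)
qed

lemma eta_integral_sum:
 assumes r: "r > 0" and \<sigma>: "\<sigma> \<in> {1, -1 :: real}" "0 < \<sigma> * \<eta>" "\<sigma> * \<eta> < 2 * pi" and \<phi>: "\<bar>\<phi> + \<eta>\<bar> < pi / 2"
 shows "summable (%n. chi12 n * eta_term (rcis r \<phi>) (loc n) (lat_limit2 \<sigma> r \<phi>))"
  and "(eta_integrand (rcis r \<phi>) (\<phi> + \<eta>) has_integral (\<Sum>n. chi12 n * eta_term (rcis r \<phi>) (loc n) (lat_limit2 \<sigma> r \<phi>))) {0..}"
proof -
 define \<theta> where "\<theta> = \<phi> + \<eta>"
 have \<eta>1: "cos \<eta> < 1" using \<sigma> by (intro cos_less_one) auto
 have co: "cos \<theta> > 0" unfolding \<theta>_def using \<phi> by (intro cos_gt_zero_pi) linarith+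
 define k where "k = 1 / sqrt (sqrt (1 - max (cos \<eta>) 0)) ^ 3"
 have k0: "k \<ge> 0" using \<eta>1 by (simp add: k_def)
 define v where "v t = csqrt (1 - of_real (t / r) * cis \<eta>)" for t
 define u where "u n t = chi12 n * (exp (- (cloc n * ray \<theta> t)) / v t ^ 3 * cis \<theta>)" for n t
 have u_int: "(u n has_integral chi12 n * eta_term (rcis r \<phi>) (loc n) (lat_limit2 \<sigma> r \<phi>)) {0..}" for n
 proof (cases "chi12 n = 0")
  case True
  have "u n = (%t. 0)" by (simp add: u_def True fun_eq_iff)
  thus ?thesis by (simp add: True)
 next
  case False
  show ?thesis unfolding u_def v_def \<theta>_def
   by (rule has_integral_mult_right[OF eta_term_integral[OF r \<sigma> \<phi> loc_pos[OF chi12_imp_pos[OF False]]]])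
 qed
 have le: "norm (u n t) \<le> real n powr (-3/2) * (k * eta_majorant (cos \<theta>) t)" if "t \<ge> 0" "t \<notin> {0}" for n t
 proof (cases "chi12 n = 0")
  case True
  thus ?thesis using k0 eta_majorant_nonneg[of "cos \<theta>" t] by (simp add: u_def)
 next
  case False
  have t: "t > 0" using that by simp
  have "norm (exp (- (cloc n * ray \<theta> t))) = exp (- (cos \<theta> * loc n * t))"
   by (simp add: norm_exp_eq_Re ray_def mult_ac)
  moreover have "norm (u n t) = norm (chi12 n) * (norm (exp (- (cloc n * ray \<theta> t))) * (1 / norm (v t) ^ 3))"
   by (simp add: u_def norm_mult norm_divide norm_power)
  ultimately have "norm (u n t) = norm (chi12 n) * (exp (- (cos \<theta> * loc n * t)) * (1 / norm (v t) ^ 3))" by simp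
  also have "\<dots> \<le> 1 * ((real n powr (-3/2) * eta_majorant (cos \<theta>) t) * k)"
   unfolding k_def v_def using that eta_majorant_nonneg[of "cos \<theta>" t]
   by (intro mult_mono norm_chi12_le eta_majorant_bound[OF co t chi12_imp_pos[OF False]]
      eta_integrand_term_bound[OF r \<eta>1]) simp_all
  finally show ?thesis by (simp add: mult_ac)
 qed
 have neg: "negligible {0::real}" by simp
 have sm: "summable (%n. real n powr (-3/2))" by (simp add: summable_real_powr_iff)
 have hi: "(%t. k * eta_majorant (cos \<theta>) t) integrable_on {0..}"
  using integrable_on_cmult_left[OF eta_majorant_integrable[OF co], of k] by simp
 have hp: "0 \<le> k * eta_majorant (cos \<theta>) t" for t by (intro mult_nonneg_nonneg k0 eta_majorant_nonneg)
 have ap: "0 \<le> real n powr (-3/2)" for n by simp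
 note S = series_integral(2,3)[OF neg u_int le sm hi hp ap]
 show "summable (%n. chi12 n * eta_term (rcis r \<phi>) (loc n) (lat_limit2 \<sigma> r \<phi>))" by (rule S(1))
 show "(eta_integrand (rcis r \<phi>) (\<phi> + \<eta>) has_integral (\<Sum>n. chi12 n * eta_term (rcis r \<phi>) (loc n) (lat_limit2 \<sigma> r \<phi>))) {0..}"
 proof (rule has_integral_spike[OF neg _ S(2)])
  fix t :: real assume "t \<in> {0..} - {0}"
  hence t: "t > 0" by auto
  have "Re (ray \<theta> t) > 0" using t co by (simp add: ray_def)
  from sums_mult2[OF eta_sums[OF this], of "1 / v t ^ 3 * cis \<theta>"]
  have "(%n. u n t) sums (eta (2 * of_real pi * \<i> * ray \<theta> t) * (1 / v t ^ 3 * cis \<theta>))"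
   by (simp add: u_def mult_ac)
  moreover have "ray \<theta> t / rcis r \<phi> = of_real (t / r) * cis \<eta>"
   using r by (simp add: ray_def rcis_def \<theta>_def cis_mult[symmetric])
  moreover have "1 - of_real (t / r) * cis \<eta> ~= 0"
   using ray_notin_nonpos[of 1 "t / r" \<eta>] \<eta>1 r t by auto
  hence "(1 - of_real (t / r) * cis \<eta>) powr (-3/2) = 1 / v t ^ 3"
   unfolding v_def by (rule powr_minus_three_halves)
  ultimately show "eta_integrand (rcis r \<phi>) (\<phi> + \<eta>) t = (\<Sum>n. u n t)"
   unfolding eta_integrand_def \<theta>_def[symmetric] by (simp only: sums_unique[symmetric] mult.assoc)
 qed
qed

abbreviation lateral_series :: "real => real => real => complex" where
 "lateral_series \<sigma> r \<phi> \<equiv> \<Sum>n. kz_coeff n * lat_term (rcis r \<phi>) (loc n) (lat_limit \<sigma> r \<phi>)"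

text \<open>The constant 1 of the series cancels against the sum of the boundary terms.\<close>

lemma lateral_value_eta:
 assumes r: "r > 0" and \<sigma>: "\<sigma> \<in> {1, -1 :: real}" "0 < \<sigma> * \<eta>" "\<sigma> * \<eta> < 2 * pi" and \<phi>: "\<bar>\<phi> + \<eta>\<bar> < pi / 2"
 shows "eta_integrand (rcis r \<phi>) (\<phi> + \<eta>) integrable_on {0..}"
  and "1 + (lateral_series \<sigma> r \<phi>) = of_real (sqrt 3) * eta_integral (rcis r \<phi>) (\<phi> + \<eta>)"
proof -
 note S = eta_integral_sum[OF assms]
 define T where "T n = chi12 n * eta_term (rcis r \<phi>) (loc n) (lat_limit2 \<sigma> r \<phi>)" for n
 show "eta_integrand (rcis r \<phi>) (\<phi> + \<eta>) integrable_on {0..}" using S(2) by (rule has_integral_integrable)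
 have I: "eta_integral (rcis r \<phi>) (\<phi> + \<eta>) = (\<Sum>n. T n)"
  unfolding eta_integral_def T_def by (rule integral_unique[OF S(2)])
 have trm: "kz_coeff n * lat_term (rcis r \<phi>) (loc n) (lat_limit \<sigma> r \<phi>) =
    of_real (sqrt 3) * T n - of_real (sqrt 3) * (chi12 n / cloc n)" for n
 proof (cases "chi12 n = 0")
  case False
  have "kz_coeff n * lat_term (rcis r \<phi>) (loc n) (lat_limit \<sigma> r \<phi>) =
   chi12 n * (of_real borel_const * of_nat n * lat_term (rcis r \<phi>) (loc n) (2 * rcis r \<phi> / 3 * lat_limit2 \<sigma> r \<phi>))"
   unfolding lat_limit_eq kz_coeff_def by simp
  thus ?thesis unfolding eta_term_lat_term[OF rcis_nonzero[OF r] chi12_imp_pos[OF False]]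
   by (simp add: T_def algebra_simps)
 qed (simp add: kz_coeff_def T_def)
 have "(%n. of_real (sqrt 3) * T n - of_real (sqrt 3) * (chi12 n / cloc n)) sums (of_real (sqrt 3) * (\<Sum>n. T n) - 1)"
  by (intro sums_diff sums_mult summable_sums sum_inverse_loc) (use S(1) in \<open>simp add: T_def\<close>)
 hence "(lateral_series \<sigma> r \<phi>) = of_real (sqrt 3) * (\<Sum>n. T n) - 1"
  unfolding trm by (rule sums_unique[symmetric])
 thus "1 + (lateral_series \<sigma> r \<phi>) = of_real (sqrt 3) * eta_integral (rcis r \<phi>) (\<phi> + \<eta>)"
  unfolding I by simp
qed

section \<open>Turning paths and lateral sums\<close>

lemma pi_sq_ge: "pi ^ 2 / 6 \<ge> 1"
proof -
 have "3 \<le> pi" using pi_gt3 by simp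
 hence "3 * 3 \<le> pi * pi" by (intro mult_mono) auto
 thus ?thesis by (simp add: power2_eq_square)
qed

lemma loc_sep:
 assumes "n < m" shows "pi ^ 2 / 6 * (real n + real m) \<le> loc m - loc n"
proof -
 have "real n + 1 \<le> real m" using assms by simp
 hence "1 * (real m + real n) \<le> (real m - real n) * (real m + real n)" by (intro mult_right_mono) auto
 also have "\<dots> = real m ^ 2 - real n ^ 2" by (simp add: power2_eq_square algebra_simps)
 finally have "pi ^ 2 / 6 * (real m + real n) \<le> pi ^ 2 / 6 * (real m ^ 2 - real n ^ 2)" by (intro mult_left_mono) auto
 thus ?thesis by (simp add: loc_def algebra_simps)
qed

lemma loc_sep_abs:
 assumes "n ~= m" shows "pi ^ 2 / 6 * (real n + real m) \<le> \<bar>loc n - loc m\<bar>"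
proof (cases "n < m")
 case True
 from loc_sep[OF this] show ?thesis by linarith
next
 case False
 hence "m < n" using assms by simp
 from loc_sep[OF this] show ?thesis unfolding add.commute[of "real n"] by linarith
qed

lemma sing_set_sep:
 assumes "s \<in> sing_set" "s' \<in> sing_set" "s ~= s'" shows "2 * (pi ^ 2 / 6) \<le> \<bar>s - s'\<bar>"
proof -
 obtain n m where nm: "s = loc n" "s' = loc m" "chi12 n ~= 0" "chi12 m ~= 0"
  using assms unfolding sing_set_eq by blast
 hence "n ~= m" using assms(3) by auto
 have "1 \<le> real n" "1 \<le> real m" using chi12_imp_pos nm(3,4) by (simp_all add: Suc_leI)
 hence "pi ^ 2 / 6 * 2 \<le> pi ^ 2 / 6 * (real n + real m)" by (intro mult_left_mono) auto
 also have "\<dots> \<le> \<bar>loc n - loc m\<bar>" by (rule loc_sep_abs[OF \<open>n ~= m\<close>])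
 finally show ?thesis unfolding nm by simp
qed

lemma sing_set_nonempty: "sing_set ~= {}"
proof -
 have "chi12 1 ~= 0" by (simp add: chi12_def)
 thus ?thesis unfolding sing_set_eq by blast
qed

lemma infdist_sing_le: "s \<in> sing_set ==> infdist t sing_set \<le> \<bar>t - s\<bar>"
 using infdist_le[of s sing_set t] by (simp add: dist_real_def)

lemma infdist_sing_ge: "(\<And>s. s \<in> sing_set ==> d \<le> \<bar>t - s\<bar>) ==> d \<le> infdist t sing_set"
 unfolding infdist_notempty[OF sing_set_nonempty]
 by (rule cINF_greatest[OF sing_set_nonempty]) (simp add: dist_real_def)

text \<open>Singularities are at least \<open>2 \<pi>\<^sup>2 / 6\<close> apart, so the nearest one is unique in this range.\<close>

lemma infdist_sing_eq:
 assumes "s \<in> sing_set" "\<bar>t - s\<bar> < pi ^ 2 / 6" shows "infdist t sing_set = \<bar>t - s\<bar>"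
proof (rule antisym[OF infdist_sing_le[OF assms(1)] infdist_sing_ge])
 fix s' assume s': "s' \<in> sing_set"
 show "\<bar>t - s\<bar> \<le> \<bar>t - s'\<bar>"
 proof (cases "s' = s")
  case False
  have "2 * (pi ^ 2 / 6) \<le> \<bar>s - s'\<bar>" using sing_set_sep[OF assms(1) s'] False by auto
  thus ?thesis using assms(2) by linarith
 qed simp
qed

lemma infdist_sing_attained:
 assumes "infdist t sing_set < pi ^ 2 / 6"
 obtains s where "s \<in> sing_set" "infdist t sing_set = \<bar>t - s\<bar>"
proof -
 have "\<not> (\<forall>s\<in>sing_set. pi ^ 2 / 6 \<le> \<bar>t - s\<bar>)"
 proof
  assume "\<forall>s\<in>sing_set. pi ^ 2 / 6 \<le> \<bar>t - s\<bar>"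
  hence "pi ^ 2 / 6 \<le> infdist t sing_set" by (intro infdist_sing_ge) blast
  thus False using assms by linarith
 qed
 then obtain s where s: "s \<in> sing_set" "\<not> pi ^ 2 / 6 \<le> \<bar>t - s\<bar>" by blast
 have "infdist t sing_set = \<bar>t - s\<bar>" by (rule infdist_sing_eq[OF s(1)]) (use s(2) in linarith)
 with s(1) show ?thesis by (rule that)
qed

lemma infdist_loc_ge:
 assumes "\<And>m. chi12 m ~= 0 ==> m ~= n" shows "pi ^ 2 / 6 \<le> infdist (loc n) sing_set"
proof (rule infdist_sing_ge)
 fix s assume "s \<in> sing_set"
 then obtain m where m: "s = loc m" "chi12 m ~= 0" unfolding sing_set_eq by blast
 have "1 \<le> real m" using chi12_imp_pos m(2) by (simp add: Suc_leI)
 hence "pi ^ 2 / 6 * 1 \<le> pi ^ 2 / 6 * (real n + real m)" by (intro mult_left_mono) auto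
 also have "\<dots> \<le> \<bar>loc n - loc m\<bar>" by (rule loc_sep_abs) (use assms[OF m(2)] in simp)
 finally show "pi ^ 2 / 6 \<le> \<bar>loc n - s\<bar>" unfolding m by simp
qed

definition bump :: "real => real => real" where
 "bump \<delta> t = max 0 (\<delta> - infdist t sing_set)"

lemma turning_path_bump: "turning_path \<sigma> \<delta> t = of_real t + of_real (\<sigma> * bump \<delta> t) * \<i>"
 by (simp add: turning_path_def bump_def complex_eq_iff)

lemma bump_bounds: "\<delta> > 0 ==> 0 \<le> bump \<delta> t" "\<delta> > 0 ==> bump \<delta> t \<le> \<delta>"
 using infdist_nonneg[of t sing_set] by (auto simp: bump_def)

lemma bump_loc:
 assumes "\<And>m. chi12 m ~= 0 ==> m ~= n" "\<delta> < pi ^ 2 / 6" shows "bump \<delta> (loc n) = 0"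
proof -
 have "pi ^ 2 / 6 \<le> infdist (loc n) sing_set" by (rule infdist_loc_ge[OF assms(1)])
 thus ?thesis using assms(2) by (simp add: bump_def)
qed

lemma bump_deriv:
 assumes \<delta>: "0 < \<delta>" "\<delta> < pi ^ 2 / 6" and t: "t \<notin> (\<Union>s\<in>sing_set. {s - \<delta>, s, s + \<delta>})"
 obtains d where "(bump \<delta> has_real_derivative d) (at t)" "\<bar>d\<bar> \<le> 1"
proof (cases "infdist t sing_set < pi ^ 2 / 6")
 case False
 have "\<forall>\<^sub>F u in nhds t. 0 = bump \<delta> u"
 proof -
  have "((%u. infdist u sing_set) \<longlongrightarrow> infdist t sing_set) (nhds t)"
   by (intro tendsto_infdist filterlim_ident)
  moreover have "\<delta> < infdist t sing_set" using False \<delta> by linarith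
  ultimately have "\<forall>\<^sub>F u in nhds t. \<delta> < infdist u sing_set" by (rule order_tendstoD(1))
  thus ?thesis by eventually_elim (simp add: bump_def)
 qed
 moreover have "((%u. 0::real) has_real_derivative 0) (at t)" by simp
 ultimately have "(bump \<delta> has_real_derivative 0) (at t)"
  by (subst (asm) DERIV_cong_ev[OF refl _ refl])
 thus ?thesis by (rule that) simp
next
 case True
 then obtain s where s: "s \<in> sing_set" "infdist t sing_set = \<bar>t - s\<bar>" by (rule infdist_sing_attained)
 have ne: "t ~= s" "t ~= s - \<delta>" "t ~= s + \<delta>" using t s(1) by auto
 define e where "e = sgn (t - s)"
 have e: "e = 1 \<or> e = -1" using ne(1) by (auto simp: e_def sgn_if)
 have ee: "\<bar>t - s\<bar> = e * (t - s)" "e * (t - s) > 0" using ne(1) by (auto simp: e_def sgn_if)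
 have lim: "((%u. e * (u - s)) \<longlongrightarrow> e * (t - s)) (nhds t)" by (intro tendsto_intros filterlim_ident)
 have "\<forall>\<^sub>F u in nhds t. e * (u - s) > 0" by (rule order_tendstoD(1)[OF lim ee(2)])
 moreover have "\<forall>\<^sub>F u in nhds t. e * (u - s) < pi ^ 2 / 6"
  by (rule order_tendstoD(2)[OF lim]) (use True s(2) ee in linarith)
 ultimately have ev: "\<forall>\<^sub>F u in nhds t. bump \<delta> u = max 0 (\<delta> - e * (u - s))"
 proof eventually_elim
  fix u assume u: "e * (u - s) > 0" "e * (u - s) < pi ^ 2 / 6"
  have "\<bar>u - s\<bar> = \<bar>e * (u - s)\<bar>" using e by auto
  hence "\<bar>u - s\<bar> = e * (u - s)" using u by simp
  moreover have "infdist u sing_set = \<bar>u - s\<bar>" by (rule infdist_sing_eq[OF s(1)]) (use calculation u in simp)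
  ultimately show "bump \<delta> u = max 0 (\<delta> - e * (u - s))" by (simp add: bump_def)
 qed
 have "\<delta> ~= e * (t - s)" using e ne by auto
 then consider "\<delta> < e * (t - s)" | "e * (t - s) < \<delta>" by linarith
 thus ?thesis
 proof cases
  case 1
  have "\<forall>\<^sub>F u in nhds t. \<delta> < e * (u - s)" by (rule order_tendstoD(1)[OF lim 1])
  with ev have ev0: "\<forall>\<^sub>F u in nhds t. bump \<delta> u = 0" by eventually_elim simp
  have "((%u. 0::real) has_real_derivative 0) (at t)" by simp
  hence "(bump \<delta> has_real_derivative 0) (at t)" by (subst DERIV_cong_ev[OF refl ev0 refl])
  thus ?thesis by (rule that) simp
 next
  case 2
  have "\<forall>\<^sub>F u in nhds t. e * (u - s) < \<delta>" by (rule order_tendstoD(2)[OF lim 2])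
  with ev have ev0: "\<forall>\<^sub>F u in nhds t. bump \<delta> u = \<delta> - e * (u - s)" by eventually_elim simp
  have "((%u. \<delta> - e * (u - s)) has_real_derivative - e) (at t)" by (auto intro!: derivative_eq_intros)
  hence "(bump \<delta> has_real_derivative - e) (at t)" by (subst DERIV_cong_ev[OF refl ev0 refl])
  thus ?thesis by (rule that) (use e in auto)
 qed
qed

lemma turning_path_deriv:
 assumes \<sigma>: "\<sigma> \<in> {1, -1 :: real}" and \<delta>: "0 < \<delta>" "\<delta> < pi ^ 2 / 6"
  and t: "t \<notin> (\<Union>s\<in>sing_set. {s - \<delta>, s, s + \<delta>})"
 shows "(turning_path \<sigma> \<delta> has_vector_derivative vector_derivative (turning_path \<sigma> \<delta>) (at t)) (at t) \<and>
   norm (vector_derivative (turning_path \<sigma> \<delta>) (at t)) \<le> 2"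
proof -
 obtain d where d: "(bump \<delta> has_real_derivative d) (at t)" "\<bar>d\<bar> \<le> 1" by (rule bump_deriv[OF \<delta> t])
 have "((%t. of_real t + of_real (\<sigma> * bump \<delta> t) * \<i>) has_vector_derivative (1 + of_real (\<sigma> * d) * \<i>)) (at t)"
  by (intro has_vector_derivative_add has_vector_derivative_mult_left has_vector_derivative_of_real)
    (auto intro!: derivative_eq_intros d(1) simp: has_real_derivative_iff_has_vector_derivative[symmetric])
 hence v: "(turning_path \<sigma> \<delta> has_vector_derivative (1 + of_real (\<sigma> * d) * \<i>)) (at t)"
  by (simp add: turning_path_bump[abs_def])
 have "norm (1 + of_real (\<sigma> * d) * \<i>) \<le> norm (1::complex) + norm (of_real (\<sigma> * d) * \<i>)" by (rule norm_triangle_ineq)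
 also have "norm (of_real (\<sigma> * d) * \<i>) = \<bar>d\<bar>" unfolding norm_mult using \<sigma> by auto
 finally show ?thesis using v vector_derivative_at[OF v] d(2) by simp
qed

text \<open>The corners of the path are at the singularities and at distance \<open>\<delta>\<close> from them.\<close>

lemma good_path_turning:
 assumes r: "r > 0" and \<sigma>: "\<sigma> \<in> {1, -1 :: real}" and \<delta>: "0 < \<delta>" "\<delta> < pi ^ 2 / 6" and \<phi>: "\<bar>\<phi>\<bar> < pi / 2"
 shows "good_path (rcis r \<phi>) (turning_path \<sigma> \<delta>) (\<delta> / 2) (r * cos \<phi>) (\<Union>s\<in>sing_set. {s - \<delta>, s, s + \<delta>})"
 unfolding good_path_def
proof (intro conjI allI impI)
 note bb = bump_bounds[OF \<delta>(1)]
 show "continuous_on {0..} (turning_path \<sigma> \<delta>)"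
  unfolding turning_path_bump[abs_def] bump_def by (intro continuous_intros continuous_on_infdist)
 have "bump \<delta> (loc 0) = 0" by (rule bump_loc[OF _ \<delta>(2)]) (use chi12_imp_pos in auto)
 thus "turning_path \<sigma> \<delta> 0 = 0" by (simp add: turning_path_bump loc_def)
 have "cos \<phi> > 0" using \<phi> by (intro cos_gt_zero_pi) linarith+
 thus "r * cos \<phi> > 0" using r by simp
 show "away (\<delta> / 2) (turning_path \<sigma> \<delta> t)" if "t \<ge> 0" for t
  unfolding away_def
 proof (intro conjI allI impI)
  show "0 < \<delta> / 2" using \<delta> by simp
  fix n assume n: "chi12 n ~= 0"
  have s: "loc n \<in> sing_set" using n unfolding sing_set_eq by blast
  define z where "z = cloc n - turning_path \<sigma> \<delta> t"
  have Re: "\<bar>Re z\<bar> = \<bar>loc n - t\<bar>" and Im: "\<bar>Im z\<bar> = bump \<delta> t"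
   using \<sigma> bb(1)[of t] by (auto simp: z_def turning_path_bump)
  show "\<delta> / 2 \<le> norm (cloc n - turning_path \<sigma> \<delta> t)"
  proof (cases "\<delta> / 2 \<le> \<bar>loc n - t\<bar>")
   case True
   thus ?thesis using abs_Re_le_cmod[of z] Re unfolding z_def[symmetric] by linarith
  next
   case False
   have "infdist t sing_set \<le> \<bar>t - loc n\<bar>" by (rule infdist_sing_le[OF s])
   hence "\<delta> / 2 \<le> bump \<delta> t" using False unfolding bump_def by linarith
   thus ?thesis using abs_Im_le_cmod[of z] Im unfolding z_def[symmetric] by linarith
  qed
 qed
 show "\<exists>A. \<forall>t\<ge>0. norm (turning_path \<sigma> \<delta> t) \<le> A * (1 + t)"
 proof (intro exI allI impI)
  fix t :: real assume t: "t \<ge> 0"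
  have "norm (turning_path \<sigma> \<delta> t) \<le> norm (complex_of_real t) + norm (of_real (\<sigma> * bump \<delta> t) * \<i>)"
   unfolding turning_path_bump by (rule norm_triangle_ineq)
  also have "norm (of_real (\<sigma> * bump \<delta> t) * \<i>) = bump \<delta> t"
   unfolding norm_mult using \<sigma> bb(1)[of t] by auto
  also have "norm (complex_of_real t) + bump \<delta> t \<le> (1 + \<delta>) * (1 + t)"
  proof -
   have "0 \<le> \<delta> * t" using \<delta> t by simp
   moreover have "(1 + \<delta>) * (1 + t) = 1 + \<delta> + t + \<delta> * t" by (simp add: algebra_simps)
   moreover have "norm (complex_of_real t) = t" using t by simp
   ultimately show ?thesis using bb(2)[of t] by linarith
  qed
  finally show "norm (turning_path \<sigma> \<delta> t) \<le> (1 + \<delta>) * (1 + t)" .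
 qed
 show "finite ((\<Union>s\<in>sing_set. {s - \<delta>, s, s + \<delta>}) \<inter> {0..b})" for b
 proof (rule finite_subset)
  show "(\<Union>s\<in>sing_set. {s - \<delta>, s, s + \<delta>}) \<inter> {0..b} \<subseteq> (\<Union>n\<in>{n. loc n < b + \<delta> + 1}. {loc n - \<delta>, loc n, loc n + \<delta>})"
  proof
   fix t assume "t \<in> (\<Union>s\<in>sing_set. {s - \<delta>, s, s + \<delta>}) \<inter> {0..b}"
   then obtain n where n: "t \<in> {loc n - \<delta>, loc n, loc n + \<delta>}" "t \<le> b" unfolding sing_set_eq by auto
   hence "loc n < b + \<delta> + 1" using \<delta> by auto
   with n(1) show "t \<in> (\<Union>n\<in>{n. loc n < b + \<delta> + 1}. {loc n - \<delta>, loc n, loc n + \<delta>})" by blast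
  qed
  show "finite (\<Union>n\<in>{n. loc n < b + \<delta> + 1}. {loc n - \<delta>, loc n, loc n + \<delta>})" using finite_loc_less by simp
 qed
 show "\<exists>M. \<forall>t>0. t \<notin> (\<Union>s\<in>sing_set. {s - \<delta>, s, s + \<delta>}) \<longrightarrow>
    (turning_path \<sigma> \<delta> has_vector_derivative vector_derivative (turning_path \<sigma> \<delta>) (at t)) (at t) \<and>
     norm (vector_derivative (turning_path \<sigma> \<delta>) (at t)) \<le> M"
  using turning_path_deriv[OF \<sigma> \<delta>] by (intro exI[of _ 2]) simp
 show "\<exists>A. \<forall>t\<ge>0. norm (exp (- (rcis r \<phi> * turning_path \<sigma> \<delta> t))) \<le> A * exp (- (r * cos \<phi>) * t)"
 proof (intro exI allI impI)
  fix t :: real assume t: "t \<ge> 0"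
  have "Re (- (rcis r \<phi> * turning_path \<sigma> \<delta> t)) = - (r * cos \<phi>) * t + r * sin \<phi> * (\<sigma> * bump \<delta> t)"
   by (simp add: turning_path_bump)
  also have "r * sin \<phi> * (\<sigma> * bump \<delta> t) \<le> \<bar>r * sin \<phi> * (\<sigma> * bump \<delta> t)\<bar>" by simp
  also have "\<bar>r * sin \<phi> * (\<sigma> * bump \<delta> t)\<bar> = r * (\<bar>sin \<phi>\<bar> * bump \<delta> t)"
   using \<sigma> r bb(1)[of t] by (auto simp: abs_mult)
  also have "\<dots> \<le> r * (1 * \<delta>)" using r bb[of t] by (intro mult_left_mono mult_mono) auto
  finally have "Re (- (rcis r \<phi> * turning_path \<sigma> \<delta> t)) \<le> r * \<delta> + - (r * cos \<phi>) * t" by simp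
  thus "norm (exp (- (rcis r \<phi> * turning_path \<sigma> \<delta> t))) \<le> exp (r * \<delta>) * exp (- (r * cos \<phi>) * t)"
   unfolding norm_exp_eq_Re exp_add[symmetric] by simp
 qed
qed

text \<open>The branch of the square root that is cut along the direction \<open>\<sigma> \<i>\<close>. Along a path that avoids \<open>N\<close>
on the side \<open>\<sigma>\<close>, the difference \<open>N - z\<close> does not meet the cut.\<close>

definition side_root :: "real => complex => complex" where
 "side_root \<sigma> z = cis (- \<sigma> * pi / 4) * csqrt (of_real \<sigma> * \<i> * z)"

lemma side_root_sq:
 assumes "\<sigma> \<in> {1, -1 :: real}" shows "side_root \<sigma> z ^ 2 = z"
proof -
 have "cis (- \<sigma> * pi / 4) ^ 2 = cis (- \<sigma> * pi / 2)" unfolding Complex.DeMoivre by (rule arg_cong[where f = cis]) simp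
 also have "\<dots> = - of_real \<sigma> * \<i>" using assms by (auto simp: complex_eq_iff)
 finally show ?thesis using assms by (auto simp: side_root_def power_mult_distrib)
qed

lemma side_root_pos:
 assumes "\<sigma> \<in> {1, -1 :: real}" "N \<ge> 0" shows "side_root \<sigma> (of_real N) = of_real (sqrt N)"
proof -
 have "csqrt (of_real \<sigma> * \<i> * of_real N) = of_real (sqrt N) * cis (\<sigma> * pi / 4)"
 proof (rule csqrt_unique)
  have "cis (\<sigma> * pi / 4) ^ 2 = cis (\<sigma> * pi / 2)" unfolding Complex.DeMoivre by (rule arg_cong[where f = cis]) simp
  also have "\<dots> = of_real \<sigma> * \<i>" using assms by (auto simp: complex_eq_iff)
  finally show "(of_real (sqrt N) * cis (\<sigma> * pi / 4)) ^ 2 = of_real \<sigma> * \<i> * of_real N"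
   using assms(2) by (simp add: power_mult_distrib flip: of_real_power)
  show "0 < Re (of_real (sqrt N) * cis (\<sigma> * pi / 4)) \<or> Re (of_real (sqrt N) * cis (\<sigma> * pi / 4)) = 0 \<and>
     0 \<le> Im (of_real (sqrt N) * cis (\<sigma> * pi / 4))"
   using assms by (cases "N = 0") (auto simp: cos_45)
 qed
 thus ?thesis by (simp add: side_root_def cis_mult mult.left_commute)
qed

lemma side_root_neg:
 assumes "\<sigma> \<in> {1, -1 :: real}" "M \<ge> 0" shows "side_root \<sigma> (- of_real M) = of_real (sqrt M) * cis (- \<sigma> * pi / 2)"
proof -
 have "csqrt (of_real \<sigma> * \<i> * - of_real M) = of_real (sqrt M) * cis (- \<sigma> * pi / 4)"
 proof (rule csqrt_unique)
  have "cis (- \<sigma> * pi / 4) ^ 2 = cis (- \<sigma> * pi / 2)" unfolding Complex.DeMoivre by (rule arg_cong[where f = cis]) simp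
  also have "\<dots> = - of_real \<sigma> * \<i>" using assms by (auto simp: complex_eq_iff)
  finally show "(of_real (sqrt M) * cis (- \<sigma> * pi / 4)) ^ 2 = of_real \<sigma> * \<i> * - of_real M"
   using assms(2) by (simp add: power_mult_distrib flip: of_real_power)
  show "0 < Re (of_real (sqrt M) * cis (- \<sigma> * pi / 4)) \<or> Re (of_real (sqrt M) * cis (- \<sigma> * pi / 4)) = 0 \<and>
     0 \<le> Im (of_real (sqrt M) * cis (- \<sigma> * pi / 4))"
   using assms by (cases "M = 0") (auto simp: cos_45)
 qed
 hence "side_root \<sigma> (- of_real M) = of_real (sqrt M) * (cis (- \<sigma> * pi / 4) * cis (- \<sigma> * pi / 4))"
  unfolding side_root_def by (simp only: mult_ac)
 also have "cis (- \<sigma> * pi / 4) * cis (- \<sigma> * pi / 4) = cis (- \<sigma> * pi / 2)"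
  unfolding cis_mult by (rule arg_cong[where f = cis]) simp
 finally show ?thesis .
qed

lemma continuous_on_side_root:
 assumes \<sigma>: "\<sigma> \<in> {1, -1 :: real}" and f: "continuous_on S f" "\<And>t. t \<in> S ==> Re (f t) = 0 ==> \<sigma> * Im (f t) < 0"
 shows "continuous_on S (%t. side_root \<sigma> (f t))"
 unfolding side_root_def
proof (intro continuous_on_mult continuous_on_const continuous_on_csqrt_compose f(1))
 fix t assume t: "t \<in> S"
 have "Re (of_real \<sigma> * \<i> * f t) = - (\<sigma> * Im (f t))" "Im (of_real \<sigma> * \<i> * f t) = \<sigma> * Re (f t)" by simp_all
 thus "of_real \<sigma> * \<i> * f t \<notin> \<real>\<^sub>\<le>\<^sub>0" unfolding complex_nonpos_Reals_iff using f(2)[OF t] \<sigma> by fastforce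
qed

lemma turning_root_family:
 assumes \<sigma>: "\<sigma> \<in> {1, -1 :: real}" and \<delta>: "0 < \<delta>" "\<delta> < pi ^ 2 / 6" and g0: "turning_path \<sigma> \<delta> 0 = 0"
   and cont: "continuous_on {0..} (turning_path \<sigma> \<delta>)"
 shows "root_family (turning_path \<sigma> \<delta>) {0..} (%n t. side_root \<sigma> (cloc n - turning_path \<sigma> \<delta> t))"
 unfolding root_family_def
proof (intro allI impI conjI ballI)
 fix n assume n: "chi12 n ~= 0"
 have s: "loc n \<in> sing_set" using n unfolding sing_set_eq by blast
 show "continuous_on {0..} (%t. side_root \<sigma> (cloc n - turning_path \<sigma> \<delta> t))"
 proof (rule continuous_on_side_root[OF \<sigma>])
  show "continuous_on {0..} (%t. cloc n - turning_path \<sigma> \<delta> t)" by (intro continuous_intros cont)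
  fix t assume "Re (cloc n - turning_path \<sigma> \<delta> t) = 0"
  hence t: "t = loc n" by (simp add: turning_path_bump)
  have "infdist t sing_set = 0" unfolding t using s by simp
  hence "bump \<delta> t = \<delta>" using \<delta> by (simp add: bump_def)
  thus "\<sigma> * Im (cloc n - turning_path \<sigma> \<delta> t) < 0" using \<sigma> \<delta> by (auto simp: turning_path_bump)
 qed
 show "side_root \<sigma> (cloc n - turning_path \<sigma> \<delta> 0) = of_real (sqrt (loc n))"
  unfolding g0 diff_zero by (rule side_root_pos[OF \<sigma>]) (simp add: loc_def)
 show "side_root \<sigma> (cloc n - turning_path \<sigma> \<delta> t) ^ 2 = cloc n - turning_path \<sigma> \<delta> t" for t
  by (rule side_root_sq[OF \<sigma>])
qed

text \<open>The points \<open>loc (12 j)\<close> are far from the singularities, so there the path is back on the axis.\<close>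

lemma lateral_turning:
 assumes r: "r > 0" and \<sigma>: "\<sigma> \<in> {1, -1 :: real}" and \<delta>: "0 < \<delta>" "\<delta> < pi ^ 2 / 6" and \<phi>: "\<bar>\<phi>\<bar> < pi / 2"
  and c: "coeff_ok c K" and h: "germ_eq h c"
 shows "has_laplace_along h (turning_path \<sigma> \<delta>) (rcis r \<phi>) (\<Sum>n. c n * lat_term (rcis r \<phi>) (loc n) (lat_limit \<sigma> r \<phi>))"
proof -
 define b where "b n k = loc (12 * (n + 1 + k))" for n k :: nat
 define s where "s = lat_root \<sigma> r \<phi>"
 have s2: "s ^ 2 = - rcis r \<phi>" unfolding s_def by (rule lat_root_sq[OF \<sigma> r])
 note gp = good_path_turning[OF r \<sigma> \<delta> \<phi>]
 have cont: "continuous_on {0..} (turning_path \<sigma> \<delta>)" and g0: "turning_path \<sigma> \<delta> 0 = 0"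
  using gp unfolding good_path_def by blast+
 have bn: "real k \<le> b n k - loc n" for n k
 proof -
  have A: "pi ^ 2 / 6 * (real n + real (12 * (n + 1 + k))) \<le> b n k - loc n" unfolding b_def by (rule loc_sep) simp
  have B: "1 * (real n + real (12 * (n + 1 + k))) \<le> pi ^ 2 / 6 * (real n + real (12 * (n + 1 + k)))"
   by (intro mult_right_mono pi_sq_ge) simp
  have "real k \<le> 1 * (real n + real (12 * (n + 1 + k)))" by simp
  from order_trans[OF order_trans[OF this B] A] show ?thesis .
 qed
 have bt: "filterlim (%k. b n k - loc n) at_top sequentially" for n
  by (rule filterlim_at_top_mono[OF filterlim_real_sequentially]) (simp add: bn)
 have "filterlim (b n) at_top sequentially" for n
 proof (rule filterlim_at_top_mono[OF bt[of n]])
  have "0 \<le> loc n" by (simp add: loc_def)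
  thus "\<forall>\<^sub>F k in sequentially. b n k - loc n \<le> b n k" by simp
 qed
 note b = this
 have lim: "(%k. K4 (rcis r \<phi>) (side_root \<sigma> (cloc n - turning_path \<sigma> \<delta> (b n k)))) \<longlonglongrightarrow> lat_limit \<sigma> r \<phi>" for n
  unfolding lat_limit_def s_def[symmetric]
 proof (rule K_limits(1)[OF _ _ _ s2 rcis_nonzero[OF r]])
  show "filterlim (%k. sqrt (b n k - loc n)) at_top sequentially"
   by (rule filterlim_compose[OF sqrt_at_top bt])
  show "(%k. of_real (sqrt r) * cis (\<phi> / 2)) \<longlonglongrightarrow> of_real (sqrt r) * cis (\<phi> / 2)" by (rule tendsto_const)
  show "\<bar>Im (of_real (sqrt r) * cis (\<phi> / 2))\<bar> < Re (of_real (sqrt r) * cis (\<phi> / 2))"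
   using r by (intro cis_sector \<phi>) simp
  fix k
  have "bump \<delta> (b n k) = 0" unfolding b_def
  proof (rule bump_loc[OF _ \<delta>(2)])
   show "m ~= 12 * (n + 1 + k)" if "chi12 m ~= 0" for m
   proof
    assume "m = 12 * (n + 1 + k)"
    hence "m mod 12 = 0" by simp
    thus False using that by (simp add: chi12_def)
   qed
  qed
  hence "cloc n - turning_path \<sigma> \<delta> (b n k) = - of_real (b n k - loc n)" by (simp add: turning_path_bump)
  moreover have "0 \<le> b n k - loc n" using bn[of k n] by linarith
  ultimately have "side_root \<sigma> (cloc n - turning_path \<sigma> \<delta> (b n k)) = of_real (sqrt (b n k - loc n)) * cis (- \<sigma> * pi / 2)"
   using side_root_neg[OF \<sigma>] by (simp only:)
  moreover have "cis ((\<phi> + \<sigma> * pi) / 2) * cis (- \<sigma> * pi / 2) = cis (\<phi> / 2)"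
   by (simp add: cis_mult add_divide_distrib)
  ultimately show "s * side_root \<sigma> (cloc n - turning_path \<sigma> \<delta> (b n k)) =
    of_real (sqrt (b n k - loc n)) * (of_real (sqrt r) * cis (\<phi> / 2))"
   unfolding s_def lat_root_def by (simp only: mult_ac)
 qed
 show ?thesis
  by (rule laplace_sum(1)[OF gp turning_root_family[OF \<sigma> \<delta> g0 cont] rcis_nonzero[OF r] c b lim h])
qed

lemma has_lateral_laplace_kz:
 assumes r: "r > 0" and \<sigma>: "\<sigma> \<in> {1, -1 :: real}"
 shows "has_lateral_laplace \<sigma> r \<phi> (lateral_series \<sigma> r \<phi>)"
 unfolding has_lateral_laplace_def
proof (intro conjI impI allI)
 show "has_laplace_along kz_borel (turning_path \<sigma> \<delta>) (rcis r \<phi>)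
   (lateral_series \<sigma> r \<phi>)"
  if "\<bar>\<phi>\<bar> < pi / 2" "0 < \<delta> \<and> \<delta> < pi\<^sup>2 / 6" for \<delta>
  using that by (intro lateral_turning[OF r \<sigma> _ _ _ coeff_ok_kz kz_borel_germ]) simp_all
 show "has_laplace_along kz_borel (ray \<theta>) (rcis r \<phi>)
   (lateral_series \<sigma> r \<phi>)"
  if "0 < \<sigma> * \<theta> \<and> \<sigma> * \<theta> < 2 * pi \<and> \<bar>\<phi> + \<theta>\<bar> < pi / 2" for \<theta>
  using that by (intro lateral_ray(1)[OF r \<sigma> _ _ _ coeff_ok_kz kz_borel_germ]) simp_all
qed

text \<open>The existence of an admissible ray makes the lateral transform unique.\<close>

lemma rotated_ray_exists:
 assumes \<sigma>: "\<sigma> \<in> {1, -1 :: real}" and \<phi>: "- 5 * pi / 2 < \<sigma> * \<phi>" "\<sigma> * \<phi> < pi / 2"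
 obtains \<theta> where "0 < \<sigma> * \<theta>" "\<sigma> * \<theta> < 2 * pi" "\<bar>\<phi> + \<theta>\<bar> < pi / 2"
proof -
 define l where "l = max 0 (- pi / 2 - \<sigma> * \<phi>)"
 define u where "u = min (2 * pi) (pi / 2 - \<sigma> * \<phi>)"
 have "l < u" using \<phi> pi_gt_zero unfolding l_def u_def by (simp add: max_def min_def)
 then obtain m where "l < m" "m < u" using dense by blast
 hence m: "0 < m" "m < 2 * pi" "- pi / 2 < \<sigma> * \<phi> + m" "\<sigma> * \<phi> + m < pi / 2" by (auto simp: l_def u_def)
 have ab: "\<bar>\<phi> + \<sigma> * m\<bar> = \<bar>\<sigma> * \<phi> + m\<bar>" using \<sigma> by auto
 have sm: "\<sigma> * (\<sigma> * m) = m" using \<sigma> by auto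
 show ?thesis
 proof (rule that)
  show "0 < \<sigma> * (\<sigma> * m)" "\<sigma> * (\<sigma> * m) < 2 * pi" unfolding sm by (fact m)+
  show "\<bar>\<phi> + \<sigma> * m\<bar> < pi / 2" unfolding ab using m(3,4) by linarith
 qed
qed

lemma lateral_sum_eq:
 assumes r: "r > 0" and \<sigma>: "\<sigma> \<in> {1, -1 :: real}" and \<phi>: "- 5 * pi / 2 < \<sigma> * \<phi>" "\<sigma> * \<phi> < pi / 2"
 shows "lateral_sum \<sigma> r \<phi> = 1 + (lateral_series \<sigma> r \<phi>)"
  and "summable (%n. kz_coeff n * lat_term (rcis r \<phi>) (loc n) (lat_limit \<sigma> r \<phi>))"
proof -
 obtain \<theta> where \<theta>: "0 < \<sigma> * \<theta>" "\<sigma> * \<theta> < 2 * pi" "\<bar>\<phi> + \<theta>\<bar> < pi / 2" by (rule rotated_ray_exists[OF \<sigma> \<phi>])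
 define L where "L = (lateral_series \<sigma> r \<phi>)"
 have L: "has_lateral_laplace \<sigma> r \<phi> L" unfolding L_def by (rule has_lateral_laplace_kz[OF r \<sigma>])
 have "(THE L. has_lateral_laplace \<sigma> r \<phi> L) = L"
 proof (rule the_equality)
  show "has_lateral_laplace \<sigma> r \<phi> L" by (rule L)
  fix L' assume L': "has_lateral_laplace \<sigma> r \<phi> L'"
  have ray: "has_laplace_along kz_borel (ray \<theta>) (rcis r \<phi>) L''" if "has_lateral_laplace \<sigma> r \<phi> L''" for L''
   using that \<theta> unfolding has_lateral_laplace_def by blast
  have "continuous_on {0..} (ray \<theta>)" unfolding ray_def[abs_def] by (intro continuous_intros)
  thus "L' = L" by (rule has_laplace_along_unique[OF ray[OF L'] ray[OF L]])
 qed
 thus "lateral_sum \<sigma> r \<phi> = 1 + L" by (simp add: lateral_sum_def kz_series_0)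
 show "summable (%n. kz_coeff n * lat_term (rcis r \<phi>) (loc n) (lat_limit \<sigma> r \<phi>))"
  by (rule lateral_ray(2)[OF r \<sigma> \<theta> coeff_ok_kz kz_borel_germ])
qed

lemma lateral_sum_eta:
 assumes r: "r > 0" and \<sigma>: "\<sigma> \<in> {1, -1 :: real}" and \<phi>: "- 5 * pi / 2 < \<sigma> * \<phi>" "\<sigma> * \<phi> < pi / 2"
  and \<eta>: "0 < \<sigma> * \<eta>" "\<sigma> * \<eta> < 2 * pi" "\<bar>\<phi> + \<eta>\<bar> < pi / 2"
 shows "eta_integrand (rcis r \<phi>) (\<phi> + \<eta>) integrable_on {0..}"
  and "lateral_sum \<sigma> r \<phi> = of_real (sqrt 3) * eta_integral (rcis r \<phi>) (\<phi> + \<eta>)"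
 using lateral_value_eta[OF r \<sigma> \<eta>] unfolding lateral_sum_eq(1)[OF r \<sigma> \<phi>] by simp_all

section \<open>Integrals of the continuation over paths to regular points\<close>

text \<open>The series of primitives converges locally uniformly once it converges at one point.\<close>

lemma prim_series:
 assumes c: "coeff_ok c K" and aw: "away \<kappa> z0" and w: "roots_at w z0" and x: "x ~= 0"
  and z1: "z1 \<in> ball z0 (\<kappa> / 2)" "summable (%n. c n * J_prim x (loc n) (branch_root n (w n) z0 z1))"
  and z: "z \<in> ball z0 (\<kappa> / 2)"
 shows "summable (%n. c n * J_prim x (loc n) (branch_root n (w n) z0 z))"
  and "((%z. \<Sum>n. c n * J_prim x (loc n) (branch_root n (w n) z0 z)) has_field_derivative
      exp (- (x * z)) * branch_sum c w z0 z) (at z)"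
proof -
 define S where "S = ball z0 (\<kappa> / 2)"
 have k0: "\<kappa> > 0" using aw by (simp add: away_def)
 have cz: "c n = 0" if "chi12 n = 0" for n using c that by (simp add: coeff_ok_def)
 define f' where "f' n z = exp (- (x * z)) * (c n / branch_root n (w n) z0 z ^ 5)" for n z
 define M where "M = exp (norm x * (norm z0 + \<kappa> / 2)) * (K * away_const (\<kappa> / 2) (norm z0 + \<kappa> / 2))"
 have nz: "norm z \<le> norm z0 + \<kappa> / 2" if "z \<in> S" for z
 proof -
  have "norm z \<le> norm z0 + norm (z - z0)" by (metis add.commute diff_add_cancel norm_triangle_ineq)
  thus ?thesis using that by (simp add: S_def dist_norm norm_minus_commute)
 qed
 have bnd: "norm (c n / branch_root n (w n) z0 z ^ 5) \<le> K * away_const (\<kappa> / 2) (norm z0 + \<kappa> / 2) * (real n / real n ^ 5)"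
  if "z \<in> S" for n z
 proof (rule coeff_term_bound[OF c away_half[OF aw] nz[OF that]])
  show "z \<in> ball z0 (\<kappa> / 2)" using that by (simp add: S_def)
  assume n: "chi12 n ~= 0"
  show "branch_root n (w n) z0 z ^ 2 = cloc n - z"
   by (rule branch_root_sq) (use w n away_not_eq[OF aw n] in \<open>auto simp: roots_at_def\<close>)
 qed
 have M: "norm (f' n z) \<le> M * (real n / real n ^ 5)" if "z \<in> S" for n z
 proof -
  have "norm (exp (- (x * z))) \<le> exp (norm x * (norm z0 + \<kappa> / 2))"
  proof -
   have "norm (exp (- (x * z))) \<le> exp (norm (- (x * z)))" by (rule norm_exp)
   also have "norm (- (x * z)) \<le> norm x * (norm z0 + \<kappa> / 2)"
    unfolding norm_minus_cancel norm_mult by (intro mult_left_mono nz that) simp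
   finally show ?thesis by simp
  qed
  hence "norm (f' n z) \<le> exp (norm x * (norm z0 + \<kappa> / 2)) * (K * away_const (\<kappa> / 2) (norm z0 + \<kappa> / 2) * (real n / real n ^ 5))"
   unfolding f'_def norm_mult by (intro mult_mono bnd that) simp_all
  thus ?thesis by (simp add: M_def mult.assoc)
 qed
 have f: "((%z. c n * J_prim x (loc n) (branch_root n (w n) z0 z)) has_field_derivative f' n z) (at z within S)"
  if zS: "z \<in> S" for n z
 proof (cases "chi12 n = 0")
  case True
  thus ?thesis by (simp add: cz f'_def)
 next
  case False
  have lt: "norm (z - z0) < norm (cloc n - z0)"
  proof -
   have "\<kappa> \<le> norm (cloc n - z0)" using aw False by (auto simp: away_def)
   moreover have "norm (z - z0) < \<kappa> / 2" using zS by (simp add: S_def dist_norm norm_minus_commute)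
   ultimately show ?thesis using k0 by linarith
  qed
  have "z ~= cloc n" using lt by auto
  with J_prim_branch_deriv[OF x lt] w False
  have "((%z. J_prim x (loc n) (branch_root n (w n) z0 z)) has_field_derivative exp (- (x * z)) / branch_root n (w n) z0 z ^ 5) (at z)"
   by (auto simp: roots_at_def)
  from DERIV_cmult[OF has_field_derivative_at_within[OF this], of "c n" S] show ?thesis by (simp add: f'_def mult_ac)
 qed
 have cS: "convex S" by (simp add: S_def)
 have u: "uniformly_convergent_on S (%n z. \<Sum>i<n. f' i z)"
  by (rule Weierstrass_m_test'[OF M summable_inverse_5])
 have zi: "z \<in> interior S" using z by (simp add: S_def interior_open)
 have z1S: "z1 \<in> S" using z1(1) by (simp add: S_def)
 note R = has_field_derivative_series'[OF cS f u z1S z1(2) zi]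
 show "summable (%n. c n * J_prim x (loc n) (branch_root n (w n) z0 z))" by (rule R(1))
 have "summable (%n. c n / branch_root n (w n) z0 z ^ 5)"
  by (rule summable_comparison_test'[OF summable_inverse_5 bnd]) (use z in \<open>simp add: S_def\<close>)
 hence "(\<Sum>n. f' n z) = exp (- (x * z)) * branch_sum c w z0 z"
  unfolding f'_def branch_sum_def by (rule suminf_mult)
 with R(2) show "((%z. \<Sum>n. c n * J_prim x (loc n) (branch_root n (w n) z0 z)) has_field_derivative
      exp (- (x * z)) * branch_sum c w z0 z) (at z)" by simp
qed

definition path_prim :: "(nat => complex) => complex => (nat => real => complex) => real => complex" where
 "path_prim c x w t = (\<Sum>n. c n * J_prim x (loc n) (w n t))"

lemma path_prim_terms_local:
 assumes T: "convex T" and \<gamma>: "continuous_on T \<gamma>" "\<gamma> ` T \<subseteq> sing_compl"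
  and w: "root_family \<gamma> T w" and c: "coeff_ok c K" and t: "t \<in> T" and aw: "away \<kappa> (\<gamma> t)"
 shows "\<forall>\<^sub>F s in at t within T. s \<in> T \<and> \<gamma> s \<in> ball (\<gamma> t) (\<kappa> / 2) \<and>
   (%n. c n * J_prim x (loc n) (w n s)) = (%n. c n * J_prim x (loc n) (branch_root n (w n t) (\<gamma> t) (\<gamma> s)))"
 using root_family_local[OF T \<gamma> w t aw]
proof eventually_elim
 case (elim s)
 have "c n * J_prim x (loc n) (w n s) = c n * J_prim x (loc n) (branch_root n (w n t) (\<gamma> t) (\<gamma> s))" for n
  using c elim by (cases "chi12 n = 0") (simp_all add: coeff_ok_def)
 thus ?case using elim by (simp add: fun_eq_iff)
qed

lemma path_prim_terms_self:
 assumes c: "coeff_ok c K" and aw: "away \<kappa> z0"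
 shows "(%n. c n * J_prim x (loc n) (branch_root n (u n) z0 z0)) = (%n. c n * J_prim x (loc n) (u n))"
proof
 fix n
 show "c n * J_prim x (loc n) (branch_root n (u n) z0 z0) = c n * J_prim x (loc n) (u n)"
  using c away_not_eq[OF aw] by (cases "chi12 n = 0") (simp_all add: coeff_ok_def branch_root_self)
qed

lemma path_prim_summable:
 assumes T: "convex T" "0 \<in> T" and \<gamma>: "continuous_on T \<gamma>" "\<gamma> ` T \<subseteq> sing_compl"
  and w: "root_family \<gamma> T w" and c: "coeff_ok c K" and x: "x ~= 0" and t: "t \<in> T"
 shows "summable (%n. c n * J_prim x (loc n) (w n t))"
proof -
 define P where "P t \<longleftrightarrow> summable (%n. c n * J_prim x (loc n) (w n t))" for t
 have "P 0 = P t"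
 proof (rule connected_local_const[OF convex_connected[OF T(1)] T(2) t]; intro ballI)
  fix t assume t: "t \<in> T"
  have "\<gamma> t \<in> sing_compl" using t \<gamma>(2) by blast
  then obtain \<kappa> where aw: "away \<kappa> (\<gamma> t)" by (rule away_exists)
  have k0: "\<kappa> > 0" using aw by (simp add: away_def)
  note PS = prim_series(1)[OF c aw root_family_roots_at[OF w t] x]
  have tb: "\<gamma> t \<in> ball (\<gamma> t) (\<kappa> / 2)" using k0 by simp
  show "\<forall>\<^sub>F s in at t within T. P t = P s"
   using path_prim_terms_local[OF T(1) \<gamma> w c t aw, of x]
  proof eventually_elim
   case (elim s)
   hence sb: "\<gamma> s \<in> ball (\<gamma> t) (\<kappa> / 2)"
    and eq: "(%n. c n * J_prim x (loc n) (w n s)) = (%n. c n * J_prim x (loc n) (branch_root n (w n t) (\<gamma> t) (\<gamma> s)))" by blast+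
   show ?case unfolding P_def eq path_prim_terms_self[OF c aw, of x "%n. w n t", symmetric]
    by (rule iffI) (erule PS[OF tb _ sb], erule PS[OF sb _ tb])
  qed
 qed
 moreover have "(%n. c n * J_prim x (loc n) (w n 0)) = (%n. 0)"
 proof
  fix n show "c n * J_prim x (loc n) (w n 0) = 0"
   using c root_familyD(2)[OF w, of n] by (cases "chi12 n = 0") (simp_all add: coeff_ok_def J_prim_0)
 qed
 hence "P 0" unfolding P_def by simp
 ultimately show ?thesis unfolding P_def by simp
qed

lemma path_prim_local:
 assumes T: "convex T" "0 \<in> T" and \<gamma>: "continuous_on T \<gamma>" "\<gamma> ` T \<subseteq> sing_compl"
  and w: "root_family \<gamma> T w" and c: "coeff_ok c K" and x: "x ~= 0" and t: "t \<in> T"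
 obtains \<Psi> where "\<forall>\<^sub>F s in at t within T. \<Psi> (\<gamma> s) = path_prim c x w s" "\<Psi> (\<gamma> t) = path_prim c x w t"
   "(\<Psi> has_field_derivative exp (- (x * \<gamma> t)) * (\<Sum>n. c n / w n t ^ 5)) (at (\<gamma> t))"
proof -
 have "\<gamma> t \<in> sing_compl" using t \<gamma>(2) by blast
 then obtain \<kappa> where aw: "away \<kappa> (\<gamma> t)" by (rule away_exists)
 have k0: "\<kappa> > 0" using aw by (simp add: away_def)
 have tb: "\<gamma> t \<in> ball (\<gamma> t) (\<kappa> / 2)" using k0 by simp
 define \<Psi> where "\<Psi> z = (\<Sum>n. c n * J_prim x (loc n) (branch_root n (w n t) (\<gamma> t) z))" for z
 show ?thesis
 proof (rule that)
  show "\<forall>\<^sub>F s in at t within T. \<Psi> (\<gamma> s) = path_prim c x w s"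
   using path_prim_terms_local[OF T(1) \<gamma> w c t aw, of x]
   by eventually_elim (simp add: \<Psi>_def path_prim_def)
  show "\<Psi> (\<gamma> t) = path_prim c x w t" by (simp add: \<Psi>_def path_prim_def path_prim_terms_self[OF c aw, of x "%n. w n t"])
  have "summable (%n. c n * J_prim x (loc n) (branch_root n (w n t) (\<gamma> t) (\<gamma> t)))"
   unfolding path_prim_terms_self[OF c aw, of x "%n. w n t"] by (rule path_prim_summable[OF T \<gamma> w c x t])
  from prim_series(2)[OF c aw root_family_roots_at[OF w t] x tb this tb]
  show "(\<Psi> has_field_derivative exp (- (x * \<gamma> t)) * (\<Sum>n. c n / w n t ^ 5)) (at (\<gamma> t))"
   unfolding \<Psi>_def branch_sum_self[OF c aw] .
 qed
qed

lemma path_prim_continuous: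
 assumes T: "convex T" "0 \<in> T" and \<gamma>: "continuous_on T \<gamma>" "\<gamma> ` T \<subseteq> sing_compl"
  and w: "root_family \<gamma> T w" and c: "coeff_ok c K" and x: "x ~= 0"
 shows "continuous_on T (path_prim c x w)"
 unfolding continuous_on_def
proof
 fix t assume t: "t \<in> T"
 obtain \<Psi> where \<Psi>: "\<forall>\<^sub>F s in at t within T. \<Psi> (\<gamma> s) = path_prim c x w s" "\<Psi> (\<gamma> t) = path_prim c x w t"
   "(\<Psi> has_field_derivative exp (- (x * \<gamma> t)) * (\<Sum>n. c n / w n t ^ 5)) (at (\<gamma> t))"
  by (rule path_prim_local[OF T \<gamma> w c x t])
 have "(\<gamma> \<longlongrightarrow> \<gamma> t) (at t within T)" using \<gamma>(1) t by (simp add: continuous_on_def)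
 hence "((%s. \<Psi> (\<gamma> s)) \<longlongrightarrow> \<Psi> (\<gamma> t)) (at t within T)" by (rule isCont_tendsto_compose[OF DERIV_isCont[OF \<Psi>(3)]])
 thus "(path_prim c x w \<longlongrightarrow> path_prim c x w t) (at t within T)"
  unfolding \<Psi>(2) using \<Psi>(1) by (rule Lim_transform_eventually)
qed

lemma path_prim_deriv:
 assumes T: "convex T" "0 \<in> T" and \<gamma>: "continuous_on T \<gamma>" "\<gamma> ` T \<subseteq> sing_compl"
  and w: "root_family \<gamma> T w" and c: "coeff_ok c K" and x: "x ~= 0" and t: "t \<in> interior T"
  and d: "(\<gamma> has_vector_derivative d) (at t)"
 shows "(path_prim c x w has_vector_derivative d * (exp (- (x * \<gamma> t)) * (\<Sum>n. c n / w n t ^ 5))) (at t)"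
proof -
 have tT: "t \<in> T" using t interior_subset by blast
 obtain \<Psi> where \<Psi>: "\<forall>\<^sub>F s in at t within T. \<Psi> (\<gamma> s) = path_prim c x w s" "\<Psi> (\<gamma> t) = path_prim c x w t"
   "(\<Psi> has_field_derivative exp (- (x * \<gamma> t)) * (\<Sum>n. c n / w n t ^ 5)) (at (\<gamma> t))"
  by (rule path_prim_local[OF T \<gamma> w c x tT])
 have 1: "(\<Psi> \<circ> \<gamma> has_vector_derivative d * (exp (- (x * \<gamma> t)) * (\<Sum>n. c n / w n t ^ 5))) (at t)"
  by (rule field_vector_diff_chain_at[OF d \<Psi>(3)])
 have "at t within T = at t" using t by (rule at_within_interior)
 with \<Psi>(1) have 2: "\<forall>\<^sub>F s in at t. (\<Psi> \<circ> \<gamma>) s = path_prim c x w s" by simp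
 have 3: "(\<Psi> \<circ> \<gamma>) t = path_prim c x w t" using \<Psi>(2) by simp
 show ?thesis
  using has_derivative_transform_eventually[OF 1[unfolded has_vector_derivative_def] 2 3]
  by (simp add: has_vector_derivative_def)
qed

text \<open>The derivative of the path may be unbounded near its corners; the fundamental theorem with
finitely many exceptional points does not need a bound.\<close>

lemma path_integral_prim:
 assumes p: "p > 0" and g1: "\<gamma> piecewise_C1_differentiable_on {0..p}" and \<gamma>: "\<gamma> ` {0..p} \<subseteq> sing_compl" "\<gamma> 0 = 0"
  and w: "root_family \<gamma> {0..p} w" and c: "coeff_ok c K" and x: "x ~= 0"
  and h: "germ_eq h c" and g: "continuation_along h \<gamma> {0..p} g"
 shows "((laplace_integrand g \<gamma> x {0..p})
      has_integral path_prim c x w p) {0..p}"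
proof -
 from g1 obtain S D where gc: "continuous_on {0..p} \<gamma>" and S: "finite S"
  and D: "\<And>t. t \<in> {0..p} - S ==> (\<gamma> has_vector_derivative D t) (at t)"
  unfolding piecewise_C1_differentiable_on_def C1_differentiable_on_def by blast
 have T: "convex {0..p}" "0 \<in> {0..p}" using p by auto
 have "((laplace_integrand g \<gamma> x {0..p})
      has_integral path_prim c x w p - path_prim c x w 0) {0..p}"
 proof (rule fundamental_theorem_of_calculus_interior_strong[OF S])
  show "continuous_on {0..p} (path_prim c x w)" by (rule path_prim_continuous[OF T gc \<gamma>(1) w c x])
  fix t assume "t \<in> {0<..<p} - S"
  hence t: "t \<in> interior {0..p}" "t \<in> {0..p} - S" "t \<in> {0..p}" by auto
  note d = D[OF t(2)]
  have "at t within {0..p} = at t" using t(1) by (rule at_within_interior)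
  hence "vector_derivative \<gamma> (at t within {0..p}) = D t" using vector_derivative_at[OF d] by simp
  moreover have "g t (\<gamma> t) = (\<Sum>n. c n / w n t ^ 5)" by (rule continuation_germ(2)[OF T gc \<gamma> w c h g t(3)])
  ultimately show "(path_prim c x w has_vector_derivative
     exp (- (x * \<gamma> t)) * g t (\<gamma> t) * vector_derivative \<gamma> (at t within {0..p})) (at t)"
   using path_prim_deriv[OF T gc \<gamma>(1) w c x t(1) d] by (simp add: mult_ac)
 qed (use p in simp)
 moreover have "c n * J_prim x (loc n) (w n 0) = 0" for n
  using c root_familyD(2)[OF w, of n] by (cases "chi12 n = 0") (simp_all add: coeff_ok_def J_prim_0)
 hence "path_prim c x w 0 = 0" by (simp only: path_prim_def suminf_zero)
 ultimately show ?thesis by simp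
qed

section \<open>Addresses\<close>

definition side :: "bool => real" where "side e = (if e then 1 else -1)"

lemma side_cases: "side e \<in> {1, -1}" by (simp add: side_def)

text \<open>The value of the \<open>n\<close>-th root at the end of any path with the address \<open>es\<close>. For \<open>loc n > p\<close> the index is
out of range, but then both sides give the positive root.\<close>

definition addr_root :: "bool list => nat => complex => complex" where
 "addr_root es n z = side_root (side (es ! num_sing (loc n))) (cloc n - z)"

lemma address_path_facts:
 assumes p: "p > 0" "p \<notin> sing_set" and a: "address_path es p \<gamma>"
 shows "continuous_on {0..p} \<gamma>" "\<gamma> ` {0..p} \<subseteq> sing_compl" "\<gamma> 0 = 0" "\<gamma> p = of_real p"
  "root_family \<gamma> {0..p} (%n t. addr_root es n (\<gamma> t))"
proof -
 from a have g1: "\<gamma> piecewise_C1_differentiable_on {0..p}" and g0: "\<gamma> 0 = 0" and gp: "\<gamma> p = of_real p"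
  and Re: "\<And>t. t \<in> {0..p} ==> Re (\<gamma> t) = t"
  and Im: "\<And>s. s \<in> sing_set ==> s < p ==> (if es ! num_sing s then Im (\<gamma> s) > 0 else Im (\<gamma> s) < 0)"
  unfolding address_path_def by auto
 show gc: "continuous_on {0..p} \<gamma>" using g1 by (simp add: piecewise_C1_differentiable_on_def)
 show "\<gamma> 0 = 0" "\<gamma> p = of_real p" by (fact g0 gp)+
 have side: "side (es ! num_sing s) * Im (\<gamma> s) > 0" if "s \<in> sing_set" "s \<in> {0..p}" for s
 proof -
  have "s < p" using that p(2) by (cases "s = p") auto
  from Im[OF that(1) this] show ?thesis by (auto simp: side_def split: if_splits)
 qed
 show "\<gamma> ` {0..p} \<subseteq> sing_compl"
 proof
  fix z assume "z \<in> \<gamma> ` {0..p}"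
  then obtain t where t: "t \<in> {0..p}" "z = \<gamma> t" by blast
  show "z \<in> sing_compl"
  proof
   assume "z \<in> of_real ` sing_set"
   then obtain s where s: "s \<in> sing_set" "\<gamma> t = of_real s" using t by auto
   have "s = t" using Re[OF t(1)] s(2) by simp
   with side[OF s(1)] s(2) t(1) show False by simp
  qed
 qed
 show "root_family \<gamma> {0..p} (%n t. addr_root es n (\<gamma> t))"
  unfolding root_family_def addr_root_def
 proof (intro allI impI conjI ballI)
  fix n assume n: "chi12 n ~= 0"
  hence s: "loc n \<in> sing_set" unfolding sing_set_eq by blast
  show "continuous_on {0..p} (%t. side_root (side (es ! num_sing (loc n))) (cloc n - \<gamma> t))"
  proof (rule continuous_on_side_root[OF side_cases])
   show "continuous_on {0..p} (%t. cloc n - \<gamma> t)" by (intro continuous_intros gc)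
   fix t assume t: "t \<in> {0..p}" "Re (cloc n - \<gamma> t) = 0"
   hence "t = loc n" using Re by simp
   with side[OF s] t(1) show "side (es ! num_sing (loc n)) * Im (cloc n - \<gamma> t) < 0" by simp
  qed
  show "side_root (side (es ! num_sing (loc n))) (cloc n - \<gamma> 0) = of_real (sqrt (loc n))"
   unfolding g0 diff_zero by (rule side_root_pos[OF side_cases]) (simp add: loc_def)
  show "side_root (side (es ! num_sing (loc n))) (cloc n - \<gamma> t) ^ 2 = cloc n - \<gamma> t" for t
   by (rule side_root_sq[OF side_cases])
 qed
qed

lemma interpolation_exists:
 assumes "finite (A :: real set)" shows "\<exists>q :: real poly. \<forall>a\<in>A. poly q a = f a"
 using assms
proof (induction A rule: finite_induct)
 case (insert a A)
 then obtain q where q: "\<forall>b\<in>A. poly q b = f b" by blast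
 define m where "m = (\<Prod>b\<in>A. [:- b, 1:])"
 have mA: "poly m b = 0" if "b \<in> A" for b
  unfolding m_def poly_prod using that insert.hyps(1) by (auto intro!: prod_zero)
 have ma: "poly m a ~= 0" unfolding m_def poly_prod using insert.hyps by auto
 define q' where "q' = q + smult ((f a - poly q a) / poly m a) m"
 have "\<forall>b\<in>insert a A. poly q' b = f b" using q mA ma by (auto simp: q'_def)
 thus ?case by blast
qed simp

lemma finite_sing_below: "finite (sing_set \<inter> {..<p})"
proof (rule finite_subset)
 show "sing_set \<inter> {..<p} \<subseteq> loc ` {n. loc n < p}" unfolding sing_set_eq by auto
qed (simp add: finite_loc_less)

lemma sing_set_pos: "s \<in> sing_set ==> s > 0"
 unfolding sing_set_eq using chi12_imp_pos loc_pos by auto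

text \<open>The graph of a polynomial with prescribed signs at finitely many points.\<close>

lemma address_path_exists:
 assumes p: "p > 0"
 obtains \<gamma> where "address_path es p \<gamma>"
proof -
 obtain q :: "real poly" where q: "\<forall>s\<in>sing_set \<inter> {..<p}. poly q s = side (es ! num_sing s)"
  using interpolation_exists[OF finite_sing_below, of p "%s. side (es ! num_sing s)"] by blast
 (* The two linear factors fix the endpoints and are positive in between. *)
 define y where "y = [:0, 1:] * ([:p, -1:] * q)"
 have y: "poly y t = t * ((p - t) * poly q t)" for t by (simp add: y_def algebra_simps)
 define \<gamma> where "\<gamma> t = of_real t + of_real (poly y t) * \<i>" for t
 have "address_path es p \<gamma>"
  unfolding address_path_def
 proof (intro conjI ballI)
  have d: "(\<gamma> has_vector_derivative (1 + of_real (poly (pderiv y) t) * \<i>)) (at t)" for t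
   unfolding \<gamma>_def[abs_def]
   by (intro has_vector_derivative_add has_vector_derivative_mult_left has_vector_derivative_of_real)
     (auto intro!: derivative_eq_intros poly_DERIV simp: has_real_derivative_iff_has_vector_derivative[symmetric])
  have "\<gamma> C1_differentiable_on {0..p}"
   unfolding C1_differentiable_on_def
   by (intro exI[of _ "%t. 1 + of_real (poly (pderiv y) t) * \<i>"] conjI ballI d continuous_intros)
  thus "\<gamma> piecewise_C1_differentiable_on {0..p}" by (rule C1_differentiable_imp_piecewise)
  show "\<gamma> 0 = 0" "\<gamma> p = of_real p" by (simp_all add: \<gamma>_def y)
  show "Re (\<gamma> t) = t" for t by (simp add: \<gamma>_def)
  fix s assume s: "s \<in> sing_set \<inter> {..<p}"
  hence "Im (\<gamma> s) = s * (p - s) * side (es ! num_sing s)" using q by (simp add: \<gamma>_def y)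
  moreover have "s * (p - s) > 0" using s sing_set_pos by simp
  ultimately show "if es ! num_sing s then 0 < Im (\<gamma> s) else Im (\<gamma> s) < 0"
   by (auto simp: side_def)
 qed
 thus ?thesis by (rule that)
qed

lemma address_value_eq:
 assumes p: "p > 0" "p \<notin> sing_set" and c: "coeff_ok c K" and h: "germ_eq h c"
 shows "address_value h es p = (\<Sum>n. c n / addr_root es n (of_real p) ^ 5)"
proof -
 have T: "convex {0..p}" "0 \<in> {0..p}" "p \<in> {0..p}" using p by auto
 obtain \<gamma> where a: "address_path es p \<gamma>" by (rule address_path_exists[OF p(1)])
 note F = address_path_facts[OF p]
 have val: "g p (of_real p) = (\<Sum>n. c n / addr_root es n (of_real p) ^ 5)"
  if a: "address_path es p \<gamma>" and g: "continuation_along h \<gamma> {0..p} g" for \<gamma> g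
  using continuation_germ(2)[OF T(1,2) F(1-3)[OF a] F(5)[OF a] c h g T(3)] unfolding F(4)[OF a] .
 show ?thesis unfolding address_value_def
 proof (rule the_equality)
  have "continuation_along h \<gamma> {0..p} (%t. branch_sum c (%n. addr_root es n (\<gamma> t)) (\<gamma> t))"
   by (rule canonical_continuation[OF T(1,2) F(1-3)[OF a] F(5)[OF a] c h])
  with a val[OF a this]
  show "\<exists>\<gamma> g. address_path es p \<gamma> \<and> continuation_along h \<gamma> {0..p} g \<and>
    (\<Sum>n. c n / addr_root es n (of_real p) ^ 5) = g p (of_real p)" by metis
 qed (use val in auto)
qed

lemma address_integral_eq:
 assumes p: "p > 0" "p \<notin> sing_set" and c: "coeff_ok c K" and h: "germ_eq h c" and x: "x ~= 0"
 shows "address_integral h x es p = (\<Sum>n. c n * J_prim x (loc n) (addr_root es n (of_real p)))"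
  and "summable (%n. c n * J_prim x (loc n) (addr_root es n (of_real p)))"
proof -
 have T: "convex {0..p}" "0 \<in> {0..p}" "p \<in> {0..p}" using p by auto
 obtain \<gamma> where a: "address_path es p \<gamma>" by (rule address_path_exists[OF p(1)])
 note F = address_path_facts[OF p]
 show "summable (%n. c n * J_prim x (loc n) (addr_root es n (of_real p)))"
  using path_prim_summable[OF T(1,2) F(1,2)[OF a] F(5)[OF a] c x T(3)] unfolding F(4)[OF a] .
 have val: "((laplace_integrand g \<gamma> x {0..p}) has_integral
    (\<Sum>n. c n * J_prim x (loc n) (addr_root es n (of_real p)))) {0..p}"
  if a: "address_path es p \<gamma>" and g: "continuation_along h \<gamma> {0..p} g" for \<gamma> g
 proof -
  have "\<gamma> piecewise_C1_differentiable_on {0..p}" using a by (simp add: address_path_def)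
  from path_integral_prim[OF p(1) this F(2,3)[OF a] F(5)[OF a] c x h g]
  show ?thesis unfolding path_prim_def F(4)[OF a] .
 qed
 show "address_integral h x es p = (\<Sum>n. c n * J_prim x (loc n) (addr_root es n (of_real p)))"
  unfolding address_integral_def
 proof (rule the_equality)
  have "continuation_along h \<gamma> {0..p} (%t. branch_sum c (%n. addr_root es n (\<gamma> t)) (\<gamma> t))"
   by (rule canonical_continuation[OF T(1,2) F(1-3)[OF a] F(5)[OF a] c h])
  with a val[OF a this]
  show "\<exists>\<gamma> g. address_path es p \<gamma> \<and> continuation_along h \<gamma> {0..p} g \<and>
    ((laplace_integrand g \<gamma> x {0..p}) has_integral
    (\<Sum>n. c n * J_prim x (loc n) (addr_root es n (of_real p)))) {0..p}" by blast
  fix I assume "\<exists>\<gamma> g. address_path es p \<gamma> \<and> continuation_along h \<gamma> {0..p} g \<and>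
    ((laplace_integrand g \<gamma> x {0..p}) has_integral I) {0..p}"
  then obtain \<gamma> g where "address_path es p \<gamma>" "continuation_along h \<gamma> {0..p} g" and
   I: "((laplace_integrand g \<gamma> x {0..p}) has_integral I) {0..p}" by blast
  from has_integral_unique[OF I val[OF this(1,2)]] show "I = (\<Sum>n. c n * J_prim x (loc n) (addr_root es n (of_real p)))" .
 qed
qed

section \<open>Weights\<close>

lemma finite_addresses [simp]: "finite {es :: bool list. length es = k}"
 using finite_lists_length_eq[of "UNIV :: bool set" k] by simp

lemma weights_total:
 assumes "is_average m" shows "(\<Sum>es | length es = k. m es) = 1"
proof (induction k)
 case 0
 have "m [] = 1" using assms unfolding is_average_def by (rule conjunct1)
 thus ?case by simp
next
 case (Suc k)
 define A where "A b = (%es. es @ [b]) ` {es :: bool list. length es = k}" for b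
 have split: "{es :: bool list. length es = Suc k} = A True \<union> A False"
 proof (rule set_eqI)
  fix es :: "bool list"
  show "es \<in> {es. length es = Suc k} \<longleftrightarrow> es \<in> A True \<union> A False"
  proof
   assume "es \<in> {es. length es = Suc k}"
   hence l: "length es = Suc k" by simp
   hence ne: "es ~= []" by (rule_tac notI) simp
   have "es = butlast es @ [last es]" using ne by simp
   moreover have "butlast es \<in> {es. length es = k}" using l by simp
   ultimately have "es \<in> A (last es)" unfolding A_def by (rule image_eqI)
   thus "es \<in> A True \<union> A False" by (cases "last es") simp_all
  next
   assume "es \<in> A True \<union> A False"
   thus "es \<in> {es. length es = Suc k}" unfolding A_def by (elim UnE imageE) simp_all
  qed
 qed
 have dis: "A True \<inter> A False = {}"
 proof (rule equals0I)
  fix es assume "es \<in> A True \<inter> A False"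
  hence "last es = True" "last es = False" unfolding A_def by (elim IntE imageE, simp)+
  thus False by simp
 qed
 have fin: "finite (A b)" for b unfolding A_def by (intro finite_imageI finite_addresses)
 have A: "sum m (A b) = (\<Sum>es | length es = k. m (es @ [b]))" for b
  unfolding A_def by (subst sum.reindex) (simp_all add: inj_on_def)
 have "(\<Sum>es | length es = Suc k. m es) = (\<Sum>es | length es = k. m (es @ [True])) + (\<Sum>es | length es = k. m (es @ [False]))"
  unfolding split sum.union_disjoint[OF fin fin dis] A ..
 also have "\<dots> = (\<Sum>es | length es = k. m es)"
  unfolding sum.distrib[symmetric]
 proof (rule sum.cong[OF refl])
  show "m (es @ [True]) + m (es @ [False]) = m es" for es
   using conjunct2[OF assms[unfolded is_average_def], THEN spec, of es] by (rule sym)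
 qed
 finally show ?case unfolding Suc.IH .
qed

lemma med_sum:
 assumes "k > 0"
 shows "(\<Sum>es | length es = k. med es * f es) = (f (replicate k True) + f (replicate k False)) / 2"
proof -
 define A where "A = {replicate k True, replicate k False}"
 have ne: "replicate k True ~= replicate k False" using assms by (cases k) auto
 have "(\<Sum>es | length es = k. med es * f es) = (\<Sum>es\<in>A. med es * f es)"
 proof (rule sum.mono_neutral_right)
  show "A \<subseteq> {es. length es = k}" by (simp add: A_def)
  show "\<forall>es\<in>{es. length es = k} - A. med es * f es = 0"
  proof
   fix es assume es: "es \<in> {es. length es = k} - A"
   have "\<not> (\<forall>e\<in>set es. e)"
   proof
    assume "\<forall>e\<in>set es. e"
    hence "replicate (length es) True = es" by (intro replicate_length_same) auto
    thus False using es by (auto simp: A_def)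
   qed
   moreover have "\<not> (\<forall>e\<in>set es. \<not> e)"
   proof
    assume "\<forall>e\<in>set es. \<not> e"
    hence "replicate (length es) False = es" by (intro replicate_length_same) auto
    thus False using es by (auto simp: A_def)
   qed
   moreover have "es ~= []" using es assms by auto
   ultimately have "med es = 0" unfolding med_def by (simp only: simp_thms if_False)
   thus "med es * f es = 0" by simp
  qed
 qed simp
 also have "\<dots> = (f (replicate k True) + f (replicate k False)) / 2"
  using ne assms by (simp add: A_def med_def add_divide_distrib)
 finally show ?thesis .
qed

definition bias :: "weights => real => nat => complex" where
 "bias m p n = (\<Sum>es | length es = num_sing p. m es * of_real (side (es ! num_sing (loc n))))"

text \<open>All that enters the average of a branch sum: total weight 1, and at each singularity that has
been passed the two sides have equal weight.\<close>

definition balanced :: "weights => bool" where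
 "balanced m \<longleftrightarrow> (\<forall>k. (\<Sum>es | length es = k. m es) = 1) \<and>
   (\<forall>p n. chi12 n ~= 0 \<and> loc n < p \<and> p \<notin> sing_set \<longrightarrow> bias m p n = 0)"

lemma num_sing_less:
 assumes "chi12 n ~= 0" "loc n < p" shows "num_sing (loc n) < num_sing p"
 unfolding num_sing_def
proof (rule psubset_card_mono[OF finite_sing_below])
 have "loc n \<in> sing_set" using assms(1) unfolding sing_set_eq by blast
 thus "sing_set \<inter> {..<loc n} \<subset> sing_set \<inter> {..<p}" using assms(2) by auto
qed

lemma balanced_med: "balanced med"
 unfolding balanced_def
proof (intro conjI allI impI)
 show "(\<Sum>es | length es = k. med es) = 1" for k
  using med_sum[of k "%es. 1"] by (cases "k = 0") (simp_all add: med_def)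
 fix p n assume n: "chi12 n ~= 0 \<and> loc n < p \<and> p \<notin> sing_set"
 hence "num_sing (loc n) < num_sing p" using num_sing_less by blast
 thus "bias med p n = 0" unfolding bias_def by (subst med_sum) (auto simp: side_def)
qed

lemma addr_root_above:
 assumes "p < loc n" shows "addr_root es n (of_real p) = of_real (sqrt (loc n - p))"
proof -
 have "cloc n - complex_of_real p = of_real (loc n - p)" by simp
 thus ?thesis unfolding addr_root_def using side_root_pos[OF side_cases, of "loc n - p"] assms by simp
qed

lemma addr_root_below:
 assumes "loc n < p"
 shows "addr_root es n (of_real p) = - of_real (side (es ! num_sing (loc n))) * (\<i> * of_real (sqrt (p - loc n)))"
proof -
 have eq: "cloc n - complex_of_real p = - of_real (p - loc n)" by simp
 have "addr_root es n (of_real p) = of_real (sqrt (p - loc n)) * cis (- side (es ! num_sing (loc n)) * pi / 2)"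
  unfolding addr_root_def eq by (rule side_root_neg[OF side_cases]) (use assms in simp)
 also have "cis (- side (es ! num_sing (loc n)) * pi / 2) = - of_real (side (es ! num_sing (loc n))) * \<i>"
  by (auto simp: complex_eq_iff side_def)
 finally show ?thesis by simp
qed

text \<open>The probe: the germ of \<open>(N - z)\<^sup>-\<^sup>5\<^sup>/\<^sup>2\<close> for a single singularity.\<close>

definition probe :: "nat => nat => complex" where
 "probe k n = (if n = k then 1 else 0)"

lemma coeff_ok_probe: "chi12 k ~= 0 ==> coeff_ok (probe k) 1"
 using chi12_imp_pos[of k] by (auto simp: coeff_ok_def probe_def)

lemma suminf_probe: "(\<Sum>n. probe k n / f n) = 1 / f k"
proof -
 have "(%n. probe k n / f n) = (%n. if n = k then 1 / f n else 0)" by (auto simp: probe_def)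
 thus ?thesis using sums_unique[OF sums_single[of k "%n. 1 / f n"]] by simp
qed

lemma probe_real:
 assumes k: "chi12 k ~= 0"
 shows "\<forall>\<^sub>F t in nhds 0. germ_at_0 (probe k) (complex_of_real t) \<in> \<real>"
proof -
 have N: "loc k > 0" using chi12_imp_pos[OF k] by (rule loc_pos)
 have "\<forall>\<^sub>F t in nhds (0::real). t < loc k" using N by (intro order_tendstoD(2)[OF filterlim_ident])
 thus ?thesis
 proof eventually_elim
  fix t assume t: "t < loc k"
  have q: "(cloc k - complex_of_real t) / (cloc k - 0) = of_real ((loc k - t) / loc k)" by simp
  have "csqrt (of_real ((loc k - t) / loc k)) = of_real (sqrt ((loc k - t) / loc k))"
   by (rule of_real_sqrt[symmetric]) (use t N in simp)
  hence "branch_root k (of_real (sqrt (loc k))) 0 (of_real t) = of_real (sqrt (loc k) * sqrt ((loc k - t) / loc k))"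
   unfolding branch_root_def q by simp
  hence "germ_at_0 (probe k) (of_real t) = of_real (1 / (sqrt (loc k) * sqrt ((loc k - t) / loc k)) ^ 5)"
   unfolding germ_at_0_def branch_sum_def suminf_probe by simp
  thus "germ_at_0 (probe k) (complex_of_real t) \<in> \<real>" by (simp only: Reals_of_real)
 qed
qed

lemma probe_analytic:
 assumes k: "chi12 k ~= 0" shows "germ_at_0 (probe k) analytic_on {0}"
proof -
 have "0 \<notin> sing_set" using sing_set_pos by blast
 hence "(0::complex) \<in> sing_compl" by auto
 then obtain \<kappa> where aw: "away \<kappa> 0" by (rule away_exists)
 have r: "roots_at (%n. of_real (sqrt (loc n))) 0"
  by (simp add: roots_at_def loc_def flip: of_real_power)
 have "germ_at_0 (probe k) holomorphic_on ball 0 (\<kappa> / 2)"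
  unfolding germ_at_0_def[abs_def] by (rule branch_sum_holomorphic[OF coeff_ok_probe[OF k] aw r])
 moreover have "\<kappa> > 0" using aw by (simp add: away_def)
 ultimately show ?thesis unfolding analytic_on_def by (auto intro!: exI[of _ "\<kappa> / 2"])
qed

text \<open>Beyond the singularity the average of the probe is \<open>\<i>\<close> times a nonzero real number times the
bias, and the bias is real because the weights are.\<close>

lemma balanced_reality_preserving:
 assumes m: "is_average m" "reality_preserving m" shows "balanced m"
 unfolding balanced_def
proof (intro conjI allI impI)
 show "(\<Sum>es | length es = k. m es) = 1" for k by (rule weights_total[OF m(1)])
 fix p k assume k: "chi12 k ~= 0 \<and> loc k < p \<and> p \<notin> sing_set"
 hence kn: "chi12 k ~= 0" and lp: "loc k < p" and ps: "p \<notin> sing_set" by auto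
 have p: "p > 0" using loc_pos[OF chi12_imp_pos[OF kn]] lp by simp
 note c = coeff_ok_probe[OF kn]
 have "\<forall>\<^sub>F z in nhds 0. germ_at_0 (probe k) z = germ_at_0 (probe k) z" by simp
 note h = this
 have "average_value m (germ_at_0 (probe k)) p \<in> \<real>"
  using m(2) probe_analytic[OF kn] continuable_germ[OF c h] probe_real[OF kn] p ps unfolding reality_preserving_def by blast
 moreover define Q where "Q = 1 / sqrt (p - loc k) ^ 5"
 have Q: "Q > 0" using lp by (simp add: Q_def)
 have "address_value (germ_at_0 (probe k)) es p = of_real (side (es ! num_sing (loc k))) * (\<i> * of_real Q)" for es
 proof -
  define s where "s = complex_of_real (side (es ! num_sing (loc k)))"
  have s: "s = 1 \<or> s = -1" by (simp add: s_def side_def)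
  have "address_value (germ_at_0 (probe k)) es p = 1 / addr_root es k (of_real p) ^ 5"
   unfolding address_value_eq[OF p ps c h] by (rule suminf_probe)
  also have "\<dots> = s * (\<i> * of_real Q)"
  proof -
   define R where "R = complex_of_real (sqrt (p - loc k) ^ 5)"
   have R: "R ~= 0" using lp by (simp add: R_def)
   have i5: "\<i> ^ 5 = \<i>" by (simp add: power_numeral_reduce)
   have "(- s * (\<i> * of_real (sqrt (p - loc k)))) ^ 5 = (- s) ^ 5 * (\<i> ^ 5 * R)"
    by (simp only: power_mult_distrib R_def of_real_power)
   also have "\<dots> = - s * (\<i> * R)" unfolding i5 using s by auto
   finally have "1 / (- s * (\<i> * of_real (sqrt (p - loc k)))) ^ 5 = 1 / (- s * (\<i> * R))" by simp
   also have "\<dots> = s * (\<i> * (1 / R))" using s R by (auto simp: field_simps)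
   finally show ?thesis unfolding addr_root_below[OF lp] s_def[symmetric] by (simp add: R_def Q_def)
  qed
  finally show ?thesis unfolding s_def .
 qed
 hence "average_value m (germ_at_0 (probe k)) p = (\<i> * of_real Q) * bias m p k"
  unfolding average_value_def bias_def sum_distrib_left by (intro sum.cong refl) (simp only: mult_ac)
 ultimately have "(\<i> * of_real Q) * bias m p k \<in> \<real>" by simp
 moreover have "bias m p k \<in> \<real>" unfolding bias_def
  by (intro sum_in_Reals Reals_mult) (use m(2) in \<open>auto simp: reality_preserving_def\<close>)
 then obtain b where b: "bias m p k = of_real b" by (auto elim: Reals_cases)
 ultimately have "Im ((\<i> * of_real Q) * of_real b) = 0" by (simp add: complex_is_Real_iff)
 hence "b = 0" using Q by simp
 thus "bias m p k = 0" by (simp add: b)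
qed

section \<open>The average Laplace transform\<close>

text \<open>The primitive is compared with \<open>H y = C exp (a y) / (y + b)\<^sup>2\<close>; with \<open>b = 4 / a\<close> its derivative dominates.
The decay of order 2 in \<open>y\<close> makes the tail of the average summable against coefficients of size \<open>n\<close>.\<close>

lemma K4_exp_bound:
 assumes x: "Re x > 0" and d: "d > 0"
 obtains C where "C \<ge> 0" "\<And>y. y \<ge> d ==> norm (exp (- (x * of_real y)) * K4 x (of_real (sqrt y))) \<le> C / y ^ 2"
proof -
 define a where "a = Re x"
 have a: "a > 0" using x by (simp add: a_def)
 have x0: "x ~= 0" using x by auto
 define F where "F y = K4 x (of_real (sqrt y))" for y
 have Fd: "(F has_vector_derivative exp (x * of_real y) / (2 * of_real (sqrt y) ^ 5)) (at y)" if y: "y > 0" for y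
 proof -
  have R: "complex_of_real (sqrt y) ~= 0" "complex_of_real (sqrt y) ^ 2 = of_real y" using y by (simp_all flip: of_real_power)
  have "(sqrt has_real_derivative inverse (sqrt y) / 2) (at y)" by (rule DERIV_real_sqrt[OF y])
  hence "((%y. complex_of_real (sqrt y)) has_vector_derivative of_real (inverse (sqrt y) / 2)) (at y)"
   by (intro has_vector_derivative_of_real) (simp add: has_real_derivative_iff_has_vector_derivative)
  from field_vector_diff_chain_at[OF this K4_deriv[OF x0 R(1)]]
  have "(F has_vector_derivative of_real (inverse (sqrt y) / 2) * (exp (x * of_real (sqrt y) ^ 2) / of_real (sqrt y) ^ 4)) (at y)"
   by (simp add: F_def[abs_def] o_def)
  also have "of_real (inverse (sqrt y) / 2) * (exp (x * of_real (sqrt y) ^ 2) / of_real (sqrt y) ^ 4) = exp (x * of_real y) / (2 * of_real (sqrt y) ^ 5)"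
   unfolding R(2) using R(1) by (simp add: field_simps power_numeral_reduce)
  finally show ?thesis .
 qed
 define b where "b = 4 / a"
 have b: "b > 0" using a by (simp add: b_def)
 (* The first summand makes the derivative of H dominate that of F, the second one gives norm (F d) <= H d. *)
 define C where "C = (1 + b / d) ^ 2 / (a * sqrt d) + norm (F d) * (d + b) ^ 2 * exp (- (a * d))"
 have C: "(1 + b / d) ^ 2 / (a * sqrt d) \<le> C" "norm (F d) * (d + b) ^ 2 * exp (- (a * d)) \<le> C" "C \<ge> 0"
  using a b d by (simp_all add: C_def)
 define H where "H y = C * exp (a * y) / (y + b) ^ 2" for y
 have Hd: "(H has_vector_derivative C * exp (a * y) / (y + b) ^ 2 * (a - 2 / (y + b))) (at y)" if y: "y > 0" for y
 proof -
  define q where "q = y + b"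
  have q: "q > 0" using y b by (simp add: q_def)
  have "((%y. C * (exp (a * y) / (y + b) ^ 2)) has_real_derivative
    C * ((exp (a * y) * a * (y + b) ^ 2 - exp (a * y) * (2 * (y + b))) / ((y + b) ^ 2 * (y + b) ^ 2))) (at y)"
   by (rule DERIV_cmult, rule DERIV_divide) (use y b in \<open>auto intro!: derivative_eq_intros\<close>)
  also have "C * ((exp (a * y) * a * (y + b) ^ 2 - exp (a * y) * (2 * (y + b))) / ((y + b) ^ 2 * (y + b) ^ 2)) =
    C * exp (a * y) / (y + b) ^ 2 * (a - 2 / (y + b))"
   unfolding q_def[symmetric] using q by (simp add: field_simps power_numeral_reduce)
  finally show ?thesis unfolding H_def[abs_def] has_real_derivative_iff_has_vector_derivative by simp
 qed
 have le: "norm (exp (x * of_real y) / (2 * of_real (sqrt y) ^ 5)) \<le> C * exp (a * y) / (y + b) ^ 2 * (a - 2 / (y + b))" if y: "y \<ge> d" for y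
 proof -
  have y0: "y > 0" using y d by linarith
  have "y + b \<le> y * (1 + b / d)"
  proof -
   have "1 * b \<le> y / d * b" using y d b by (intro mult_right_mono) simp_all
   thus ?thesis by (simp add: algebra_simps)
  qed
  hence "(y + b) ^ 2 \<le> (y * (1 + b / d)) ^ 2" using y0 b by (intro power_mono) simp_all
  hence yb: "(y + b) ^ 2 \<le> y ^ 2 * (1 + b / d) ^ 2" by (simp only: power_mult_distrib)
  have s5: "sqrt y ^ 5 = y ^ 2 * sqrt y" using y0 by (simp add: power_numeral_reduce)
  have "(1 + b / d) ^ 2 / (a * sqrt y) \<le> (1 + b / d) ^ 2 / (a * sqrt d)"
   using a d y y0 by (intro divide_left_mono mult_left_mono) simp_all
  from order_trans[OF this C(1)] have "(1 + b / d) ^ 2 \<le> C * (a * sqrt y)" using a y0 by (simp add: pos_divide_le_eq)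
  hence "y ^ 2 * (1 + b / d) ^ 2 \<le> y ^ 2 * (C * (a * sqrt y))" by (rule mult_left_mono) simp
  with yb have "(y + b) ^ 2 \<le> C * a * sqrt y ^ 5" by (simp add: s5 mult_ac)
  hence "1 / (2 * sqrt y ^ 5) \<le> C / (y + b) ^ 2 * (a / 2)" using y0 b by (simp add: field_simps)
  moreover have "a / 2 \<le> a - 2 / (y + b)"
  proof -
   have "2 / (y + b) \<le> 2 / b" using y0 b by (intro divide_left_mono) simp_all
   thus ?thesis by (simp add: b_def)
  qed
  hence "C / (y + b) ^ 2 * (a / 2) \<le> C / (y + b) ^ 2 * (a - 2 / (y + b))" using C(3) by (intro mult_left_mono) simp_all
  ultimately have "exp (a * y) * (1 / (2 * sqrt y ^ 5)) \<le> exp (a * y) * (C / (y + b) ^ 2 * (a - 2 / (y + b)))"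
   by (intro mult_left_mono) simp_all
  moreover have "norm (exp (x * of_real y) / (2 * of_real (sqrt y) ^ 5)) = exp (a * y) * (1 / (2 * sqrt y ^ 5))"
   using y0 by (simp add: norm_divide norm_mult norm_power norm_exp_eq_Re a_def)
  ultimately show ?thesis by (simp add: mult_ac)
 qed
 have Fd_le: "norm (F d) \<le> H d"
 proof -
  have "norm (F d) * (d + b) ^ 2 * exp (- (a * d)) * exp (a * d) \<le> C * exp (a * d)" using C(2) by (rule mult_right_mono) simp
  thus ?thesis using d b by (simp add: H_def pos_le_divide_eq mult.assoc flip: exp_add)
 qed
 have FH: "norm (F y) \<le> H y" if y: "y \<ge> d" for y
 proof (cases "y = d")
  case False
  hence lt: "d < y" using y by simp
  have "norm (F y - F d) \<le> H y - H d"
  proof (rule differentiable_bound_general[OF lt])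
   show "continuous_on {d..y} F"
    by (rule continuous_on_vector_derivative[where f' = "%y. exp (x * of_real y) / (2 * of_real (sqrt y) ^ 5)"])
      (use Fd d in \<open>auto intro: has_vector_derivative_at_within\<close>)
   show "continuous_on {d..y} H"
    by (rule continuous_on_vector_derivative[where f' = "%y. C * exp (a * y) / (y + b) ^ 2 * (a - 2 / (y + b))"])
      (use Hd d in \<open>auto intro: has_vector_derivative_at_within\<close>)
   fix t assume t: "d < t" "t < y"
   have t0: "t > 0" using t d by linarith
   show "(F has_vector_derivative exp (x * of_real t) / (2 * of_real (sqrt t) ^ 5)) (at t)" by (rule Fd[OF t0])
   show "(H has_vector_derivative C * exp (a * t) / (t + b) ^ 2 * (a - 2 / (t + b))) (at t)" by (rule Hd[OF t0])
   show "norm (exp (x * of_real t) / (2 * of_real (sqrt t) ^ 5)) \<le> C * exp (a * t) / (t + b) ^ 2 * (a - 2 / (t + b))"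
    by (rule le) (use t in simp)
  qed
  thus ?thesis using Fd_le norm_triangle_ineq[of "F y - F d" "F d"] by simp
 qed (use Fd_le in simp)
 show ?thesis
 proof (rule that[OF C(3)])
  fix y assume y: "y \<ge> d"
  have "norm (exp (- (x * of_real y)) * F y) = exp (- (a * y)) * norm (F y)" by (simp add: norm_mult norm_exp_eq_Re a_def)
  also have "\<dots> \<le> exp (- (a * y)) * H y" by (intro mult_left_mono FH y) simp
  also have "\<dots> = C / (y + b) ^ 2" by (simp add: H_def flip: exp_add)
  also have "\<dots> \<le> C / y ^ 2" using C(3) y d b by (intro divide_left_mono power_mono) simp_all
  finally show "norm (exp (- (x * of_real y)) * K4 x (of_real (sqrt y))) \<le> C / y ^ 2" by (simp add: F_def)
 qed
qed

lemma lat_term_balance: "lat_term x N 0 = (lat_term x N Q + lat_term x N (- Q)) / 2"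
 by (simp add: lat_term_def algebra_simps)

lemma lat_limit_minus: "lat_limit (-1) r \<phi> = - lat_limit 1 r \<phi>"
proof -
 have "cis ((\<phi> + (-1) * pi) / 2) = - cis ((\<phi> + 1 * pi) / 2)"
  by (simp add: complex_eq_iff add_divide_distrib diff_divide_distrib cos_add sin_add cos_diff sin_diff)
 hence "lat_root (-1) r \<phi> = - lat_root 1 r \<phi>" unfolding lat_root_def by simp
 thus ?thesis by (simp add: lat_limit_def)
qed

lemma rcis_polar: "rcis (norm x) (Arg x) = x"
 by (simp add: rcis_cmod_Arg)

lemma Arg_half_plane: "Re x > 0 ==> \<bar>Arg x\<bar> < pi / 2"
 using Arg_Re_pos[of x] by simp

abbreviation averaged_integral :: "weights => (complex => complex) => complex => real => complex" where
 "averaged_integral m h x p \<equiv> \<Sum>es | length es = num_sing p. m es * address_integral h x es p"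

text \<open>A passed singularity contributes the same as half the sum of the two sides, because \<open>K4\<close> is odd
and the bias vanishes.\<close>

lemma average_integral_eq:
 assumes m: "balanced m" and p: "p > 0" "p \<notin> sing_set" and c: "coeff_ok c K"
  and h: "germ_eq h c" and x: "x ~= 0"
 shows "(%n. c n * (lat_term x (loc n) 0 - (if p < loc n then lat_term x (loc n) 0 - J_prim x (loc n) (of_real (sqrt (loc n - p))) else 0)))
   sums (averaged_integral m h x p)"
proof -
 note A = address_integral_eq[OF p c h x]
 have "(%n. \<Sum>es | length es = num_sing p. m es * (c n * J_prim x (loc n) (addr_root es n (of_real p)))) sums
   (averaged_integral m h x p)"
  unfolding A(1) by (intro sums_sum sums_mult summable_sums A(2))
 moreover have "(\<Sum>es | length es = num_sing p. m es * (c n * J_prim x (loc n) (addr_root es n (of_real p))))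
  = c n * (lat_term x (loc n) 0 - (if p < loc n then lat_term x (loc n) 0 - J_prim x (loc n) (of_real (sqrt (loc n - p))) else 0))" for n
 proof (cases "chi12 n = 0")
  case True
  hence "c n = 0" using c by (simp add: coeff_ok_def)
  thus ?thesis by simp
 next
  case n: False
  have tot: "(\<Sum>es | length es = num_sing p. m es) = 1" using m by (simp add: balanced_def)
  have "loc n ~= p" using n p(2) unfolding sing_set_eq by auto
  then consider "p < loc n" | "loc n < p" by linarith
  thus ?thesis
  proof cases
   case 1
   have "(\<Sum>es | length es = num_sing p. m es * (c n * J_prim x (loc n) (addr_root es n (of_real p))))
    = (\<Sum>es | length es = num_sing p. m es) * (c n * J_prim x (loc n) (of_real (sqrt (loc n - p))))"
    unfolding addr_root_above[OF 1] sum_distrib_right ..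
   thus ?thesis unfolding tot using 1 by simp
  next
   case 2
   define E where "E = 2 * exp (- (x * cloc n))"
   define Q where "Q = K4 x (\<i> * of_real (sqrt (p - loc n)))"
   have J: "J_prim x (loc n) (addr_root es n (of_real p)) = lat_term x (loc n) 0 + of_real (side (es ! num_sing (loc n))) * (E * Q)" for es
   proof -
    have "K4 x (addr_root es n (of_real p)) = - of_real (side (es ! num_sing (loc n))) * Q"
     unfolding addr_root_below[OF 2] Q_def side_def by (simp add: K4_minus)
    thus ?thesis by (simp add: J_prim_def lat_term_def E_def algebra_simps)
   qed
   have "(\<Sum>es | length es = num_sing p. m es * (c n * J_prim x (loc n) (addr_root es n (of_real p))))
    = (\<Sum>es | length es = num_sing p. m es * (c n * lat_term x (loc n) 0) +
       (m es * of_real (side (es ! num_sing (loc n)))) * (c n * (E * Q)))"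
    unfolding J by (intro sum.cong refl) (simp add: algebra_simps)
   also have "\<dots> = (\<Sum>es | length es = num_sing p. m es) * (c n * lat_term x (loc n) 0) + bias m p n * (c n * (E * Q))"
    unfolding sum.distrib bias_def sum_distrib_right ..
   also have "bias m p n = 0" using m n 2 p(2) by (simp add: balanced_def)
   finally show ?thesis unfolding tot using 2 by simp
  qed
 qed
 ultimately show ?thesis by (simp only:)
qed

lemma lat_term_zero_summable:
 assumes x: "Re x > 0" and c: "coeff_ok c K" and h: "germ_eq h c"
 shows "summable (%n. c n * lat_term x (loc n) 0)"
proof -
 define r where "r = norm x"
 define \<phi> where "\<phi> = Arg x"
 have r: "r > 0" using x by (auto simp: r_def)
 have xr: "x = rcis r \<phi>" by (simp add: r_def \<phi>_def rcis_polar)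
 have \<phi>: "\<bar>\<phi>\<bar> < pi / 2" unfolding \<phi>_def by (rule Arg_half_plane[OF x])
 have sg: "summable (%n. c n * lat_term x (loc n) (lat_limit \<sigma> r \<phi>))" if \<sigma>: "\<sigma> \<in> {1, -1}" for \<sigma>
 proof -
  have "\<bar>\<sigma> * \<phi>\<bar> < pi / 2" using \<phi> \<sigma> by auto
  hence b: "- 5 * pi / 2 < \<sigma> * \<phi>" "\<sigma> * \<phi> < pi / 2" by linarith+
  obtain \<theta> where \<theta>: "0 < \<sigma> * \<theta>" "\<sigma> * \<theta> < 2 * pi" "\<bar>\<phi> + \<theta>\<bar> < pi / 2"
   by (rule rotated_ray_exists[OF \<sigma> b])
  show ?thesis unfolding xr by (rule lateral_ray(2)[OF r \<sigma> \<theta> c h])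
 qed
 have "summable (%n. (c n * lat_term x (loc n) (lat_limit 1 r \<phi>) + c n * lat_term x (loc n) (lat_limit (-1) r \<phi>)) / 2)"
  by (intro summable_divide summable_add sg) simp_all
 thus ?thesis unfolding lat_limit_minus lat_term_balance[of x _ "lat_limit 1 r \<phi>"]
  by (simp add: algebra_simps add_divide_distrib)
qed

lemma summable_inverse_cube: "summable (%n. C * (1 / real n ^ 3))"
 using inverse_power_summable[of 3, where ?'a = real] by (intro summable_mult) (simp add: inverse_eq_divide)

text \<open>Only the singularities beyond \<open>p\<close> distinguish the average from its limit; their terms carry
the factor \<open>exp (- x p)\<close>.\<close>

lemma average_tail:
 assumes m: "balanced m" and c: "coeff_ok c K" and h: "germ_eq h c"
  and x: "Re x > 0" and d: "d > 0"
 obtains M where "\<And>p. p > 0 ==> (\<And>s. s \<in> sing_set ==> d \<le> \<bar>p - s\<bar>) ==>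
   norm ((averaged_integral m h x p) - (\<Sum>n. c n * lat_term x (loc n) 0))
    \<le> M * (exp (- (Re x * p)) * (1 + p / d) ^ 2)"
proof -
 have x0: "x ~= 0" using x by auto
 obtain C where C: "C \<ge> 0" "\<And>y. y \<ge> d ==> norm (exp (- (x * of_real y)) * K4 x (of_real (sqrt y))) \<le> C / y ^ 2"
  by (rule K4_exp_bound[OF x d]) blast
 have K0: "K \<ge> 0"
 proof -
  have "norm (c 1) \<le> K * real 1" using c unfolding coeff_ok_def by blast
  thus ?thesis using order_trans[OF norm_ge_zero] by fastforce
 qed
 define M where "M = 2 * K * C * (\<Sum>n. 1 / real n ^ 3)"
 show ?thesis
 proof (rule that[of M])
  fix p :: real assume p: "p > 0" and sep: "\<And>s. s \<in> sing_set ==> d \<le> \<bar>p - s\<bar>"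
  have ps: "p \<notin> sing_set" using sep[of p] d by auto
  define A where "A = (averaged_integral m h x p)"
  define L where "L = (\<Sum>n. c n * lat_term x (loc n) 0)"
  define B where "B = 2 * K * C * exp (- (Re x * p)) * (1 + p / d) ^ 2"
  have B0: "B \<ge> 0" using K0 C(1) by (simp add: B_def)
  define T where "T n = (if p < loc n then lat_term x (loc n) 0 - J_prim x (loc n) (of_real (sqrt (loc n - p))) else 0)" for n
  have "(%n. c n * (lat_term x (loc n) 0 - T n)) sums A"
   unfolding A_def T_def by (rule average_integral_eq[OF m p ps c h x0])
  from sums_diff[OF summable_sums[OF lat_term_zero_summable[OF x c h]] this]
  have s: "(%n. c n * T n) sums (L - A)" by (simp add: L_def algebra_simps)
  have bound: "norm (c n * T n) \<le> B * (1 / real n ^ 3)" for n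
  proof (cases "chi12 n = 0 \<or> \<not> p < loc n")
   case True
   hence z: "c n * T n = 0" using c by (auto simp: coeff_ok_def T_def)
   show ?thesis unfolding z using B0 by simp
  next
   case False
   hence n: "chi12 n ~= 0" "p < loc n" by auto
   have n0: "real n > 0" using chi12_imp_pos[OF n(1)] by simp
   define y where "y = loc n - p"
   have "loc n \<in> sing_set" using n(1) unfolding sing_set_eq by blast
   from sep[OF this] n(2) have yd: "y \<ge> d" "y > 0" by (auto simp: y_def)
   have "T n = 2 * exp (- (x * cloc n)) * K4 x (of_real (sqrt y))"
    using n(2) by (simp add: T_def lat_term_def J_prim_def y_def algebra_simps)
   also have "exp (- (x * cloc n)) = exp (- (x * of_real p)) * exp (- (x * of_real y))"
    unfolding exp_add[symmetric] by (simp add: y_def algebra_simps)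
   finally have T: "T n = 2 * exp (- (x * of_real p)) * (exp (- (x * of_real y)) * K4 x (of_real (sqrt y)))" by simp
   have e: "norm (2 * exp (- (x * of_real p))) = 2 * exp (- (Re x * p))" by (simp add: norm_mult norm_exp_eq_Re)
   have "norm (T n) \<le> 2 * exp (- (Re x * p)) * (C / y ^ 2)"
    unfolding T norm_mult[of "2 * exp (- (x * of_real p))"] e by (intro mult_left_mono C(2) yd(1)) simp
   moreover have "C / y ^ 2 \<le> C * ((1 + p / d) ^ 2 / real n ^ 4)"
   proof -
    have "1 * p \<le> (y / d) * p" using yd d p by (intro mult_right_mono) simp_all
    moreover have "y * (1 + p / d) = y + (y / d) * p" by (simp add: field_simps)
    moreover have "loc n = y + p" by (simp add: y_def)
    ultimately have "loc n \<le> y * (1 + p / d)" by linarith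
    moreover have "real n ^ 2 \<le> loc n" by (rule loc_ge_sq)
    ultimately have "real n ^ 2 \<le> y * (1 + p / d)" by linarith
    hence "(real n ^ 2) ^ 2 \<le> (y * (1 + p / d)) ^ 2" by (intro power_mono) simp_all
    hence "real n ^ 4 \<le> y ^ 2 * (1 + p / d) ^ 2" by (simp add: power_mult_distrib)
    hence "1 / y ^ 2 \<le> (1 + p / d) ^ 2 / real n ^ 4" using yd n0 by (simp add: field_simps)
    from mult_left_mono[OF this C(1)] show ?thesis by simp
   qed
   ultimately have "norm (T n) \<le> 2 * exp (- (Re x * p)) * (C * ((1 + p / d) ^ 2 / real n ^ 4))"
    using mult_left_mono[of "C / y ^ 2" "C * ((1 + p / d) ^ 2 / real n ^ 4)" "2 * exp (- (Re x * p))"] by simp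
   moreover have "norm (c n) \<le> K * real n" using c unfolding coeff_ok_def by blast
   ultimately have "norm (c n) * norm (T n) \<le> (K * real n) * (2 * exp (- (Re x * p)) * (C * ((1 + p / d) ^ 2 / real n ^ 4)))"
    using K0 by (intro mult_mono) simp_all
   also have "\<dots> = B * (real n / real n ^ 4)" by (simp add: B_def)
   also have "real n / real n ^ 4 = 1 / real n ^ 3" using n0 by (simp add: power_numeral_reduce)
   finally show ?thesis by (simp add: norm_mult)
  qed
  have "norm (L - A) \<le> (\<Sum>n. B * (1 / real n ^ 3))"
   unfolding sums_unique[OF s] by (rule norm_suminf_le[OF bound summable_inverse_cube])
  also have "\<dots> = B * (\<Sum>n. 1 / real n ^ 3)"
   by (rule suminf_mult) (use summable_inverse_cube[of 1] in simp)
  also have "\<dots> = M * (exp (- (Re x * p)) * (1 + p / d) ^ 2)" by (simp add: B_def M_def)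
  finally show "norm (A - L) \<le> M * (exp (- (Re x * p)) * (1 + p / d) ^ 2)" by (simp add: norm_minus_commute)
 qed
qed

lemma exp_poly_decay:
 assumes "a > 0" "d > (0::real)"
 shows "((%p. M * (exp (- (a * p)) * (1 + p / d) ^ 2)) \<longlongrightarrow> 0) at_top"
 using assms by real_asymp

lemma has_average_laplace_balanced:
 assumes m: "balanced m" and c: "coeff_ok c K" and h: "germ_eq h c" and x: "Re x > 0"
 shows "has_average_laplace m h x (\<Sum>n. c n * lat_term x (loc n) 0)"
 unfolding has_average_laplace_def
proof (intro allI impI)
 fix d :: real assume d: "d > 0"
 define S where "S = {p. \<forall>s\<in>sing_set. d \<le> \<bar>p - s\<bar>}"
 define L where "L = (\<Sum>n. c n * lat_term x (loc n) 0)"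
 obtain M where M: "\<And>p. p > 0 ==> (\<And>s. s \<in> sing_set ==> d \<le> \<bar>p - s\<bar>) ==>
   norm ((averaged_integral m h x p) - L)
    \<le> M * (exp (- (Re x * p)) * (1 + p / d) ^ 2)"
  unfolding L_def by (rule average_tail[OF m c h x d]) blast
 have "\<forall>\<^sub>F p in inf at_top (principal S). norm ((averaged_integral m h x p) - L)
    \<le> M * (exp (- (Re x * p)) * (1 + p / d) ^ 2)"
  unfolding eventually_inf_principal
  using eventually_gt_at_top[of "0::real"]
 proof eventually_elim
  case (elim p)
  show ?case
  proof
   assume "p \<in> S"
   hence "d \<le> \<bar>p - s\<bar>" if "s \<in> sing_set" for s using that unfolding S_def by blast
   from M[OF elim this] show "norm ((averaged_integral m h x p) - L)
    \<le> M * (exp (- (Re x * p)) * (1 + p / d) ^ 2)" .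
  qed
 qed
 moreover have "((%p. M * (exp (- (Re x * p)) * (1 + p / d) ^ 2)) \<longlongrightarrow> 0) (inf at_top (principal S))"
  by (rule tendsto_mono[OF inf_le1 exp_poly_decay[OF x d]])
 ultimately have "((%p. (averaged_integral m h x p) - L) \<longlongrightarrow> 0) (inf at_top (principal S))"
  by (rule Lim_null_comparison)
 thus "((%p. \<Sum>es | length es = num_sing p. m es * address_integral h x es p) \<longlongrightarrow> L) (inf at_top (principal S))"
  by (rule Lim_null[THEN iffD2])
qed

text \<open>Needed for the uniqueness of the limit: the filter is not trivial.\<close>

lemma regular_points_unbounded: "inf at_top (principal {p. \<forall>s\<in>sing_set. pi ^ 2 / 6 \<le> \<bar>p - s\<bar>}) ~= bot"
proof
 assume "inf at_top (principal {p. \<forall>s\<in>sing_set. pi ^ 2 / 6 \<le> \<bar>p - s\<bar>}) = bot"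
 hence "\<forall>\<^sub>F p in inf at_top (principal {p. \<forall>s\<in>sing_set. pi ^ 2 / 6 \<le> \<bar>p - s\<bar>}). False" by (simp add: trivial_limit_def[symmetric])
 then obtain b where b: "\<And>p. p \<ge> b ==> \<not> (\<forall>s\<in>sing_set. pi ^ 2 / 6 \<le> \<bar>p - s\<bar>)"
  unfolding eventually_inf_principal eventually_at_top_linorder by blast
 obtain k :: nat where k: "b \<le> real k" using real_arch_simple by blast
 have "real k \<le> real (12 * k)" by simp
 also have "\<dots> \<le> loc (12 * k)" by (rule loc_ge_real)
 finally have "b \<le> loc (12 * k)" using k by linarith
 have ne: "m ~= 12 * k" if "chi12 m ~= 0" for m
 proof
  assume "m = 12 * k"
  hence "m mod 12 = 0" by simp
  thus False using that by (simp add: chi12_def)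
 qed
 have "pi ^ 2 / 6 \<le> \<bar>loc (12 * k) - s\<bar>" if "s \<in> sing_set" for s
  using infdist_loc_ge[of "12 * k", OF ne] infdist_sing_le[OF that, of "loc (12 * k)"] by linarith
 thus False using b[OF \<open>b \<le> loc (12 * k)\<close>] by blast
qed

lemma average_sum_balanced:
 assumes m: "balanced m" and x: "Re x > 0"
 shows "has_average_laplace m kz_borel x (\<Sum>n. kz_coeff n * lat_term x (loc n) 0)"
  and "average_sum m x = 1 + (\<Sum>n. kz_coeff n * lat_term x (loc n) 0)"
proof -
 define L where "L = (\<Sum>n. kz_coeff n * lat_term x (loc n) 0)"
 show L: "has_average_laplace m kz_borel x L"
  unfolding L_def by (rule has_average_laplace_balanced[OF m coeff_ok_kz kz_borel_germ x])
 have "(THE L. has_average_laplace m kz_borel x L) = L"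
 proof (rule the_equality)
  show "has_average_laplace m kz_borel x L" by (rule L)
  fix L' assume L': "has_average_laplace m kz_borel x L'"
  have d: "pi ^ 2 / 6 > 0" by simp
  show "L' = L"
   using tendsto_unique[OF regular_points_unbounded L'[unfolded has_average_laplace_def, rule_format, OF d]
      L[unfolded has_average_laplace_def, rule_format, OF d]] .
 qed
 thus "average_sum m x = 1 + L" by (simp add: average_sum_def kz_series_0)
qed

lemma average_sum_lateral:
 assumes m: "balanced m" and x: "Re x > 0"
 shows "average_sum m x = (S_mur (norm x) (Arg x) + S_mul (norm x) (Arg x)) / 2"
proof -
 define r where "r = norm x"
 define \<phi> where "\<phi> = Arg x"
 have r: "r > 0" using x by (auto simp: r_def)
 have xr: "rcis r \<phi> = x" by (simp add: r_def \<phi>_def rcis_polar)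
 have \<phi>: "\<bar>\<phi>\<bar> < pi / 2" unfolding \<phi>_def by (rule Arg_half_plane[OF x])
 have r1: "- 5 * pi / 2 < 1 * \<phi>" "1 * \<phi> < pi / 2" "- 5 * pi / 2 < -1 * \<phi>" "-1 * \<phi> < pi / 2"
  using \<phi> by (auto simp: abs_less_iff)
 have 1: "(1::real) \<in> {1, -1}" "(-1::real) \<in> {1, -1}" by simp_all
 note P = lateral_sum_eq[OF r 1(1) r1(1,2), unfolded xr]
 note M = lateral_sum_eq[OF r 1(2) r1(3,4), unfolded xr]
 have "(%n. (kz_coeff n * lat_term x (loc n) (lat_limit (-1) r \<phi>) + kz_coeff n * lat_term x (loc n) (lat_limit 1 r \<phi>)) / 2)
   sums (((\<Sum>n. kz_coeff n * lat_term x (loc n) (lat_limit (-1) r \<phi>)) + (\<Sum>n. kz_coeff n * lat_term x (loc n) (lat_limit 1 r \<phi>))) / 2)"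
  by (intro sums_divide sums_add summable_sums P(2) M(2))
 moreover have "(kz_coeff n * lat_term x (loc n) (lat_limit (-1) r \<phi>) + kz_coeff n * lat_term x (loc n) (lat_limit 1 r \<phi>)) / 2
   = kz_coeff n * lat_term x (loc n) 0" for n
  unfolding lat_limit_minus lat_term_balance[of x _ "lat_limit 1 r \<phi>"] by (simp add: algebra_simps)
 ultimately have "(\<Sum>n. kz_coeff n * lat_term x (loc n) 0) =
   ((\<Sum>n. kz_coeff n * lat_term x (loc n) (lat_limit (-1) r \<phi>)) + (\<Sum>n. kz_coeff n * lat_term x (loc n) (lat_limit 1 r \<phi>))) / 2"
  by (simp only: sums_unique[symmetric])
 thus ?thesis unfolding average_sum_balanced(2)[OF m x] S_mur_def S_mul_def r_def[symmetric] \<phi>_def[symmetric] P(1) M(1)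
  by (simp add: field_simps)
qed

lemma average_sum_cnj:
 assumes m: "balanced m" and x: "Re x > 0"
 shows "cnj (average_sum m x) = average_sum m (cnj x)"
proof -
 have x': "Re (cnj x) > 0" using x by simp
 have x0: "x ~= 0" using x by auto
 have kc: "cnj (kz_coeff n) = kz_coeff n" for n by (simp add: kz_coeff_def chi12_def)
 have lt: "cnj (lat_term x N 0) = lat_term (cnj x) N 0" for N
 proof -
  have "K4 (cnj x) (of_real (sqrt N)) = cnj (K4 x (of_real (sqrt N)))"
   using K4_cnj[OF x0, of "of_real (sqrt N)"] by simp
  thus ?thesis by (simp add: lat_term_def exp_cnj)
 qed
 have "(%n. cnj (kz_coeff n * lat_term x (loc n) 0)) sums cnj (\<Sum>n. kz_coeff n * lat_term x (loc n) 0)"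
  unfolding sums_cnj by (rule summable_sums, rule lat_term_zero_summable[OF x coeff_ok_kz kz_borel_germ])
 hence "(%n. kz_coeff n * lat_term (cnj x) (loc n) 0) sums cnj (\<Sum>n. kz_coeff n * lat_term x (loc n) 0)"
  by (simp add: kc lt)
 thus ?thesis unfolding average_sum_balanced(2)[OF m x] average_sum_balanced(2)[OF m x']
  by (simp add: sums_unique[symmetric])
qed

section \<open>The Dirichlet series\<close>

definition theta_sum :: "complex => complex" where
 "theta_sum x = (\<Sum>n. chi12 n * of_nat n * exp (- (x * cloc n)))"

lemma lat_limit_powr:
 assumes x: "Re x > 0"
 shows "lat_limit 1 (norm x) (Arg x) = - \<i> * of_real (2 / 3 * sqrt pi) * x powr (3/2)"
proof -
 have x0: "x ~= 0" using x by auto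
 define r where "r = norm x"
 define \<phi> where "\<phi> = Arg x"
 have r: "r > 0" using x0 by (simp add: r_def)
 have xr: "rcis r \<phi> = x" by (simp add: r_def \<phi>_def rcis_polar)
 have \<phi>: "\<bar>\<phi>\<bar> < pi / 2" unfolding \<phi>_def by (rule Arg_half_plane[OF x])
 have "csqrt x = of_real (sqrt r) * cis (\<phi> / 2)"
 proof (rule csqrt_unique)
  have "(of_real (sqrt r) * cis (\<phi> / 2)) ^ 2 = of_real (sqrt r ^ 2) * cis \<phi>"
   unfolding power_mult_distrib by (simp add: Complex.DeMoivre)
  thus "(of_real (sqrt r) * cis (\<phi> / 2)) ^ 2 = x" using r by (simp add: xr[symmetric] rcis_def)
  have "cos (\<phi> / 2) > 0" using \<phi> by (intro cos_gt_zero_pi) auto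
  thus "0 < Re (of_real (sqrt r) * cis (\<phi> / 2)) \<or> Re (of_real (sqrt r) * cis (\<phi> / 2)) = 0 \<and> 0 \<le> Im (of_real (sqrt r) * cis (\<phi> / 2))"
   using r by simp
 qed
 moreover have "cis ((\<phi> + 1 * pi) / 2) = \<i> * cis (\<phi> / 2)"
  by (simp add: complex_eq_iff add_divide_distrib cos_add sin_add)
 ultimately have root: "lat_root 1 r \<phi> = \<i> * csqrt x" unfolding lat_root_def by simp
 have c0: "csqrt x ~= 0" using x0 by simp
 have "x powr (3/2) = csqrt x ^ 3"
 proof -
  have "csqrt x ^ 3 = exp (3 * (Ln x / 2))" using x0 by (simp add: csqrt_exp_Ln flip: exp_of_nat_mult)
  thus ?thesis using x0 by (simp add: powr_def)
 qed
 also have "csqrt x ^ 3 = (csqrt x ^ 2) ^ 2 / csqrt x" using c0 by (simp add: power_numeral_reduce field_simps del: power2_csqrt)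
 finally have P: "x powr (3/2) = x ^ 2 / csqrt x" by simp
 show ?thesis unfolding r_def[symmetric] \<phi>_def[symmetric] lat_limit_def root xr P
  using c0 by (simp add: field_simps)
qed

text \<open>In the difference of the two sides the values at 0 of the primitives cancel, and only the two
opposite limits at infinity remain.\<close>

lemma stokes_delta_sums:
 assumes x: "Re x > 0"
 shows "(%n. chi12 n * of_nat n * exp (- (x * cloc n))) sums theta_sum x"
  and "stokes_delta x = - \<i> * of_real (sqrt 2 * pi * sqrt pi) * x powr (3/2) * theta_sum x"
proof -
 have x0: "x ~= 0" using x by auto
 define r where "r = norm x"
 define \<phi> where "\<phi> = Arg x"
 have r: "r > 0" using x0 by (simp add: r_def)
 have xr: "rcis r \<phi> = x" by (simp add: r_def \<phi>_def rcis_polar)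
 have \<phi>: "\<bar>\<phi>\<bar> < pi / 2" unfolding \<phi>_def by (rule Arg_half_plane[OF x])
 have r1: "- 5 * pi / 2 < 1 * \<phi>" "1 * \<phi> < pi / 2" "- 5 * pi / 2 < -1 * \<phi>" "-1 * \<phi> < pi / 2"
  using \<phi> by (auto simp: abs_less_iff)
 have 1: "(1::real) \<in> {1, -1}" "(-1::real) \<in> {1, -1}" by simp_all
 note P = lateral_sum_eq[OF r 1(1) r1(1,2), unfolded xr]
 note M = lateral_sum_eq[OF r 1(2) r1(3,4), unfolded xr]
 define Q where "Q = lat_limit 1 r \<phi>"
 define c0 where "c0 = 2 * of_real borel_const * Q"
 have Q: "Q = - \<i> * of_real (2 / 3 * sqrt pi) * x powr (3/2)"
  unfolding Q_def r_def \<phi>_def by (rule lat_limit_powr[OF x])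
 have Q0: "Q ~= 0" using x0 unfolding Q by simp
 have c00: "c0 ~= 0" using Q0 borel_const_pos by (simp add: c0_def)
 have "(%n. (kz_coeff n * lat_term x (loc n) (lat_limit (-1) r \<phi>) - kz_coeff n * lat_term x (loc n) (lat_limit 1 r \<phi>)) / 2)
   sums (((\<Sum>n. kz_coeff n * lat_term x (loc n) (lat_limit (-1) r \<phi>)) - (\<Sum>n. kz_coeff n * lat_term x (loc n) (lat_limit 1 r \<phi>))) / 2)"
  by (intro sums_divide sums_diff summable_sums P(2) M(2))
 moreover have "((\<Sum>n. kz_coeff n * lat_term x (loc n) (lat_limit (-1) r \<phi>)) - (\<Sum>n. kz_coeff n * lat_term x (loc n) (lat_limit 1 r \<phi>))) / 2 = stokes_delta x"
  unfolding stokes_delta_def S_mur_def S_mul_def r_def[symmetric] \<phi>_def[symmetric] P(1) M(1) by simp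
 moreover have "(kz_coeff n * lat_term x (loc n) (lat_limit (-1) r \<phi>) - kz_coeff n * lat_term x (loc n) (lat_limit 1 r \<phi>)) / 2
   = c0 * (chi12 n * of_nat n * exp (- (x * cloc n)))" for n
  unfolding lat_limit_minus by (simp add: Q_def[symmetric] lat_term_def kz_coeff_def c0_def algebra_simps)
 ultimately have S: "(%n. c0 * (chi12 n * of_nat n * exp (- (x * cloc n)))) sums stokes_delta x" by (simp only:)
 from sums_mult[OF this, of "1 / c0"] c00
 have "(%n. chi12 n * of_nat n * exp (- (x * cloc n))) sums (1 / c0 * stokes_delta x)" by simp
 thus T: "(%n. chi12 n * of_nat n * exp (- (x * cloc n))) sums theta_sum x"
  unfolding theta_sum_def using sums_summable summable_sums by blast
 have "stokes_delta x = c0 * theta_sum x" using sums_unique2[OF S sums_mult[OF T]] .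
 also have "c0 = - \<i> * of_real (2 * borel_const * (2 / 3 * sqrt pi)) * x powr (3/2)" unfolding c0_def Q by simp
 also have "2 * borel_const * (2 / 3 * sqrt pi) = sqrt 2 * pi * sqrt pi"
 proof -
  have "2 = sqrt 2 * sqrt 2" by simp
  thus ?thesis by (simp add: borel_const_def field_simps)
 qed
 finally show "stokes_delta x = - \<i> * of_real (sqrt 2 * pi * sqrt pi) * x powr (3/2) * theta_sum x" .
qed

lemma stokes_delta_eta_tilde:
 assumes x: "Re x > 0"
 shows "stokes_delta x = - \<i> * of_real (sqrt 2) * (of_real pi * x) powr (3/2) * eta_tilde (2 * of_real pi * \<i> * x)"
proof -
 have x0: "x ~= 0" using x by auto
 have "(%n. chi12 (Suc n) * of_nat (Suc n) * exp (- (x * of_real (loc (Suc n))))) sums theta_sum x"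
  using stokes_delta_sums(1)[OF x] by (subst sums_Suc_iff) simp
 moreover have "exp (- (x * of_real (loc (Suc n)))) = exp (of_real pi * \<i> * of_nat (Suc n) ^ 2 * (2 * of_real pi * \<i> * x) / 12)" for n
  by (rule arg_cong[where f = exp]) (simp add: loc_def power2_eq_square field_simps del: of_nat_Suc)
 ultimately have e: "eta_tilde (2 * of_real pi * \<i> * x) = theta_sum x"
  unfolding eta_tilde_def by (simp only: sums_unique[symmetric])
 have "(of_real pi * x) powr (3/2) = exp (3/2 * (of_real (ln pi) + Ln x))"
  using x0 by (simp add: powr_def Ln_times_of_real Ln_of_real)
 also have "\<dots> = of_real (exp (3/2 * ln pi)) * x powr (3/2)"
  using x0 by (simp add: powr_def exp_add distrib_left flip: exp_of_real)
 also have "exp (3/2 * ln pi) = pi * sqrt pi"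
 proof -
  have "exp (3/2 * ln pi) = exp (ln pi + ln pi / 2)" by (rule arg_cong[where f = exp]) simp
  also have "\<dots> = pi * sqrt pi" unfolding exp_add by (simp add: powr_half_sqrt[symmetric] powr_def)
  finally show ?thesis .
 qed
 finally show ?thesis unfolding stokes_delta_sums(2)[OF x] e by simp
qed

definition theta_coeff :: "nat => complex" where
 "theta_coeff k = (if k \<in> range (%n. n ^ 2) then chi12 (inv (%n. n ^ 2) k) * of_nat (inv (%n. n ^ 2) k) else 0)"

lemma inj_square: "inj (%n::nat. n ^ 2)"
 by (rule injI) simp

lemma theta_coeff_square: "theta_coeff (n ^ 2) = chi12 n * of_nat n"
 by (simp add: theta_coeff_def inv_f_f[OF inj_square, simplified])

lemma theta_coeff_sums:
 assumes x: "Re x > 0"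
 shows "(%k. theta_coeff k * exp (- (of_real pi ^ 2 / 6) * x) ^ k) sums theta_sum x"
proof -
 have "exp (- (of_real pi ^ 2 / 6) * x) ^ (n ^ 2) = exp (- (x * cloc n))" for n
  unfolding exp_of_nat_mult[symmetric] by (rule arg_cong[where f = exp]) (simp add: loc_def)
 hence "(%n. theta_coeff (n ^ 2) * exp (- (of_real pi ^ 2 / 6) * x) ^ (n ^ 2)) sums theta_sum x"
  using stokes_delta_sums(1)[OF x] by (simp add: theta_coeff_square)
 moreover have "strict_mono (%n::nat. n ^ 2)" by (intro strict_monoI) (simp add: power_strict_mono)
 ultimately show ?thesis
  by (subst (asm) sums_mono_reindex) (auto simp: theta_coeff_def)
qed

lemma theta_coeff_support: "{k. theta_coeff k ~= 0} = (%n. n ^ 2) ` {n. chi12 n ~= 0}"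
proof (intro equalityI subsetI)
 fix k assume "k \<in> {k. theta_coeff k ~= 0}"
 hence k: "theta_coeff k ~= 0" by simp
 then obtain n where n: "k = n ^ 2" by (auto simp: theta_coeff_def split: if_splits)
 with k have "chi12 n ~= 0" by (auto simp: theta_coeff_square)
 thus "k \<in> (%n. n ^ 2) ` {n. chi12 n ~= 0}" using n by blast
next
 fix k :: nat assume "k \<in> (%n. n ^ 2) ` {n. chi12 n ~= 0}"
 then obtain n where n: "k = n ^ 2" "chi12 n ~= 0" by blast
 hence "n > 0" using chi12_imp_pos by blast
 thus "k \<in> {k. theta_coeff k ~= 0}" using n by (simp add: theta_coeff_square)
qed

lemma infinite_chi12: "infinite {n. chi12 n ~= 0}"
proof (rule infinite_super)
 show "infinite (range (%j::nat. 12 * j + 1))" by (rule range_inj_infinite) (simp add: inj_def)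
 show "range (%j::nat. 12 * j + 1) \<subseteq> {n. chi12 n ~= 0}" by (auto simp: chi12_def)
qed

text \<open>The \<open>k\<close>-th exponent is the square of an integer that is at least \<open>k\<close>.\<close>

lemma lacunary_scaled_theta:
 assumes "C ~= 0" shows "lacunary (%k. C * theta_coeff k)"
proof -
 define S where "S = {k. theta_coeff k ~= 0}"
 have S: "infinite S" unfolding S_def theta_coeff_support
  using infinite_chi12 finite_imageD[OF _ inj_on_subset[OF inj_square subset_UNIV]] by blast
 define r where "r k = (SOME n. enumerate S k = n ^ 2)" for k
 have r: "enumerate S k = r k ^ 2" for k
 proof -
  have "\<exists>n. enumerate S k = n ^ 2" using enumerate_in_set[OF S, of k] unfolding S_def theta_coeff_support by blast
  thus ?thesis unfolding r_def by (rule someI_ex)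
 qed
 have "strict_mono r"
 proof (rule strict_monoI)
  fix i j :: nat assume "i < j"
  hence "enumerate S i < enumerate S j" by (rule enumerate_mono[OF _ S])
  thus "r i < r j" unfolding r by (rule power_less_imp_less_base) simp
 qed
 hence "k \<le> r k" for k by (rule strict_mono_imp_increasing)
 hence ge: "k ^ 2 \<le> enumerate S k" for k unfolding r by (rule power_mono) simp
 have "filterlim (%k. real (enumerate S k) / real k) at_top at_top"
 proof (rule filterlim_at_top_mono[OF filterlim_real_sequentially])
  show "\<forall>\<^sub>F k in sequentially. real k \<le> real (enumerate S k) / real k"
   using eventually_gt_at_top[of 0]
  proof eventually_elim
   case (elim k)
   have "real (k ^ 2) \<le> real (enumerate S k)" using ge by (simp only: of_nat_le_iff)
   thus ?case using elim by (simp add: pos_le_divide_eq power2_eq_square)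
  qed
 qed
 moreover have "{k. C * theta_coeff k ~= 0} = S" using assms by (simp add: S_def)
 ultimately show ?thesis using S by (simp add: lacunary_def)
qed

text \<open>A power series in \<open>exp (- \<pi>\<^sup>2 x / 6)\<close>.\<close>

lemma theta_sum_holomorphic: "theta_sum holomorphic_on {x. Re x > 0}"
proof -
 define P where "P w = (\<Sum>k. theta_coeff k * w ^ k)" for w
 have "(%k. theta_coeff k * (w - 0) ^ k) sums P w" if w: "w \<in> ball 0 1" for w
 proof (cases "w = 0")
  case True
  have "summable (%k. theta_coeff k * 0 ^ k)" by (rule sums_summable[OF powser_sums_zero])
  thus ?thesis unfolding P_def True by (simp add: summable_sums)
 next
  case False
  define x where "x = - (6 / of_real pi ^ 2) * Ln w"
  have "ln (norm w) < 0" using w False by (simp add: ln_less_zero)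
  hence "Re (Ln w) < 0" using False by simp
  moreover have "Re x = - (6 / pi ^ 2) * Re (Ln w)"
  proof -
   have "x = of_real (- (6 / pi ^ 2)) * Ln w" by (simp add: x_def)
   thus ?thesis by (simp only: Re_complex_of_real Im_complex_of_real times_complex.sel)
  qed
  hence "Re x = (6 / pi ^ 2) * (- Re (Ln w))" by simp
  moreover have "(6 / pi ^ 2) * (- Re (Ln w)) > 0" if "Re (Ln w) < 0" using that by (intro mult_pos_pos) simp_all
  ultimately have x: "Re x > 0" by simp
  have "- (of_real pi ^ 2 / 6) * x = Ln w" by (simp add: x_def)
  hence "exp (- (of_real pi ^ 2 / 6) * x) = w" using False by simp
  with theta_coeff_sums[OF x] have "summable (%k. theta_coeff k * w ^ k)" by (auto dest: sums_summable)
  thus ?thesis unfolding P_def by (simp add: summable_sums)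
 qed
 hence P: "P holomorphic_on ball 0 1" by (rule power_series_holomorphic)
 have "(P \<circ> (%x. exp (- (of_real pi ^ 2 / 6) * x))) holomorphic_on {x. Re x > 0}"
 proof (rule holomorphic_on_compose_gen[OF _ P])
  show "(%x. exp (- (of_real pi ^ 2 / 6) * x)) holomorphic_on {x. Re x > 0}" by (intro holomorphic_intros)
  have "Re (- (of_real pi ^ 2 / 6) * x) = - (pi ^ 2 / 6) * Re x" for x
  proof -
   have "- (of_real pi ^ 2 / 6) * x = of_real (- (pi ^ 2 / 6)) * x" by simp
   thus ?thesis by (simp only: Re_complex_of_real Im_complex_of_real times_complex.sel)
  qed
  thus "(%x. exp (- (of_real pi ^ 2 / 6) * x)) ` {x. Re x > 0} \<subseteq> ball 0 1"
   by (auto simp: norm_exp_eq_Re simp del: mult_minus_left)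
 qed
 moreover have "(P \<circ> (%x. exp (- (of_real pi ^ 2 / 6) * x))) x = theta_sum x" if "x \<in> {x. Re x > 0}" for x
  unfolding o_def P_def using theta_coeff_sums[of x] that by (auto simp: sums_iff)
 ultimately show ?thesis by (rule holomorphic_transform)
qed

lemma half_plane_not_nonpos: "Re x > 0 ==> x \<notin> \<real>\<^sub>\<le>\<^sub>0"
 by (auto simp: complex_nonpos_Reals_iff)

lemma stokes_delta_holomorphic: "stokes_delta holomorphic_on {x. Re x > 0}"
proof (rule holomorphic_transform)
 show "(%x. - \<i> * of_real (sqrt 2 * pi * sqrt pi) * x powr (3/2) * theta_sum x) holomorphic_on {x. Re x > 0}"
  by (intro holomorphic_intros theta_sum_holomorphic) (auto simp: half_plane_not_nonpos)
qed (simp add: stokes_delta_sums(2))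

section \<open>The natural boundary\<close>

lemma exp_minus_le_inverse_square: "y > 0 ==> exp (- y) \<le> 6 ^ 5 / (y::real) ^ 2"
proof -
 assume y: "y > 0"
 have "y ^ 2 \<le> (1 + y) ^ 2" using y by (intro power_mono) simp_all
 also have "\<dots> \<le> (1 + y) ^ 5" using y by (intro power_increasing) simp_all
 also have "\<dots> \<le> (1 + 5 / 1) ^ 5 * exp (1 * y)" using y by (intro poly_exp_bound) simp_all
 finally have "y ^ 2 \<le> 6 ^ 5 * exp y" by simp
 hence "y ^ 2 * exp (- y) \<le> 6 ^ 5 * exp y * exp (- y)" by (rule mult_right_mono) simp
 also have "6 ^ 5 * exp y * exp (- y) = 6 ^ 5" by (simp add: exp_minus)
 finally show ?thesis using y by (simp add: pos_le_divide_eq mult.commute)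
qed

lemma theta_term_summable:
 assumes t: "t > 0" shows "summable (%n. real n * exp (- (t * loc n)))"
proof (rule summable_comparison_test'[OF summable_inverse_cube[of "6 ^ 5 / t ^ 2"]])
 fix n :: nat
 show "norm (real n * exp (- (t * loc n))) \<le> 6 ^ 5 / t ^ 2 * (1 / real n ^ 3)"
 proof (cases "n = 0")
  case False
  define y where "y = t * real n ^ 2"
  have y: "y > 0" using t False by (simp add: y_def)
  have "y \<le> t * loc n" unfolding y_def using t by (intro mult_left_mono loc_ge_sq) simp
  hence "exp (- (t * loc n)) \<le> exp (- y)" by simp
  also have "\<dots> \<le> 6 ^ 5 / y ^ 2" by (rule exp_minus_le_inverse_square[OF y])
  finally have "real n * exp (- (t * loc n)) \<le> real n * (6 ^ 5 / y ^ 2)" by (rule mult_left_mono) simp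
  also have "\<dots> = 6 ^ 5 / t ^ 2 * (1 / real n ^ 3)"
   using t False by (simp add: y_def power_mult_distrib field_simps power_numeral_reduce)
  finally show ?thesis by simp
 qed simp
qed

text \<open>The double zeros at the endpoints give Fourier coefficients of order \<open>k\<^sup>-\<^sup>3\<close>, which is enough against
the growth of the coefficients.\<close>

definition weight :: "real => real => complex" where
 "weight l s = of_real ((s ^ 2 - l ^ 2) ^ 2)"

lemma weight_total:
 assumes "l > 0" shows "(weight l has_integral of_real (16 / 15 * l ^ 5)) {-l..l}"
proof -
 define G where "G s = s ^ 5 / 5 - 2 * l ^ 2 * s ^ 3 / 3 + l ^ 4 * s" for s
 have "((%s. (s ^ 2 - l ^ 2) ^ 2) has_integral G l - G (-l)) {-l..l}"
 proof (rule fundamental_theorem_of_calculus)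
  show "(G has_vector_derivative (s ^ 2 - l ^ 2) ^ 2) (at s within {-l..l})" for s
   unfolding G_def[abs_def] has_real_derivative_iff_has_vector_derivative[symmetric]
   by (auto intro!: derivative_eq_intros simp: power2_eq_square algebra_simps power_numeral_reduce)
 qed (use assms in simp)
 moreover have "G l - G (-l) = 16 / 15 * l ^ 5"
  by (simp add: G_def power_numeral_reduce field_simps)
 ultimately have "((%s. (s ^ 2 - l ^ 2) ^ 2) has_integral 16 / 15 * l ^ 5) {-l..l}" by simp
 from has_integral_of_real[OF this, where 'b = complex] show ?thesis unfolding weight_def[abs_def] .
qed

lemma weight_fourier:
 assumes k: "1 \<le> \<bar>k\<bar>" and l: "l > 0"
 obtains I where "((%s. weight l s * exp (\<i> * of_real (k * s))) has_integral I) {-l..l}"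
  "norm I \<le> 2 * (8 * l ^ 2 + 24 * l + 24) / \<bar>k\<bar> ^ 3"
proof -
 define \<kappa> where "\<kappa> = \<i> * complex_of_real k"
 define u where "u = 1 / \<kappa>"
 define L where "L = complex_of_real l"
 have \<kappa>u: "\<kappa> * u = 1" using k by (auto simp: \<kappa>_def u_def)
 have nu: "norm u = 1 / \<bar>k\<bar>" "norm u \<le> 1" using k by (simp_all add: u_def \<kappa>_def norm_divide norm_mult)
 define V0 where "V0 z = (z ^ 2 - L ^ 2) ^ 2" for z
 define V1 where "V1 z = 4 * z ^ 3 - 4 * L ^ 2 * z" for z
 define V2 where "V2 z = 12 * z ^ 2 - 4 * L ^ 2" for z
 define V3 where "V3 z = 24 * z" for z :: complex
 define H where "H z = u * (V0 z - u * (V1 z - u * (V2 z - u * (V3 z - u * 24))))" for z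
 define H' where "H' z = u * (V1 z - u * (V2 z - u * (V3 z - u * 24)))" for z
 have d0: "(V0 has_field_derivative V1 z) (at z)" for z
  unfolding V0_def[abs_def] V1_def by (auto intro!: derivative_eq_intros simp: power2_eq_square algebra_simps power_numeral_reduce)
 have d1: "(V1 has_field_derivative V2 z) (at z)" for z
  unfolding V1_def[abs_def] V2_def by (auto intro!: derivative_eq_intros simp: power2_eq_square algebra_simps power_numeral_reduce)
 have d2: "(V2 has_field_derivative V3 z) (at z)" for z
  unfolding V2_def[abs_def] V3_def by (auto intro!: derivative_eq_intros simp: power2_eq_square algebra_simps power_numeral_reduce)
 have d3: "(V3 has_field_derivative 24) (at z)" for z
  unfolding V3_def[abs_def] by (auto intro!: derivative_eq_intros)
 have dH: "(H has_field_derivative H' z) (at z)" for z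
 proof -
  have "(H has_field_derivative (u * (V1 z - u * (V2 z - u * (V3 z - u * (24 - 0)))))) (at z)"
   unfolding H_def[abs_def] by (intro DERIV_cmult DERIV_diff d0 d1 d2 d3 DERIV_const)
  thus ?thesis by (simp add: H'_def)
 qed
 have HH: "\<kappa> * H z + H' z = V0 z" for z
 proof -
  have "\<kappa> * H z = (\<kappa> * u) * (V0 z - u * (V1 z - u * (V2 z - u * (V3 z - u * 24))))" by (simp add: H_def)
  thus ?thesis unfolding \<kappa>u H'_def by simp
 qed
 have dG: "((%z. exp (\<kappa> * z) * H z) has_field_derivative V0 z * exp (\<kappa> * z)) (at z)" for z
 proof -
  have "((%z. exp (\<kappa> * z)) has_field_derivative exp (\<kappa> * z) * \<kappa>) (at z)"
   by (auto intro!: derivative_eq_intros)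
  from DERIV_mult[OF this dH] have "((%z. exp (\<kappa> * z) * H z) has_field_derivative exp (\<kappa> * z) * (\<kappa> * H z + H' z)) (at z)"
   by (simp add: algebra_simps)
  thus ?thesis unfolding HH by (simp add: mult.commute)
 qed
 define G where "G s = exp (\<kappa> * of_real s) * H (of_real s)" for s :: real
 have I: "((%s. V0 (of_real s) * exp (\<kappa> * of_real s)) has_integral G l - G (-l)) {-l..l}"
 proof (rule fundamental_theorem_of_calculus)
  show "(G has_vector_derivative V0 (of_real s) * exp (\<kappa> * of_real s)) (at s within {-l..l})" for s
   unfolding G_def[abs_def] by (rule has_vector_derivative_real_field[OF dG])
 qed (use l in simp)
 have bnd: "norm (G s) \<le> (8 * l ^ 2 + 24 * l + 24) / \<bar>k\<bar> ^ 3" if s: "s = l \<or> s = - l" for s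
 proof -
  define z where "z = complex_of_real s"
  have z: "z ^ 2 = L ^ 2" "norm z = l" using s l by (auto simp: z_def L_def)
  have V: "V0 z = 0" "V1 z = 0" "V2 z = of_real (8 * l ^ 2)" using z(1)
   by (simp_all add: V0_def V1_def V2_def power_numeral_reduce power2_eq_square L_def)
  have "H z = u ^ 3 * (of_real (8 * l ^ 2) - u * (V3 z - u * 24))"
   by (simp add: H_def V power_numeral_reduce)
  hence "norm (H z) = norm u ^ 3 * norm (of_real (8 * l ^ 2) - u * (V3 z - u * 24))" by (simp add: norm_mult norm_power)
  also have "norm (of_real (8 * l ^ 2) - u * (V3 z - u * 24)) \<le> norm (complex_of_real (8 * l ^ 2)) + norm (u * (V3 z - u * 24))"
   by (rule norm_triangle_ineq4)
  also have "norm (u * (V3 z - u * 24)) \<le> 1 * norm (V3 z - u * 24)"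
   unfolding norm_mult by (intro mult_right_mono nu) simp
  also have "norm (V3 z - u * 24) \<le> norm (V3 z) + norm (u * 24)" by (rule norm_triangle_ineq4)
  also have "norm (V3 z) = 24 * l" by (simp add: V3_def norm_mult z)
  also have "norm (u * 24) \<le> 24" using nu(2) by (simp add: norm_mult)
  also have "norm (complex_of_real (8 * l ^ 2)) = 8 * l ^ 2" by (simp only: norm_of_real) simp
  finally have "norm (H z) \<le> norm u ^ 3 * (8 * l ^ 2 + 1 * (24 * l + 24))" by (simp add: mult_left_mono)
  moreover have "norm (exp (\<kappa> * z)) = 1" by (simp add: norm_exp_eq_Re \<kappa>_def z_def)
  hence "norm (G s) = norm (H z)" unfolding G_def z_def[symmetric] norm_mult by simp
  ultimately show ?thesis by (simp add: nu(1) power_divide add.assoc)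
 qed
 show ?thesis
 proof (rule that)
  have "V0 (of_real s) = weight l s" for s by (simp add: V0_def weight_def L_def)
  moreover have "\<kappa> * of_real s = \<i> * of_real (k * s)" for s by (simp add: \<kappa>_def)
  ultimately show "((%s. weight l s * exp (\<i> * of_real (k * s))) has_integral (G l - G (-l))) {-l..l}" using I by (simp only:)
  define X where "X = 8 * l ^ 2 + 24 * l + 24"
  have "norm (G l - G (-l)) \<le> norm (G l) + norm (G (-l))" by (rule norm_triangle_ineq4)
  also have "\<dots> \<le> X / \<bar>k\<bar> ^ 3 + X / \<bar>k\<bar> ^ 3" unfolding X_def by (intro add_mono bnd) simp_all
  also have "\<dots> = 2 * X / \<bar>k\<bar> ^ 3" by simp
  finally show "norm (G l - G (-l)) \<le> 2 * (8 * l ^ 2 + 24 * l + 24) / \<bar>k\<bar> ^ 3" unfolding X_def .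
 qed
qed

lemma norm_weight_le:
 assumes "l > 0" "s \<in> {-l..l}" shows "norm (weight l s) \<le> l ^ 4"
proof -
 have "s ^ 2 \<le> l ^ 2" using assms by (intro abs_le_square_iff[THEN iffD1]) auto
 hence "\<bar>s ^ 2 - l ^ 2\<bar> \<le> l ^ 2" by simp
 hence "\<bar>s ^ 2 - l ^ 2\<bar> ^ 2 \<le> (l ^ 2) ^ 2" by (rule power_mono) simp
 thus ?thesis by (simp add: weight_def norm_power flip: of_real_diff of_real_power)
qed

lemma summable_inverse_square: "summable (%n. C * (1 / real n ^ 2))"
 using inverse_power_summable[of 2, where ?'a = real] by (intro summable_mult) (simp add: inverse_eq_divide)

lemma norm_chi12: "chi12 n ~= 0 ==> norm (chi12 n) = 1"
 by (auto simp: chi12_def split: if_splits)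

text \<open>A bound on a segment parallel to the imaginary axis bounds each single coefficient: in the
integral against the weight and \<open>exp (\<i> loc m y)\<close> the term \<open>n\<close> has frequency \<open>loc m - loc n\<close>, of absolute value
at least \<open>n\<close> unless \<open>n = m\<close>.\<close>

lemma theta_coefficient_bound:
 assumes t: "t > 0" and l: "l > 0" and m: "chi12 m ~= 0"
  and M: "\<And>s. s \<in> {-l..l} ==> norm (theta_sum (of_real t + \<i> * of_real (c + s))) \<le> M"
 shows "real m * exp (- (t * loc m)) * (16 / 15 * l ^ 5) \<le>
   M * l ^ 4 * (2 * l) + 2 * (8 * l ^ 2 + 24 * l + 24) * (\<Sum>n. 1 / real n ^ 2)"
proof -
 define B where "B = 2 * (8 * l ^ 2 + 24 * l + 24)"
 have B0: "B \<ge> 0" using l by (simp add: B_def)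
 define x where "x s = of_real t + \<i> * of_real (c + s)" for s
 define wt where "wt s = weight l s * exp (\<i> * of_real (loc m * (c + s)))" for s
 define f where "f n s = chi12 n * of_nat n * exp (- (x s * cloc n)) * wt s" for n s
 define K where "K n = chi12 n * of_nat n * exp (- of_real (t * loc n)) * exp (\<i> * of_real ((loc m - loc n) * c))" for n
 have f_eq: "f n s = K n * (weight l s * exp (\<i> * of_real ((loc m - loc n) * s)))" for n s
 proof -
  have e: "exp (- (x s * cloc n)) * exp (\<i> * of_real (loc m * (c + s))) =
   exp (- of_real (t * loc n)) * exp (\<i> * of_real ((loc m - loc n) * c)) * exp (\<i> * of_real ((loc m - loc n) * s))"
   unfolding exp_add[symmetric] by (rule arg_cong[where f = exp]) (simp add: x_def algebra_simps)
  have g1: "P * X1 * (W * X2) = P * W * (X1 * X2)" and g2: "P * W * (Y1 * Y2 * Y3) = P * Y1 * Y2 * (W * Y3)"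
   for P W X1 X2 Y1 Y2 Y3 :: complex by simp_all
  have "f n s = chi12 n * of_nat n * weight l s * (exp (- (x s * cloc n)) * exp (\<i> * of_real (loc m * (c + s))))"
   unfolding f_def wt_def by (rule g1)
  also note e
  also have "chi12 n * of_nat n * weight l s * (exp (- of_real (t * loc n)) * exp (\<i> * of_real ((loc m - loc n) * c)) *
    exp (\<i> * of_real ((loc m - loc n) * s))) = K n * (weight l s * exp (\<i> * of_real ((loc m - loc n) * s)))"
   unfolding K_def by (rule g2)
  finally show ?thesis .
 qed
 have nK: "norm (K n) = norm (chi12 n) * real n * exp (- (t * loc n))" for n
  by (simp add: K_def norm_mult norm_exp_eq_Re)
 have nK': "norm (K n) \<le> real n * exp (- (t * loc n))" for n
 proof -
  have "norm (chi12 n) * (real n * exp (- (t * loc n))) \<le> 1 * (real n * exp (- (t * loc n)))"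
   by (intro mult_right_mono norm_chi12_le) simp
  thus ?thesis unfolding nK by (simp add: mult.assoc)
 qed
 have nwt: "norm (wt s) \<le> l ^ 4" if "s \<in> {-l..l}" for s
  using norm_weight_le[OF l that] by (simp add: wt_def norm_mult norm_exp_eq_Re)
 define g where "g s = theta_sum (x s) * wt s" for s
 have fg: "(%n. f n s) sums g s" for s
 proof -
  have "Re (x s) > 0" using t by (simp add: x_def)
  from sums_mult2[OF stokes_delta_sums(1)[OF this], of "wt s"] show ?thesis by (simp add: f_def g_def)
 qed
 have ul: "uniform_limit {-l..l} (%N s. \<Sum>n<N. f n s) (%s. \<Sum>n. f n s) sequentially"
 proof (rule Weierstrass_m_test)
  show "summable (%n. real n * exp (- (t * loc n)) * l ^ 4)" by (intro summable_mult2 theta_term_summable t)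
  show "norm (f n s) \<le> real n * exp (- (t * loc n)) * l ^ 4" if "s \<in> {-l..l}" for n s
  proof -
   have "norm (weight l s * exp (\<i> * of_real ((loc m - loc n) * s))) = norm (weight l s)"
    by (simp add: norm_mult norm_exp_eq_Re)
   hence "norm (f n s) = norm (K n) * norm (weight l s)" unfolding f_eq norm_mult[of "K n"] by simp
   also have "\<dots> \<le> real n * exp (- (t * loc n)) * l ^ 4"
    by (intro mult_mono nK' norm_weight_le[OF l that]) simp_all
   finally show ?thesis .
  qed
 qed
 have gs: "(%s. \<Sum>n. f n s) = g" using fg by (simp add: fun_eq_iff sums_iff)
 have fc: "continuous_on {-l..l} (f n)" for n
  unfolding f_def x_def wt_def weight_def by (intro continuous_intros)
 have fN: "continuous_on {-l..l} (%s. \<Sum>n<N. f n s)" for N by (intro continuous_intros fc)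
 obtain I J where I: "\<And>N. ((%s. \<Sum>n<N. f n s) has_integral I N) {-l..l}" and J: "(g has_integral J) {-l..l}"
  and IJ: "I \<longlonglongrightarrow> J"
  using uniform_limit_integral[OF ul[unfolded gs] fN sequentially_bot] by blast
 define T where "T n = integral {-l..l} (f n)" for n
 have fT: "(f n has_integral T n) {-l..l}" for n
  unfolding T_def by (rule integrable_integral[OF integrable_continuous_real[OF fc]])
 have "I = (%N. \<Sum>n<N. T n)"
  by (rule ext, rule has_integral_unique[OF I has_integral_sum[OF finite_lessThan fT]])
 with IJ have TJ: "T sums J" unfolding sums_def by (simp only:)
 have "0 \<in> {-l..l}" using l by simp
 hence "M \<ge> 0" by (rule order_trans[OF norm_ge_zero M])
 have nJ: "norm J \<le> M * l ^ 4 * (2 * l)"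
 proof -
  have "norm J \<le> (M * l ^ 4) * measure lborel {-l..l}"
  proof (rule has_integral_bound_real[OF _ finite.emptyI J])
   show "0 \<le> M * l ^ 4" using \<open>M \<ge> 0\<close> l by simp
   show "norm (g s) \<le> M * l ^ 4" if "s \<in> {-l..l} - {}" for s
    unfolding g_def norm_mult x_def by (intro mult_mono M nwt) (use that \<open>M \<ge> 0\<close> in auto)
  qed
  thus ?thesis using l by simp
 qed
 have Tm: "norm (T m) = real m * exp (- (t * loc m)) * (16 / 15 * l ^ 5)"
 proof -
  have "f m = (%s. K m * weight l s)" by (rule ext) (simp add: f_eq)
  hence "(f m has_integral K m * of_real (16 / 15 * l ^ 5)) {-l..l}"
   by (simp only:) (rule has_integral_mult_right[OF weight_total[OF l]])
  from has_integral_unique[OF fT this] have "T m = K m * of_real (16 / 15 * l ^ 5)" .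
  moreover have "norm (complex_of_real (16 / 15 * l ^ 5)) = 16 / 15 * l ^ 5"
   unfolding norm_of_real using l by simp
  ultimately show ?thesis by (simp only: norm_mult nK norm_chi12[OF m])
 qed
 have Tn: "norm (T n - (if n = m then T n else 0)) \<le> B * (1 / real n ^ 2)" for n
 proof (cases "n = m \<or> n = 0")
  case True
  have "T 0 = 0"
  proof -
   have "f 0 = (%s. 0)" by (simp add: f_def fun_eq_iff)
   thus ?thesis by (simp add: T_def)
  qed
  thus ?thesis using True B0 by auto
 next
  case False
  hence n: "n ~= m" "real n \<ge> 1" by auto
  define k where "k = loc m - loc n"
  have "1 * (real m + real n) \<le> pi ^ 2 / 6 * (real m + real n)" by (intro mult_right_mono pi_sq_ge) simp
  also have "\<dots> \<le> \<bar>k\<bar>" unfolding k_def by (rule loc_sep_abs) (use n in simp)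
  finally have kn: "real n \<le> \<bar>k\<bar>" by simp
  have k1: "1 \<le> \<bar>k\<bar>" using kn n by linarith
  obtain I where I: "((%s. weight l s * exp (\<i> * of_real (k * s))) has_integral I) {-l..l}" "norm I \<le> B / \<bar>k\<bar> ^ 3"
   unfolding B_def by (rule weight_fourier[OF k1 l]) blast
  have "f n = (%s. K n * (weight l s * exp (\<i> * of_real (k * s))))" by (rule ext) (simp only: f_eq k_def)
  hence "(f n has_integral K n * I) {-l..l}" by (simp only:) (rule has_integral_mult_right[OF I(1)])
  from has_integral_unique[OF fT this] have Tn: "T n = K n * I" .
  have "norm (K n) \<le> real n"
  proof -
   have "real n * exp (- (t * loc n)) \<le> real n * 1" using t by (intro mult_left_mono) (simp_all add: loc_def)
   thus ?thesis using nK'[of n] by linarith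
  qed
  moreover have "norm I \<le> B / real n ^ 3"
  proof -
   have "real n ^ 3 \<le> \<bar>k\<bar> ^ 3" using kn by (intro power_mono) simp_all
   hence "B / \<bar>k\<bar> ^ 3 \<le> B / real n ^ 3" using B0 n k1 by (intro divide_left_mono) simp_all
   thus ?thesis using I(2) by linarith
  qed
  ultimately have "norm (K n) * norm I \<le> real n * (B / real n ^ 3)" by (intro mult_mono) simp_all
  also have "\<dots> = B * (1 / real n ^ 2)" using n by (simp add: power_numeral_reduce)
  finally show ?thesis using n(1) unfolding Tn norm_mult[symmetric] by (simp only: if_False diff_zero)
 qed
 have "(%n. T n - (if n = m then T n else 0)) sums (J - T m)" by (rule sums_diff[OF TJ sums_single])
 hence "J - T m = (\<Sum>n. T n - (if n = m then T n else 0))" by (rule sums_unique)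
 hence "norm (J - T m) \<le> (\<Sum>n. B * (1 / real n ^ 2))"
  by (simp only:) (rule norm_suminf_le[OF Tn summable_inverse_square])
 also have "\<dots> = B * (\<Sum>n. 1 / real n ^ 2)"
  by (rule suminf_mult) (use summable_inverse_square[of 1] in simp)
 finally have "norm (J - T m) \<le> B * (\<Sum>n. 1 / real n ^ 2)" .
 moreover have "norm (T m) \<le> norm J + norm (J - T m)"
  using norm_triangle_ineq4[of J "J - T m"] by simp
 ultimately show ?thesis using nJ Tm unfolding B_def[symmetric] by linarith
qed

text \<open>The segment is placed off the real axis because \<open>x\<^sup>3\<^sup>/\<^sup>2\<close> has to stay away from 0.\<close>

lemma stokes_delta_natural_boundary: "natural_boundary stokes_delta {x. Re x > 0}"
 unfolding natural_boundary_def
proof (intro conjI ballI notI)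
 show "stokes_delta holomorphic_on {x. Re x > 0}" by (rule stokes_delta_holomorphic)
 fix z assume "z \<in> frontier {x. Re x > 0}"
 hence z: "Re z = 0"
 proof -
  have "closure {x. Re x > 0} \<subseteq> {x. Re x \<ge> 0}"
   by (rule closure_minimal) (auto simp: closed_halfspace_Re_ge)
  moreover have "open {x. Re x > 0}" by (rule open_halfspace_Re_gt)
  ultimately show ?thesis using \<open>z \<in> frontier {x. Re x > 0}\<close> unfolding frontier_def by (auto simp: interior_open)
 qed
 assume "\<exists>e>0. \<exists>h. h holomorphic_on ball z e \<and> (\<forall>w\<in>ball z e \<inter> {x. Re x > 0}. h w = stokes_delta w)"
 then obtain e h where e: "e > 0" and h: "h holomorphic_on ball z e"
  and eq: "\<And>w. w \<in> ball z e ==> Re w > 0 ==> h w = stokes_delta w" by blast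
 define l where "l = e / 8"
 (* The segment is moved away from the real axis, but stays inside the ball. *)
 define c where "c = (if Im z \<ge> 0 then Im z + e / 2 else Im z - e / 2)"
 have l: "l > 0" using e by (simp add: l_def)
 define Q where "Q = cbox (Complex 0 (c - l)) (Complex l (c + l))"
 have Q: "w \<in> ball z e" "Re w \<ge> 0" "Im w ~= 0" if "w \<in> Q" for w
 proof -
  from that have w: "0 \<le> Re w" "Re w \<le> l" "\<bar>Im w - c\<bar> \<le> l" by (auto simp: Q_def in_cbox_complex_iff)
  show "Re w \<ge> 0" by (rule w)
  show "Im w ~= 0" using w(3) e by (auto simp: c_def l_def split: if_splits)
  have "\<bar>Im w - Im z\<bar> \<le> l + e / 2" using w(3) e by (auto simp: c_def split: if_splits)
  moreover have "norm (w - z) \<le> \<bar>Re (w - z)\<bar> + \<bar>Im (w - z)\<bar>" by (rule cmod_le)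
  ultimately have "norm (w - z) \<le> l + (l + e / 2)" using w z by simp
  also have "\<dots> < e" using e by (simp add: l_def)
  finally show "w \<in> ball z e" by (simp add: dist_norm norm_minus_commute)
 qed
 define C where "C = - \<i> * complex_of_real (sqrt 2 * pi * sqrt pi)"
 have C: "C ~= 0" by (simp add: C_def)
 have "continuous_on Q (%w. h w / (C * w powr (3/2)))"
 proof (intro continuous_intros)
  show "continuous_on Q h"
   by (rule continuous_on_subset[OF holomorphic_on_imp_continuous_on[OF h]]) (use Q(1) in blast)
  show "Q \<subseteq> {x. 0 \<le> Re x \<or> Im x ~= 0}" using Q(2) by blast
  show "\<forall>w\<in>Q. C * w powr (3/2) ~= 0" using Q(3) C by fastforce
 qed simp
 moreover have "compact Q" unfolding Q_def by (rule compact_cbox)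
 ultimately have "bounded ((%w. h w / (C * w powr (3/2))) ` Q)"
  by (intro compact_imp_bounded compact_continuous_image)
 then obtain M where M: "\<And>w. w \<in> Q ==> norm (h w / (C * w powr (3/2))) \<le> M"
  unfolding bounded_iff by blast
 have bound: "norm (theta_sum (of_real t + \<i> * of_real (c + s))) \<le> M" if t: "0 < t" "t \<le> l" and s: "s \<in> {-l..l}" for t s
 proof -
  define w where "w = of_real t + \<i> * complex_of_real (c + s)"
  have w: "w \<in> Q" using t s by (auto simp: w_def Q_def in_cbox_complex_iff)
  have wr: "Re w > 0" using t by (simp add: w_def)
  have "w ~= 0" using wr by auto
  have "h w = C * w powr (3/2) * theta_sum w"
   unfolding eq[OF Q(1)[OF w] wr] stokes_delta_sums(2)[OF wr] C_def ..
  hence "h w / (C * w powr (3/2)) = theta_sum w" using C \<open>w ~= 0\<close> by simp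
  with M[OF w] show ?thesis unfolding w_def by simp
 qed
 define R where "R = M * l ^ 4 * (2 * l) + 2 * (8 * l ^ 2 + 24 * l + 24) * (\<Sum>n. 1 / real n ^ 2)"
 define a where "a = exp (-1) * (16 / 15 * l ^ 5)"
 have a: "a > 0" using l by (simp add: a_def)
 obtain j :: nat where j: "max (R / a) (1 / l) < real j" using reals_Archimedean2 by blast
 (* At t = 1 / loc m the factor exp (- t loc m) is a constant, so the coefficient bound limits m itself. *)
 define m where "m = 12 * j + 1"
 have m: "chi12 m ~= 0" by (simp add: m_def chi12_def)
 have jm: "real j \<le> real m" by (simp add: m_def)
 have lm: "loc m > 0" using chi12_imp_pos[OF m] by (rule loc_pos)
 have "1 / l < loc m" using j jm loc_ge_real[of m] by simp
 hence t: "0 < 1 / loc m" "1 / loc m \<le> l" using l lm by (simp_all add: field_simps)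
 have "real m * exp (- (1 / loc m * loc m)) * (16 / 15 * l ^ 5) \<le> R"
  unfolding R_def by (rule theta_coefficient_bound[OF t(1) l m bound[OF t]])
 hence "real m * a \<le> R" using lm by (simp add: a_def mult.assoc)
 hence "real m \<le> R / a" using a by (simp add: pos_le_divide_eq)
 thus False using j jm by simp
qed

section \<open>Radial limits\<close>

definition mean_zero_periodic :: "nat => (nat => complex) => bool" where
 "mean_zero_periodic P \<psi> \<longleftrightarrow> P > 0 \<and> (\<forall>n. \<psi> (n + P) = \<psi> n) \<and> (\<Sum>n<P. \<psi> n) = 0"

lemma periodic_bounded:
 fixes f :: "nat => complex"
 assumes "P > 0" "\<And>n. f (n + P) = f n"
 obtains B where "B \<ge> 0" "\<And>n. norm (f n) \<le> B"
proof -
 have "f (n + k * P) = f n" for n k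
 proof (induction k)
  case (Suc k)
  have "f (n + Suc k * P) = f ((n + k * P) + P)" by (simp add: add_ac)
  thus ?case using assms(2) Suc by simp
 qed simp
 hence m: "f n = f (n mod P)" for n
 proof -
  assume *: "\<And>n k. f (n + k * P) = f n"
  have "f (n mod P + (n div P) * P) = f (n mod P)" by (rule *)
  thus ?thesis by simp
 qed
 show ?thesis
 proof (rule that)
  show "(\<Sum>k<P. norm (f k)) \<ge> 0" by (intro sum_nonneg) simp
  fix n
  have "n mod P \<in> {..<P}" using assms(1) by simp
  hence "norm (f (n mod P)) \<le> (\<Sum>k<P. norm (f k))" by (rule member_le_sum) simp_all
  thus "norm (f n) \<le> (\<Sum>k<P. norm (f k))" by (simp add: m[of n])
 qed
qed

text \<open>The partial sums of a mean zero periodic sequence are periodic. Splitting off their mean \<open>s\<close>, whose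
sum with the differences telescopes, leaves a sequence of the same kind.\<close>

lemma abel_summation_step:
 assumes "mean_zero_periodic P \<psi>"
 obtains s \<psi>' where "mean_zero_periodic P \<psi>'"
  "\<And>F T. F \<longlonglongrightarrow> 0 ==> (%n. \<psi>' n * (F (Suc n) - F n)) sums T ==> (%n. \<psi> n * F n) sums (s * F 0 - T)"
proof -
 from assms have P: "P > 0" and per: "\<And>n. \<psi> (n + P) = \<psi> n" and z: "(\<Sum>n<P. \<psi> n) = 0"
  unfolding mean_zero_periodic_def by blast+
 define S where "S n = (\<Sum>k<n. \<psi> k)" for n
 have S_per: "S (n + P) = S n" for n
  by (induction n) (simp_all add: S_def z per)
 define s where "s = (\<Sum>n<P. S (Suc n)) / of_nat P"
 define \<psi>' where "\<psi>' n = S (Suc n) - s" for n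
 obtain B where B: "B \<ge> 0" "\<And>n. norm (S n) \<le> B" by (rule periodic_bounded[where f = S, OF P S_per]) blast
 show ?thesis
 proof (rule that)
  have "\<psi>' (n + P) = \<psi>' n" for n unfolding \<psi>'_def using S_per[of "Suc n"] by simp
  moreover have "(\<Sum>n<P. \<psi>' n) = 0" unfolding \<psi>'_def sum_subtractf using P by (simp add: s_def)
  ultimately show "mean_zero_periodic P \<psi>'" using P unfolding mean_zero_periodic_def by blast
  fix F T assume F: "F \<longlonglongrightarrow> 0" and T: "(%n. \<psi>' n * (F (Suc n) - F n)) sums T"
  have part: "(\<Sum>n<N. \<psi> n * F n) = S N * F N - s * (F N - F 0) - (\<Sum>n<N. \<psi>' n * (F (Suc n) - F n))" for N
   by (induction N) (simp_all add: S_def \<psi>'_def algebra_simps)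
  have "(%N. S N * F N) \<longlonglongrightarrow> 0"
  proof (rule Lim_null_comparison)
   show "\<forall>\<^sub>F N in sequentially. norm (S N * F N) \<le> B * norm (F N)"
    unfolding norm_mult by (intro always_eventually allI mult_right_mono B) simp
   show "(%N. B * norm (F N)) \<longlonglongrightarrow> 0" using tendsto_mult_right_zero[OF tendsto_norm_zero[OF F], of B] by (simp add: mult.commute)
  qed
  hence "(%N. S N * F N - s * (F N - F 0) - (\<Sum>n<N. \<psi>' n * (F (Suc n) - F n))) \<longlonglongrightarrow> 0 - s * (0 - F 0) - T"
   using T unfolding sums_def by (intro tendsto_intros F)
  thus "(%n. \<psi> n * F n) sums (s * F 0 - T)" unfolding sums_def part by simp
 qed
qed

definition odd_gauss :: "real => real => real" where
 "odd_gauss \<mu> u = u * exp (- (\<mu> * u ^ 2))"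

lemma third_difference:
 fixes F F1 F2 F3 :: "real => real"
 assumes d: "\<And>u. (F has_real_derivative F1 u) (at u)" "\<And>u. (F1 has_real_derivative F2 u) (at u)"
   "\<And>u. (F2 has_real_derivative F3 u) (at u)"
 obtains \<xi> where "a < \<xi>" "F (a + 3) - 3 * F (a + 2) + 3 * F (a + 1) - F a = F3 \<xi>"
proof -
 have sh: "((%u. f (u + k)) has_real_derivative f' (u + k)) (at u)"
  if "\<And>u. (f has_real_derivative f' u) (at u)" for f f' :: "real => real" and k u
  using that[of "u + k"] by (simp add: DERIV_shift)
 define g where "g u = F (u + 2) - 2 * F (u + 1) + F u" for u
 define g1 where "g1 u = F1 (u + 2) - 2 * F1 (u + 1) + F1 u" for u
 define k where "k u = F1 (u + 1) - F1 u" for u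
 define k1 where "k1 u = F2 (u + 1) - F2 u" for u
 have g: "(g has_real_derivative g1 u) (at u)" for u
  unfolding g_def[abs_def] g1_def by (intro DERIV_add DERIV_diff DERIV_cmult sh d)
 have k: "(k has_real_derivative k1 u) (at u)" for u
  unfolding k_def[abs_def] k1_def by (intro DERIV_diff sh d)
 obtain \<xi>1 where 1: "a < \<xi>1" "g (a + 1) - g a = (a + 1 - a) * g1 \<xi>1"
  using MVT2[of a "a + 1" g g1] g by auto
 obtain \<xi>2 where 2: "\<xi>1 < \<xi>2" "k (\<xi>1 + 1) - k \<xi>1 = (\<xi>1 + 1 - \<xi>1) * k1 \<xi>2"
  using MVT2[of \<xi>1 "\<xi>1 + 1" k k1] k by auto
 obtain \<xi>3 where 3: "\<xi>2 < \<xi>3" "F2 (\<xi>2 + 1) - F2 \<xi>2 = (\<xi>2 + 1 - \<xi>2) * F3 \<xi>3"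
  using MVT2[of \<xi>2 "\<xi>2 + 1" F2 F3] d(3) by auto
 have "F (a + 3) - 3 * F (a + 2) + 3 * F (a + 1) - F a = g (a + 1) - g a" by (simp add: g_def add.assoc)
 also have "\<dots> = k (\<xi>1 + 1) - k \<xi>1" using 1(2) by (simp add: g1_def k_def add.assoc)
 also have "\<dots> = F3 \<xi>3" using 2(2) 3(2) by (simp add: k1_def)
 finally show ?thesis by (intro that[of \<xi>3]) (use 1(1) 2(1) 3(1) in linarith)+
qed

text \<open>The third derivative is \<open>\<mu>\<close> times a rapidly decreasing function of \<open>\<mu> u\<^sup>2\<close>. Summed over \<open>n\<close> the
bound is of order \<open>\<mu>\<^sup>1\<^sup>/\<^sup>4\<close>, so it tends to 0.\<close>

lemma odd_gauss_third_difference: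
 assumes \<mu>: "\<mu> > 0"
 shows "\<bar>odd_gauss \<mu> (real n + 3) - 3 * odd_gauss \<mu> (real n + 2) + 3 * odd_gauss \<mu> (real n + 1) - odd_gauss \<mu> (real n)\<bar>
   \<le> 24 * 11 ^ 5 * \<mu> * ((if n = 0 then 1 else 0) + (\<mu> / 2) powr (-3/4) * real n powr (-3/2))"
proof -
 define E where "E u = exp (- (\<mu> * u ^ 2))" for u
 have dE: "(E has_real_derivative (- 2 * \<mu> * u * E u)) (at u)" for u
  unfolding E_def[abs_def] by (auto intro!: derivative_eq_intros)
 have dP: "((%u. p u * E u) has_real_derivative (p' u - 2 * \<mu> * u * p u) * E u) (at u)"
  if "(p has_real_derivative p' u) (at u)" for p p' u
  using DERIV_mult[OF that dE[of u]] by (simp add: algebra_simps)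
 define F1 where "F1 u = (1 - 2 * \<mu> * u * u) * E u" for u
 define F2 where "F2 u = ((0 - 4 * \<mu> * u) - 2 * \<mu> * u * (1 - 2 * \<mu> * u * u)) * E u" for u
 define F3 where "F3 u = (- 6 * \<mu> + 12 * \<mu> ^ 2 * u ^ 2 - 2 * \<mu> * u * ((0 - 4 * \<mu> * u) - 2 * \<mu> * u * (1 - 2 * \<mu> * u * u))) * E u" for u
 have d1: "(odd_gauss \<mu> has_real_derivative F1 u) (at u)" for u
  using dP[of "%u. u" "%u. 1"] by (simp add: odd_gauss_def[abs_def] E_def F1_def)
 have d2: "(F1 has_real_derivative F2 u) (at u)" for u
  unfolding F1_def[abs_def] F2_def by (rule dP) (auto intro!: derivative_eq_intros)
 have d3: "(F2 has_real_derivative F3 u) (at u)" for u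
  unfolding F2_def[abs_def] F3_def
  by (rule dP) (auto intro!: derivative_eq_intros simp: algebra_simps power2_eq_square)
 obtain \<xi> where \<xi>: "real n < \<xi>" "odd_gauss \<mu> (real n + 3) - 3 * odd_gauss \<mu> (real n + 2) + 3 * odd_gauss \<mu> (real n + 1) - odd_gauss \<mu> (real n) = F3 \<xi>"
  by (rule third_difference[OF d1 d2 d3])
 define v where "v = \<mu> * \<xi> ^ 2"
 have v: "v \<ge> 0" using \<mu> by (simp add: v_def)
 have "F3 \<xi> = \<mu> * (- 6 + 24 * v - 8 * v ^ 2) * exp (- v)"
  by (simp add: F3_def E_def v_def algebra_simps power2_eq_square)
 hence "\<bar>F3 \<xi>\<bar> = \<mu> * \<bar>- 6 + 24 * v - 8 * v ^ 2\<bar> * exp (- v)" using \<mu> by (simp add: abs_mult)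
 also have "\<dots> \<le> \<mu> * (24 * (11 ^ 5 * exp (v / 2))) * exp (- v)"
 proof (intro mult_right_mono mult_left_mono)
  have "\<bar>- 6 + 24 * v - 8 * v ^ 2\<bar> \<le> 24 * (1 + v) ^ 2"
  proof -
   have "24 * (1 + v) ^ 2 = 24 + 48 * v + 24 * v ^ 2" by (simp add: power2_eq_square algebra_simps)
   moreover have "0 \<le> v ^ 2" by simp
   ultimately show ?thesis using v by linarith
  qed
  also have "\<dots> \<le> 24 * (1 + v) ^ 5" using v by (intro mult_left_mono power_increasing) simp_all
  also have "\<dots> \<le> 24 * ((1 + 5 / (1 / 2)) ^ 5 * exp (1 / 2 * v))"
   using v by (intro mult_left_mono poly_exp_bound) simp_all
  finally show "\<bar>- 6 + 24 * v - 8 * v ^ 2\<bar> \<le> 24 * (11 ^ 5 * exp (v / 2))" by simp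
 qed (use \<mu> in simp_all)
 also have "\<dots> = 24 * 11 ^ 5 * \<mu> * (exp (v / 2) * exp (- v))" by simp
 also have "exp (v / 2) * exp (- v) = exp (- (v / 2))" unfolding exp_add[symmetric] by simp
 also have "24 * 11 ^ 5 * \<mu> * exp (- (v / 2)) \<le> 24 * 11 ^ 5 * \<mu> * ((if n = 0 then 1 else 0) + (\<mu> / 2) powr (-3/4) * real n powr (-3/2))"
 proof (rule mult_left_mono)
  show "exp (- (v / 2)) \<le> (if n = 0 then 1 else 0) + (\<mu> / 2) powr (-3/4) * real n powr (-3/2)"
  proof (cases "n = 0")
   case True
   thus ?thesis using v by simp
  next
   case False
   hence n: "real n > 0" by simp
   define y where "y = (\<mu> / 2) * (real n ^ 2)"
   have "real n ^ 2 \<le> \<xi> ^ 2" using \<xi>(1) by (intro power_mono) simp_all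
   hence "y \<le> v / 2" using \<mu> by (simp add: y_def v_def)
   hence "exp (- (v / 2)) \<le> exp (- y)" by simp
   also have "\<dots> \<le> y powr (-3/4)" by (rule exp_minus_le_powr) (use \<mu> n in \<open>simp add: y_def\<close>)
   also have "\<dots> = (\<mu> / 2) powr (-3/4) * (real n ^ 2) powr (-3/4)"
    unfolding y_def by (rule powr_mult)
   also have "(real n ^ 2) powr (-3/4) = real n powr (-3/2)"
    using n by (simp flip: powr_numeral add: powr_powr)
   finally show ?thesis using False by simp
  qed
 qed (use \<mu> in simp)
 finally show ?thesis unfolding \<xi>(2) .
qed

lemma periodic_gauss_limit:
 assumes "mean_zero_periodic P \<psi>"
 obtains l where "((%\<mu>. \<Sum>n. \<psi> n * of_real (odd_gauss \<mu> (real n))) \<longlongrightarrow> l) (at_right 0)"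
proof -
 obtain s0 \<psi>1 where p1: "mean_zero_periodic P \<psi>1" and
  a1: "\<And>F T. F \<longlonglongrightarrow> 0 ==> (%n. \<psi>1 n * (F (Suc n) - F n)) sums T ==> (%n. \<psi> n * F n) sums (s0 * F 0 - T)"
  by (rule abel_summation_step[OF assms]) blast
 obtain s1 \<psi>2 where p2: "mean_zero_periodic P \<psi>2" and
  a2: "\<And>F T. F \<longlonglongrightarrow> 0 ==> (%n. \<psi>2 n * (F (Suc n) - F n)) sums T ==> (%n. \<psi>1 n * F n) sums (s1 * F 0 - T)"
  by (rule abel_summation_step[OF p1]) blast
 obtain s2 \<psi>3 where p3: "mean_zero_periodic P \<psi>3" and
  a3: "\<And>F T. F \<longlonglongrightarrow> 0 ==> (%n. \<psi>3 n * (F (Suc n) - F n)) sums T ==> (%n. \<psi>2 n * F n) sums (s2 * F 0 - T)"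
  by (rule abel_summation_step[OF p2]) blast
 obtain B where B: "B \<ge> 0" "\<And>n. norm (\<psi>3 n) \<le> B"
  using periodic_bounded[of P \<psi>3] p3 unfolding mean_zero_periodic_def by blast
 define Z where "Z = (\<Sum>n. real n powr (-3/2))"
 have Zs: "summable (%n. real n powr (-3/2))" by (simp add: summable_real_powr_iff)
 define D3 where "D3 \<mu> n = odd_gauss \<mu> (real n + 3) - 3 * odd_gauss \<mu> (real n + 2) + 3 * odd_gauss \<mu> (real n + 1) - odd_gauss \<mu> (real n)" for \<mu> n
 define T3 where "T3 \<mu> = (\<Sum>n. \<psi>3 n * of_real (D3 \<mu> n))" for \<mu>
 define b where "b \<mu> = B * (24 * 11 ^ 5 * \<mu>) * (1 + (\<mu> / 2) powr (-3/4) * Z)" for \<mu>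
 have T3: "(%n. \<psi>3 n * of_real (D3 \<mu> n)) sums T3 \<mu> \<and> norm (T3 \<mu>) \<le> b \<mu>" if \<mu>: "\<mu> > 0" for \<mu>
 proof -
  define q where "q n = B * (24 * 11 ^ 5 * \<mu>) * ((if n = 0 then 1 else 0) + (\<mu> / 2) powr (-3/4) * real n powr (-3/2))" for n :: nat
  have "(%n. (if n = 0 then 1 else 0) + (\<mu> / 2) powr (-3/4) * real n powr (-3/2)) sums (1 + (\<mu> / 2) powr (-3/4) * Z)"
   unfolding Z_def by (intro sums_add sums_mult summable_sums Zs sums_single)
  hence q: "q sums b \<mu>" unfolding q_def b_def by (rule sums_mult)
  have le: "norm (\<psi>3 n * of_real (D3 \<mu> n)) \<le> q n" for n
  proof -
   have "norm (\<psi>3 n) * \<bar>D3 \<mu> n\<bar> \<le> B * (24 * 11 ^ 5 * \<mu> * ((if n = 0 then 1 else 0) + (\<mu> / 2) powr (-3/4) * real n powr (-3/2)))"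
    unfolding D3_def by (intro mult_mono B odd_gauss_third_difference[OF \<mu>]) simp_all
   thus ?thesis by (simp only: norm_mult norm_of_real q_def mult.assoc)
  qed
  have "summable (%n. \<psi>3 n * of_real (D3 \<mu> n))" by (rule summable_comparison_test'[OF sums_summable[OF q] le])
  moreover have "norm (T3 \<mu>) \<le> (\<Sum>n. q n)" unfolding T3_def by (rule norm_suminf_le[OF le sums_summable[OF q]])
  ultimately show ?thesis using sums_unique[OF q] by (simp add: T3_def summable_sums)
 qed
 have val: "(\<Sum>n. \<psi> n * of_real (odd_gauss \<mu> (real n))) =
   - (s1 * of_real (exp (- \<mu>)) - (s2 * of_real (2 * exp (- (4 * \<mu>)) - 2 * exp (- \<mu>)) - T3 \<mu>))" if \<mu>: "\<mu> > 0" for \<mu>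
 proof -
  define F0 where "F0 n = complex_of_real (odd_gauss \<mu> (real n))" for n
  define F1 where "F1 n = F0 (Suc n) - F0 n" for n
  define F2 where "F2 n = F1 (Suc n) - F1 n" for n
  have "summable (%n. real n * exp (- (\<mu> * (6 / pi ^ 2) * loc n)))" by (rule theta_term_summable) (use \<mu> in simp)
  from summable_LIMSEQ_zero[OF this] have "(%n. odd_gauss \<mu> (real n)) \<longlonglongrightarrow> 0"
   by (simp add: odd_gauss_def loc_def)
  from tendsto_of_real[OF this, where 'a = complex] have l0: "F0 \<longlonglongrightarrow> 0" unfolding F0_def[abs_def] by simp
  have l1: "F1 \<longlonglongrightarrow> 0" unfolding F1_def[abs_def] using tendsto_diff[OF LIMSEQ_Suc[OF l0] l0] by simp
  have l2: "F2 \<longlonglongrightarrow> 0" unfolding F2_def[abs_def] using tendsto_diff[OF LIMSEQ_Suc[OF l1] l1] by simp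
  have "F2 (Suc n) - F2 n = of_real (D3 \<mu> n)" for n
  proof -
   have "real (Suc n) = real n + 1" "real (Suc (Suc n)) = real n + 2" "real (Suc (Suc (Suc n))) = real n + 3" by simp_all
   thus ?thesis unfolding F2_def F1_def F0_def D3_def by (simp only:) simp
  qed
  hence "(%n. \<psi>3 n * (F2 (Suc n) - F2 n)) sums T3 \<mu>" using T3[OF \<mu>] by simp
  from a3[OF l2 this] have "(%n. \<psi>2 n * (F1 (Suc n) - F1 n)) sums (s2 * F2 0 - T3 \<mu>)" unfolding F2_def .
  from a2[OF l1 this] have "(%n. \<psi>1 n * (F0 (Suc n) - F0 n)) sums (s1 * F1 0 - (s2 * F2 0 - T3 \<mu>))" unfolding F1_def .
  from a1[OF l0 this] have "(\<Sum>n. \<psi> n * F0 n) = s0 * F0 0 - (s1 * F1 0 - (s2 * F2 0 - T3 \<mu>))" by (simp only: sums_unique[symmetric])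
  moreover have "F0 0 = 0" "F0 (Suc 0) = of_real (exp (- \<mu>))" "F0 (Suc (Suc 0)) = of_real (2 * exp (- (4 * \<mu>)))"
   by (simp_all add: F0_def odd_gauss_def mult.commute)
  ultimately show ?thesis unfolding F1_def F2_def F0_def by simp
 qed
 have lim3: "(T3 \<longlongrightarrow> 0) (at_right 0)"
 proof (rule Lim_null_comparison)
  show "\<forall>\<^sub>F \<mu> in at_right 0. norm (T3 \<mu>) \<le> b \<mu>"
   using eventually_at_right_less[of "0::real"] by eventually_elim (use T3 in blast)
  have "((%\<mu>::real. \<mu> * (\<mu> / 2) powr (-3/4)) \<longlongrightarrow> 0) (at_right 0)" by real_asymp
  moreover have "((%\<mu>::real. \<mu>) \<longlongrightarrow> 0) (at_right 0)" by (rule tendsto_ident_at)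
  ultimately have "((%\<mu>. B * 24 * 11 ^ 5 * \<mu> + B * 24 * 11 ^ 5 * Z * (\<mu> * (\<mu> / 2) powr (-3/4))) \<longlongrightarrow>
   B * 24 * 11 ^ 5 * 0 + B * 24 * 11 ^ 5 * Z * 0) (at_right 0)" by (intro tendsto_add tendsto_mult tendsto_const)
  moreover have "b = (%\<mu>. B * 24 * 11 ^ 5 * \<mu> + B * 24 * 11 ^ 5 * Z * (\<mu> * (\<mu> / 2) powr (-3/4)))"
   by (simp add: b_def fun_eq_iff distrib_left mult_ac)
  ultimately show "(b \<longlongrightarrow> 0) (at_right 0)" by (simp only: mult_zero_right add_0_right)
 qed
 have e1: "((%\<mu>::real. exp (- \<mu>)) \<longlongrightarrow> 1) (at_right 0)" by real_asymp
 have e2: "((%\<mu>::real. 2 * exp (- (4 * \<mu>)) - 2 * exp (- \<mu>)) \<longlongrightarrow> 0) (at_right 0)" by real_asymp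
 have "((%\<mu>. - (s1 * of_real (exp (- \<mu>)) - (s2 * of_real (2 * exp (- (4 * \<mu>)) - 2 * exp (- \<mu>)) - T3 \<mu>)))
   \<longlongrightarrow> - (s1 * of_real 1 - (s2 * of_real 0 - 0))) (at_right 0)"
  by (intro tendsto_minus tendsto_diff tendsto_mult tendsto_const tendsto_of_real e1 e2 lim3)
 moreover have "\<forall>\<^sub>F \<mu> in at_right 0. - (s1 * of_real (exp (- \<mu>)) - (s2 * of_real (2 * exp (- (4 * \<mu>)) - 2 * exp (- \<mu>)) - T3 \<mu>)) =
   (\<Sum>n. \<psi> n * of_real (odd_gauss \<mu> (real n)))"
  using eventually_at_right_less[of "0::real"] by eventually_elim (simp only: val)
 ultimately show ?thesis by (intro that) (rule Lim_transform_eventually)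
qed

definition unity :: "nat => int => complex" where
 "unity P k = exp (2 * (of_int k / of_nat P) * of_real pi * \<i>)"

lemma unity_cong:
 assumes "P > 0" "int P dvd k - k'" shows "unity P k = unity P k'"
proof -
 from assms(2) obtain j where "k - k' = int P * j" by (rule dvdE)
 hence j: "k = k' + int P * j" by simp
 have "2 * (of_int k / of_nat P) * of_real pi * \<i> = 2 * (of_int k' / of_nat P) * of_real pi * \<i> + 2 * of_int j * of_real pi * \<i>"
  unfolding j using assms(1) by (simp add: field_simps)
 thus ?thesis unfolding unity_def exp_add using exp_integer_2pi[of "of_int j"] by (simp only:) (simp add: mult_ac)
qed

text \<open>Take \<open>u = 1\<close> modulo the power of 2 in \<open>P\<close> and \<open>u = - 1\<close> modulo the odd part; then \<open>u\<^sup>2 = 1\<close>, and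
\<open>u = 5\<close> modulo 12 because 3 divides the odd part.\<close>

lemma twisting_unit_exists:
 assumes "P > 0" "24 dvd P"
 obtains u :: nat where "int P dvd int u * int u - 1" "u mod 12 = 5"
proof -
 have "\<not> is_unit (2::nat)" by simp
 then obtain w where w: "P = 2 ^ multiplicity 2 P * w" "\<not> 2 dvd w"
  using multiplicity_decompose'[of P "2::nat"] assms(1) by auto
 define A where "A = (2::nat) ^ multiplicity 2 P"
 have PA: "P = A * w" using w(1) by (simp add: A_def)
 have "odd w" using w(2) by simp
 hence cop: "coprime A w" unfolding A_def by simp
 have "coprime (8::nat) w" using \<open>odd w\<close> coprime_power_left_iff[of 2 3 w] by simp
 moreover have "8 dvd A * w" unfolding PA[symmetric] by (rule dvd_trans[OF _ assms(2)]) simp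
 ultimately have A8: "8 dvd A" by (simp add: coprime_dvd_mult_left_iff)
 have "coprime (3::nat) 2" using coprime_add_one_left[of "2::nat"] by simp
 hence "coprime (3::nat) A" unfolding A_def by simp
 moreover have "3 dvd A * w" unfolding PA[symmetric] by (rule dvd_trans[OF _ assms(2)]) simp
 ultimately have w3: "3 dvd w" by (simp add: coprime_dvd_mult_right_iff)
 obtain u where u: "[u = 1] (mod A)" "[u = w - 1] (mod w)" using binary_chinese_remainder_nat[OF cop] by blast
 have w0: "w > 0" using assms(1) PA by simp
 have dA: "int A dvd int u - 1"
  using u(1) by (simp add: cong_int_iff[symmetric] cong_iff_dvd_diff)
 have dw: "int w dvd int u + 1"
 proof -
  have "int w dvd int u - int (w - 1)" using u(2) by (simp add: cong_int_iff[symmetric] cong_iff_dvd_diff)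
  hence "int w dvd int u - int (w - 1) + int w" by simp
  thus ?thesis using w0 by (simp add: of_nat_diff)
 qed
 have sq: "int u * int u - 1 = (int u - 1) * (int u + 1)" by (simp add: algebra_simps)
 show ?thesis
 proof (rule that)
  have "int A * int w dvd (int u - 1) * (int u + 1)" by (rule mult_dvd_mono[OF dA dw])
  thus "int P dvd int u * int u - 1" unfolding sq PA by simp
  have "int 8 dvd int A" "int 3 dvd int w" using A8 w3 by (simp_all only: of_nat_dvd_iff)
  hence i: "8 dvd int u - 1" "3 dvd int u + 1" using dvd_trans[OF _ dA, of 8] dvd_trans[OF _ dw, of 3] by simp_all
  have "4 dvd int u - 1" by (rule dvd_trans[OF _ i(1)]) simp
  from dvd_diff[OF this, of 4] dvd_diff[OF i(2), of 6] have "4 dvd int u - 5" "3 dvd int u - 5" by simp_all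
  moreover have "coprime (4::int) 3" using coprime_add_one_left[of "3::int"] by simp
  ultimately have "4 * 3 dvd int u - 5" by (intro divides_mult)
  hence "12 dvd int u - 5" by simp
  hence "int u mod 12 = 5 mod 12" by (simp only: mod_eq_dvd_iff)
  hence "int (u mod 12) = int 5" by (simp add: zmod_int)
  thus "u mod 12 = 5" by (simp only: of_nat_eq_iff)
 qed
qed

lemma chi12_cong: "m mod 12 = n mod 12 ==> chi12 m = chi12 n"
 by (simp add: chi12_def)

lemma chi12_times_5:
 assumes "u mod 12 = 5" shows "chi12 (u * n) = - chi12 n"
proof -
 define r where "r = n mod 12"
 have "(u * n) mod 12 = (5 * r) mod 12" using mod_mult_eq[of u 12 n] assms by (simp add: r_def)
 moreover have "r < 12" by (simp add: r_def)
 hence "r \<in> {..<12}" by simp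
 moreover have "{..<12::nat} = {0,1,2,3,4,5,6,7,8,9,10,11}" by (auto simp: lessThan_nat_numeral)
 ultimately have "r \<in> {0,1,2,3,4,5,6,7,8,9,10,11}" and m: "(u * n) mod 12 = (5 * r) mod 12" by (simp_all only:)
 thus ?thesis unfolding chi12_def r_def[symmetric] m by (elim insertE emptyE) simp_all
qed

text \<open>Multiplication by the twisting unit permutes the residues, fixes the squares, and changes the
sign of \<open>\<chi>\<close>.\<close>

lemma twisted_character_mean_zero:
 assumes P: "P > 0" "24 dvd P"
 shows "mean_zero_periodic P (%n. chi12 n * unity P (a * int n ^ 2))"
 unfolding mean_zero_periodic_def
proof (intro conjI allI P(1))
 have P12: "12 dvd P" using P(2) dvd_trans[of 12 24 P] by simp
 fix n
 obtain k where "P = 12 * k" using P12 by (rule dvdE)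
 hence "(n + P) mod 12 = n mod 12" by simp
 moreover have "int P dvd a * int (n + P) ^ 2 - a * int n ^ 2"
 proof -
  have "a * int (n + P) ^ 2 - a * int n ^ 2 = int P * (a * (2 * int n + int P))"
   by (simp add: power2_eq_square algebra_simps)
  thus ?thesis by simp
 qed
 ultimately show "chi12 (n + P) * unity P (a * int (n + P) ^ 2) = chi12 n * unity P (a * int n ^ 2)"
  using unity_cong[OF P(1), of "a * int (n + P) ^ 2" "a * int n ^ 2"] chi12_cong[of "n + P" n] by simp
next
 have P12: "12 dvd P" using P(2) dvd_trans[of 12 24 P] by simp
 define f where "f n = chi12 n * unity P (a * int n ^ 2)" for n
 obtain u where u: "int P dvd int u * int u - 1" "u mod 12 = 5" by (rule twisting_unit_exists[OF P])
 define \<pi> where "\<pi> n = (u * n) mod P" for n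
 have \<pi>d: "int P dvd int (\<pi> n) - int u * int n" for n
 proof -
  have "int (\<pi> n) = (int u * int n) mod int P" by (simp add: \<pi>_def zmod_int)
  hence "int (\<pi> n) mod int P = (int u * int n) mod int P" by simp
  thus ?thesis by (simp only: mod_eq_dvd_iff)
 qed
 have inv: "\<pi> (\<pi> n) = n" if "n < P" for n
 proof -
  have "int P dvd (int (\<pi> (\<pi> n)) - int u * int (\<pi> n)) + int u * (int (\<pi> n) - int u * int n) + int n * (int u * int u - 1)"
   by (intro dvd_add dvd_mult \<pi>d u(1))
  also have "\<dots> = int (\<pi> (\<pi> n)) - int n" by (simp add: algebra_simps)
  finally have "int (\<pi> (\<pi> n)) mod int P = int n mod int P" by (simp add: mod_eq_dvd_iff)
  moreover have "\<pi> (\<pi> n) < P" using P(1) by (simp add: \<pi>_def)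
  ultimately show ?thesis using that by simp
 qed
 have \<pi>P: "\<pi> n \<in> {..<P}" for n using P(1) by (simp add: \<pi>_def)
 have tw: "f (\<pi> n) = - f n" for n
 proof -
  have "(\<pi> n) mod 12 = (u * n) mod 12" unfolding \<pi>_def by (rule mod_mod_cancel[OF P12])
  hence "chi12 (\<pi> n) = - chi12 n" using chi12_cong[of "\<pi> n" "u * n"] chi12_times_5[OF u(2), of n] by simp
  moreover have "int P dvd a * int (\<pi> n) ^ 2 - a * int n ^ 2"
  proof -
   have "int P dvd a * ((int (\<pi> n) - int u * int n) * (int (\<pi> n) + int u * int n)) + a * int n ^ 2 * (int u * int u - 1)"
    by (rule dvd_add[OF dvd_mult[OF dvd_mult2[OF \<pi>d]] dvd_mult[OF u(1)]])
   thus ?thesis by (simp add: power2_eq_square algebra_simps)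
  qed
  hence "unity P (a * int (\<pi> n) ^ 2) = unity P (a * int n ^ 2)" by (rule unity_cong[OF P(1)])
  ultimately show ?thesis by (simp add: f_def)
 qed
 have "(\<Sum>n<P. f n) = (\<Sum>n<P. f (\<pi> n))"
  by (rule sum.reindex_bij_witness[of _ \<pi> \<pi>]) (simp_all add: inv \<pi>P[unfolded lessThan_iff])
 also have "\<dots> = - (\<Sum>n<P. f n)" unfolding tw by (rule sum_negf)
 finally have "(\<Sum>n<P. f n) = 0" by simp
 thus "(\<Sum>n<P. chi12 n * unity P (a * int n ^ 2)) = 0" by (simp add: f_def)
qed

lemma stokes_delta_radial_limit:
 fixes c :: rat
 shows "\<exists>l. ((%t. stokes_delta (of_rat c / (2 * of_real pi * \<i>) + complex_of_real t)) \<longlongrightarrow> l) (at_right 0)"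
proof -
 obtain a b where c: "c = Fract a b" "b > 0" by (cases c) auto
 (* The phases exp (pi i n^2 a / (12 b)) and the character have this common period. *)
 define P where "P = 24 * nat b"
 have P: "P > 0" "24 dvd P" using c(2) by (simp_all add: P_def)
 have Pb: "of_nat P = 24 * complex_of_int b" using c(2) by (simp add: P_def of_nat_nat)
 have cc: "of_rat c = complex_of_int a / of_int b" unfolding c(1) using c(2) by (simp add: of_rat_rat)
 define x0 where "x0 = of_rat c / (2 * complex_of_real pi * \<i>)"
 have Re0: "Re x0 = 0"
 proof -
  have "x0 = of_real (- (real_of_int a / real_of_int b) / (2 * pi)) * \<i>"
   using c(2) by (simp add: x0_def cc field_simps)
  thus ?thesis by (simp only: Re_complex_of_real Im_complex_of_real times_complex.sel) simp
 qed
 obtain l where l: "((%\<mu>. \<Sum>n. (chi12 n * unity P (a * int n ^ 2)) * of_real (odd_gauss \<mu> (real n))) \<longlongrightarrow> l) (at_right 0)"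
  by (rule periodic_gauss_limit[OF twisted_character_mean_zero[OF P]])
 have th: "theta_sum (x0 + of_real t) = (\<Sum>n. (chi12 n * unity P (a * int n ^ 2)) * of_real (odd_gauss (t * (pi ^ 2 / 6)) (real n)))" for t
  unfolding theta_sum_def
 proof (intro arg_cong[where f = suminf] ext)
  fix n
  have "- ((x0 + of_real t) * cloc n) = 2 * (of_int (a * int n ^ 2) / of_nat P) * of_real pi * \<i> + of_real (- (t * (pi ^ 2 / 6) * real n ^ 2))"
  proof -
   have "x0 * cloc n = - (2 * (of_int (a * int n ^ 2) / of_nat P) * of_real pi * \<i>)"
    unfolding x0_def cc Pb loc_def using c(2) by (simp add: field_simps power2_eq_square)
   moreover have "- ((x0 + of_real t) * cloc n) = - (x0 * cloc n) + of_real (- (t * loc n))"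
    by (simp add: algebra_simps)
   moreover have "- (t * loc n) = - (t * (pi ^ 2 / 6) * real n ^ 2)" by (simp add: loc_def)
   ultimately show ?thesis by (simp only: minus_minus)
  qed
  hence "exp (- ((x0 + of_real t) * cloc n)) = unity P (a * int n ^ 2) * of_real (exp (- (t * (pi ^ 2 / 6) * real n ^ 2)))"
   by (simp only: exp_add unity_def exp_of_real)
  thus "chi12 n * of_nat n * exp (- ((x0 + of_real t) * cloc n)) =
    chi12 n * unity P (a * int n ^ 2) * of_real (odd_gauss (t * (pi ^ 2 / 6)) (real n))"
   by (simp add: odd_gauss_def)
 qed
 have "filterlim (%t::real. t * (pi ^ 2 / 6)) (at_right 0) (at_right 0)" by real_asymp
 from filterlim_compose[OF l this]
 have lim: "((%t. theta_sum (x0 + of_real t)) \<longlongrightarrow> l) (at_right 0)" unfolding th .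
 have "((%t::real. t) \<longlongrightarrow> 0) (at_right 0)" by (rule tendsto_ident_at)
 hence xt: "((%t. x0 + complex_of_real t) \<longlongrightarrow> x0 + of_real 0) (at_right 0)" by (intro tendsto_intros)
 have "\<exists>p. ((%t. (x0 + complex_of_real t) powr (3/2)) \<longlongrightarrow> p) (at_right 0)"
 proof (cases "x0 = 0")
  case True
  have "((%t. (x0 + complex_of_real t) powr (3/2)) \<longlongrightarrow> 0) (at_right 0)"
   by (rule tendsto_powr_complex_0[OF _ tendsto_const]) (use xt True in simp_all)
  thus ?thesis by blast
 next
  case False
  hence "x0 \<notin> \<real>\<^sub>\<le>\<^sub>0" using Re0 by (auto simp: complex_nonpos_Reals_iff complex_eq_iff)
  hence "((%t. (x0 + complex_of_real t) powr (3/2)) \<longlongrightarrow> x0 powr (3/2)) (at_right 0)"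
   by (intro tendsto_powr_complex tendsto_const) (use xt in simp_all)
  thus ?thesis by blast
 qed
 then obtain p where p: "((%t. (x0 + complex_of_real t) powr (3/2)) \<longlongrightarrow> p) (at_right 0)" by blast
 have "((%t. - \<i> * of_real (sqrt 2 * pi * sqrt pi) * (x0 + of_real t) powr (3/2) * theta_sum (x0 + of_real t)) \<longlongrightarrow>
   - \<i> * of_real (sqrt 2 * pi * sqrt pi) * p * l) (at_right 0)"
  by (intro tendsto_mult tendsto_const p lim)
 moreover have "\<forall>\<^sub>F t in at_right 0. - \<i> * of_real (sqrt 2 * pi * sqrt pi) * (x0 + of_real t) powr (3/2) * theta_sum (x0 + of_real t) = stokes_delta (x0 + of_real t)"
  using eventually_at_right_less[of "0::real"]
 proof eventually_elim
  case (elim t)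
  have "Re (x0 + of_real t) > 0" using elim Re0 by simp
  thus ?case by (rule stokes_delta_sums(2)[symmetric])
 qed
 ultimately have "((%t. stokes_delta (x0 + complex_of_real t)) \<longlongrightarrow> - \<i> * of_real (sqrt 2 * pi * sqrt pi) * p * l) (at_right 0)"
  by (rule Lim_transform_eventually)
 thus ?thesis unfolding x0_def by blast
qed

section \<open>The main statements\<close>

lemma kz_borel_radius: "ereal (pi\<^sup>2 / 6) \<le> fps_conv_radius (borel_transform kz_series)"
 unfolding fps_conv_radius_def
proof (rule conv_radius_geI_ex)
 fix r :: real assume r: "0 < r" "ereal r < ereal (pi\<^sup>2 / 6)"
 hence "norm (complex_of_real r) < pi ^ 2 / 6" by simp
 from sums_summable[OF kz_borel_disc(2)[OF this]]
 show "\<exists>z. norm z = r \<and> summable (%n. fps_nth (borel_transform kz_series) n * z ^ n)"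
  using r by (intro exI[of _ "of_real r"]) simp
qed

lemma powr_principal_root:
 assumes "n > 0" "norm p < pi\<^sup>2 / 6"
 shows "(- p + of_nat n ^ 2 * of_real pi ^ 2 / 6) powr (5/2) = principal_root n p ^ 5"
proof -
 have l: "loc n > 0" by (rule loc_pos[OF assms(1)])
 have "pi ^ 2 / 6 * 1 \<le> pi ^ 2 / 6 * real n" using assms(1) by (intro mult_left_mono) simp_all
 hence "pi ^ 2 / 6 \<le> loc n" using loc_ge[OF assms(1)] by linarith
 hence "norm p < norm (cloc n)" using assms(2) l by simp
 hence nz: "cloc n - p ~= 0" by auto
 have "csqrt (cloc n - p) = csqrt (cloc n * ((cloc n - p) / cloc n))" using l by simp
 also have "\<dots> = principal_root n p" unfolding principal_root_def by (rule csqrt_scale[OF l])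
 finally have c: "csqrt (cloc n - p) = principal_root n p" .
 have "csqrt (cloc n - p) ^ 5 = exp (5 * (Ln (cloc n - p) / 2))"
  using nz by (simp add: csqrt_exp_Ln flip: exp_of_nat_mult)
 hence "(cloc n - p) powr (5/2) = csqrt (cloc n - p) ^ 5" using nz by (simp add: powr_def)
 moreover have "- p + of_nat n ^ 2 * of_real pi ^ 2 / 6 = cloc n - p" by (simp add: loc_def)
 ultimately show ?thesis unfolding c by simp
qed

lemma kz_borel_formula:
 assumes p: "norm p < pi\<^sup>2 / 6"
 shows "summable (%n. chi12 (Suc n) * of_nat (Suc n) /
            (- p + of_nat (Suc n) ^ 2 * of_real pi ^ 2 / 6) powr (5/2)) \<and>
    kz_borel p = of_real (3 * pi / (2 * sqrt 2)) *
     (\<Sum>n. chi12 (Suc n) * of_nat (Suc n) /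
         (- p + of_nat (Suc n) ^ 2 * of_real pi ^ 2 / 6) powr (5/2))"
proof -
 define g where "g n = chi12 n * of_nat n / principal_root n p ^ 5" for n
 note D = kz_borel_disc[OF p, folded g_def]
 have e: "chi12 (Suc n) * of_nat (Suc n) / (- p + of_nat (Suc n) ^ 2 * of_real pi ^ 2 / 6) powr (5/2) = g (Suc n)" for n
  unfolding g_def by (subst powr_principal_root[OF _ p]) simp_all
 have "summable (%n. g (Suc n))" using D(1) by (simp add: summable_Suc_iff)
 moreover have "(\<Sum>n. g (Suc n)) = (\<Sum>n. g n)" using suminf_split_head[OF D(1)] by (simp add: g_def)
 moreover have "kz_borel p = of_real borel_const * (\<Sum>n. g n)"
  unfolding kz_borel_def eval_fps_def using D(2) by (rule sums_unique[symmetric])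
 ultimately show ?thesis unfolding e borel_const_def by simp
qed

lemma kz_borel_continuation:
 assumes \<gamma>: "path_from_0_in sing_compl \<gamma>"
 shows "\<exists>g w. continuation_along kz_borel \<gamma> {0..1} g \<and>
      (\<forall>n. chi12 n ~= 0 \<longrightarrow>
       continuous_on {0..1} (w n) \<and> w n 0 = of_real (real n * pi / sqrt 6) \<and>
       (\<forall>t\<in>{0..1}. w n t ^ 2 = - \<gamma> t + of_nat n ^ 2 * of_real pi ^ 2 / 6)) \<and>
      (\<forall>t\<in>{0..1}.
       summable (%n. chi12 (Suc n) * of_nat (Suc n) / w (Suc n) t ^ 5) \<and>
       g t (\<gamma> t) = of_real (3 * pi / (2 * sqrt 2)) *
        (\<Sum>n. chi12 (Suc n) * of_nat (Suc n) / w (Suc n) t ^ 5))"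
proof -
 note F = path_from_0_facts[OF \<gamma>]
 have T: "convex {0..1::real}" "0 \<in> {0..1::real}" by auto
 obtain w where w: "root_family \<gamma> {0..1} w" by (rule root_family_exists[OF T F])
 define g where "g t = branch_sum kz_coeff (%n. w n t) (\<gamma> t)" for t
 have g: "continuation_along kz_borel \<gamma> {0..1} g"
  unfolding g_def by (rule canonical_continuation[OF T F w coeff_ok_kz kz_borel_germ])
 have "summable (%n. chi12 (Suc n) * of_nat (Suc n) / w (Suc n) t ^ 5) \<and>
       g t (\<gamma> t) = of_real (3 * pi / (2 * sqrt 2)) *
        (\<Sum>n. chi12 (Suc n) * of_nat (Suc n) / w (Suc n) t ^ 5)" if t: "t \<in> {0..1}" for t
 proof -
  have "\<gamma> t \<in> sing_compl" using F(2) t by blast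
  then obtain \<kappa> where aw: "away \<kappa> (\<gamma> t)" by (rule away_exists)
  define q where "q n = chi12 n * of_nat n / w n t ^ 5" for n
  have kq: "kz_coeff n / w n t ^ 5 = of_real borel_const * q n" for n by (simp add: kz_coeff_def q_def)
  have s: "summable (%n. of_real borel_const * q n)"
   using branch_sum_summable[OF coeff_ok_kz aw root_family_roots_at[OF w t]] unfolding kq .
  from summable_mult[OF this, of "1 / of_real borel_const"] have q: "summable q" using borel_const_pos by simp
  have "g t (\<gamma> t) = of_real borel_const * (\<Sum>n. q n)"
   unfolding g_def branch_sum_self[OF coeff_ok_kz aw] kq by (rule suminf_mult[OF q])
  moreover have "q 0 = 0" by (simp add: q_def)
  hence "(\<Sum>n. q (Suc n)) = (\<Sum>n. q n)" using suminf_split_head[OF q] by simp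
  moreover have "summable (%n. q (Suc n))" using q by (simp add: summable_Suc_iff)
  moreover have "chi12 (Suc n) * of_nat (Suc n) / w (Suc n) t ^ 5 = q (Suc n)" for n by (simp only: q_def)
  ultimately show ?thesis by (simp only: borel_const_def)
 qed
 moreover have "continuous_on {0..1} (w n) \<and> w n 0 = of_real (real n * pi / sqrt 6) \<and>
       (\<forall>t\<in>{0..1}. w n t ^ 2 = - \<gamma> t + of_nat n ^ 2 * of_real pi ^ 2 / 6)" if n: "chi12 n ~= 0" for n
 proof (intro conjI ballI)
  show "continuous_on {0..1} (w n)" by (rule root_familyD(1)[OF w n]) simp
  show "w n 0 = of_real (real n * pi / sqrt 6)" unfolding root_familyD(2)[OF w n] sqrt_loc ..
  fix t :: real assume t: "t \<in> {0..1}"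
  have "cloc n - \<gamma> t = - \<gamma> t + of_nat n ^ 2 * of_real pi ^ 2 / 6" by (simp add: loc_def)
  with root_familyD(3)[OF w n t] show "w n t ^ 2 = - \<gamma> t + of_nat n ^ 2 * of_real pi ^ 2 / 6" by simp
 qed
 ultimately show ?thesis using g by blast
qed

lemma left_summation:
 assumes r: "r > 0" and \<phi>: "- 5 * pi / 2 < \<phi> \<and> \<phi> < pi / 2"
 shows "\<exists>L. has_lateral_laplace 1 r \<phi> L"
  and "0 < \<epsilon> ==> \<epsilon> < 2 * pi ==> - pi / 2 < \<phi> + \<epsilon> ==> \<phi> + \<epsilon> < pi / 2 ==>
   eta_integrand (rcis r \<phi>) (\<phi> + \<epsilon>) integrable_on {0..} \<and>
   S_mul r \<phi> = of_real (sqrt 3) * eta_integral (rcis r \<phi>) (\<phi> + \<epsilon>)"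
proof -
 show "\<exists>L. has_lateral_laplace 1 r \<phi> L" using has_lateral_laplace_kz[OF r, of "1" \<phi>] by blast
 assume \<epsilon>: "0 < \<epsilon>" "\<epsilon> < 2 * pi" "- pi / 2 < \<phi> + \<epsilon>" "\<phi> + \<epsilon> < pi / 2"
 have "\<bar>\<phi> + \<epsilon>\<bar> < pi / 2" using \<epsilon>(3,4) by linarith
 note E = lateral_sum_eta[where \<sigma> = "1" and \<phi> = \<phi> and \<eta> = "\<epsilon>", OF r _ _ _ _ _ this]
 show "eta_integrand (rcis r \<phi>) (\<phi> + \<epsilon>) integrable_on {0..} \<and>
   S_mul r \<phi> = of_real (sqrt 3) * eta_integral (rcis r \<phi>) (\<phi> + \<epsilon>)"
  unfolding S_mul_def using E \<phi> \<epsilon> by simp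
qed

lemma right_summation:
 assumes r: "r > 0" and \<phi>: "- pi / 2 < \<phi> \<and> \<phi> < 5 * pi / 2"
 shows "\<exists>L. has_lateral_laplace (-1) r \<phi> L"
  and "0 < \<epsilon> ==> \<epsilon> < 2 * pi ==> - pi / 2 < \<phi> - \<epsilon> ==> \<phi> - \<epsilon> < pi / 2 ==>
   eta_integrand (rcis r \<phi>) (\<phi> - \<epsilon>) integrable_on {0..} \<and>
   S_mur r \<phi> = of_real (sqrt 3) * eta_integral (rcis r \<phi>) (\<phi> - \<epsilon>)"
proof -
 show "\<exists>L. has_lateral_laplace (-1) r \<phi> L" using has_lateral_laplace_kz[OF r, of "-1" \<phi>] by blast
 assume \<epsilon>: "0 < \<epsilon>" "\<epsilon> < 2 * pi" "- pi / 2 < \<phi> - \<epsilon>" "\<phi> - \<epsilon> < pi / 2"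
 have "\<bar>\<phi> + - \<epsilon>\<bar> < pi / 2" using \<epsilon>(3,4) by linarith
 note E = lateral_sum_eta[where \<sigma> = "-1" and \<phi> = \<phi> and \<eta> = "- \<epsilon>", OF r _ _ _ _ _ this]
 show "eta_integrand (rcis r \<phi>) (\<phi> - \<epsilon>) integrable_on {0..} \<and>
   S_mur r \<phi> = of_real (sqrt 3) * eta_integral (rcis r \<phi>) (\<phi> - \<epsilon>)"
  unfolding S_mur_def using E \<phi> \<epsilon> by simp
qed

lemma median_eta:
 assumes x: "Re x > 0" and \<epsilon>: "\<epsilon> > 0" "Arg x + \<epsilon> < pi / 2 \<and> - pi / 2 < Arg x - \<epsilon>"
 shows "average_sum med x = of_real (sqrt 3) / 2 * (eta_integral x (Arg x + \<epsilon>) + eta_integral x (Arg x - \<epsilon>))"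
proof -
 have r: "norm x > 0" using x by auto
 have "S_mul (norm x) (Arg x) = of_real (sqrt 3) * eta_integral (rcis (norm x) (Arg x)) (Arg x + \<epsilon>)"
  by (rule left_summation(2)[OF r, THEN conjunct2]) (use \<epsilon> in linarith)+
 moreover have "S_mur (norm x) (Arg x) = of_real (sqrt 3) * eta_integral (rcis (norm x) (Arg x)) (Arg x - \<epsilon>)"
  by (rule right_summation(2)[OF r, THEN conjunct2]) (use \<epsilon> in linarith)+
 ultimately show ?thesis unfolding average_sum_lateral[OF balanced_med x] rcis_polar by (simp add: field_simps)
qed

lemma average_independent:
 assumes "is_average m" "reality_preserving m" "Re x > 0"
 shows "\<exists>L. has_average_laplace m kz_borel x L" "average_sum m x = average_sum med x"
proof -
 note m = balanced_reality_preserving[OF assms(1,2)]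
 show "\<exists>L. has_average_laplace m kz_borel x L" using average_sum_balanced(1)[OF m assms(3)] by blast
 show "average_sum m x = average_sum med x"
  unfolding average_sum_balanced(2)[OF m assms(3)] average_sum_balanced(2)[OF balanced_med assms(3)] ..
qed

lemma stokes_delta_lacunary:
 "\<exists>a. lacunary a \<and> (\<forall>x. Re x > 0 \<longrightarrow>
   (%k. a k * exp (- (of_real pi ^ 2 / 6) * x) ^ k) sums (stokes_delta x / x powr (3/2)))"
proof (intro exI conjI allI impI)
 define C where "C = - \<i> * complex_of_real (sqrt 2 * pi * sqrt pi)"
 have "C ~= 0" by (simp add: C_def)
 thus "lacunary (%k. C * theta_coeff k)" by (rule lacunary_scaled_theta)
 fix x assume x: "Re x > 0"
 hence "x ~= 0" by auto
 hence "stokes_delta x / x powr (3/2) = C * theta_sum x"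
  unfolding stokes_delta_sums(2)[OF x] C_def[symmetric] by simp
 moreover have "(%k. C * (theta_coeff k * exp (- (of_real pi ^ 2 / 6) * x) ^ k)) sums (C * theta_sum x)"
  by (rule sums_mult[OF theta_coeff_sums[OF x]])
 ultimately show "(%k. C * theta_coeff k * exp (- (of_real pi ^ 2 / 6) * x) ^ k) sums (stokes_delta x / x powr (3/2))"
  by (simp only: mult.assoc)
qed

lemma kz_borel_branch_points: "\<forall>s\<in>sing_set. sqrt_branch_point kz_borel sing_compl (of_real s)"
proof
 fix s assume "s \<in> sing_set"
 then obtain k where k: "s = loc k" "chi12 k ~= 0" unfolding sing_set_eq by blast
 have "kz_coeff k ~= 0" using k(2) chi12_imp_pos[OF k(2)] borel_const_pos by (simp add: kz_coeff_def)
 thus "sqrt_branch_point kz_borel sing_compl (of_real s)"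
  unfolding k(1) by (rule sqrt_branch_point_germ[OF coeff_ok_kz kz_borel_germ k(2)])
qed

lemma kz_borel_double_valued: "double_valued_in kz_borel sing_compl"
 by (rule double_valued_germ[OF coeff_ok_kz kz_borel_germ]) (use borel_const_pos in \<open>simp add: kz_coeff_def chi12_def\<close>)

theorem theorem3:
  shows
    "ereal (pi\<^sup>2 / 6) \<le> fps_conv_radius (borel_transform kz_series) \<and>
     (\<forall>p. norm p < pi\<^sup>2 / 6 \<longrightarrow>
        summable (\<lambda>n. chi12 (Suc n) * of_nat (Suc n) /
                       (- p + of_nat (Suc n) ^ 2 * of_real pi ^ 2 / 6) powr (5/2)) \<and>
        kz_borel p = of_real (3 * pi / (2 * sqrt 2)) *
          (\<Sum>n. chi12 (Suc n) * of_nat (Suc n) /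
                 (- p + of_nat (Suc n) ^ 2 * of_real pi ^ 2 / 6) powr (5/2))) \<and>
     (\<forall>\<gamma>. path_from_0_in sing_compl \<gamma> \<longrightarrow>
        (\<exists>g w. continuation_along kz_borel \<gamma> {0..1} g \<and>
           (\<forall>n. chi12 n \<noteq> 0 \<longrightarrow>
              continuous_on {0..1} (w n) \<and> w n 0 = of_real (real n * pi / sqrt 6) \<and>
              (\<forall>t\<in>{0..1}. w n t ^ 2 = - \<gamma> t + of_nat n ^ 2 * of_real pi ^ 2 / 6)) \<and>
           (\<forall>t\<in>{0..1}.
              summable (\<lambda>n. chi12 (Suc n) * of_nat (Suc n) / w (Suc n) t ^ 5) \<and>
              g t (\<gamma> t) = of_real (3 * pi / (2 * sqrt 2)) *
                (\<Sum>n. chi12 (Suc n) * of_nat (Suc n) / w (Suc n) t ^ 5)))) \<and>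
     double_valued_in kz_borel sing_compl \<and>
     (\<forall>s\<in>sing_set. sqrt_branch_point kz_borel sing_compl (of_real s)) \<and>

     \<comment> \<open>(b)\<close>
     (\<forall>r>0. \<forall>\<phi>. - 5 * pi / 2 < \<phi> \<and> \<phi> < pi / 2 \<longrightarrow>
        (\<exists>L. has_lateral_laplace 1 r \<phi> L) \<and>
        (\<forall>\<epsilon>. 0 < \<epsilon> \<and> \<epsilon> < 2 * pi \<and> - pi / 2 < \<phi> + \<epsilon> \<and> \<phi> + \<epsilon> < pi / 2 \<longrightarrow>
           eta_integrand (rcis r \<phi>) (\<phi> + \<epsilon>) integrable_on {0..} \<and>
           S_mul r \<phi> = of_real (sqrt 3) * eta_integral (rcis r \<phi>) (\<phi> + \<epsilon>))) \<and>
     (\<forall>r>0. \<forall>\<phi>. - pi / 2 < \<phi> \<and> \<phi> < 5 * pi / 2 \<longrightarrow>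
        (\<exists>L. has_lateral_laplace (-1) r \<phi> L) \<and>
        (\<forall>\<epsilon>. 0 < \<epsilon> \<and> \<epsilon> < 2 * pi \<and> - pi / 2 < \<phi> - \<epsilon> \<and> \<phi> - \<epsilon> < pi / 2 \<longrightarrow>
           eta_integrand (rcis r \<phi>) (\<phi> - \<epsilon>) integrable_on {0..} \<and>
           S_mur r \<phi> = of_real (sqrt 3) * eta_integral (rcis r \<phi>) (\<phi> - \<epsilon>))) \<and>

     \<comment> \<open>(c)\<close>
     (\<forall>m x. is_average m \<and> reality_preserving m \<and> Re x > 0 \<longrightarrow>
        (\<exists>L. has_average_laplace m kz_borel x L) \<and> average_sum m x = average_sum med x) \<and>
     (\<forall>x. Re x > 0 \<longrightarrow>
        (\<exists>L. has_average_laplace med kz_borel x L) \<and>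
        average_sum med x = (S_mur (norm x) (Arg x) + S_mul (norm x) (Arg x)) / 2 \<and>
        (\<forall>\<epsilon>>0. Arg x + \<epsilon> < pi / 2 \<and> - pi / 2 < Arg x - \<epsilon> \<longrightarrow>
           average_sum med x = of_real (sqrt 3) / 2 *
             (eta_integral x (Arg x + \<epsilon>) + eta_integral x (Arg x - \<epsilon>))) \<and>
        cnj (average_sum med x) = average_sum med (cnj x)) \<and>

     \<comment> \<open>(d)\<close>
     (\<forall>x. Re x > 0 \<longrightarrow>
        stokes_delta x = - \<i> * of_real (sqrt 2) * (of_real pi * x) powr (3/2) *
                         eta_tilde (2 * of_real pi * \<i> * x)) \<and>
     (\<exists>a. lacunary a \<and>
        (\<forall>x. Re x > 0 \<longrightarrow>
           (\<lambda>k. a k * exp (- (of_real pi ^ 2 / 6) * x) ^ k) sums (stokes_delta x / x powr (3/2)))) \<and>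
     natural_boundary stokes_delta {x. Re x > 0} \<and>
     (\<forall>c :: rat. \<exists>l. ((\<lambda>t. stokes_delta (of_rat c / (2 * of_real pi * \<i>) + complex_of_real t))
                      \<longlongrightarrow> l) (at_right 0))"
proof (intro conjI, goal_cases)
  case 1 show ?case by (rule kz_borel_radius)
next
  case 2 show ?case using kz_borel_formula by blast
next
  case 3 show ?case using kz_borel_continuation by blast
next
  case 4 show ?case by (rule kz_borel_double_valued)
next
  case 5 show ?case by (rule kz_borel_branch_points)
next
  case 6 show ?case
  proof (intro allI impI conjI, goal_cases)
    case (1 r \<phi>) thus ?case by (rule left_summation(1))
  qed (rule left_summation(2)[THEN conjunct1] left_summation(2)[THEN conjunct2], auto)+
next
  case 7 show ?case
  proof (intro allI impI conjI, goal_cases)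
    case (1 r \<phi>) thus ?case by (rule right_summation(1))
  qed (rule right_summation(2)[THEN conjunct1] right_summation(2)[THEN conjunct2], auto)+
next
  case 8 show ?case using average_independent by (intro allI impI conjI) blast+
next
  case 9 show ?case
    using average_sum_balanced(1)[OF balanced_med] average_sum_lateral[OF balanced_med] median_eta
      average_sum_cnj[OF balanced_med] by (intro allI impI conjI) blast+
next
  case 10 show ?case using stokes_delta_eta_tilde by blast
next
  case 11 show ?case by (rule stokes_delta_lacunary)
next
  case 12 show ?case by (rule stokes_delta_natural_boundary)
next
  case 13 show ?case using stokes_delta_radial_limit by blast
qed

end
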